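(* Let $\mathcal B$ be a set operad with $\mathcal B(0)=\emptyset$ and $\mathcal P=\mathbb F[\mathcal B]$ the (reduced) operad spanned by it. The functor $P_{\mathcal P}:\beta(\mathcal P)\to\gamma(\mathcal P)$, $(A,\beta)\mapsto(A,\gamma)$ with $\gamma_{[x]_{\underline r},{\underline r}}=\beta_{\mathscr O_{\Sigma_{\underline r}}([x]_{\underline r}),{\underline r}}$ (identity on morphisms), restricts to a functor $\beta'(\mathcal P)\to\gamma'(\mathcal P)$, and this restricted functor is an isomorphism of categories.
   Context: $[n]=\{1,\dots,n\}$; $\mathcal P(n)=\mathbb F[\mathcal B(n)]$ with basis $\mathcal B(n)$ stable under $\Sigma_n$; $1\in\mathcal B(1)$ the unit and $\mu(x\otimes y_1\otimes\dots\otimes y_n)$ the full operadic composition. Compositions ${\underline r}\in\mathrm{Comp}_p(n)$ (nonnegative $p$-tuples with sum $n$) are identified with the partitions of $[n]$ into consecutive intervals ${\underline r}_i$ of lengths $r_i$; $\Sigma_{\underline r}\subseteq\Sigma_n$ preserves each ${\underline r}_i$; for an ordered partition $R$ of $[n]$, $\Sigma_R=\prod\Sigma_{R_i}$, $\sigma(R)=(\sigma(R_i))_i$. $[x]_H,\Omega_H(x),\mathrm{Stab}_H(x)$: class, orbit, stabiliser; subscripts ${\underline r}$ or $R$ mean $H=\Sigma_{\underline r}$ or $\Sigma_R$. $\mathscr O_{\Sigma_{\underline r}}([x]_{\underline r})=\sum_{y\in\Omega_{\Sigma_{\underline r}}(x)}y$. Sums over $G/H$ run over left coset representatives; integers are mapped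 to $\mathbb F$. For $\rho\in\Sigma_p$: ${\underline r}^\rho=(r_{\rho^{-1}(i)})_i$, $\rho^*$ the associated block permutation with blocks of sizes $r_i$. ${\underline q}\rhd{\underline r}=(\sum_{i\in{\underline q}_j}r_i)_{j\in[s]}$ for ${\underline q}\in\mathrm{Comp}_s(p)$. ${\underline r}\circ_1(l,m)=(l,m,r_2,\dots,r_p)$. Partition operations: for an ordered partition $Q=(Q_1,\dots,Q_s)$ of $[m]$ and $k\ge0$, $\gamma_k(Q)=(\bigsqcup_{t=0}^{k-1}(Q_j+tm))_j$; $R\otimes Q=(R_1,\dots,R_p,Q_1+n,\dots,Q_s+n)$ for $R$ a partition of $[n]$; ${\underline r}\diamond({\underline q}_i)_{i\in[p]}=\gamma_{r_1}({\underline q}_1)\otimes\dots\otimes\gamma_{r_p}({\underline q}_p)$ for ${\underline q}_i\in\mathrm{Comp}_{k_i}(m_i)$, a partition of $[M]$, $M=\sum r_im_i$. $\prod_i\Sigma_{r_i}\wr\Sigma_{{\underline q}_i}\subseteq\Sigma_{{\underline r}\diamond({\underline q}_i)}\subseteq\Sigma_M$: cutting $[M]$ into consecutive segments of lengths $r_im_i$ and segment $i$ into $r_i$ consecutive blocks of length $m_i$, the permutations preserving segments, permuting blocks within a segment order-preservingly, and acting inside each block of segment $i$ by an element of $\Sigma_{{\underline q}_i}$. $\beta(\mathcal P)$: objects $(A,\beta)$, $\beta_{x,{\underline r}}:A^p\to A$ for $x\in\mathcal P(n)^{\Sigma_{\underline r}}$, with ($\beta$1) $\beta_{x,{\underline r}}(a_1,\dots,a_p)=\beta_{\rho^*\cdot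 x,{\underline r}^\rho}(a_{\rho^{-1}(1)},\dots,a_{\rho^{-1}(p)})$; ($\beta$2) $\beta_{x,(0,{\underline r})}(a_0,a_1,\dots)=\beta_{x,{\underline r}}(a_1,\dots)$; ($\beta$3) $\beta_{x,{\underline r}}(\lambda a_1,\dots)=\lambda^{r_1}\beta_{x,{\underline r}}(a_1,\dots)$; ($\beta$4) $\beta_{x,{\underline r}}$ at ($a_j$ repeated $q_j$ times)$_j$ equals $\beta_{\sum_{\sigma\in\Sigma_{{\underline q}\rhd{\underline r}}/\Sigma_{\underline r}}\sigma\cdot x,{\underline q}\rhd{\underline r}}(a_1,\dots,a_s)$; ($\beta$5) $\beta_{x,{\underline r}}(a_0+a_1,a_2,\dots)=\sum_{l+m=r_1}\beta_{x,{\underline r}\circ_1(l,m)}(a_0,a_1,a_2,\dots)$; ($\beta$6) linearity in $x$. With $\beta_{y,R}:=\beta_{\tau\cdot y,{\underline r}}$ for $\tau(R)={\underline r}$, $\beta'(\mathcal P)$ is the full subcategory satisfying ($\beta$7a) $\beta_{1,(1)}(a)=a$ and ($\beta$7b) $\beta_{x,{\underline r}}(\beta_{x_1,{\underline q}_1}(b_1),\dots,\beta_{x_p,{\underline q}_p}(b_p))=\beta_{\sum_\tau\tau\cdot\mu(x\otimes x_1^{\otimes r_1}\otimes\dots\otimes x_p^{\otimes r_p}),{\underline r}\diamond({\underline q}_i)}((b_{ij})_{i,j})$ for $x\in\mathcal P(n)^{\Sigma_{\underline r}}$, $x_i\in\mathcal P(m_i)^{\Sigma_{{\underline q}_i}}$,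 $b_i\in A^{k_i}$, $\tau$ over $\Sigma_{{\underline r}\diamond({\underline q}_i)}/\prod_i\Sigma_{r_i}\wr\Sigma_{{\underline q}_i}$. $\gamma(\mathcal P)$: objects $(A,\gamma)$, $\gamma_{[x]_{\underline r},{\underline r}}:A^p\to A$ for $[x]_{\underline r}\in\Sigma_{\underline r}\backslash\mathcal B(n)$, with ($\gamma$1) $\gamma_{[x]_{\underline r},{\underline r}}(a_1,\dots,a_p)=\gamma_{[\rho^*\cdot x]_{{\underline r}^\rho},{\underline r}^\rho}(a_{\rho^{-1}(1)},\dots,a_{\rho^{-1}(p)})$; ($\gamma$2) $\gamma_{[x]_{(0,{\underline r})},(0,{\underline r})}(a_0,a_1,\dots)=\gamma_{[x]_{\underline r},{\underline r}}(a_1,\dots)$; ($\gamma$3) $\gamma_{[x]_{\underline r},{\underline r}}(\lambda a_1,\dots)=\lambda^{r_1}\gamma_{[x]_{\underline r},{\underline r}}(a_1,\dots)$; ($\gamma$4) $\gamma_{[x]_{\underline r},{\underline r}}$ at ($a_j$ repeated $q_j$ times)$_j$ equals $\frac{|\mathrm{Stab}_{{\underline q}\rhd{\underline r}}(x)|}{|\mathrm{Stab}_{\underline r}(x)|}\gamma_{[x]_{{\underline q}\rhd{\underline r}},{\underline q}\rhd{\underline r}}(a_1,\dots,a_s)$; ($\gamma$5) $\gamma_{[x]_{\underline r},{\underline r}}(a_0+a_1,a_2,\dots)=\sum_{l+m=r_1}\sum_{[y]\in\Sigma_{{\underline r}\circ_1(l,m)}\backslash\Omega_{\Sigma_{\underline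 r}}(x)}\gamma_{[y],{\underline r}\circ_1(l,m)}(a_0,a_1,a_2,\dots)$. With $\gamma_{[y]_R,R}:=\gamma_{[\tau\cdot y]_{\underline r},{\underline r}}$ for $\tau(R)={\underline r}$, $\gamma'(\mathcal P)$ is the full subcategory satisfying ($\gamma$6a) $\gamma_{[1],(1)}(a)=a$; ($\gamma$6b) for $x\in\mathcal B(n)$, $x_i\in\mathcal B(m_i)$, $a_i\in A^{k_i}$, with $X=\mu(x\otimes x_1^{\otimes r_1}\otimes\dots\otimes x_p^{\otimes r_p})$: $\gamma_{[x]_{\underline r},{\underline r}}(\gamma_{[x_1]_{{\underline q}_1},{\underline q}_1}(a_1),\dots,\gamma_{[x_p]_{{\underline q}_p},{\underline q}_p}(a_p))=\frac{|\mathrm{Stab}_{{\underline r}\diamond({\underline q}_i)}(X)|}{|\mathrm{Stab}_{\underline r}(x)|\prod_i|\mathrm{Stab}_{{\underline q}_i}(x_i)|^{r_i}}\gamma_{[X]_{{\underline r}\diamond({\underline q}_i)},{\underline r}\diamond({\underline q}_i)}((a_{ij})_{i,j})$. Morphisms in all categories: linear maps commuting with operations. *)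

theory Defs
  imports Main "HOL.Vector_Spaces" "HOL-Combinatorics.Permutations"
begin

text \<open>Conventions: everything is 0-based, i.e. [n] is rendered as {0..<n}, the p blocks of a
composition r (a nat list with sum n) are the intervals ivl r i, i < length r.
Permutations of [n] are functions nat => nat permuting {..<n}.\<close>

definition off :: "nat list \<Rightarrow> nat \<Rightarrow> nat" where
  "off r i = sum_list (take i r)"

definition ivl :: "nat list \<Rightarrow> nat \<Rightarrow> nat set" where
  "ivl r i = {off r i ..< off r (Suc i)}"

text \<open>index of the block of r containing k (for k < sum_list r)\<close>
definition blk :: "nat list \<Rightarrow> nat \<Rightarrow> nat" where
  "blk r k = (LEAST i. k < off r (Suc i))"

definition Sym :: "nat \<Rightarrow> (nat \<Rightarrow> nat) set" where
  "Sym n = {\<sigma>. \<sigma> permutes {..<n}}"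

definition SymR :: "nat \<Rightarrow> nat set list \<Rightarrow> (nat \<Rightarrow> nat) set" where
  "SymR n R = {\<sigma> \<in> Sym n. \<forall>i<length R. \<sigma> ` (R ! i) = R ! i}"

definition parts :: "nat list \<Rightarrow> nat set list" where
  "parts r = map (ivl r) [0..<length r]"

definition Symc :: "nat list \<Rightarrow> (nat \<Rightarrow> nat) set" where
  "Symc r = SymR (sum_list r) (parts r)"

definition plist :: "(nat \<Rightarrow> nat) \<Rightarrow> 'x list \<Rightarrow> 'x list" where
  "plist \<rho> xs = map (\<lambda>i. xs ! inv \<rho> i) [0..<length xs]"

text \<open>rho^*: block permutation, moving block i of r order-preservingly to block rho(i) of r^rho\<close>
definition block_perm :: "nat list \<Rightarrow> (nat \<Rightarrow> nat) \<Rightarrow> nat \<Rightarrow> nat" where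
  "block_perm r \<rho> k = (if k < sum_list r
     then off (plist \<rho> r) (\<rho> (blk r k)) + (k - off r (blk r k)) else k)"

definition dsum :: "nat list \<Rightarrow> (nat \<Rightarrow> nat) list \<Rightarrow> nat \<Rightarrow> nat" where
  "dsum ms \<tau>s k = (if k < sum_list ms
     then off ms (blk ms k) + (\<tau>s ! blk ms k) (k - off ms (blk ms k)) else k)"

definition tri :: "nat list \<Rightarrow> nat list \<Rightarrow> nat list" where
  "tri q r = map (\<lambda>j. \<Sum>i\<in>ivl q j. r ! i) [0..<length q]"

text \<open>r diamond (q_i)_i : segment i has r_i blocks of length m_i = sum q_i\<close>
definition msz :: "nat list list \<Rightarrow> nat \<Rightarrow> nat" where
  "msz qs i = sum_list (qs ! i)"

definition base :: "nat list \<Rightarrow> nat list list \<Rightarrow> nat \<Rightarrow> nat" where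
  "base r qs i = (\<Sum>i'<i. r ! i' * msz qs i')"

definition Mtot :: "nat list \<Rightarrow> nat list list \<Rightarrow> nat" where
  "Mtot r qs = base r qs (length r)"

definition diamond :: "nat list \<Rightarrow> nat list list \<Rightarrow> nat set list" where
  "diamond r qs = concat (map (\<lambda>i. map (\<lambda>j. \<Union>t<r ! i.
       (\<lambda>k. base r qs i + t * msz qs i + k) ` ivl (qs ! i) j) [0..<length (qs ! i)])
     [0..<length r])"

text \<open>the subgroup prod_i Sigma_{r_i} wr Sigma_{q_i} of Sigma_M\<close>
definition wreath :: "nat list \<Rightarrow> nat list list \<Rightarrow> (nat \<Rightarrow> nat) set" where
  "wreath r qs = {\<sigma> \<in> Sym (Mtot r qs). \<exists>\<pi> \<theta>.
     (\<forall>i<length r. \<pi> i \<in> Sym (r ! i) \<and> (\<forall>t<r ! i. \<theta> i t \<in> Symc (qs ! i))) \<and>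
     (\<forall>i<length r. \<forall>t<r ! i. \<forall>k<msz qs i.
        \<sigma> (base r qs i + t * msz qs i + k) = base r qs i + \<pi> i t * msz qs i + \<theta> i t k)}"

definition straighten :: "nat \<Rightarrow> nat set list \<Rightarrow> nat \<Rightarrow> nat" where
  "straighten M R = (SOME \<tau>. \<tau> \<in> Sym M \<and> (\<forall>i<length R. \<tau> ` (R ! i) = ivl (map card R) i))"

definition set_operad :: "(nat \<Rightarrow> 'o set) \<Rightarrow> ((nat \<Rightarrow> nat) \<Rightarrow> 'o \<Rightarrow> 'o) \<Rightarrow> 'o
     \<Rightarrow> ('o \<Rightarrow> 'o list \<Rightarrow> 'o) \<Rightarrow> bool" where
  "set_operad B act u cmp \<longleftrightarrow>
     (\<forall>n m. n \<noteq> m \<longrightarrow> B n \<inter> B m = {}) \<and>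
     (\<forall>n \<sigma> x. \<sigma> \<in> Sym n \<and> x \<in> B n \<longrightarrow> act \<sigma> x \<in> B n) \<and>
     (\<forall>n x. x \<in> B n \<longrightarrow> act id x = x) \<and>
     (\<forall>n \<sigma> \<tau> x. \<sigma> \<in> Sym n \<and> \<tau> \<in> Sym n \<and> x \<in> B n \<longrightarrow> act (\<sigma> \<circ> \<tau>) x = act \<sigma> (act \<tau> x)) \<and>
     u \<in> B 1 \<and>
     (\<forall>n x ys ms. x \<in> B n \<and> length ys = n \<and> length ms = n \<and> (\<forall>i<n. ys ! i \<in> B (ms ! i))
        \<longrightarrow> cmp x ys \<in> B (sum_list ms)) \<and>
     (\<forall>n y. y \<in> B n \<longrightarrow> cmp u [y] = y) \<and>
     (\<forall>n x. x \<in> B n \<longrightarrow> cmp x (replicate n u) = x) \<and>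
     (\<forall>n x ys ms zs. x \<in> B n \<and> length ys = n \<and> length ms = n \<and> (\<forall>i<n. ys ! i \<in> B (ms ! i)) \<and>
        length zs = n \<and> (\<forall>i<n. length (zs ! i) = ms ! i \<and> (\<forall>j<ms ! i. \<exists>k. zs ! i ! j \<in> B k))
        \<longrightarrow> cmp (cmp x ys) (concat zs) = cmp x (map (\<lambda>i. cmp (ys ! i) (zs ! i)) [0..<n])) \<and>
     (\<forall>n x ys ms \<sigma>. x \<in> B n \<and> length ys = n \<and> length ms = n \<and> (\<forall>i<n. ys ! i \<in> B (ms ! i)) \<and>
        \<sigma> \<in> Sym n
        \<longrightarrow> cmp (act \<sigma> x) ys =
            act (block_perm (map (\<lambda>i. ms ! \<sigma> i) [0..<n]) \<sigma>) (cmp x (map (\<lambda>i. ys ! \<sigma> i) [0..<n]))) \<and>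
     (\<forall>n x ys ms \<tau>s. x \<in> B n \<and> length ys = n \<and> length ms = n \<and> (\<forall>i<n. ys ! i \<in> B (ms ! i)) \<and>
        length \<tau>s = n \<and> (\<forall>i<n. \<tau>s ! i \<in> Sym (ms ! i))
        \<longrightarrow> cmp x (map (\<lambda>i. act (\<tau>s ! i) (ys ! i)) [0..<n]) = act (dsum ms \<tau>s) (cmp x ys))"

definition Pn :: "(nat \<Rightarrow> 'o set) \<Rightarrow> nat \<Rightarrow> ('o \<Rightarrow> 'k::field) set" where
  "Pn B n = {x. finite {y. x y \<noteq> 0} \<and> (\<forall>y. x y \<noteq> 0 \<longrightarrow> y \<in> B n)}"

definition lact :: "(nat \<Rightarrow> 'o set) \<Rightarrow> ((nat \<Rightarrow> nat) \<Rightarrow> 'o \<Rightarrow> 'o) \<Rightarrow> nat \<Rightarrow> (nat \<Rightarrow> nat)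
     \<Rightarrow> ('o \<Rightarrow> 'k::field) \<Rightarrow> 'o \<Rightarrow> 'k" where
  "lact B act n \<sigma> x = (\<lambda>y. if y \<in> B n then x (act (inv \<sigma>) y) else 0)"

definition Pinv :: "(nat \<Rightarrow> 'o set) \<Rightarrow> ((nat \<Rightarrow> nat) \<Rightarrow> 'o \<Rightarrow> 'o) \<Rightarrow> nat list \<Rightarrow> ('o \<Rightarrow> 'k::field) set" where
  "Pinv B act r = {x \<in> Pn B (sum_list r). \<forall>\<sigma>\<in>Symc r. lact B act (sum_list r) \<sigma> x = x}"

definition lcomp :: "('o \<Rightarrow> 'o list \<Rightarrow> 'o) \<Rightarrow> ('o \<Rightarrow> 'k::field) \<Rightarrow> ('o \<Rightarrow> 'k) list \<Rightarrow> 'o \<Rightarrow> 'k" where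
  "lcomp cmp x ys = (\<lambda>z. \<Sum>b\<in>{b. x b \<noteq> 0}. \<Sum>cs\<in>listset (map (\<lambda>y. {c. y c \<noteq> 0}) ys).
      if cmp b cs = z then x b * (\<Prod>i<length ys. (ys ! i) (cs ! i)) else 0)"

definition csum :: "(nat \<Rightarrow> nat) set \<Rightarrow> (nat \<Rightarrow> nat) set \<Rightarrow> ((nat \<Rightarrow> nat) \<Rightarrow> 'o \<Rightarrow> 'k::field) \<Rightarrow> 'o \<Rightarrow> 'k" where
  "csum G H f = (\<lambda>z. \<Sum>C\<in>(\<lambda>g. (\<lambda>h. g \<circ> h) ` H) ` G. f (SOME g. g \<in> C) z)"

definition delta :: "'o \<Rightarrow> 'o \<Rightarrow> 'k::field" where
  "delta u = (\<lambda>z. if z = u then 1 else 0)"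

text \<open>An object on the vector space (A, sc) is a family beta x r as, x in P(n)^{Sigma_r},
  r a composition of length p, as in A^p; it is taken to be 0 outside this domain.\<close>

definition beta_dom where
  "beta_dom B act x r as \<longleftrightarrow> x \<in> Pinv B act r \<and> length as = length r"

definition betaR :: "nat \<Rightarrow> (('o \<Rightarrow> 'k::field) \<Rightarrow> nat list \<Rightarrow> 'a list \<Rightarrow> 'a) \<Rightarrow> (nat \<Rightarrow> 'o set)
     \<Rightarrow> ((nat \<Rightarrow> nat) \<Rightarrow> 'o \<Rightarrow> 'o) \<Rightarrow> ('o \<Rightarrow> 'k) \<Rightarrow> nat set list \<Rightarrow> 'a list \<Rightarrow> 'a" where
  "betaR M beta B act y R as = beta (lact B act M (straighten M R) y) (map card R) as"

definition beta_obj :: "(nat \<Rightarrow> 'o set) \<Rightarrow> ((nat \<Rightarrow> nat) \<Rightarrow> 'o \<Rightarrow> 'o) \<Rightarrow> ('k::field \<Rightarrow> 'a::ab_group_add \<Rightarrow> 'a)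
     \<Rightarrow> (('o \<Rightarrow> 'k) \<Rightarrow> nat list \<Rightarrow> 'a list \<Rightarrow> 'a) \<Rightarrow> bool" where
  "beta_obj B act sc beta \<longleftrightarrow>
     (\<forall>x r as. \<not> beta_dom B act x r as \<longrightarrow> beta x r as = 0) \<and>
     (\<forall>x r as \<rho>. beta_dom B act x r as \<and> \<rho> \<in> Sym (length r) \<longrightarrow>
        beta x r as = beta (lact B act (sum_list r) (block_perm r \<rho>) x) (plist \<rho> r) (plist \<rho> as)) \<and>
     (\<forall>x r a0 as. beta_dom B act x (0 # r) (a0 # as) \<longrightarrow> beta x (0 # r) (a0 # as) = beta x r as) \<and>
     (\<forall>x r a as c. beta_dom B act x r (a # as) \<longrightarrow>
        beta x r (sc c a # as) = sc (c ^ hd r) (beta x r (a # as))) \<and>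
     (\<forall>x r q as. x \<in> Pinv B act r \<and> sum_list q = length r \<and> length as = length q \<longrightarrow>
        beta x r (concat (map (\<lambda>j. replicate (q ! j) (as ! j)) [0..<length q])) =
        beta (csum (Symc (tri q r)) (Symc r) (\<lambda>\<sigma>. lact B act (sum_list r) \<sigma> x)) (tri q r) as) \<and>
     (\<forall>x r a0 a1 as. beta_dom B act x r (a1 # as) \<longrightarrow>
        beta x r ((a0 + a1) # as) = (\<Sum>l\<le>hd r. beta x (l # (hd r - l) # tl r) (a0 # a1 # as))) \<and>
     (\<forall>x y r as. x \<in> Pinv B act r \<and> y \<in> Pinv B act r \<and> length as = length r \<longrightarrow>
        beta (\<lambda>z. x z + y z) r as = beta x r as + beta y r as) \<and>
     (\<forall>c x r as. x \<in> Pinv B act r \<and> length as = length r \<longrightarrow>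
        beta (\<lambda>z. c * x z) r as = sc c (beta x r as))"

definition beta'_obj :: "(nat \<Rightarrow> 'o set) \<Rightarrow> ((nat \<Rightarrow> nat) \<Rightarrow> 'o \<Rightarrow> 'o) \<Rightarrow> 'o \<Rightarrow> ('o \<Rightarrow> 'o list \<Rightarrow> 'o)
     \<Rightarrow> ('k::field \<Rightarrow> 'a::ab_group_add \<Rightarrow> 'a) \<Rightarrow> (('o \<Rightarrow> 'k) \<Rightarrow> nat list \<Rightarrow> 'a list \<Rightarrow> 'a) \<Rightarrow> bool" where
  "beta'_obj B act u cmp sc beta \<longleftrightarrow> beta_obj B act sc beta \<and>
     (\<forall>a. beta (delta u) [1] [a] = a) \<and>
     (\<forall>x r xs qs bs. x \<in> Pinv B act r \<and> length xs = length r \<and> length qs = length r \<and>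
        length bs = length r \<and>
        (\<forall>i<length r. xs ! i \<in> Pinv B act (qs ! i) \<and> length (bs ! i) = length (qs ! i)) \<longrightarrow>
        beta x r (map (\<lambda>i. beta (xs ! i) (qs ! i) (bs ! i)) [0..<length r]) =
        betaR (Mtot r qs) beta B act
          (csum (SymR (Mtot r qs) (diamond r qs)) (wreath r qs)
             (\<lambda>\<tau>. lact B act (Mtot r qs) \<tau>
                 (lcomp cmp x (concat (map (\<lambda>i. replicate (r ! i) (xs ! i)) [0..<length r])))))
          (diamond r qs) (concat bs))"

definition beta_hom where
  "beta_hom B act sA sB betaA betaB f \<longleftrightarrow> Vector_Spaces.linear sA sB f \<and>
     (\<forall>x r as. beta_dom B act x r as \<longrightarrow> f (betaA x r as) = betaB x r (map f as))"

text \<open>classes [x]_r are represented by the orbits Omega_{Sigma_r}(x)\<close>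
definition orbc :: "((nat \<Rightarrow> nat) \<Rightarrow> 'o \<Rightarrow> 'o) \<Rightarrow> nat list \<Rightarrow> 'o \<Rightarrow> 'o set" where
  "orbc act r x = (\<lambda>\<sigma>. act \<sigma> x) ` Symc r"

definition orbR :: "((nat \<Rightarrow> nat) \<Rightarrow> 'o \<Rightarrow> 'o) \<Rightarrow> (nat \<Rightarrow> nat) set \<Rightarrow> 'o \<Rightarrow> 'o set" where
  "orbR act G x = (\<lambda>\<sigma>. act \<sigma> x) ` G"

definition stab :: "((nat \<Rightarrow> nat) \<Rightarrow> 'o \<Rightarrow> 'o) \<Rightarrow> (nat \<Rightarrow> nat) set \<Rightarrow> 'o \<Rightarrow> (nat \<Rightarrow> nat) set" where
  "stab act G x = {\<sigma> \<in> G. act \<sigma> x = x}"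

definition gamma_dom where
  "gamma_dom B act Q r as \<longleftrightarrow> (\<exists>x\<in>B (sum_list r). Q = orbc act r x) \<and> length as = length r"

definition gammaR :: "nat \<Rightarrow> ('o set \<Rightarrow> nat list \<Rightarrow> 'a list \<Rightarrow> 'a) \<Rightarrow> ((nat \<Rightarrow> nat) \<Rightarrow> 'o \<Rightarrow> 'o)
     \<Rightarrow> 'o \<Rightarrow> nat set list \<Rightarrow> 'a list \<Rightarrow> 'a" where
  "gammaR M gamma act y R as =
     gamma (orbc act (map card R) (act (straighten M R) y)) (map card R) as"

definition gamma_obj :: "(nat \<Rightarrow> 'o set) \<Rightarrow> ((nat \<Rightarrow> nat) \<Rightarrow> 'o \<Rightarrow> 'o) \<Rightarrow> ('k::field \<Rightarrow> 'a::ab_group_add \<Rightarrow> 'a)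
     \<Rightarrow> ('o set \<Rightarrow> nat list \<Rightarrow> 'a list \<Rightarrow> 'a) \<Rightarrow> bool" where
  "gamma_obj B act sc gamma \<longleftrightarrow>
     (\<forall>Q r as. \<not> gamma_dom B act Q r as \<longrightarrow> gamma Q r as = 0) \<and>
     (\<forall>x r as \<rho>. x \<in> B (sum_list r) \<and> length as = length r \<and> \<rho> \<in> Sym (length r) \<longrightarrow>
        gamma (orbc act r x) r as =
        gamma (orbc act (plist \<rho> r) (act (block_perm r \<rho>) x)) (plist \<rho> r) (plist \<rho> as)) \<and>
     (\<forall>x r a0 as. x \<in> B (sum_list r) \<and> length as = length r \<longrightarrow>
        gamma (orbc act (0 # r) x) (0 # r) (a0 # as) = gamma (orbc act r x) r as) \<and>
     (\<forall>x r a as c. x \<in> B (sum_list r) \<and> length (a # as) = length r \<longrightarrow>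
        gamma (orbc act r x) r (sc c a # as) = sc (c ^ hd r) (gamma (orbc act r x) r (a # as))) \<and>
     (\<forall>x r q as. x \<in> B (sum_list r) \<and> sum_list q = length r \<and> length as = length q \<longrightarrow>
        gamma (orbc act r x) r (concat (map (\<lambda>j. replicate (q ! j) (as ! j)) [0..<length q])) =
        sc (of_nat (card (stab act (Symc (tri q r)) x) div card (stab act (Symc r) x)))
           (gamma (orbc act (tri q r) x) (tri q r) as)) \<and>
     (\<forall>x r a0 a1 as. x \<in> B (sum_list r) \<and> length (a1 # as) = length r \<longrightarrow>
        gamma (orbc act r x) r ((a0 + a1) # as) =
        (\<Sum>l\<le>hd r. \<Sum>Q\<in>orbc act (l # (hd r - l) # tl r) ` orbc act r x.
            gamma Q (l # (hd r - l) # tl r) (a0 # a1 # as)))"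

definition gamma'_obj :: "(nat \<Rightarrow> 'o set) \<Rightarrow> ((nat \<Rightarrow> nat) \<Rightarrow> 'o \<Rightarrow> 'o) \<Rightarrow> 'o \<Rightarrow> ('o \<Rightarrow> 'o list \<Rightarrow> 'o)
     \<Rightarrow> ('k::field \<Rightarrow> 'a::ab_group_add \<Rightarrow> 'a) \<Rightarrow> ('o set \<Rightarrow> nat list \<Rightarrow> 'a list \<Rightarrow> 'a) \<Rightarrow> bool" where
  "gamma'_obj B act u cmp sc gamma \<longleftrightarrow> gamma_obj B act sc gamma \<and>
     (\<forall>a. gamma (orbc act [1] u) [1] [a] = a) \<and>
     (\<forall>x r xs qs as. x \<in> B (sum_list r) \<and> length xs = length r \<and> length qs = length r \<and>
        length as = length r \<and>
        (\<forall>i<length r. xs ! i \<in> B (sum_list (qs ! i)) \<and> length (as ! i) = length (qs ! i)) \<longrightarrow>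
        gamma (orbc act r x) r
          (map (\<lambda>i. gamma (orbc act (qs ! i) (xs ! i)) (qs ! i) (as ! i)) [0..<length r]) =
        (let X = cmp x (concat (map (\<lambda>i. replicate (r ! i) (xs ! i)) [0..<length r])) in
         sc (of_nat (card (stab act (SymR (Mtot r qs) (diamond r qs)) X) div
                     (card (stab act (Symc r) x) *
                      (\<Prod>i<length r. card (stab act (Symc (qs ! i)) (xs ! i)) ^ (r ! i)))))
            (gammaR (Mtot r qs) gamma act X (diamond r qs) (concat as))))"

definition gamma_hom where
  "gamma_hom B act sA sB gammaA gammaB f \<longleftrightarrow> Vector_Spaces.linear sA sB f \<and>
     (\<forall>Q r as. gamma_dom B act Q r as \<longrightarrow> f (gammaA Q r as) = gammaB Q r (map f as))"

definition Pfun :: "(nat \<Rightarrow> 'o set) \<Rightarrow> ((nat \<Rightarrow> nat) \<Rightarrow> 'o \<Rightarrow> 'o)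
     \<Rightarrow> (('o \<Rightarrow> 'k::field) \<Rightarrow> nat list \<Rightarrow> 'a list \<Rightarrow> 'a::zero) \<Rightarrow> 'o set \<Rightarrow> nat list \<Rightarrow> 'a list \<Rightarrow> 'a" where
  "Pfun B act beta = (\<lambda>Q r as. if gamma_dom B act Q r as
      then beta (\<lambda>z. if z \<in> Q then 1 else 0) r as else 0)"

end

theory Submission
  imports Defs "HOL-Library.FuncSet"
begin

text \<open>
  The invariants of \<open>\<Sigma>_r\<close> in \<open>\<P>(n)\<close> have the sums over \<open>\<Sigma>_r\<close>-orbits of \<open>\<B>(n)\<close> as a basis, so \<open>\<beta>\<close> is
  recovered from \<open>\<gamma>\<close> by linear extension, and every axiom that is linear in the operation may be
  checked on orbit sums. For the axioms \<open>\<beta>4\<close> and \<open>\<beta>7b\<close> this is a count: a coset sum over \<open>G/H\<close> of the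
  orbit sum of \<open>H x\<close> is \<open>|Stab_G x| / |Stab_H x|\<close> times the orbit sum of \<open>G x\<close>; for \<open>\<beta>7b\<close> the wreath
  product acts on the pairs (outer operation, tuple of inner operations), and since \<open>\<B>(0)\<close> is empty its
  elements are determined by their block permutation and their actions inside the blocks.

  The axiom \<open>\<beta>7b\<close> is not linear but polynomial in the inner operations. If one of them is a sum
  \<open>v + v'\<close>, then \<open>\<beta>5\<close> splits the outer operation over all \<open>l + m = r_i\<close>; the terms have repeated
  arguments, which are merged again by \<open>\<beta>1\<close> and \<open>\<beta>4\<close>, and the choice of the \<open>l\<close> blocks that receive \<open>v\<close>
  is a coset of a smaller wreath product in the given one. Induction on the sizes of the supports
  reduces \<open>\<beta>7b\<close> to inner operations that are multiples of orbit sums.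

  Ordered partitions of \<open>[n]\<close> are handled as labellings \<open>f\<close> of \<open>[n]\<close>, with \<open>\<Sigma>_R\<close> the group of
  permutations that preserve \<open>f\<close>.
\<close>

section \<open>Compositions, labellings and permutations\<close>

text \<open>Two arbitrary choices sit in the definitions: the coset representatives in
  \<open>csum\<close> and the permutation \<open>straighten\<close>. They are harmless only on
  invariant elements, so membership in the invariants of the group at hand (\<open>Pfix\<close>) is
  carried along everywhere, also for the wreath product, which is not the group of a partition.
  Splitting an inner operation duplicates a slot together with its arguments, so the compositions on
  both sides of \<beta>7b change. A single relabelling rule that contains \<beta>1 and \<beta>4
  (\<open>betaR_relabel\<close>) absorbs this change. The induction measures supports by the squares
  of their sizes: splitting a support of size a + b into a and b keeps the total size, but lowers
  the squares by 2ab, which outweighs the additional slot. Slots of multiplicity 0 are removed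
  beforehand, since 0 to the power 0 is 1 and a zero inner operation makes both sides vanish only if
  its multiplicity is positive.\<close>

lemma off_0 [simp]: "off r 0 = 0"
  by (simp add: off_def)

lemma off_Cons_Suc [simp]: "off (a # r) (Suc i) = a + off r i"
  by (simp add: off_def)

lemma off_Suc: "i < length r \<Longrightarrow> off r (Suc i) = off r i + r ! i"
  by (simp add: off_def take_Suc_conv_app_nth)

lemma off_length [simp]: "off r (length r) = sum_list r"
  by (simp add: off_def)

lemma off_mono: "i \<le> j \<Longrightarrow> off r i \<le> off r j"
proof (induction r arbitrary: i j)
  case Nil
  then show ?case by (simp add: off_def)
next
  case (Cons a r)
  then show ?case by (cases i; cases j) auto
qed

lemma off_eq_sum: "i \<le> length r \<Longrightarrow> off r i = (\<Sum>j<i. r ! j)"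
  by (induction i) (simp_all add: off_Suc)

lemma blk_eqI:
  assumes "off r i \<le> k" "k < off r (Suc i)"
  shows "blk r k = i"
  unfolding blk_def
proof (rule Least_equality)
  fix y assume "k < off r (Suc y)"
  show "i \<le> y"
  proof (rule ccontr)
    assume "\<not> i \<le> y"
    then have "off r (Suc y) \<le> off r i" by (intro off_mono) simp
    with assms \<open>k < off r (Suc y)\<close> show False by simp
  qed
qed fact

lemma blk_props:
  assumes "k < sum_list r"
  shows "blk r k < length r" "off r (blk r k) \<le> k" "k < off r (Suc (blk r k))"
proof -
  from assms have ne: "r \<noteq> []" by auto
  then have ex: "k < off r (Suc (length r - 1))" using assms by simp
  then have le: "blk r k \<le> length r - 1" unfolding blk_def by (rule Least_le)
  show "blk r k < length r" using le ne by (cases r) auto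
  show "k < off r (Suc (blk r k))" unfolding blk_def using ex by (rule LeastI)
  show "off r (blk r k) \<le> k"
  proof (cases "blk r k")
    case 0
    then show ?thesis by simp
  next
    case (Suc j)
    have "\<not> k < off r (Suc j)"
      using not_less_Least[of j "\<lambda>i. k < off r (Suc i)"] Suc unfolding blk_def by simp
    with Suc show ?thesis by simp
  qed
qed

lemma blk_off: "i < length r \<Longrightarrow> t < r ! i \<Longrightarrow> blk r (off r i + t) = i"
  by (rule blk_eqI) (simp_all add: off_Suc)

lemma off_less: "i < length r \<Longrightarrow> t < r ! i \<Longrightarrow> off r i + t < sum_list r"
  using off_mono[of "Suc i" "length r" r] by (simp add: off_Suc)

lemma pos_cases:
  assumes "k < sum_list r"
  obtains i t where "i < length r" "t < r ! i" "k = off r i + t" "blk r k = i"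
proof
  show "blk r k < length r" "k = off r (blk r k) + (k - off r (blk r k))" "blk r k = blk r k"
    using blk_props[OF assms] by simp_all
  show "k - off r (blk r k) < r ! blk r k"
    using blk_props[OF assms] by (simp add: off_Suc)
qed

lemma off_append: "off (xs @ ys) i = off xs i + off ys (i - length xs)"
  by (simp add: off_def)

lemma off_beyond: "length r \<le> i \<Longrightarrow> off r i = sum_list r"
  by (simp add: off_def)

lemma blk_append:
  assumes "k < sum_list xs + sum_list ys"
  shows "blk (xs @ ys) k = (if k < sum_list xs then blk xs k else length xs + blk ys (k - sum_list xs))"
proof (cases "k < sum_list xs")
  case True
  note b = blk_props[OF True]
  show ?thesis using True b by (auto intro!: blk_eqI simp: off_append)
next
  case False
  then have "k - sum_list xs < sum_list ys" using assms by simp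
  note b = blk_props[OF this]
  show ?thesis using False b by (auto intro!: blk_eqI simp: off_append off_beyond Suc_diff_le)
qed

lemma blk_Cons:
  assumes "k < a + sum_list r"
  shows "blk (a # r) k = (if k < a then 0 else Suc (blk r (k - a)))"
proof (cases "k < a")
  case True
  then show ?thesis by (auto intro!: blk_eqI)
next
  case False
  then have "k - a < sum_list r" using assms by simp
  note b = blk_props[OF this]
  show ?thesis using False b by (auto intro!: blk_eqI)
qed

section \<open>Labellings in place of ordered partitions\<close>

definition lparts :: "nat \<Rightarrow> nat \<Rightarrow> (nat \<Rightarrow> nat) \<Rightarrow> nat set list" where
  "lparts n p f = map (\<lambda>i. {k. k < n \<and> f k = i}) [0..<p]"

definition SF :: "nat \<Rightarrow> (nat \<Rightarrow> nat) \<Rightarrow> (nat \<Rightarrow> nat) set" where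
  "SF n f = {\<sigma> \<in> Sym n. \<forall>k<n. f (\<sigma> k) = f k}"

definition subgrp :: "nat \<Rightarrow> (nat \<Rightarrow> nat) set \<Rightarrow> bool" where
  "subgrp n G \<longleftrightarrow> G \<subseteq> Sym n \<and> id \<in> G \<and> (\<forall>\<sigma>\<in>G. \<forall>\<tau>\<in>G. \<sigma> \<circ> \<tau> \<in> G) \<and> (\<forall>\<sigma>\<in>G. inv \<sigma> \<in> G)"

lemma Sym_less: "\<sigma> \<in> Sym n \<Longrightarrow> \<sigma> k < n \<longleftrightarrow> k < n"
  unfolding Sym_def using permutes_in_image[of \<sigma> "{..<n}" k] by simp

lemma Sym_bij: "\<sigma> \<in> Sym n \<Longrightarrow> bij \<sigma>"
  unfolding Sym_def by (simp add: permutes_bij)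

lemma Sym_inv: "\<sigma> \<in> Sym n \<Longrightarrow> inv \<sigma> \<in> Sym n"
  unfolding Sym_def by (simp add: permutes_inv)

lemma Sym_comp: "\<sigma> \<in> Sym n \<Longrightarrow> \<tau> \<in> Sym n \<Longrightarrow> \<sigma> \<circ> \<tau> \<in> Sym n"
  unfolding Sym_def by (simp add: permutes_compose)

lemma Sym_id: "id \<in> Sym n" unfolding Sym_def by (simp add: permutes_id)

lemma Sym_inv_o: "\<sigma> \<in> Sym n \<Longrightarrow> inv \<sigma> \<circ> \<sigma> = id" "\<sigma> \<in> Sym n \<Longrightarrow> \<sigma> \<circ> inv \<sigma> = id"
  unfolding Sym_def by (simp_all add: permutes_inv_o)

lemma Sym_inv_apply [simp]: "\<sigma> \<in> Sym n \<Longrightarrow> inv \<sigma> (\<sigma> k) = k" "\<sigma> \<in> Sym n \<Longrightarrow> \<sigma> (inv \<sigma> k) = k"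
  unfolding Sym_def by (simp_all add: permutes_inverses)

lemma Sym_inv_comp: "\<sigma> \<in> Sym n \<Longrightarrow> \<tau> \<in> Sym n \<Longrightarrow> inv (\<sigma> \<circ> \<tau>) = inv \<tau> \<circ> inv \<sigma>"
  by (simp add: o_inv_distrib Sym_bij)

lemma Sym_inv_inv: "\<sigma> \<in> Sym n \<Longrightarrow> inv (inv \<sigma>) = \<sigma>"
  by (simp add: inv_inv_eq Sym_bij)

lemma Sym_beyond: "\<sigma> \<in> Sym n \<Longrightarrow> \<not> k < n \<Longrightarrow> \<sigma> k = k"
  unfolding Sym_def by (auto simp: permutes_def)

lemma SymI:
  assumes "\<And>k. k < n \<Longrightarrow> \<sigma> k < n" "\<And>k. \<not> k < n \<Longrightarrow> \<sigma> k = k" "inj_on \<sigma> {..<n}"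
  shows "\<sigma> \<in> Sym n"
proof -
  have "\<sigma> ` {..<n} \<subseteq> {..<n}" using assms(1) by auto
  then have "\<sigma> ` {..<n} = {..<n}" using assms(3) by (simp add: endo_inj_surj)
  then have "bij_betw \<sigma> {..<n} {..<n}" using assms(3) by (simp add: bij_betw_def)
  then show ?thesis unfolding Sym_def using assms(2) by (auto intro: bij_imp_permutes)
qed

lemma Sym_eqI:
  assumes "\<sigma> \<in> Sym n" "\<tau> \<in> Sym n" "\<And>k. k < n \<Longrightarrow> \<sigma> k = \<tau> k"
  shows "\<sigma> = \<tau>"
  using assms Sym_beyond by (metis ext)

lemma Sym_prod:
  fixes h :: "nat \<Rightarrow> 'c::comm_monoid_mult"
  assumes "\<sigma> \<in> Sym n"
  shows "(\<Prod>k<n. h (\<sigma> k)) = (\<Prod>k<n. h k)"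
  using prod.permute[of \<sigma> "{..<n}" h] assms by (simp add: Sym_def o_def)

lemma finite_Sym: "finite (Sym n)"
  unfolding Sym_def by (simp add: finite_permutations)

lemma subgrp_finite: "subgrp n G \<Longrightarrow> finite G"
  unfolding subgrp_def using finite_Sym finite_subset by blast

lemma SF_subgrp: "subgrp n (SF n f)"
  unfolding subgrp_def SF_def
  by (auto simp: Sym_id Sym_comp Sym_inv Sym_less) (metis Sym_inv Sym_inv_apply(2) Sym_less)

lemma SF_Sym: "\<sigma> \<in> SF n f \<Longrightarrow> \<sigma> \<in> Sym n" by (simp add: SF_def)

lemma ivl_iff_blk: "i < length r \<Longrightarrow> k \<in> ivl r i \<longleftrightarrow> k < sum_list r \<and> blk r k = i"
proof -
  assume i: "i < length r"
  have "off r (Suc i) \<le> sum_list r" using off_mono[of "Suc i" "length r" r] i by simp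
  then show ?thesis unfolding ivl_def using blk_props[of k r] blk_eqI[of r i k] by fastforce
qed

lemma parts_eq: "parts r = lparts (sum_list r) (length r) (blk r)"
  unfolding parts_def lparts_def by (auto simp: ivl_iff_blk)

lemma SymR_lparts:
  assumes "\<And>k. k < n \<Longrightarrow> f k < p"
  shows "SymR n (lparts n p f) = SF n f"
proof (intro set_eqI iffI)
  fix \<sigma> assume s: "\<sigma> \<in> SymR n (lparts n p f)"
  then have S: "\<sigma> \<in> Sym n" by (simp add: SymR_def)
  have "f (\<sigma> k) = f k" if k: "k < n" for k
  proof -
    have "\<sigma> ` {j. j < n \<and> f j = f k} = {j. j < n \<and> f j = f k}"
      using s assms[OF k] by (simp add: SymR_def lparts_def)
    with k show ?thesis by blast
  qed
  with S show "\<sigma> \<in> SF n f" by (simp add: SF_def)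
next
  fix \<sigma> assume s: "\<sigma> \<in> SF n f"
  then have S: "\<sigma> \<in> Sym n" by (rule SF_Sym)
  have i: "inv \<sigma> \<in> SF n f" using s SF_subgrp[of n f] by (simp add: subgrp_def)
  have "\<sigma> ` {j. j < n \<and> f j = i} = {j. j < n \<and> f j = i}" for i
  proof (intro set_eqI iffI)
    fix x assume "x \<in> {j. j < n \<and> f j = i}"
    then have "\<sigma> (inv \<sigma> x) = x" "inv \<sigma> x \<in> {j. j < n \<and> f j = i}"
      using i S by (auto simp: SF_def Sym_less)
    then show "x \<in> \<sigma> ` {j. j < n \<and> f j = i}" by (metis imageI)
  qed (use s in \<open>auto simp: SF_def Sym_less\<close>)
  then show "\<sigma> \<in> SymR n (lparts n p f)" using S by (simp add: SymR_def lparts_def)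
qed

lemma Symc_eq: "Symc r = SF (sum_list r) (blk r)"
  unfolding Symc_def parts_eq by (rule SymR_lparts) (rule blk_props)

lemma Symc_subgrp: "subgrp (sum_list r) (Symc r)"
  by (simp add: Symc_eq SF_subgrp)

text \<open>Bijections between fibres over the same label are chosen independently and glued. This
  serves both to straighten a partition and to move a prescribed set of blocks
  (\<open>Symc_move\<close>).\<close>

lemma label_perm_exists:
  assumes f: "\<And>k. k < n \<Longrightarrow> f k < p"
    and eq: "\<And>i. i < p \<Longrightarrow> card {k. k < n \<and> f k = i} = card {k. k < n \<and> f' k = i}"
  shows "\<exists>\<tau>\<in>Sym n. \<forall>k<n. f' (\<tau> k) = f k"
proof -
  have "\<exists>h. bij_betw h {k. k < n \<and> f k = i} {k. k < n \<and> f' k = i}" if "i < p" for i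
    using eq[OF that] by (intro finite_same_card_bij) auto
  then obtain h where h: "\<And>i. i < p \<Longrightarrow> bij_betw (h i) {k. k < n \<and> f k = i} {k. k < n \<and> f' k = i}"
    by metis
  define \<tau> where "\<tau> k = (if k < n then h (f k) k else k)" for k
  have im: "\<tau> k < n \<and> f' (\<tau> k) = f k" if "k < n" for k
    using bij_betwE[OF h[OF f[OF that]]] that by (auto simp: \<tau>_def)
  have "\<tau> \<in> Sym n"
  proof (rule SymI)
    show "inj_on \<tau> {..<n}"
    proof (rule inj_onI)
      fix k l assume kl: "k \<in> {..<n}" "l \<in> {..<n}" "\<tau> k = \<tau> l"
      then have "f k = f l" using im by (metis lessThan_iff)
      moreover have "inj_on (h (f k)) {j. j < n \<and> f j = f k}"
        using h[OF f[of k]] kl by (simp add: bij_betw_def)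
      ultimately show "k = l" using kl by (auto simp: \<tau>_def dest: inj_onD)
    qed
  qed (use im in \<open>auto simp: \<tau>_def\<close>)
  with im show ?thesis by blast
qed

definition cnt :: "nat \<Rightarrow> nat \<Rightarrow> (nat \<Rightarrow> nat) \<Rightarrow> nat list" where
  "cnt n p f = map card (lparts n p f)"

lemma length_cnt [simp]: "length (cnt n p f) = p"
  by (simp add: cnt_def lparts_def)

lemma nth_cnt: "i < p \<Longrightarrow> cnt n p f ! i = card {k. k < n \<and> f k = i}"
  by (simp add: cnt_def lparts_def)

lemma sum_cnt: 
  assumes "\<And>k. k < n \<Longrightarrow> f k < p"
  shows "sum_list (cnt n p f) = n"
proof -
  have "sum_list (cnt n p f) = (\<Sum>i<p. card {k. k < n \<and> f k = i})"
    by (simp add: sum_list_sum_nth atLeast0LessThan nth_cnt)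
  also have "\<dots> = card (\<Union>i<p. {k. k < n \<and> f k = i})"
    by (subst card_UN_disjoint) auto
  also have "(\<Union>i<p. {k. k < n \<and> f k = i}) = {..<n}" using assms by auto
  finally show ?thesis by simp
qed

text \<open>\<tau> maps the fibre over \<open>i\<close> bijectively onto the interval
  \<open>i\<close> of \<open>r\<close>, so the cardinalities agree.\<close>

lemma cnt_eqI:
  assumes "\<tau> \<in> Sym n" "sum_list r = n" "length r = p" "\<And>k. k < n \<Longrightarrow> blk r (\<tau> k) = f k"
  shows "cnt n p f = r"
proof (rule nth_equalityI)
  fix i assume i: "i < length (cnt n p f)"
  have "\<tau> ` {k. k < n \<and> f k = i} = ivl r i"
  proof (intro set_eqI iffI)
    fix x assume "x \<in> ivl r i"
    then have "x < n" "blk r x = i" using i assms by (simp_all add: ivl_iff_blk)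
    then have "\<tau> (inv \<tau> x) = x" "inv \<tau> x < n" "f (inv \<tau> x) = i"
      using assms(1) assms(4)[of "inv \<tau> x"] by (simp_all add: Sym_less Sym_inv)
    then show "x \<in> \<tau> ` {k. k < n \<and> f k = i}" by (metis (mono_tags, lifting) imageI mem_Collect_eq)
  next
    fix x assume "x \<in> \<tau> ` {k. k < n \<and> f k = i}"
    then show "x \<in> ivl r i" using i assms by (auto simp: ivl_iff_blk Sym_less)
  qed
  moreover have "inj_on \<tau> {k. k < n \<and> f k = i}"
    using Sym_bij[OF assms(1)] by (meson bij_is_inj inj_on_subset subset_UNIV)
  ultimately have "card {k. k < n \<and> f k = i} = card (ivl r i)" by (metis card_image)
  also have "\<dots> = r ! i" using i assms(3) by (simp add: ivl_def off_Suc)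
  finally show "cnt n p f ! i = r ! i" using i by (simp add: nth_cnt)
qed (use assms in simp)

text \<open>The property of which \<open>straighten\<close> picks a witness by choice. On invariant
  elements any other witness may take its place, see \<open>betaR_straightens\<close>.\<close>

definition straightens :: "nat \<Rightarrow> nat \<Rightarrow> (nat \<Rightarrow> nat) \<Rightarrow> (nat \<Rightarrow> nat) \<Rightarrow> bool" where
  "straightens n p f \<tau> \<longleftrightarrow> \<tau> \<in> Sym n \<and> (\<forall>k<n. blk (cnt n p f) (\<tau> k) = f k)"

lemma straightensI:
  assumes "\<tau> \<in> Sym n" "sum_list r = n" "length r = p" "\<And>k. k < n \<Longrightarrow> blk r (\<tau> k) = f k"
  shows "straightens n p f \<tau>" "cnt n p f = r"
  using cnt_eqI[OF assms] assms by (auto simp: straightens_def)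

text \<open>The intervals of \<open>cnt n p f\<close> are themselves a labelling, with the same
  fibre sizes as \<open>f\<close>.\<close>

lemma straightens_exists:
  assumes "\<And>k. k < n \<Longrightarrow> f k < p"
  shows "\<exists>\<tau>. straightens n p f \<tau>"
proof -
  have "cnt n p (blk (cnt n p f)) = cnt n p f"
    by (rule cnt_eqI[where \<tau> = id]) (auto simp: Sym_id sum_cnt[OF assms])
  then have "card {k. k < n \<and> f k = i} = card {k. k < n \<and> blk (cnt n p f) k = i}" if "i < p" for i
    using that nth_cnt[OF that] by metis
  from label_perm_exists[OF assms this] show ?thesis by (auto simp: straightens_def)
qed

lemma straightens_straighten:
  assumes f: "\<And>k. k < n \<Longrightarrow> f k < p"
  shows "straightens n p f (straighten n (lparts n p f))"
proof -
  have iff: "(\<tau> \<in> Sym n \<and> (\<forall>i<length (lparts n p f). \<tau> ` (lparts n p f ! i) = ivl (map card (lparts n p f)) i))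
      \<longleftrightarrow> straightens n p f \<tau>" for \<tau>
  proof (cases "\<tau> \<in> Sym n")
    case T: True
    have "(\<forall>i<p. \<tau> ` {k. k < n \<and> f k = i} = ivl (cnt n p f) i) \<longleftrightarrow> (\<forall>k<n. blk (cnt n p f) (\<tau> k) = f k)"
      (is "?l \<longleftrightarrow> ?r")
    proof
      assume ?l
      show ?r
      proof (intro allI impI)
        fix k assume "k < n"
        then have "\<tau> k \<in> ivl (cnt n p f) (f k)" using \<open>?l\<close> f by blast
        then show "blk (cnt n p f) (\<tau> k) = f k" using f[OF \<open>k < n\<close>] by (simp add: ivl_iff_blk)
      qed
    next
      assume r: ?r
      show ?l
      proof (intro allI impI set_eqI iffI)
        fix i x assume i: "i < p" and "x \<in> ivl (cnt n p f) i"
        then have "x < n" "blk (cnt n p f) x = i" by (simp_all add: ivl_iff_blk sum_cnt[OF f])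
        then have "\<tau> (inv \<tau> x) = x" "inv \<tau> x < n" "f (inv \<tau> x) = i"
          using T r[rule_format, of "inv \<tau> x"] by (simp_all add: Sym_less Sym_inv)
        then show "x \<in> \<tau> ` {k. k < n \<and> f k = i}" by (metis (mono_tags, lifting) imageI mem_Collect_eq)
      qed (use r T in \<open>auto simp: ivl_iff_blk sum_cnt[OF f] Sym_less\<close>)
    qed
    then show ?thesis using T by (simp add: straightens_def cnt_def[symmetric]) (simp add: lparts_def)
  qed (simp add: straightens_def)
  have "\<exists>\<tau>. straightens n p f \<tau>" by (rule straightens_exists[OF f])
  then show ?thesis unfolding straighten_def iff by (rule someI_ex)
qed

section \<open>Block permutations and merged compositions\<close>

lemma length_plist [simp]: "length (plist \<rho> xs) = length xs"
  by (simp add: plist_def)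

lemma nth_plist: "i < length xs \<Longrightarrow> plist \<rho> xs ! i = xs ! inv \<rho> i"
  by (simp add: plist_def)

lemma sum_plist: "\<rho> \<in> Sym (length r) \<Longrightarrow> sum_list (plist \<rho> (r::nat list)) = sum_list r"
  using sum.permute[of "inv \<rho>" "{..<length r}" "\<lambda>i. r ! i"]
  by (simp add: sum_list_sum_nth atLeast0LessThan nth_plist Sym_def permutes_inv o_def)

lemma block_perm_off:
  assumes "\<rho> \<in> Sym (length r)" "i < length r" "t < r ! i"
  shows "block_perm r \<rho> (off r i + t) = off (plist \<rho> r) (\<rho> i) + t"
  using assms by (simp add: block_perm_def off_less blk_off)

lemma blk_block_perm:
  assumes "\<rho> \<in> Sym (length r)" "k < sum_list r"
  shows "blk (plist \<rho> r) (block_perm r \<rho> k) = \<rho> (blk r k)" "block_perm r \<rho> k < sum_list r"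
proof -
  from assms(2) obtain i t where it: "i < length r" "t < r ! i" "k = off r i + t" "blk r k = i"
    by (rule pos_cases)
  have l: "\<rho> i < length (plist \<rho> r)" "t < plist \<rho> r ! \<rho> i"
    using assms(1) it by (simp_all add: Sym_less nth_plist)
  show "blk (plist \<rho> r) (block_perm r \<rho> k) = \<rho> (blk r k)"
    using blk_off[OF l] it by (simp add: block_perm_off[OF assms(1)] )
  show "block_perm r \<rho> k < sum_list r"
    using off_less[OF l] it by (simp add: block_perm_off[OF assms(1)] sum_plist[OF assms(1)])
qed

lemma block_perm_Sym:
  assumes "\<rho> \<in> Sym (length r)"
  shows "block_perm r \<rho> \<in> Sym (sum_list r)"
proof (rule SymI)
  show "inj_on (block_perm r \<rho>) {..<sum_list r}"
  proof (rule inj_onI)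
    fix k l assume kl: "k \<in> {..<sum_list r}" "l \<in> {..<sum_list r}" "block_perm r \<rho> k = block_perm r \<rho> l"
    from kl(1) obtain i t where k: "i < length r" "t < r ! i" "k = off r i + t" "blk r k = i"
      by (auto elim: pos_cases)
    from kl(2) obtain j s where l: "j < length r" "s < r ! j" "l = off r j + s" "blk r l = j"
      by (auto elim: pos_cases)
    have "\<rho> i = \<rho> j" using blk_block_perm(1)[OF assms, of k] blk_block_perm(1)[OF assms, of l] kl k l by simp
    then have "i = j" using assms by (metis Sym_inv_apply(1))
    then show "k = l" using kl(3) k l by (simp add: block_perm_off[OF assms])
  qed
qed (use blk_block_perm[OF assms] in \<open>auto simp: block_perm_def\<close>)

lemma length_tri [simp]: "length (tri q r) = length q" by (simp add: tri_def)

lemma off_tri: "sum_list q = length r \<Longrightarrow> j \<le> length q \<Longrightarrow> off (tri q r) j = off r (off q j)"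
proof (induction j)
  case (Suc j)
  have le: "off q j \<le> off q (Suc j)" "off q (Suc j) \<le> length r"
    using off_mono[of "Suc j" "length q" q] off_mono[of j "Suc j" q] Suc.prems by simp_all
  have "off (tri q r) (Suc j) = off r (off q j) + (\<Sum>i\<in>ivl q j. r ! i)"
    using Suc by (simp add: off_Suc tri_def)
  also have "\<dots> = off r (off q (Suc j))"
    using le by (simp add: off_eq_sum ivl_def lessThan_atLeast0 sum.atLeastLessThan_concat)
  finally show ?case .
qed simp

lemma sum_tri: "sum_list q = length r \<Longrightarrow> sum_list (tri q r) = sum_list r"
  using off_tri[of q r "length q"] off_length[of "tri q r"] by simp

text \<open>Offsets of the merged composition are offsets of \<open>r\<close> taken at offsets of
  \<open>q\<close>. In terms of labellings, merging is composition with \<open>blk q\<close>, and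
  this is how \<beta>4 is used later.\<close>

lemma blk_tri:
  assumes q: "sum_list q = length r" and k: "k < sum_list r"
  shows "blk (tri q r) k = blk q (blk r k)"
proof (rule blk_eqI)
  note b = blk_props[OF k]
  have b1: "blk r k < sum_list q" using b(1) q by simp
  note c = blk_props[OF b1]
  have "off r (off q (blk q (blk r k))) \<le> off r (blk r k)" by (rule off_mono) (rule c)
  then show "off (tri q r) (blk q (blk r k)) \<le> k" using b c q by (simp add: off_tri)
  have "off r (Suc (blk r k)) \<le> off r (off q (Suc (blk q (blk r k))))" by (rule off_mono) (use c in simp)
  then show "k < off (tri q r) (Suc (blk q (blk r k)))" using b c q by (simp add: off_tri Suc_leI)
qed

text \<open>Repeating arguments is pulling the argument list back along \<open>blk q\<close>. The
  same form describes the repeated arguments of \<beta>4 and the repeated inner operations of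
  \<beta>7b.\<close>

lemma concat_replicate_nth:
  "concat (map (\<lambda>j. replicate (q ! j) (a j)) [0..<length q]) = map (\<lambda>k. a (blk q k)) [0..<sum_list q]"
proof (induction q arbitrary: a)
  case (Cons c q)
  have "concat (map (\<lambda>j. replicate ((c # q) ! j) (a j)) [0..<length (c # q)])
      = replicate c (a 0) @ concat (map (\<lambda>j. replicate (q ! j) (a (Suc j))) [0..<length q])"
    by (simp add: upt_conv_Cons map_Suc_upt[symmetric] o_def del: upt_Suc)
  also have "\<dots> = replicate c (a 0) @ map (\<lambda>k. a (Suc (blk q k))) [0..<sum_list q]"
    by (simp add: Cons.IH[of "\<lambda>j. a (Suc j)"])
  also have "\<dots> = map (\<lambda>k. a (blk (c # q) k)) [0..<sum_list (c # q)]"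
    by (rule nth_equalityI) (auto simp: nth_append blk_Cons)
  finally show ?case .
qed simp

lemma nth_concat_off:
  "i < length xss \<Longrightarrow> t < length (xss ! i) \<Longrightarrow> concat xss ! (off (map length xss) i + t) = xss ! i ! t"
proof (induction xss arbitrary: i)
  case (Cons xs xss)
  then show ?case by (cases i) (auto simp: nth_append add.assoc)
qed simp

section \<open>Coset sums and invariants\<close>

text \<open>The condition on \<open>t\<close> says that \<open>g\<close> lies in the left coset of
  \<open>t\<close>. Transversals can be chosen freely, translated and multiplied, unlike the fixed
  representatives inside \<open>csum\<close>.\<close>

definition transversal :: "(nat \<Rightarrow> nat) set \<Rightarrow> (nat \<Rightarrow> nat) set \<Rightarrow> (nat \<Rightarrow> nat) set \<Rightarrow> bool" where
  "transversal G H T \<longleftrightarrow> T \<subseteq> G \<and> (\<forall>g\<in>G. \<exists>!t. t \<in> T \<and> inv t \<circ> g \<in> H)"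

definition conj_by :: "(nat \<Rightarrow> nat) \<Rightarrow> (nat \<Rightarrow> nat) set \<Rightarrow> (nat \<Rightarrow> nat) set" where
  "conj_by \<tau> G = (\<lambda>\<sigma>. \<tau> \<circ> \<sigma> \<circ> inv \<tau>) ` G"

lemma subgrpD:
  assumes "subgrp n G"
  shows "G \<subseteq> Sym n" "id \<in> G" "\<And>\<sigma> \<tau>. \<sigma> \<in> G \<Longrightarrow> \<tau> \<in> G \<Longrightarrow> \<sigma> \<circ> \<tau> \<in> G" "\<And>\<sigma>. \<sigma> \<in> G \<Longrightarrow> inv \<sigma> \<in> G"
    "\<And>\<sigma>. \<sigma> \<in> G \<Longrightarrow> \<sigma> \<in> Sym n"
  using assms by (auto simp: subgrp_def)

lemma Sym_cancel:
  assumes "\<sigma> \<in> Sym n"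
  shows "\<sigma> \<circ> (inv \<sigma> \<circ> \<tau>) = \<tau>" "inv \<sigma> \<circ> (\<sigma> \<circ> \<tau>) = \<tau>" "\<tau> \<circ> \<sigma> \<circ> inv \<sigma> = \<tau>" "\<tau> \<circ> inv \<sigma> \<circ> \<sigma> = \<tau>"
  using assms by (auto simp: fun_eq_iff)

lemma transversalD:
  assumes "transversal G H T"
  shows "T \<subseteq> G" "\<And>g. g \<in> G \<Longrightarrow> \<exists>t\<in>T. inv t \<circ> g \<in> H"
    "\<And>g t t'. g \<in> G \<Longrightarrow> t \<in> T \<Longrightarrow> t' \<in> T \<Longrightarrow> inv t \<circ> g \<in> H \<Longrightarrow> inv t' \<circ> g \<in> H \<Longrightarrow> t = t'"
  using assms unfolding transversal_def by blast+

lemma coset_eq_iff: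
  assumes G: "subgrp n G" and H: "subgrp n H" "H \<subseteq> G" and g: "g \<in> G" "g' \<in> G"
  shows "(\<lambda>h. g \<circ> h) ` H = (\<lambda>h. g' \<circ> h) ` H \<longleftrightarrow> inv g \<circ> g' \<in> H"
proof
  have S: "g \<in> Sym n" "g' \<in> Sym n" using subgrpD(5)[OF G] g by auto
  assume "(\<lambda>h. g \<circ> h) ` H = (\<lambda>h. g' \<circ> h) ` H"
  then have "g' \<circ> id \<in> (\<lambda>h. g \<circ> h) ` H" using subgrpD(2)[OF H(1)] by blast
  then obtain h where "h \<in> H" "g' = g \<circ> h" by auto
  then show "inv g \<circ> g' \<in> H" using S by (simp add: Sym_cancel)
next
  have S: "g \<in> Sym n" "g' \<in> Sym n" using subgrpD(5)[OF G] g by auto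
  assume a: "inv g \<circ> g' \<in> H"
  have b: "inv g' \<circ> g \<in> H"
    using subgrpD(4)[OF H(1) a] S by (simp add: Sym_inv_comp[where n=n] Sym_inv Sym_inv_inv[where n=n])
  show "(\<lambda>h. g \<circ> h) ` H = (\<lambda>h. g' \<circ> h) ` H"
  proof (intro set_eqI iffI)
    fix x assume "x \<in> (\<lambda>h. g \<circ> h) ` H"
    then obtain h where h: "h \<in> H" "x = g \<circ> h" by auto
    have "x = g' \<circ> ((inv g' \<circ> g) \<circ> h)" using h S by (auto simp: fun_eq_iff)
    then show "x \<in> (\<lambda>h. g' \<circ> h) ` H" using subgrpD(3)[OF H(1) b h(1)] by blast
  next
    fix x assume "x \<in> (\<lambda>h. g' \<circ> h) ` H"
    then obtain h where h: "h \<in> H" "x = g' \<circ> h" by auto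
    have "x = g \<circ> ((inv g \<circ> g') \<circ> h)" using h S by (auto simp: fun_eq_iff)
    then show "x \<in> (\<lambda>h. g \<circ> h) ` H" using subgrpD(3)[OF H(1) a h(1)] by blast
  qed
qed

lemma coset_some:
  assumes "subgrp n H"
  shows "\<exists>h\<in>H. (SOME x. x \<in> (\<lambda>h. g \<circ> h) ` H) = g \<circ> h"
proof -
  have "g \<circ> id \<in> (\<lambda>h. g \<circ> h) ` H" using subgrpD(2)[OF assms] by blast
  then have "(SOME x. x \<in> (\<lambda>h. g \<circ> h) ` H) \<in> (\<lambda>h. g \<circ> h) ` H"
    by (rule someI[of "\<lambda>x. x \<in> (\<lambda>h. g \<circ> h) ` H"])
  then show ?thesis by auto
qed

lemma comp_left_inj:
  assumes "g \<in> Sym n"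
  shows "inj_on ((\<circ>) g) (T :: (nat \<Rightarrow> nat) set)"
proof (rule inj_onI)
  fix a b :: "nat \<Rightarrow> nat" assume "g \<circ> a = g \<circ> b"
  then have "inv g \<circ> (g \<circ> a) = inv g \<circ> (g \<circ> b)" by (rule arg_cong)
  then show "a = b" unfolding Sym_cancel(2)[OF assms] .
qed

text \<open>The summand is constant on left cosets, so the representative picked by
  \<open>SOME\<close> contributes the same as the one in \<open>T\<close>.\<close>

lemma csum_transversal:
  assumes G: "subgrp n G" and H: "subgrp n H" "H \<subseteq> G" and T: "transversal G H T"
    and inv: "\<And>g h. g \<in> G \<Longrightarrow> h \<in> H \<Longrightarrow> \<phi> (g \<circ> h) = \<phi> g"
  shows "csum G H \<phi> = (\<lambda>z. \<Sum>t\<in>T. \<phi> t z)"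
proof
  fix z
  have TG: "T \<subseteq> G" using T by (simp add: transversal_def)
  have inj: "inj_on (\<lambda>g. (\<lambda>h. g \<circ> h) ` H) T"
  proof (rule inj_onI)
    fix t t' assume t: "t \<in> T" "t' \<in> T" "(\<lambda>h. t \<circ> h) ` H = (\<lambda>h. t' \<circ> h) ` H"
    then have "inv t \<circ> t' \<in> H" using TG by (subst (asm) coset_eq_iff[OF G H]) auto
    moreover have "t' \<in> Sym n" using t TG subgrpD(5)[OF G] by blast
    then have "inv t' \<circ> t' \<in> H" using subgrpD(2)[OF H(1)] by (simp add: Sym_inv_o)
    ultimately show "t = t'" using t TG by (intro transversalD(3)[OF T, of t']) auto
  qed
  have img: "(\<lambda>g. (\<lambda>h. g \<circ> h) ` H) ` G = (\<lambda>g. (\<lambda>h. g \<circ> h) ` H) ` T"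
  proof (intro equalityI subsetI)
    fix C assume "C \<in> (\<lambda>g. (\<lambda>h. g \<circ> h) ` H) ` G"
    then obtain g where g: "g \<in> G" "C = (\<lambda>h. g \<circ> h) ` H" by auto
    then obtain t where t: "t \<in> T" "inv t \<circ> g \<in> H" using transversalD(2)[OF T] by blast
    then have "(\<lambda>h. t \<circ> h) ` H = C" using coset_eq_iff[OF G H, of t g] g TG by auto
    then show "C \<in> (\<lambda>g. (\<lambda>h. g \<circ> h) ` H) ` T" using t by auto
  qed (use TG in auto)
  have "csum G H \<phi> z = (\<Sum>t\<in>T. \<phi> (SOME g. g \<in> (\<lambda>h. t \<circ> h) ` H) z)"
    unfolding csum_def img sum.reindex[OF inj] by (rule sum.cong) simp_all
  also have "\<dots> = (\<Sum>t\<in>T. \<phi> t z)"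
  proof (rule sum.cong)
    fix t assume "t \<in> T"
    then have "t \<in> G" using TG by blast
    moreover obtain h where "h \<in> H" "(SOME g. g \<in> (\<lambda>h. t \<circ> h) ` H) = t \<circ> h"
      using coset_some[OF H(1), of t] by blast
    ultimately show "\<phi> (SOME g. g \<in> (\<lambda>h. t \<circ> h) ` H) z = \<phi> t z" by (simp add: inv)
  qed simp
  finally show "csum G H \<phi> z = (\<Sum>t\<in>T. \<phi> t z)" .
qed

lemma transversal_exists:
  assumes G: "subgrp n G" and H: "subgrp n H" "H \<subseteq> G"
  shows "\<exists>T. transversal G H T"
proof -
  \<comment> \<open>\<open>s g\<close> depends on \<open>g\<close> only through its coset; this
    gives the uniqueness in the definition of a transversal.\<close>
  define s where "s g = (SOME x. x \<in> (\<lambda>h. g \<circ> h) ` H)" for g :: "nat \<Rightarrow> nat"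
  have s: "\<exists>h\<in>H. s g = g \<circ> h" for g unfolding s_def by (rule coset_some[OF H(1)])
  have sG: "s g \<in> G" if "g \<in> G" for g using s[of g] subgrpD(3)[OF G that] H(2) by auto
  have ss: "inv (s g) \<circ> g \<in> H" if "g \<in> G" for g
  proof -
    obtain h where h: "h \<in> H" "s g = g \<circ> h" using s by auto
    have S: "g \<in> Sym n" "h \<in> Sym n" using that h subgrpD(5)[OF G] H(2) by auto
    have "inv (s g) \<circ> g = inv h"
      unfolding h(2) using S by (simp add: Sym_inv_comp[where n=n] Sym_cancel[where n=n])
    then show ?thesis using subgrpD(4)[OF H(1)] h by simp
  qed
  have "transversal G H (s ` G)"
    unfolding transversal_def
  proof (intro conjI ballI)
    fix g assume g: "g \<in> G"
    show "\<exists>!t. t \<in> s ` G \<and> inv t \<circ> g \<in> H"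
    proof (rule ex1I[of _ "s g"])
      fix t assume t: "t \<in> s ` G \<and> inv t \<circ> g \<in> H"
      then obtain g' where g': "g' \<in> G" "t = s g'" by auto
      have "(\<lambda>h. t \<circ> h) ` H = (\<lambda>h. g \<circ> h) ` H" using coset_eq_iff[OF G H, of t g] g g' t sG by simp
      moreover have "(\<lambda>h. t \<circ> h) ` H = (\<lambda>h. g' \<circ> h) ` H"
        using coset_eq_iff[OF G H, of t g'] g' ss[of g'] sG by simp
      ultimately show "t = s g" using g' by (simp add: s_def)
    qed (use g ss in auto)
  qed (use sG in auto)
  then show ?thesis by blast
qed

text \<open>If \<open>e\<close> separates exactly the left cosets, then it labels them, and the
  coset sum becomes a sum over its values. Later \<open>e\<close> records which blocks a wreath
  product element moves to the places of a split slot.\<close>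

lemma csum_reindex:
  assumes G: "subgrp n G" and H: "subgrp n H" "H \<subseteq> G"
    and e: "\<And>g g'. g \<in> G \<Longrightarrow> g' \<in> G \<Longrightarrow> e g = e g' \<longleftrightarrow> inv g \<circ> g' \<in> H"
    and \<phi>: "\<And>g. g \<in> G \<Longrightarrow> \<phi> g = F (e g)"
  shows "csum G H \<phi> = (\<lambda>z. \<Sum>s\<in>e ` G. F s z)"
proof -
  obtain T where T: "transversal G H T" using transversal_exists[OF G H] by blast
  then have TG: "T \<subseteq> G" by (simp add: transversal_def)
  have "\<phi> (g \<circ> h) = \<phi> g" if "g \<in> G" "h \<in> H" for g h
  proof -
    have "g \<circ> h \<in> G" using subgrpD(3)[OF G that(1)] that H(2) by auto
    moreover have "inv g \<circ> (g \<circ> h) = h" by (rule Sym_cancel(2)[OF subgrpD(5)[OF G that(1)]])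
    then have "e g = e (g \<circ> h)" using e[OF that(1) calculation] that(2) by simp
    ultimately show ?thesis using \<phi>[of g] \<phi>[of "g \<circ> h"] that(1) by simp
  qed
  then have "csum G H \<phi> = (\<lambda>z. \<Sum>t\<in>T. \<phi> t z)" by (rule csum_transversal[OF G H T, where \<phi> = \<phi>])
  also have "\<dots> = (\<lambda>z. \<Sum>t\<in>T. F (e t) z)"
  proof (rule ext, rule sum.cong[OF refl])
    fix z t assume "t \<in> T"
    then show "\<phi> t z = F (e t) z" using \<phi>[of t] TG by auto
  qed
  also have "\<dots> = (\<lambda>z. \<Sum>s\<in>e ` T. F s z)"
  proof -
    have "inj_on e T"
    proof (rule inj_onI)
      fix t t' assume t: "t \<in> T" "t' \<in> T" "e t = e t'"
      have tG: "t \<in> G" "t' \<in> G" using t TG by auto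
      have "inv t \<circ> t' \<in> H" "inv t' \<circ> t' \<in> H" using t(3) e[OF tG] e[OF tG(2) tG(2)] by simp_all
      then show "t = t'" using t tG by (intro transversalD(3)[OF T, of t']) auto
    qed
    then show ?thesis by (simp add: sum.reindex o_def)
  qed
  also have "e ` T = e ` G"
  proof
    show "e ` G \<subseteq> e ` T"
    proof
      fix s assume "s \<in> e ` G"
      then obtain g where g: "g \<in> G" "s = e g" by auto
      then obtain t where t: "t \<in> T" "inv t \<circ> g \<in> H" using transversalD(2)[OF T] by blast
      then have "e t = e g" using e[of t g] TG g by blast
      then show "s \<in> e ` T" using t(1) g(2) by (metis image_eqI)
    qed
  qed (use TG in auto)
  finally show ?thesis .
qed

lemma csum_add: "csum G H (\<lambda>\<sigma> z. f \<sigma> z + g \<sigma> z) = (\<lambda>z. csum G H f z + csum G H g z)"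
  unfolding csum_def by (simp add: sum.distrib)

lemma csum_scale: "csum G H (\<lambda>\<sigma> z. c * f \<sigma> z) = (\<lambda>z. c * csum G H f z)"
  unfolding csum_def by (simp add: sum_distrib_left)

lemma csum_sum: "csum G H (\<lambda>\<sigma> z. \<Sum>i\<in>I. f i \<sigma> z) = (\<lambda>z. \<Sum>i\<in>I. csum G H (f i) z)"
  unfolding csum_def by (rule ext, rule sum.swap)

lemma conj_inj:
  assumes \<tau>: "\<tau> \<in> Sym n" and eq: "\<tau> \<circ> a \<circ> inv \<tau> = \<tau> \<circ> b \<circ> inv \<tau>"
  shows "a = b"
proof -
  have "inv \<tau> \<circ> (\<tau> \<circ> c \<circ> inv \<tau>) \<circ> \<tau> = c" for c using \<tau> by (intro ext) simp
  note c = this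
  show ?thesis using c[of a] unfolding eq c[of b] by (rule sym)
qed

lemma conj_by_subgrp:
  assumes \<tau>: "\<tau> \<in> Sym n" and G: "subgrp n G"
  shows "subgrp n (conj_by \<tau> G)"
proof -
  note D = subgrpD[OF G]
  have 1: "\<tau> \<circ> id \<circ> inv \<tau> = id" using \<tau> by (auto simp: fun_eq_iff)
  have 2: "(\<tau> \<circ> \<sigma> \<circ> inv \<tau>) \<circ> (\<tau> \<circ> \<sigma>' \<circ> inv \<tau>) = \<tau> \<circ> (\<sigma> \<circ> \<sigma>') \<circ> inv \<tau>" for \<sigma> \<sigma>'
    using \<tau> by (auto simp: fun_eq_iff)
  have 3: "inv (\<tau> \<circ> \<sigma> \<circ> inv \<tau>) = \<tau> \<circ> inv \<sigma> \<circ> inv \<tau>" if "\<sigma> \<in> G" for \<sigma>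
    using \<tau> D(5)[OF that] by (simp add: Sym_inv_comp[where n=n] Sym_comp Sym_inv Sym_inv_inv[where n=n] o_assoc)
  show ?thesis
    unfolding subgrp_def conj_by_def
  proof (intro conjI ballI)
    show "(\<lambda>\<sigma>. \<tau> \<circ> \<sigma> \<circ> inv \<tau>) ` G \<subseteq> Sym n" using \<tau> D(5) by (auto intro!: Sym_comp Sym_inv)
    show "id \<in> (\<lambda>\<sigma>. \<tau> \<circ> \<sigma> \<circ> inv \<tau>) ` G" using D(2) 1 by (metis image_eqI)
  next
    fix a b assume "a \<in> (\<lambda>\<sigma>. \<tau> \<circ> \<sigma> \<circ> inv \<tau>) ` G" "b \<in> (\<lambda>\<sigma>. \<tau> \<circ> \<sigma> \<circ> inv \<tau>) ` G"
    then obtain a' b' where "a' \<in> G" "b' \<in> G" "a = \<tau> \<circ> a' \<circ> inv \<tau>" "b = \<tau> \<circ> b' \<circ> inv \<tau>" by auto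
    then show "a \<circ> b \<in> (\<lambda>\<sigma>. \<tau> \<circ> \<sigma> \<circ> inv \<tau>) ` G" using D(3)[of a' b'] 2[of a' b'] by (metis image_eqI)
  next
    fix a assume "a \<in> (\<lambda>\<sigma>. \<tau> \<circ> \<sigma> \<circ> inv \<tau>) ` G"
    then obtain a' where "a' \<in> G" "a = \<tau> \<circ> a' \<circ> inv \<tau>" by auto
    then show "inv a \<in> (\<lambda>\<sigma>. \<tau> \<circ> \<sigma> \<circ> inv \<tau>) ` G" using D(4)[of a'] 3[of a'] by (metis image_eqI)
  qed
qed

text \<open>\<tau> carries one labelling to the other, hence conjugates their groups. With \<tau> a
  straightening permutation, \<open>SF n f\<close> becomes the group of a composition.\<close>

lemma SF_conj:
  assumes \<tau>: "\<tau> \<in> Sym n" and f: "\<And>k. k < n \<Longrightarrow> f' (\<tau> k) = f k"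
  shows "conj_by \<tau> (SF n f) = SF n f'"
proof (intro equalityI subsetI)
  have f2: "f (inv \<tau> k) = f' k" if "k < n" for k
    using f[of "inv \<tau> k"] that \<tau> by (simp add: Sym_less Sym_inv)
  fix \<sigma> assume "\<sigma> \<in> conj_by \<tau> (SF n f)"
  then obtain \<pi> where p: "\<pi> \<in> Sym n" "\<And>k. k < n \<Longrightarrow> f (\<pi> k) = f k" "\<sigma> = \<tau> \<circ> \<pi> \<circ> inv \<tau>"
    by (auto simp: conj_by_def SF_def)
  have "\<sigma> \<in> Sym n" using p \<tau> by (simp add: Sym_comp Sym_inv)
  moreover have "f' (\<sigma> k) = f' k" if "k < n" for k
    using p that \<tau> f f2 by (simp add: Sym_less Sym_inv)
  ultimately show "\<sigma> \<in> SF n f'" by (simp add: SF_def)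
next
  have f2: "f (inv \<tau> k) = f' k" if "k < n" for k
    using f[of "inv \<tau> k"] that \<tau> by (simp add: Sym_less Sym_inv)
  fix \<sigma> assume s: "\<sigma> \<in> SF n f'"
  then have S: "\<sigma> \<in> Sym n" by (rule SF_Sym)
  have "inv \<tau> \<circ> \<sigma> \<circ> \<tau> \<in> SF n f"
    using s S \<tau> f f2 by (simp add: SF_def Sym_comp Sym_inv Sym_less)
  moreover have "\<sigma> = \<tau> \<circ> (inv \<tau> \<circ> \<sigma> \<circ> \<tau>) \<circ> inv \<tau>" using \<tau> by (auto simp: fun_eq_iff)
  ultimately show "\<sigma> \<in> conj_by \<tau> (SF n f)" unfolding conj_by_def by blast
qed

lemma transversal_conj:
  assumes \<tau>: "\<tau> \<in> Sym n" and G: "subgrp n G" and H: "subgrp n H" "H \<subseteq> G" and T: "transversal G H T"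
  shows "transversal (conj_by \<tau> G) (conj_by \<tau> H) (conj_by \<tau> T)"
  unfolding transversal_def
proof (intro conjI ballI)
  have TG: "T \<subseteq> G" using T by (simp add: transversal_def)
  then show "conj_by \<tau> T \<subseteq> conj_by \<tau> G" by (auto simp: conj_by_def)
  fix g assume "g \<in> conj_by \<tau> G"
  then obtain g' where g': "g' \<in> G" "g = \<tau> \<circ> g' \<circ> inv \<tau>" by (auto simp: conj_by_def)
  have inj: "\<tau> \<circ> a \<circ> inv \<tau> = \<tau> \<circ> b \<circ> inv \<tau> \<longleftrightarrow> a = b" for a b :: "nat \<Rightarrow> nat"
    using conj_inj[OF \<tau>] by blast
  have mem: "\<tau> \<circ> a \<circ> inv \<tau> \<in> conj_by \<tau> K \<longleftrightarrow> a \<in> K" for a K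
    using inj by (auto simp: conj_by_def)
  have eq: "inv (\<tau> \<circ> t \<circ> inv \<tau>) \<circ> g = \<tau> \<circ> (inv t \<circ> g') \<circ> inv \<tau>" if "t \<in> T" for t
    using \<tau> g'(2) subgrpD(5)[OF G, of t] that TG
    by (auto simp: Sym_inv_comp[where n=n] Sym_comp Sym_inv Sym_inv_inv[where n=n] fun_eq_iff)
  obtain t where t: "t \<in> T" "inv t \<circ> g' \<in> H" and uniq: "\<And>t'. t' \<in> T \<Longrightarrow> inv t' \<circ> g' \<in> H \<Longrightarrow> t' = t"
    using transversalD(2)[OF T g'(1)] transversalD(3)[OF T g'(1)] by blast
  show "\<exists>!t. t \<in> conj_by \<tau> T \<and> inv t \<circ> g \<in> conj_by \<tau> H"
  proof (rule ex1I[of _ "\<tau> \<circ> t \<circ> inv \<tau>"])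
    show "\<tau> \<circ> t \<circ> inv \<tau> \<in> conj_by \<tau> T \<and> inv (\<tau> \<circ> t \<circ> inv \<tau>) \<circ> g \<in> conj_by \<tau> H"
      using t by (simp add: mem eq)
    fix s assume s: "s \<in> conj_by \<tau> T \<and> inv s \<circ> g \<in> conj_by \<tau> H"
    then obtain s' where s': "s' \<in> T" "s = \<tau> \<circ> s' \<circ> inv \<tau>" by (auto simp: conj_by_def)
    then have "inv s' \<circ> g' \<in> H" using s by (simp add: mem eq)
    then show "s = \<tau> \<circ> t \<circ> inv \<tau>" using uniq s' by simp
  qed
qed

text \<open>\<open>Pinv\<close> only covers groups of compositions; invariants of arbitrary
  partitions and of wreath products are needed as well.\<close>

definition Pfix :: "(nat \<Rightarrow> 'o set) \<Rightarrow> ((nat \<Rightarrow> nat) \<Rightarrow> 'o \<Rightarrow> 'o) \<Rightarrow> nat \<Rightarrow> (nat \<Rightarrow> nat) set \<Rightarrow> ('o \<Rightarrow> 'k::field) set" where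
  "Pfix B act n G = {x \<in> Pn B n. \<forall>\<sigma>\<in>G. lact B act n \<sigma> x = x}"

lemma Pinv_eq_Pfix: "Pinv B act r = Pfix B act (sum_list r) (Symc r)"
  by (simp add: Pinv_def Pfix_def)

lemma Pn_add:
  assumes "x \<in> Pn B n" "y \<in> Pn B n"
  shows "(\<lambda>z. x z + y z) \<in> Pn B n"
proof -
  have sub: "{z. x z + y z \<noteq> 0} \<subseteq> {z. x z \<noteq> 0} \<union> {z. y z \<noteq> 0}" by auto
  have "finite {z. x z + y z \<noteq> 0}" by (rule finite_subset[OF sub]) (use assms in \<open>simp add: Pn_def\<close>)
  moreover have "z \<in> B n" if "x z + y z \<noteq> 0" for z
    using sub that assms by (auto simp: Pn_def)
  ultimately show ?thesis by (simp add: Pn_def)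
qed

lemma Pn_scale: "x \<in> Pn B n \<Longrightarrow> (\<lambda>z. c * x z) \<in> Pn B n"
  unfolding Pn_def using finite_subset[of "{z. c * x z \<noteq> 0}" "{z. x z \<noteq> 0}"] by auto

lemma Pn_zero: "(\<lambda>z. 0) \<in> Pn B n" by (simp add: Pn_def)

lemma Pn_sum: "(\<And>i. i \<in> I \<Longrightarrow> x i \<in> Pn B n) \<Longrightarrow> (\<lambda>z. \<Sum>i\<in>I. x i z) \<in> Pn B n"
  by (induction I rule: infinite_finite_induct) (auto simp: Pn_zero intro: Pn_add)

lemma Pn_outside: "x \<in> Pn B n \<Longrightarrow> z \<notin> B n \<Longrightarrow> x z = 0"
  by (auto simp: Pn_def)

lemma lact_add: "lact B act n \<sigma> (\<lambda>z. x z + y z) = (\<lambda>z. lact B act n \<sigma> x z + lact B act n \<sigma> y z)"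
  by (auto simp: lact_def)

lemma lact_scale: "lact B act n \<sigma> (\<lambda>z. c * x z) = (\<lambda>z. c * lact B act n \<sigma> x z)"
  by (auto simp: lact_def)

lemma lact_sum: "lact B act n \<sigma> (\<lambda>z. \<Sum>i\<in>I. x i z) = (\<lambda>z. \<Sum>i\<in>I. lact B act n \<sigma> (x i) z)"
  by (auto simp: lact_def)

lemma lact_zero: "lact B act n \<sigma> (\<lambda>z. 0) = (\<lambda>z. 0)"
  by (auto simp: lact_def)

lemma Pfix_add: "x \<in> Pfix B act n G \<Longrightarrow> y \<in> Pfix B act n G \<Longrightarrow> (\<lambda>z. x z + y z) \<in> Pfix B act n G"
  by (simp add: Pfix_def Pn_add lact_add)

lemma Pfix_scale: "x \<in> Pfix B act n G \<Longrightarrow> (\<lambda>z. c * x z) \<in> Pfix B act n G"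
  by (simp add: Pfix_def Pn_scale lact_scale)

lemma Pfix_zero: "(\<lambda>z. 0) \<in> Pfix B act n G"
  by (simp add: Pfix_def Pn_zero lact_zero)

lemma Pfix_sum: "(\<And>i. i \<in> I \<Longrightarrow> x i \<in> Pfix B act n G) \<Longrightarrow> (\<lambda>z. \<Sum>i\<in>I. x i z) \<in> Pfix B act n G"
  by (simp add: Pfix_def Pn_sum lact_sum)

lemma Pfix_mono: "H \<subseteq> G \<Longrightarrow> Pfix B act n G \<subseteq> Pfix B act n H"
  by (auto simp: Pfix_def)

text \<open>Elements of the linear operad are coefficient functions, so for an orbit
  \<open>Q\<close> this is the orbit sum.\<close>

definition ind :: "'o set \<Rightarrow> 'o \<Rightarrow> 'k::field" where
  "ind Q = (\<lambda>z. if z \<in> Q then 1 else 0)"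

lemma orbc_eq_orbR: "orbc act r x = orbR act (Symc r) x"
  by (simp add: orbc_def orbR_def)

locale set_op =
  fixes B :: "nat \<Rightarrow> 'o set" and act :: "(nat \<Rightarrow> nat) \<Rightarrow> 'o \<Rightarrow> 'o" and u :: 'o
    and cmp :: "'o \<Rightarrow> 'o list \<Rightarrow> 'o"
  assumes operad: "set_operad B act u cmp" and B0: "B 0 = {}"
begin

lemmas op = operad[unfolded set_operad_def]

lemma act_in: "\<sigma> \<in> Sym n \<Longrightarrow> x \<in> B n \<Longrightarrow> act \<sigma> x \<in> B n"
  using op[THEN conjunct2, THEN conjunct1] by blast

lemma act_id: "x \<in> B n \<Longrightarrow> act id x = x"
  using op[THEN conjunct2, THEN conjunct2, THEN conjunct1] by blast

lemma act_comp: "\<sigma> \<in> Sym n \<Longrightarrow> \<tau> \<in> Sym n \<Longrightarrow> x \<in> B n \<Longrightarrow> act (\<sigma> \<circ> \<tau>) x = act \<sigma> (act \<tau> x)"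
  using op[THEN conjunct2, THEN conjunct2, THEN conjunct2, THEN conjunct1] by blast

lemma unit_in: "u \<in> B 1"
  using op[THEN conjunct2, THEN conjunct2, THEN conjunct2, THEN conjunct2, THEN conjunct1] by blast

lemma cmp_in: "x \<in> B n \<Longrightarrow> length ys = n \<Longrightarrow> length ms = n \<Longrightarrow> (\<And>i. i < n \<Longrightarrow> ys ! i \<in> B (ms ! i))
    \<Longrightarrow> cmp x ys \<in> B (sum_list ms)"
  using op[THEN conjunct2, THEN conjunct2, THEN conjunct2, THEN conjunct2, THEN conjunct2, THEN conjunct1] by blast

lemma cmp_act_left: "x \<in> B n \<Longrightarrow> length ys = n \<Longrightarrow> length ms = n \<Longrightarrow> (\<And>i. i < n \<Longrightarrow> ys ! i \<in> B (ms ! i))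
    \<Longrightarrow> \<sigma> \<in> Sym n \<Longrightarrow> cmp (act \<sigma> x) ys =
      act (block_perm (map (\<lambda>i. ms ! \<sigma> i) [0..<n]) \<sigma>) (cmp x (map (\<lambda>i. ys ! \<sigma> i) [0..<n]))"
  using op[THEN conjunct2, THEN conjunct2, THEN conjunct2, THEN conjunct2, THEN conjunct2, THEN conjunct2, THEN conjunct2, THEN conjunct2, THEN conjunct2, THEN conjunct1] by blast

lemma cmp_act_right: "x \<in> B n \<Longrightarrow> length ys = n \<Longrightarrow> length ms = n \<Longrightarrow> (\<And>i. i < n \<Longrightarrow> ys ! i \<in> B (ms ! i))
    \<Longrightarrow> length \<tau>s = n \<Longrightarrow> (\<And>i. i < n \<Longrightarrow> \<tau>s ! i \<in> Sym (ms ! i)) \<Longrightarrow>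
      cmp x (map (\<lambda>i. act (\<tau>s ! i) (ys ! i)) [0..<n]) = act (dsum ms \<tau>s) (cmp x ys)"
  using op[THEN conjunct2, THEN conjunct2, THEN conjunct2, THEN conjunct2, THEN conjunct2, THEN conjunct2, THEN conjunct2, THEN conjunct2, THEN conjunct2, THEN conjunct2] by blast

lemma act_inv [simp]:
  assumes "\<sigma> \<in> Sym n" "x \<in> B n"
  shows "act (inv \<sigma>) (act \<sigma> x) = x" "act \<sigma> (act (inv \<sigma>) x) = x"
  using assms act_comp[of "inv \<sigma>" n \<sigma> x] act_comp[of \<sigma> n "inv \<sigma>" x]
  by (simp_all add: Sym_inv Sym_inv_o act_id)

lemma act_eq_iff: "\<sigma> \<in> Sym n \<Longrightarrow> x \<in> B n \<Longrightarrow> z \<in> B n \<Longrightarrow> act (inv \<sigma>) z = x \<longleftrightarrow> act \<sigma> x = z"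
  using act_inv by metis

lemma lact_Pn: "\<sigma> \<in> Sym n \<Longrightarrow> x \<in> Pn B n \<Longrightarrow> lact B act n \<sigma> x \<in> Pn B n"
proof -
  assume a: "\<sigma> \<in> Sym n" "x \<in> Pn B n"
  have "{y. lact B act n \<sigma> x y \<noteq> 0} \<subseteq> act \<sigma> ` {y. x y \<noteq> 0}"
  proof
    fix y assume "y \<in> {y. lact B act n \<sigma> x y \<noteq> 0}"
    then have "y \<in> B n" "x (act (inv \<sigma>) y) \<noteq> 0" by (auto simp: lact_def split: if_splits)
    then show "y \<in> act \<sigma> ` {y. x y \<noteq> 0}" using a by (intro image_eqI[of _ _ "act (inv \<sigma>) y"]) auto
  qed
  then show ?thesis using a by (auto simp: Pn_def lact_def finite_subset split: if_splits)
qed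

lemma lact_id: "x \<in> Pn B n \<Longrightarrow> lact B act n id x = x"
  by (auto simp: lact_def fun_eq_iff act_id Pn_outside)

lemma lact_comp:
  assumes "\<sigma> \<in> Sym n" "\<tau> \<in> Sym n"
  shows "lact B act n (\<sigma> \<circ> \<tau>) x = lact B act n \<sigma> (lact B act n \<tau> x)"
  using assms by (auto simp: lact_def fun_eq_iff Sym_inv_comp[where n=n] act_comp[where n=n] Sym_inv act_in)

lemma lact_conj:
  assumes \<tau>: "\<tau> \<in> Sym n" and \<sigma>: "\<sigma> \<in> Sym n"
  shows "lact B act n (\<tau> \<circ> \<sigma> \<circ> inv \<tau>) (lact B act n \<tau> x) = lact B act n \<tau> (lact B act n \<sigma> x)"
proof -
  have "lact B act n (\<tau> \<circ> \<sigma> \<circ> inv \<tau>) (lact B act n \<tau> x) = lact B act n (\<tau> \<circ> \<sigma> \<circ> inv \<tau> \<circ> \<tau>) x"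
    using \<tau> \<sigma> by (intro lact_comp[symmetric] Sym_comp Sym_inv)
  also have "\<dots> = lact B act n (\<tau> \<circ> \<sigma>) x" by (simp only: Sym_cancel[OF \<tau>])
  also have "\<dots> = lact B act n \<tau> (lact B act n \<sigma> x)" using \<tau> \<sigma> by (rule lact_comp)
  finally show ?thesis .
qed

lemma Pfix_conj:
  assumes \<tau>: "\<tau> \<in> Sym n" and G: "subgrp n G" and x: "x \<in> Pfix B act n G"
  shows "lact B act n \<tau> x \<in> Pfix B act n (conj_by \<tau> G)"
proof -
  have "lact B act n (\<tau> \<circ> \<sigma> \<circ> inv \<tau>) (lact B act n \<tau> x) = lact B act n \<tau> x" if "\<sigma> \<in> G" for \<sigma>
    unfolding lact_conj[OF \<tau> subgrpD(5)[OF G that]] using x that by (simp add: Pfix_def)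
  then show ?thesis using x \<tau> by (auto simp: Pfix_def lact_Pn conj_by_def)
qed

lemma lact_right_inv:
  assumes "subgrp n G" "H \<subseteq> G" "x \<in> Pfix B act n H" "g \<in> G" "h \<in> H"
  shows "lact B act n (g \<circ> h) x = lact B act n g x"
  using assms subgrpD(5)[OF assms(1)] by (subst lact_comp) (auto simp: Pfix_def)

lemma csum_lact_transversal:
  assumes "subgrp n G" "subgrp n H" "H \<subseteq> G" "x \<in> Pfix B act n H" "transversal G H T"
  shows "csum G H (\<lambda>\<sigma>. lact B act n \<sigma> x) = (\<lambda>z. \<Sum>t\<in>T. lact B act n t x z)"
  by (rule csum_transversal[OF assms(1-3,5)]) (rule lact_right_inv[OF assms(1,3,4)])

lemma csum_self:
  assumes G: "subgrp n G" and x: "x \<in> Pfix B act n G"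
  shows "csum G G (\<lambda>\<sigma>. lact B act n \<sigma> x) = x"
proof -
  have "transversal G G {id}" using subgrpD[OF G] by (auto simp: transversal_def)
  then show ?thesis using csum_lact_transversal[OF G G _ x] x by (simp add: lact_id Pfix_def)
qed

text \<open>Conjugation by \<tau> turns a transversal of the given groups into one of the conjugate
  groups, and a conjugated element acts on the translate of \<open>x\<close> as the original one
  acts on \<open>x\<close>, followed by \<tau>.\<close>

lemma csum_conj:
  assumes \<tau>: "\<tau> \<in> Sym n" and G: "subgrp n G" and H: "subgrp n H" "H \<subseteq> G" and x: "x \<in> Pfix B act n H"
  shows "csum (conj_by \<tau> G) (conj_by \<tau> H) (\<lambda>\<sigma>. lact B act n \<sigma> (lact B act n \<tau> x))
    = lact B act n \<tau> (csum G H (\<lambda>\<sigma>. lact B act n \<sigma> x))"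
proof -
  obtain T where T: "transversal G H T" using transversal_exists[OF G H] by blast
  then have TS: "t \<in> Sym n" if "t \<in> T" for t using that subgrpD(5)[OF G] by (auto simp: transversal_def)
  have inj: "inj_on (\<lambda>\<sigma>. \<tau> \<circ> \<sigma> \<circ> inv \<tau>) T"
    using conj_inj[OF \<tau>] by (intro inj_onI) blast
  have "csum (conj_by \<tau> G) (conj_by \<tau> H) (\<lambda>\<sigma>. lact B act n \<sigma> (lact B act n \<tau> x))
    = (\<lambda>z. \<Sum>t\<in>conj_by \<tau> T. lact B act n t (lact B act n \<tau> x) z)"
    using H by (intro csum_lact_transversal transversal_conj[OF \<tau> G H T] conj_by_subgrp[OF \<tau>] G
       Pfix_conj[OF \<tau> H(1) x]) (auto simp: conj_by_def)
  also have "\<dots> = (\<lambda>z. \<Sum>t\<in>T. lact B act n (\<tau> \<circ> t \<circ> inv \<tau>) (lact B act n \<tau> x) z)"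
    unfolding conj_by_def by (simp add: sum.reindex[OF inj])
  also have "\<dots> = (\<lambda>z. \<Sum>t\<in>T. lact B act n \<tau> (lact B act n t x) z)"
  proof (intro ext sum.cong refl)
    fix z t assume "t \<in> T"
    then show "lact B act n (\<tau> \<circ> t \<circ> inv \<tau>) (lact B act n \<tau> x) z = lact B act n \<tau> (lact B act n t x) z"
      by (simp only: lact_conj[OF \<tau> TS])
  qed
  also have "\<dots> = lact B act n \<tau> (csum G H (\<lambda>\<sigma>. lact B act n \<sigma> x))"
    by (simp add: csum_lact_transversal[OF G H x T] lact_sum)
  finally show ?thesis .
qed

text \<open>Left translation by an element of \<open>G\<close> maps a transversal to another one, so
  it permutes the terms of the sum up to the choice of representatives.\<close>

lemma csum_Pfix:
  assumes G: "subgrp n G" and H: "subgrp n H" "H \<subseteq> G" and x: "x \<in> Pfix B act n H"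
  shows "csum G H (\<lambda>\<sigma>. lact B act n \<sigma> x) \<in> Pfix B act n G"
proof -
  obtain T where T: "transversal G H T" using transversal_exists[OF G H] by blast
  then have TG: "T \<subseteq> G" by (simp add: transversal_def)
  have eq: "csum G H (\<lambda>\<sigma>. lact B act n \<sigma> x) = (\<lambda>z. \<Sum>t\<in>T. lact B act n t x z)"
    by (rule csum_lact_transversal[OF G H x T])
  have "lact B act n g (csum G H (\<lambda>\<sigma>. lact B act n \<sigma> x)) = csum G H (\<lambda>\<sigma>. lact B act n \<sigma> x)"
    if g: "g \<in> G" for g
  proof -
    have gS: "g \<in> Sym n" using g subgrpD(5)[OF G] by blast
    have inj: "inj_on ((\<circ>) g) T" by (rule comp_left_inj[OF gS])
    have "transversal G H ((\<circ>) g ` T)"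
      unfolding transversal_def
    proof (intro conjI ballI)
      show "(\<circ>) g ` T \<subseteq> G" using TG g subgrpD(3)[OF G] by auto
      fix k assume k: "k \<in> G"
      have "inv g \<circ> k \<in> G" using g k subgrpD(3,4)[OF G] by auto
      then obtain t where t: "t \<in> T" "inv t \<circ> (inv g \<circ> k) \<in> H"
        and uniq: "\<And>t'. t' \<in> T \<Longrightarrow> inv t' \<circ> (inv g \<circ> k) \<in> H \<Longrightarrow> t' = t"
        using transversalD(2)[OF T] transversalD(3)[OF T] by blast
      have c: "inv (g \<circ> t') \<circ> k = inv t' \<circ> (inv g \<circ> k)" if "t' \<in> T" for t'
        using that TG subgrpD(5)[OF G] gS by (subst Sym_inv_comp[where n=n]) (auto simp: o_assoc)
      show "\<exists>!t. t \<in> (\<circ>) g ` T \<and> inv t \<circ> k \<in> H"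
      proof (rule ex1I[of _ "g \<circ> t"])
        show "g \<circ> t \<in> (\<circ>) g ` T \<and> inv (g \<circ> t) \<circ> k \<in> H" using t c by simp
        fix w assume "w \<in> (\<circ>) g ` T \<and> inv w \<circ> k \<in> H"
        then obtain t' where t': "t' \<in> T" "w = g \<circ> t'" "inv w \<circ> k \<in> H" by blast
        then show "w = g \<circ> t" using uniq[of t'] c[of t'] by simp
      qed
    qed
    then have "csum G H (\<lambda>\<sigma>. lact B act n \<sigma> x) = (\<lambda>z. \<Sum>t\<in>(\<circ>) g ` T. lact B act n t x z)"
      by (rule csum_lact_transversal[OF G H x])
    also have "\<dots> = (\<lambda>z. \<Sum>t\<in>T. lact B act n g (lact B act n t x) z)"
    proof -
      have "lact B act n (g \<circ> t) x = lact B act n g (lact B act n t x)" if "t \<in> T" for t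
        using that TG subgrpD(5)[OF G] gS by (intro lact_comp) auto
      then show ?thesis by (simp add: sum.reindex[OF inj])
    qed
    also have "\<dots> = lact B act n g (csum G H (\<lambda>\<sigma>. lact B act n \<sigma> x))"
      unfolding eq by (simp add: lact_sum)
    finally show ?thesis by simp
  qed
  moreover have "csum G H (\<lambda>\<sigma>. lact B act n \<sigma> x) \<in> Pn B n"
    unfolding eq using x TG subgrpD(5)[OF G] by (intro Pn_sum lact_Pn) (auto simp: Pfix_def)
  ultimately show ?thesis by (simp add: Pfix_def)
qed

text \<open>Products of representatives for \<open>G\<close> over \<open>K\<close> with
  representatives for \<open>K\<close> over \<open>H\<close> form a transversal for \<open>G\<close>
  over \<open>H\<close>.\<close>

lemma csum_trans:
  assumes G: "subgrp n G" and K: "subgrp n K" "K \<subseteq> G" and H: "subgrp n H" "H \<subseteq> K"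
    and x: "x \<in> Pfix B act n H"
  shows "csum G K (\<lambda>\<tau>. lact B act n \<tau> (csum K H (\<lambda>\<sigma>. lact B act n \<sigma> x))) = csum G H (\<lambda>\<sigma>. lact B act n \<sigma> x)"
proof -
  obtain T where T: "transversal G K T" using transversal_exists[OF G K] by blast
  obtain S where S: "transversal K H S" using transversal_exists[OF K(1) H] by blast
  have TG: "T \<subseteq> G" and SK: "S \<subseteq> K" using T S by (simp_all add: transversal_def)
  have TS: "t \<in> Sym n" if "t \<in> T" for t using that TG subgrpD(5)[OF G] by auto
  have SS: "s \<in> Sym n" if "s \<in> S" for s using that SK subgrpD(5)[OF K(1)] by auto
  have HG: "H \<subseteq> G" using H K by simp
  let ?m = "\<lambda>(t, s). t \<circ> s"
  \<comment> \<open>The coset of \<open>K\<close> that contains \<open>g\<close> determines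
    \<open>t\<close>; after division by \<open>t\<close>, the coset of \<open>H\<close> determines
    \<open>s\<close>.\<close>
  have key: "t = t' \<and> s = s'" if "t \<in> T" "s \<in> S" "t' \<in> T" "s' \<in> S" "g \<in> G"
      "inv (t \<circ> s) \<circ> g \<in> H" "inv (t' \<circ> s') \<circ> g \<in> H" for t s t' s' g
  proof -
    have e1: "inv t \<circ> g = s \<circ> (inv (t \<circ> s) \<circ> g)"
      using TS[OF that(1)] SS[OF that(2)] by (auto simp: Sym_inv_comp[where n=n] fun_eq_iff)
    have e2: "inv t' \<circ> g = s' \<circ> (inv (t' \<circ> s') \<circ> g)"
      using TS[OF that(3)] SS[OF that(4)] by (auto simp: Sym_inv_comp[where n=n] fun_eq_iff)
    have k: "inv t \<circ> g \<in> K" "inv t' \<circ> g \<in> K"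
      unfolding e1 e2 using that SK H subgrpD(3)[OF K(1)] by blast+
    then have tt: "t = t'" using that by (intro transversalD(3)[OF T, of g]) auto
    have "inv s \<circ> (inv t \<circ> g) \<in> H" "inv s' \<circ> (inv t \<circ> g) \<in> H"
      using that TS SS tt by (simp_all add: Sym_inv_comp[where n=n] o_assoc)
    then have "s = s'" using that k by (intro transversalD(3)[OF S, of "inv t \<circ> g"]) auto
    with tt show ?thesis by simp
  qed
  have inj: "inj_on ?m (T \<times> S)"
  proof (rule inj_onI, clarify)
    fix t s t' s' assume a: "t \<in> T" "s \<in> S" "t' \<in> T" "s' \<in> S" "t \<circ> s = t' \<circ> s'"
    have "t \<circ> s \<in> G" using a TG SK K subgrpD(3)[OF G] by blast
    moreover have "inv (t \<circ> s) \<circ> (t \<circ> s) \<in> H"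
      using Sym_inv_o(1)[OF Sym_comp[OF TS SS]] a subgrpD(2)[OF H(1)] by simp
    ultimately show "t = t' \<and> s = s'" using key[of t s t' s' "t \<circ> s"] a by simp
  qed
  have "transversal G H (?m ` (T \<times> S))"
    unfolding transversal_def
  proof (intro conjI ballI)
    show "?m ` (T \<times> S) \<subseteq> G"
    proof clarify
      fix t s assume "t \<in> T" "s \<in> S"
      then show "t \<circ> s \<in> G" using TG SK K(2) by (intro subgrpD(3)[OF G]) auto
    qed
    fix g assume g: "g \<in> G"
    then obtain t where t: "t \<in> T" "inv t \<circ> g \<in> K" using transversalD(2)[OF T] by blast
    then obtain s where s: "s \<in> S" "inv s \<circ> (inv t \<circ> g) \<in> H" using transversalD(2)[OF S] by blast
    have m: "inv (t \<circ> s) \<circ> g \<in> H" using t s TS SS by (simp add: Sym_inv_comp[where n=n] o_assoc)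
    show "\<exists>!t. t \<in> ?m ` (T \<times> S) \<and> inv t \<circ> g \<in> H"
    proof (rule ex1I[of _ "t \<circ> s"])
      fix w assume "w \<in> ?m ` (T \<times> S) \<and> inv w \<circ> g \<in> H"
      then obtain t' s' where "t' \<in> T" "s' \<in> S" "w = t' \<circ> s'" "inv (t' \<circ> s') \<circ> g \<in> H" by auto
      then show "w = t \<circ> s" using key[of t s t' s' g] t s g m by simp
    qed (use t s m in auto)
  qed
  then have "csum G H (\<lambda>\<sigma>. lact B act n \<sigma> x) = (\<lambda>z. \<Sum>w\<in>?m ` (T \<times> S). lact B act n w x z)"
    by (rule csum_lact_transversal[OF G H(1) HG x])
  also have "\<dots> = (\<lambda>z. \<Sum>(t, s)\<in>T \<times> S. lact B act n (t \<circ> s) x z)"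
    unfolding sum.reindex[OF inj] by (intro ext sum.cong) auto
  also have "\<dots> = (\<lambda>z. \<Sum>(t, s)\<in>T \<times> S. lact B act n t (lact B act n s x) z)"
    using TS SS by (intro ext sum.cong) (auto simp: lact_comp)
  also have "\<dots> = (\<lambda>z. \<Sum>t\<in>T. lact B act n t (\<lambda>z. \<Sum>s\<in>S. lact B act n s x z) z)"
    by (simp add: lact_sum sum.cartesian_product)
  also have "\<dots> = (\<lambda>z. \<Sum>t\<in>T. lact B act n t (csum K H (\<lambda>\<sigma>. lact B act n \<sigma> x)) z)"
    by (simp add: csum_lact_transversal[OF K(1) H x S])
  also have "\<dots> = csum G K (\<lambda>\<tau>. lact B act n \<tau> (csum K H (\<lambda>\<sigma>. lact B act n \<sigma> x)))"
    by (rule csum_lact_transversal[OF G K _ T, symmetric]) (rule csum_Pfix[OF K(1) H x])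
  finally show ?thesis by simp
qed

text \<open>The elements that send \<open>x\<close> to \<open>z\<close> form the left coset of the
  stabiliser through any one of them.\<close>

lemma card_orbit_fibre:
  assumes G: "subgrp n G" and x: "x \<in> B n" and z: "z \<in> orbR act G x"
  shows "card {g \<in> G. act g x = z} = card (stab act G x)"
proof -
  obtain g0 where g0: "g0 \<in> G" "z = act g0 x" using z by (auto simp: orbR_def)
  have S: "g0 \<in> Sym n" using g0 subgrpD(5)[OF G] by blast
  have "bij_betw ((\<circ>) g0) (stab act G x) {g \<in> G. act g x = z}"
  proof (rule bij_betw_byWitness[where f' = "(\<circ>) (inv g0)"])
    show "(\<circ>) g0 ` stab act G x \<subseteq> {g \<in> G. act g x = z}"
      using g0 subgrpD(3,5)[OF G] S x by (auto simp: stab_def act_comp[where n=n])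
    show "(\<circ>) (inv g0) ` {g \<in> G. act g x = z} \<subseteq> stab act G x"
      using g0 subgrpD[OF G] S x by (auto simp: stab_def act_comp[where n=n] Sym_inv act_inv[where n=n])
  qed (use S in \<open>auto simp: Sym_cancel\<close>)
  then show ?thesis by (simp add: bij_betw_same_card)
qed

lemma orbR_subset: "subgrp n G \<Longrightarrow> x \<in> B n \<Longrightarrow> orbR act G x \<subseteq> B n"
  using subgrpD(5) act_in by (fastforce simp: orbR_def)

lemma orbR_self: "subgrp n G \<Longrightarrow> x \<in> B n \<Longrightarrow> x \<in> orbR act G x"
  unfolding orbR_def using subgrpD(2) act_id by (metis image_eqI)

lemma stab_card_pos: "subgrp n G \<Longrightarrow> x \<in> B n \<Longrightarrow> card (stab act G x) > 0"
proof -
  assume a: "subgrp n G" "x \<in> B n"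
  then have "id \<in> stab act G x" "finite (stab act G x)"
    using subgrpD(2)[OF a(1)] subgrp_finite[OF a(1)] by (auto simp: stab_def act_id)
  then show ?thesis by (auto simp: card_gt_0_iff)
qed

text \<open>Counting the pairs (coset representative, element of H) sending x to z in two ways avoids
  dividing by orders of groups, which may vanish in the field.\<close>

lemma csum_count:
  fixes L :: "'o \<Rightarrow> nat"
  assumes G: "subgrp n G" and H: "subgrp n H" "H \<subseteq> G" and x: "x \<in> B n" and s: "s > 0"
    and L: "\<And>z. z \<in> B n \<Longrightarrow> s * L z = card {h \<in> H. act h x = z}"
  shows "csum G H (\<lambda>\<tau>. lact B act n \<tau> (\<lambda>z. of_nat (L z) :: 'k::field))
    = (\<lambda>z. of_nat (card (stab act G x) div s) * ind (orbR act G x) z)"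
proof
  fix z
  let ?C = "(\<lambda>g. (\<lambda>h. g \<circ> h) ` H) ` G"
  define c where "c C = (SOME g. g \<in> C)" for C :: "(nat \<Rightarrow> nat) set"
  have fin: "finite G" "finite H" using G H subgrp_finite by auto
  have cC: "c C \<in> G \<and> C = (\<lambda>h. c C \<circ> h) ` H" if C: "C \<in> ?C" for C
  proof -
    obtain g where g: "g \<in> G" "C = (\<lambda>h. g \<circ> h) ` H" using C by auto
    obtain h where h: "h \<in> H" "c C = g \<circ> h" using coset_some[OF H(1), of g] g by (auto simp: c_def)
    have m: "c C \<in> G" using h g H subgrpD(3)[OF G] by auto
    have e: "inv g \<circ> c C = h" unfolding h(2) by (rule Sym_cancel(2)[OF subgrpD(5)[OF G g(1)]])
    have "(\<lambda>h. g \<circ> h) ` H = (\<lambda>h. c C \<circ> h) ` H"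
      unfolding coset_eq_iff[OF G H g(1) m] e by (rule h(1))
    then show ?thesis using m g(2) by (simp only: simp_thms)
  qed
  show "csum G H (\<lambda>\<tau>. lact B act n \<tau> (\<lambda>z. of_nat (L z))) z
    = of_nat (card (stab act G x) div s) * (ind (orbR act G x) z :: 'k)"
  proof (cases "z \<in> B n")
    case False
    then have "z \<notin> orbR act G x" using orbR_subset[OF G x] by auto
    then show ?thesis using False by (simp add: csum_def lact_def ind_def)
  next
    case z: True
    have S: "c C \<in> Sym n" if "C \<in> ?C" for C by (rule subgrpD(5)[OF G conjunct1[OF cC[OF that]]])
    \<comment> \<open>Translation by the representative of \<open>C\<close> turns the elements of
      \<open>H\<close> counted by \<open>L\<close> into the elements of the coset \<open>C\<close>
      that send \<open>x\<close> to \<open>z\<close>.\<close>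
    have per: "s * L (act (inv (c C)) z) = card {g \<in> C. act g x = z}" if C: "C \<in> ?C" for C
    proof -
      have "s * L (act (inv (c C)) z) = card {h \<in> H. act h x = act (inv (c C)) z}"
        using z S[OF C] by (intro L) (simp add: act_in Sym_inv)
      also have "{h \<in> H. act h x = act (inv (c C)) z} = {h \<in> H. act (c C \<circ> h) x = z}"
      proof (rule Collect_cong, rule conj_cong[OF refl])
        fix h assume "h \<in> H"
        then have hS: "h \<in> Sym n" by (rule subgrpD(5)[OF H(1)])
        show "act h x = act (inv (c C)) z \<longleftrightarrow> act (c C \<circ> h) x = z"
          using act_eq_iff[OF S[OF C] act_in[OF hS x] z] unfolding act_comp[OF S[OF C] hS x] by auto
      qed
      also have "card \<dots> = card ((\<circ>) (c C) ` \<dots>)"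
        by (rule card_image[symmetric], rule comp_left_inj[OF S[OF C]])
      also have "(\<circ>) (c C) ` {h \<in> H. act (c C \<circ> h) x = z} = {g \<in> (\<lambda>h. c C \<circ> h) ` H. act g x = z}"
        by auto
      also have "\<dots> = {g \<in> C. act g x = z}"
        by (rule arg_cong[where f = "\<lambda>X. {g \<in> X. act g x = z}"], rule conjunct2[OF cC[OF C], symmetric])
      finally show ?thesis .
    qed
    \<comment> \<open>The cosets partition \<open>G\<close>, so the local counts add up to the
      number of elements of \<open>G\<close> that send \<open>x\<close> to \<open>z\<close>.\<close>
    have "s * (\<Sum>C\<in>?C. L (act (inv (c C)) z)) = (\<Sum>C\<in>?C. card {g \<in> C. act g x = z})"
      unfolding sum_distrib_left by (rule sum.cong) (use per in auto)
    also have "\<dots> = card (\<Union>C\<in>?C. {g \<in> C. act g x = z})"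
    proof (rule card_UN_disjoint[symmetric])
      show "\<forall>C\<in>?C. \<forall>D\<in>?C. C \<noteq> D \<longrightarrow> {g \<in> C. act g x = z} \<inter> {g \<in> D. act g x = z} = {}"
      proof (intro ballI impI, rule ccontr)
        fix C D assume CD: "C \<in> ?C" "D \<in> ?C" "C \<noteq> D" "{g \<in> C. act g x = z} \<inter> {g \<in> D. act g x = z} \<noteq> {}"
        then obtain g where g: "g \<in> C" "g \<in> D" by auto
        obtain a b where ab: "a \<in> G" "b \<in> G" "C = (\<lambda>h. a \<circ> h) ` H" "D = (\<lambda>h. b \<circ> h) ` H" using CD by auto
        then obtain h h' where h: "h \<in> H" "h' \<in> H" "g = a \<circ> h" "g = b \<circ> h'" using g by auto
        have gG: "g \<in> G" using h ab H subgrpD(3)[OF G] by auto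
        have "inv a \<circ> g \<in> H" "inv b \<circ> g \<in> H" using h Sym_cancel(2)[OF subgrpD(5)[OF G ab(1)], of h] Sym_cancel(2)[OF subgrpD(5)[OF G ab(2)], of h'] by simp_all
        then have "C = D" using coset_eq_iff[OF G H ab(1) gG] coset_eq_iff[OF G H ab(2) gG] ab by simp
        then show False using CD by simp
      qed
    qed (use fin in auto)
    also have "(\<Union>C\<in>?C. {g \<in> C. act g x = z}) = {g \<in> G. act g x = z}"
    proof (intro equalityI subsetI)
      fix g assume g: "g \<in> {g \<in> G. act g x = z}"
      have "g \<in> (\<lambda>h. g \<circ> h) ` H" using subgrpD(2)[OF H(1)] by (metis comp_id image_eqI)
      then show "g \<in> (\<Union>C\<in>?C. {g \<in> C. act g x = z})" using g by auto
    qed (use H subgrpD(3)[OF G] in auto)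
    finally have N: "s * (\<Sum>C\<in>?C. L (act (inv (c C)) z)) = card {g \<in> G. act g x = z}" .
    have "csum G H (\<lambda>\<tau>. lact B act n \<tau> (\<lambda>z. of_nat (L z))) z
       = (of_nat (\<Sum>C\<in>?C. L (act (inv (c C)) z)) :: 'k)"
      using z by (simp add: csum_def lact_def c_def)
    also have "\<dots> = of_nat (card (stab act G x) div s) * ind (orbR act G x) z"
    proof (cases "z \<in> orbR act G x")
      case True
      then have "s * (\<Sum>C\<in>?C. L (act (inv (c C)) z)) = card (stab act G x)"
        using N card_orbit_fibre[OF G x] by simp
      \<comment> \<open>The division is exact: the stabiliser order has just been written as a
        multiple of \<open>s\<close>, an equation of natural numbers that is only afterwards mapped
        to the field.\<close>
      then have "card (stab act G x) div s = (\<Sum>C\<in>?C. L (act (inv (c C)) z))"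
        using s by (metis nonzero_mult_div_cancel_left neq0_conv)
      then show ?thesis using True by (simp add: ind_def)
    next
      case False
      then have "{g \<in> G. act g x = z} = {}" by (auto simp: orbR_def)
      then have "s * (\<Sum>C\<in>?C. L (act (inv (c C)) z)) = 0" unfolding N by (simp only: card.empty)
      then have "(\<Sum>C\<in>?C. L (act (inv (c C)) z)) = 0" using s by (metis mult_is_0 neq0_conv)
      then show ?thesis using False by (simp add: ind_def)
    qed
    finally show ?thesis .
  qed
qed

text \<open>The case of \<open>csum_count\<close> in which \<open>L\<close> is the indicator of the
  orbit under \<open>H\<close>: each of its points is hit by as many elements of \<open>H\<close> as
  the stabiliser has. It yields the coefficient in \<gamma>4.\<close>

lemma csum_ind:
  assumes G: "subgrp n G" and H: "subgrp n H" "H \<subseteq> G" and x: "x \<in> B n"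
  shows "csum G H (\<lambda>\<tau>. lact B act n \<tau> (ind (orbR act H x)))
    = (\<lambda>z. of_nat (card (stab act G x) div card (stab act H x)) * (ind (orbR act G x) z :: 'k::field))"
proof -
  define L where "L z = (if z \<in> orbR act H x then 1 else 0 :: nat)" for z
  have "card (stab act H x) * L z = card {h \<in> H. act h x = z}" for z
  proof (cases "z \<in> orbR act H x")
    case True
    then show ?thesis using card_orbit_fibre[OF H(1) x] by (simp add: L_def)
  next
    case False
    then have "{h \<in> H. act h x = z} = {}" by (auto simp: orbR_def)
    then have "card {h \<in> H. act h x = z} = 0" by (simp only: card.empty)
    then show ?thesis using False by (simp add: L_def)
  qed
  then have "csum G H (\<lambda>\<tau>. lact B act n \<tau> (\<lambda>z. of_nat (L z) :: 'k))
    = (\<lambda>z. of_nat (card (stab act G x) div card (stab act H x)) * ind (orbR act G x) z)"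
    by (intro csum_count[OF G H x] stab_card_pos[OF H(1) x])
  moreover have "(\<lambda>z. of_nat (L z) :: 'k) = ind (orbR act H x)" by (auto simp: L_def ind_def)
  ultimately show ?thesis by simp
qed

lemma orbR_eq:
  assumes G: "subgrp n G" and x: "x \<in> B n" and y: "y \<in> orbR act G x"
  shows "orbR act G y = orbR act G x"
proof -
  obtain g where g: "g \<in> G" "y = act g x" using y by (auto simp: orbR_def)
  note D = subgrpD[OF G]
  show ?thesis
  proof (intro equalityI subsetI)
    fix z assume "z \<in> orbR act G y"
    then obtain h where "h \<in> G" "z = act (h \<circ> g) x" using g D x by (auto simp: orbR_def act_comp[where n=n])
    then show "z \<in> orbR act G x" using D g by (auto simp: orbR_def)
  next
    fix z assume "z \<in> orbR act G x"
    then obtain h where h: "h \<in> G" "z = act h x" by (auto simp: orbR_def)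
    have "z = act (h \<circ> inv g) y"
      using h g x D(4,5) act_in by (simp add: act_comp[where n=n] act_inv[where n=n])
    then show "z \<in> orbR act G y" using D h g by (auto simp: orbR_def)
  qed
qed

lemma lact_ind:
  assumes \<tau>: "\<tau> \<in> Sym n" and Q: "Q \<subseteq> B n"
  shows "lact B act n \<tau> (ind Q) = ind (act \<tau> ` Q)"
proof
  fix z
  show "lact B act n \<tau> (ind Q) z = ind (act \<tau> ` Q) z"
  proof (cases "z \<in> B n")
    case True
    have "act (inv \<tau>) z \<in> Q \<longleftrightarrow> z \<in> act \<tau> ` Q"
    proof
      assume "act (inv \<tau>) z \<in> Q"
      then show "z \<in> act \<tau> ` Q" using act_inv(2)[OF \<tau> True] by (metis image_eqI)
    next
      assume "z \<in> act \<tau> ` Q"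
      then obtain q where q: "q \<in> Q" "z = act \<tau> q" by auto
      then show "act (inv \<tau>) z \<in> Q" using act_inv(1)[OF \<tau>, of q] Q by auto
    qed
    then show ?thesis using True by (simp add: lact_def ind_def)
  next
    case False
    then have "z \<notin> act \<tau> ` Q" using Q \<tau> act_in by blast
    then show ?thesis using False by (simp add: lact_def ind_def)
  qed
qed

lemma act_orbR_conj:
  assumes \<tau>: "\<tau> \<in> Sym n" and G: "subgrp n G" and x: "x \<in> B n"
  shows "act \<tau> ` orbR act G x = orbR act (conj_by \<tau> G) (act \<tau> x)"
proof -
  have "act (\<tau> \<circ> \<sigma> \<circ> inv \<tau>) (act \<tau> x) = act \<tau> (act \<sigma> x)" if "\<sigma> \<in> G" for \<sigma>
    using subgrpD(5)[OF G that] \<tau> x by (simp add: act_comp[where n=n] act_in Sym_comp Sym_inv act_inv[where n=n])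
  then show ?thesis unfolding orbR_def conj_by_def image_image by (intro image_cong) auto
qed

lemma ind_Pfix:
  assumes G: "subgrp n G" and x: "x \<in> B n"
  shows "ind (orbR act G x) \<in> Pfix B act n G"
proof -
  have fin: "finite (orbR act G x)" using subgrp_finite[OF G] by (simp add: orbR_def)
  have "act \<sigma> ` orbR act G x = orbR act G x" if s: "\<sigma> \<in> G" for \<sigma>
  proof (intro equalityI subsetI)
    fix z assume "z \<in> act \<sigma> ` orbR act G x"
    then obtain h where "h \<in> G" "z = act (\<sigma> \<circ> h) x"
      using s x subgrpD(5)[OF G] by (auto simp: orbR_def act_comp[where n=n])
    then show "z \<in> orbR act G x" using s subgrpD(3)[OF G] by (auto simp: orbR_def)
  next
    fix z assume "z \<in> orbR act G x"
    then obtain h where h: "h \<in> G" "z = act h x" by (auto simp: orbR_def)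
    have "z = act \<sigma> (act (inv \<sigma> \<circ> h) x)"
      using h s x subgrpD(5)[OF G] act_in by (simp add: act_comp[where n=n] Sym_inv act_inv[where n=n])
    moreover have "inv \<sigma> \<circ> h \<in> G" using s h subgrpD[OF G] by auto
    ultimately show "z \<in> act \<sigma> ` orbR act G x" by (auto simp: orbR_def)
  qed
  then show ?thesis using fin orbR_subset[OF G x] subgrpD(5)[OF G]
    by (auto simp: Pfix_def Pn_def lact_ind) (auto simp: ind_def split: if_splits)
qed

lemma Pfix_const:
  assumes G: "subgrp n G" and x: "x \<in> Pfix B act n G" and y: "y \<in> B n" and z: "z \<in> orbR act G y"
  shows "x z = x y"
proof -
  obtain g where g: "g \<in> G" "z = act g y" using z by (auto simp: orbR_def)
  have gS: "g \<in> Sym n" by (rule subgrpD(5)[OF G g(1)])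
  have "lact B act n g x = x" using x g(1) unfolding Pfix_def by blast
  then have "x z = lact B act n g x z" by simp
  also have "\<dots> = x (act (inv g) (act g y))" using act_in[OF gS y] g(2) by (simp only: lact_def if_True)
  also have "\<dots> = x y" by (simp only: act_inv(1)[OF gS y])
  finally show ?thesis .
qed

text \<open>An invariant is constant on orbits, so subtracting the right multiple of one orbit sum
  removes exactly that orbit from the support and leaves an invariant.\<close>

lemma Pfix_split:
  assumes G: "subgrp n G" and x: "x \<in> Pfix B act n G" and y: "x y \<noteq> 0"
  defines "v \<equiv> \<lambda>z. if z \<in> orbR act G y then 0 else x z"
  shows "y \<in> B n" "v \<in> Pfix B act n G" "x = (\<lambda>z. x y * ind (orbR act G y) z + v z)"
    "{z. v z \<noteq> 0} = {z. x z \<noteq> 0} - orbR act G y" "orbR act G y \<subseteq> {z. x z \<noteq> 0}"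
proof -
  show yB: "y \<in> B n" using x y by (auto simp: Pfix_def Pn_def)
  note c = Pfix_const[OF G x yB]
  show eq: "x = (\<lambda>z. x y * ind (orbR act G y) z + v z)"
    by (auto simp: fun_eq_iff v_def ind_def c)
  have "v = (\<lambda>z. x z + (- x y) * ind (orbR act G y) z)"
    by (auto simp: fun_eq_iff v_def ind_def c)
  then show "v \<in> Pfix B act n G" using Pfix_add[OF x Pfix_scale[OF ind_Pfix[OF G yB], of "- x y"]] by simp
  show "{z. v z \<noteq> 0} = {z. x z \<noteq> 0} - orbR act G y" by (auto simp: v_def)
  show "orbR act G y \<subseteq> {z. x z \<noteq> 0}" using c y by auto
qed

text \<open>The form in which it is used that orbit sums span the invariants. Each step removes one
  orbit from the finite support.\<close>

lemma Pfix_induct: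
  assumes G: "subgrp n G" and x: "x \<in> Pfix B act n G"
    and zero: "P (\<lambda>z. 0)"
    and step: "\<And>y c v. y \<in> B n \<Longrightarrow> v \<in> Pfix B act n G \<Longrightarrow> P v \<Longrightarrow> P (\<lambda>z. c * ind (orbR act G y) z + v z)"
  shows "P x"
  using x
proof (induction "card {z. x z \<noteq> 0}" arbitrary: x rule: less_induct)
  case less
  show ?case
  proof (cases "x = (\<lambda>z. 0)")
    case False
    then obtain y where y: "x y \<noteq> 0" by auto
    note s = Pfix_split[OF G less.prems y]
    have "finite {z. x z \<noteq> 0}" using less.prems by (simp add: Pfix_def Pn_def)
    moreover have "{z. x z \<noteq> 0} - orbR act G y \<subset> {z. x z \<noteq> 0}"
      using orbR_self[OF G s(1)] y by blast
    ultimately have "card ({z. x z \<noteq> 0} - orbR act G y) < card {z. x z \<noteq> 0}" by (rule psubset_card_mono)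
    then have "P (\<lambda>z. if z \<in> orbR act G y then 0 else x z)"
      using less.hyps[OF _ s(2)] unfolding s(4) by blast
    from step[OF s(1,2) this, of "x y"] show ?thesis by (rule back_subst[of P, OF _ s(3)[symmetric]])
  qed (use zero in simp)
qed

end

section \<open>Relabelling the arguments of an operation\<close>

lemma beta_objD:
  assumes "beta_obj B act sc beta"
  shows "\<And>x r as. \<not> beta_dom B act x r as \<Longrightarrow> beta x r as = 0"
    and "\<And>x r as \<rho>. x \<in> Pinv B act r \<Longrightarrow> length as = length r \<Longrightarrow> \<rho> \<in> Sym (length r) \<Longrightarrow>
        beta x r as = beta (lact B act (sum_list r) (block_perm r \<rho>) x) (plist \<rho> r) (plist \<rho> as)"
    and "\<And>x r a as c. x \<in> Pinv B act r \<Longrightarrow> length (a # as) = length r \<Longrightarrow>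
        beta x r (sc c a # as) = sc (c ^ hd r) (beta x r (a # as))"
    and "\<And>x r q as. x \<in> Pinv B act r \<Longrightarrow> sum_list q = length r \<Longrightarrow> length as = length q \<Longrightarrow>
        beta x r (concat (map (\<lambda>j. replicate (q ! j) (as ! j)) [0..<length q])) =
        beta (csum (Symc (tri q r)) (Symc r) (\<lambda>\<sigma>. lact B act (sum_list r) \<sigma> x)) (tri q r) as"
    and "\<And>x r a0 a1 as. x \<in> Pinv B act r \<Longrightarrow> length (a1 # as) = length r \<Longrightarrow>
        beta x r ((a0 + a1) # as) = (\<Sum>l\<le>hd r. beta x (l # (hd r - l) # tl r) (a0 # a1 # as))"
    and "\<And>x y r as. x \<in> Pinv B act r \<Longrightarrow> y \<in> Pinv B act r \<Longrightarrow> length as = length r \<Longrightarrow>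
        beta (\<lambda>z. x z + y z) r as = beta x r as + beta y r as"
    and "\<And>c x r as. x \<in> Pinv B act r \<Longrightarrow> length as = length r \<Longrightarrow>
        beta (\<lambda>z. c * x z) r as = sc c (beta x r as)"
    and "\<And>x r a0 as. x \<in> Pinv B act (0 # r) \<Longrightarrow> length as = length r \<Longrightarrow>
        beta x (0 # r) (a0 # as) = beta x r as"
proof (goal_cases)
  case 1 show ?case using assms[unfolded beta_obj_def beta_dom_def, THEN conjunct1] 1 unfolding beta_dom_def by blast
next
  case 2 then show ?case using assms[unfolded beta_obj_def beta_dom_def, THEN conjunct2, THEN conjunct1] by blast
next
  case 3 then show ?case using assms[unfolded beta_obj_def beta_dom_def, THEN conjunct2, THEN conjunct2, THEN conjunct2, THEN conjunct1] by blast
next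
  case 4 then show ?case using assms[unfolded beta_obj_def beta_dom_def, THEN conjunct2, THEN conjunct2, THEN conjunct2, THEN conjunct2, THEN conjunct1] by blast
next
  case 5 then show ?case using assms[unfolded beta_obj_def beta_dom_def, THEN conjunct2, THEN conjunct2, THEN conjunct2, THEN conjunct2, THEN conjunct2, THEN conjunct1] by blast
next
  case 6 then show ?case using assms[unfolded beta_obj_def beta_dom_def, THEN conjunct2, THEN conjunct2, THEN conjunct2, THEN conjunct2, THEN conjunct2, THEN conjunct2, THEN conjunct1] by blast
next
  case 7 then show ?case using assms[unfolded beta_obj_def beta_dom_def, THEN conjunct2, THEN conjunct2, THEN conjunct2, THEN conjunct2, THEN conjunct2, THEN conjunct2, THEN conjunct2] by blast
next
  case (8 x r a0 as)
  then have "length (a0 # as) = length (0 # r)" by simp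
  with 8 show ?case using assms[unfolded beta_obj_def beta_dom_def, THEN conjunct2, THEN conjunct2, THEN conjunct1] by blast
qed

lemma SF_mono: "(\<And>k. k < n \<Longrightarrow> f k = h (f' k)) \<Longrightarrow> SF n f' \<subseteq> SF n f"
  by (auto simp: SF_def Sym_less)

lemma SF_inj:
  assumes "\<And>k. k < n \<Longrightarrow> f k \<in> S" "inj_on g S"
  shows "SF n (\<lambda>k. g (f k)) = SF n f"
  using assms by (auto simp: SF_def Sym_less inj_on_eq_iff)

lemma Pinv_refine:
  assumes "sum_list r' = sum_list r" "\<And>k. k < sum_list r \<Longrightarrow> blk r k = h (blk r' k)"
  shows "Pinv B act r \<subseteq> Pinv B act r'"
  unfolding Pinv_eq_Pfix assms(1) Symc_eq by (rule Pfix_mono, rule SF_mono) (rule assms(2))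

text \<open>Brings the \<open>c\<close> positions that start at \<open>m\<close> to the front and
  shifts the first \<open>m\<close> positions back by \<open>c\<close>.\<close>

definition rot :: "nat \<Rightarrow> nat \<Rightarrow> nat \<Rightarrow> nat" where
  "rot m c k = (if k < m then k + c else if k < m + c then k - m else k)"

lemma rot_Sym: "m + c \<le> n \<Longrightarrow> rot m c \<in> Sym n"
  by (rule SymI) (auto simp: rot_def inj_on_def)

lemma blk_split:
  assumes "k < sum_list (r1 @ (l + m) # r2)"
  shows "blk (r1 @ (l + m) # r2) k = (if blk (r1 @ l # m # r2) k \<le> length r1 then blk (r1 @ l # m # r2) k
     else blk (r1 @ l # m # r2) k - 1)"
  using assms blk_props(1)[of k r1] by (auto simp: blk_append blk_Cons ac_simps)

lemma Pinv_split: "Pinv B act (r1 @ (l + m) # r2) \<subseteq> Pinv B act (r1 @ l # m # r2)"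
  by (rule Pinv_refine[where h = "\<lambda>j. if j \<le> length r1 then j else j - 1"]) (simp, rule blk_split)

context set_op
begin

text \<open>Two straightening permutations differ by an element that preserves the labels, and such
  an element fixes \<open>x\<close>. So \<open>betaR\<close> does not depend on the choice hidden in
  \<open>straighten\<close>.\<close>

lemma betaR_straightens:
  assumes f: "\<And>k. k < n \<Longrightarrow> f k < p" and x: "x \<in> Pfix B act n (SF n f)" and \<tau>: "straightens n p f \<tau>"
  shows "betaR n beta B act x (lparts n p f) as = beta (lact B act n \<tau> x) (cnt n p f) as"
proof -
  define \<sigma> where "\<sigma> = straighten n (lparts n p f)"
  have s: "straightens n p f \<sigma>" unfolding \<sigma>_def by (rule straightens_straighten[OF f])
  have S: "\<sigma> \<in> Sym n" "\<tau> \<in> Sym n" using s \<tau> by (simp_all add: straightens_def)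
  have mem: "inv \<tau> \<circ> \<sigma> \<in> SF n f"
  proof -
    have "f (inv \<tau> (\<sigma> k)) = f k" if "k < n" for k
    proof -
      have "inv \<tau> (\<sigma> k) < n" using S that by (simp add: Sym_less Sym_inv)
      then have "blk (cnt n p f) (\<tau> (inv \<tau> (\<sigma> k))) = f (inv \<tau> (\<sigma> k))"
        using \<tau> unfolding straightens_def by blast
      moreover have "blk (cnt n p f) (\<sigma> k) = f k" using s that unfolding straightens_def by blast
      ultimately show ?thesis using S by simp
    qed
    then show ?thesis using S by (simp add: SF_def Sym_comp Sym_inv)
  qed
  have "lact B act n \<sigma> x = lact B act n (\<tau> \<circ> (inv \<tau> \<circ> \<sigma>)) x" by (simp only: Sym_cancel[OF S(2)])
  also have "\<dots> = lact B act n \<tau> (lact B act n (inv \<tau> \<circ> \<sigma>) x)"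
    using S by (intro lact_comp Sym_comp Sym_inv)
  also have "lact B act n (inv \<tau> \<circ> \<sigma>) x = x" using x mem unfolding Pfix_def by blast
  finally show ?thesis by (simp add: betaR_def cnt_def \<sigma>_def)
qed

lemma betaR_blk:
  assumes x: "x \<in> Pinv B act r"
  shows "betaR (sum_list r) beta B act x (lparts (sum_list r) (length r) (blk r)) as = beta x r as"
proof -
  have s: "straightens (sum_list r) (length r) (blk r) id" "cnt (sum_list r) (length r) (blk r) = r"
    using straightensI[OF Sym_id, of r "sum_list r" "length r" "blk r"] by simp_all
  have x': "x \<in> Pfix B act (sum_list r) (SF (sum_list r) (blk r))" using x by (simp add: Pinv_eq_Pfix Symc_eq)
  then have "lact B act (sum_list r) id x = x" by (simp add: lact_id Pfix_def)
  then show ?thesis using betaR_straightens[OF _ x' s(1)] by (simp add: s(2) blk_props)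
qed

text \<open>\<beta>1 and \<beta>4 in one rule, free of any order of the blocks: arguments that
  factor through \<open>g\<close> may be merged along \<open>g\<close>, at the cost of a coset sum.
  All later changes of slots are instances of it.\<close>

lemma betaR_relabel:
  assumes b: "beta_obj B act sc beta"
    and f: "\<And>k. k < n \<Longrightarrow> f k < p" and g: "\<And>j. j < p \<Longrightarrow> g j < s" and x: "x \<in> Pfix B act n (SF n f)"
  shows "betaR n beta B act x (lparts n p f) (map (\<lambda>j. a (g j)) [0..<p])
    = betaR n beta B act (csum (SF n (\<lambda>k. g (f k))) (SF n f) (\<lambda>\<sigma>. lact B act n \<sigma> x))
        (lparts n s (\<lambda>k. g (f k))) (map a [0..<s])"
proof -
  obtain \<tau> where \<tau>: "straightens n p f \<tau>" using straightens_exists[of n f p] f by blast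
  \<comment> \<open>\<rho> brings the arguments with the same value of \<open>g\<close> next to each
    other, which is the shape that \<beta>4 asks for.\<close>
  obtain \<rho> where \<rho>: "straightens p s g \<rho>" using straightens_exists[of p g s] g by blast
  define r where "r = cnt n p f"
  define q where "q = cnt p s g"
  define r' where "r' = plist \<rho> r"
  \<comment> \<open>\<tau>' puts the blocks of \<open>f\<close> into the order given by \<rho>, and
    so straightens the coarser labelling at the same time.\<close>
  define \<tau>' where "\<tau>' = block_perm r \<rho> \<circ> \<tau>"
  define as where "as = map (\<lambda>j. a (g j)) [0..<p]"
  have r: "sum_list r = n" "length r = p" by (simp_all add: r_def sum_cnt[OF f])
  have q: "sum_list q = p" "length q = s" by (simp_all add: q_def sum_cnt[OF g])
  have \<tau>S: "\<tau> \<in> Sym n" and bf: "\<And>k. k < n \<Longrightarrow> blk r (\<tau> k) = f k"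
    using \<tau> by (simp_all add: straightens_def r_def)
  have \<rho>S: "\<rho> \<in> Sym p" and bg: "\<And>j. j < p \<Longrightarrow> blk q (\<rho> j) = g j"
    using \<rho> by (simp_all add: straightens_def q_def)
  have \<rho>r: "\<rho> \<in> Sym (length r)" using \<rho>S r by simp
  have bp: "block_perm r \<rho> \<in> Sym n" using block_perm_Sym[OF \<rho>r] r by simp
  have \<tau>'S: "\<tau>' \<in> Sym n" unfolding \<tau>'_def by (rule Sym_comp[OF bp \<tau>S])
  have r': "sum_list r' = n" "length r' = p" using r \<rho>r by (simp_all add: r'_def sum_plist)
  have b': "blk r' (\<tau>' k) = \<rho> (f k)" if "k < n" for k
    using blk_block_perm(1)[OF \<rho>r, of "\<tau> k"] bf[OF that] Sym_less[OF \<tau>S] that r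
    by (simp add: r'_def \<tau>'_def)
  have t: "sum_list (tri q r') = n" "length (tri q r') = s"
    using sum_tri[of q r'] q r' by simp_all
  have bt: "blk (tri q r') (\<tau>' k) = g (f k)" if "k < n" for k
  proof -
    have "\<tau>' k < sum_list r'" using that \<tau>'S r' by (simp add: Sym_less)
    then show ?thesis using b'[OF that] bg[OF f[OF that]] q r' by (simp add: blk_tri)
  qed
  note str = straightensI[where f = "\<lambda>k. g (f k)", OF \<tau>'S t bt]
  \<comment> \<open>\<rho> only renames labels, so \<tau>' conjugates the group of \<open>f\<close>
    to that of the rearranged composition.\<close>
  have \<rho>f: "SF n (\<lambda>k. \<rho> (f k)) = SF n f"
    using f bij_is_inj[OF Sym_bij[OF \<rho>S]] by (intro SF_inj[where S = UNIV]) auto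
  have c1: "conj_by \<tau> (SF n f) = Symc r"
    using SF_conj[OF \<tau>S, of "blk r" f] bf r by (simp add: Symc_eq)
  have c2: "conj_by \<tau>' (SF n f) = Symc r'"
    using SF_conj[OF \<tau>'S, of "blk r'" "\<lambda>k. \<rho> (f k)"] b' r' \<rho>f by (simp add: Symc_eq)
  have c3: "conj_by \<tau>' (SF n (\<lambda>k. g (f k))) = Symc (tri q r')"
    using SF_conj[OF \<tau>'S, of "blk (tri q r')" "\<lambda>k. g (f k)"] bt t by (simp add: Symc_eq)
  have x1: "lact B act n \<tau> x \<in> Pinv B act r"
    using Pfix_conj[OF \<tau>S SF_subgrp x] c1 r by (simp add: Pinv_eq_Pfix)
  have x2: "lact B act n \<tau>' x \<in> Pinv B act r'"
    using Pfix_conj[OF \<tau>'S SF_subgrp x] c2 r' by (simp add: Pinv_eq_Pfix)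
  have args: "plist \<rho> as = concat (map (\<lambda>j. replicate (q ! j) (map a [0..<s] ! j)) [0..<length q])"
  proof -
    have "plist \<rho> as ! i = map (\<lambda>k. map a [0..<s] ! blk q k) [0..<sum_list q] ! i" if i: "i < p" for i
    proof -
      have ir: "inv \<rho> i < p" using i Sym_less[OF Sym_inv[OF \<rho>S]] by simp
      have "g (inv \<rho> i) = blk q i" using bg[OF ir] \<rho>S by simp
      moreover have "blk q i < s" using blk_props(1)[of i q] i q by simp
      ultimately show ?thesis using i ir q by (simp add: nth_plist as_def)
    qed
    then show ?thesis unfolding concat_replicate_nth by (intro nth_equalityI) (simp_all add: as_def q)
  qed
  have "betaR n beta B act x (lparts n p f) as = beta (lact B act n \<tau> x) r as"
    unfolding r_def by (rule betaR_straightens[OF f x \<tau>])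
  also have "\<dots> = beta (lact B act n (block_perm r \<rho>) (lact B act n \<tau> x)) r' (plist \<rho> as)"
    using beta_objD(2)[OF b x1 _ \<rho>r, of as] r by (simp add: r'_def as_def)
  also have "lact B act n (block_perm r \<rho>) (lact B act n \<tau> x) = lact B act n \<tau>' x"
    unfolding \<tau>'_def by (rule lact_comp[OF bp \<tau>S, symmetric])
  also have "beta (lact B act n \<tau>' x) r' (plist \<rho> as)
     = beta (csum (Symc (tri q r')) (Symc r') (\<lambda>\<sigma>. lact B act n \<sigma> (lact B act n \<tau>' x))) (tri q r') (map a [0..<s])"
    unfolding args using beta_objD(4)[OF b x2, of q "map a [0..<s]"] q r' by simp
  also have "csum (Symc (tri q r')) (Symc r') (\<lambda>\<sigma>. lact B act n \<sigma> (lact B act n \<tau>' x))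
     = lact B act n \<tau>' (csum (SF n (\<lambda>k. g (f k))) (SF n f) (\<lambda>\<sigma>. lact B act n \<sigma> x))"
    unfolding c2[symmetric] c3[symmetric]
    by (rule csum_conj[OF \<tau>'S SF_subgrp SF_subgrp _ x], rule SF_mono) simp
  also have "beta (lact B act n \<tau>' (csum (SF n (\<lambda>k. g (f k))) (SF n f) (\<lambda>\<sigma>. lact B act n \<sigma> x))) (tri q r') (map a [0..<s])
     = betaR n beta B act (csum (SF n (\<lambda>k. g (f k))) (SF n f) (\<lambda>\<sigma>. lact B act n \<sigma> x))
        (lparts n s (\<lambda>k. g (f k))) (map a [0..<s])"
  proof -
    have "csum (SF n (\<lambda>k. g (f k))) (SF n f) (\<lambda>\<sigma>. lact B act n \<sigma> x) \<in> Pfix B act n (SF n (\<lambda>k. g (f k)))"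
      by (rule csum_Pfix[OF SF_subgrp SF_subgrp _ x], rule SF_mono) simp
    then show ?thesis
      using betaR_straightens[of n "\<lambda>k. g (f k)" s, OF _ _ str(1), where beta = beta and as = "map a [0..<s]"] f g str(2) by simp
  qed
  finally show ?thesis by (simp add: as_def)
qed

text \<open>If \<open>g\<close> is injective, nothing is merged and the coset sum is trivial. Labels
  missed by \<open>g\<close> become blocks of size 0, which is how an argument of multiplicity 0 can
  be inserted at any position.\<close>

lemma beta_relabel_inj:
  assumes b: "beta_obj B act sc beta" and x: "x \<in> Pinv B act r"
    and g: "\<And>j. j < length r \<Longrightarrow> g j < length r'" and inj: "inj_on g {..<length r}"
    and n: "sum_list r = n" "sum_list r' = n"
    and \<tau>: "\<tau> \<in> Sym n" "\<And>k. k < n \<Longrightarrow> blk r' (\<tau> k) = g (blk r k)"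
    and len: "length as = length r" "length as' = length r'"
    and as: "\<And>j. j < length r \<Longrightarrow> as ! j = as' ! g j"
  shows "beta x r as = beta (lact B act n \<tau> x) r' as'"
proof -
  note str = straightensI[where f = "\<lambda>k. g (blk r k)", OF \<tau>(1) n(2) refl \<tau>(2)]
  have x': "x \<in> Pfix B act n (SF n (blk r))" using x n by (simp add: Pinv_eq_Pfix Symc_eq)
  have bl: "blk r k < length r" if "k < n" for k using that n by (simp add: blk_props)
  have sf: "SF n (\<lambda>k. g (blk r k)) = SF n (blk r)"
    using bl inj by (intro SF_inj[where S = "{..<length r}"]) auto
  have as1: "as = map (\<lambda>j. as' ! g j) [0..<length r]" using len as by (intro nth_equalityI) simp_all
  have as2: "as' = map ((!) as') [0..<length r']" using len by (intro nth_equalityI) simp_all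
  have "beta x r as = betaR n beta B act x (lparts n (length r) (blk r)) as"
    using betaR_blk[OF x, of beta as] n by simp
  also have "\<dots> = betaR n beta B act (csum (SF n (\<lambda>k. g (blk r k))) (SF n (blk r)) (\<lambda>\<sigma>. lact B act n \<sigma> x))
        (lparts n (length r') (\<lambda>k. g (blk r k))) (map ((!) as') [0..<length r'])"
    unfolding as1 by (rule betaR_relabel[OF b bl g x'])
  also have "csum (SF n (\<lambda>k. g (blk r k))) (SF n (blk r)) (\<lambda>\<sigma>. lact B act n \<sigma> x) = x"
    unfolding sf by (rule csum_self[OF SF_subgrp x'])
  also have "betaR n beta B act x (lparts n (length r') (\<lambda>k. g (blk r k))) (map ((!) as') [0..<length r'])
     = beta (lact B act n \<tau> x) r' as'"
    using betaR_straightens[of n "\<lambda>k. g (blk r k)" "length r'" x \<tau> beta as'] x' sf str bl g as2 by simp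
  finally show ?thesis .
qed

text \<open>\<beta>3 and \<beta>5 concern the first argument only; this rotation gives access to any
  other one.\<close>

lemma beta_rotate:
  assumes b: "beta_obj B act sc beta" and x: "x \<in> Pinv B act (r1 @ c # r2)"
    and len: "length as1 = length r1" "length as2 = length r2"
  shows "beta x (r1 @ c # r2) (as1 @ a # as2)
    = beta (lact B act (sum_list (r1 @ c # r2)) (rot (sum_list r1) c) x) (c # r1 @ r2) (a # as1 @ as2)"
proof (rule beta_relabel_inj[OF b x, where g = "\<lambda>j. if j < length r1 then Suc j else if j = length r1 then 0 else j"])
  show "rot (sum_list r1) c \<in> Sym (sum_list (r1 @ c # r2))" by (rule rot_Sym) simp
  fix k assume k: "k < sum_list (r1 @ c # r2)"
  show "blk (c # r1 @ r2) (rot (sum_list r1) c k) =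
    (if blk (r1 @ c # r2) k < length r1 then Suc (blk (r1 @ c # r2) k)
     else if blk (r1 @ c # r2) k = length r1 then 0 else blk (r1 @ c # r2) k)"
    using k blk_props(1)[of k r1] by (auto simp: rot_def blk_append blk_Cons ac_simps)
qed (use len in \<open>auto simp: inj_on_def nth_append nth_Cons' split: if_splits\<close>)

text \<open>The permutation depends on \<open>l\<close> and \<open>m\<close> only through their sum.
  Hence all terms that \<beta>5 produces after one rotation can be rotated back with the same
  element.\<close>

lemma beta_rotate2:
  assumes b: "beta_obj B act sc beta" and x: "x \<in> Pinv B act (r1 @ l # m # r2)"
    and len: "length as1 = length r1" "length as2 = length r2"
  shows "beta x (r1 @ l # m # r2) (as1 @ a0 # a1 # as2)
    = beta (lact B act (sum_list (r1 @ (l + m) # r2)) (rot (sum_list r1) (l + m)) x) (l # m # r1 @ r2) (a0 # a1 # as1 @ as2)"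
proof (rule beta_relabel_inj[OF b x, where g = "\<lambda>j. if j < length r1 then Suc (Suc j) else if j = length r1 then 0
      else if j = Suc (length r1) then 1 else j"])
  show "rot (sum_list r1) (l + m) \<in> Sym (sum_list (r1 @ (l + m) # r2))" by (rule rot_Sym) simp
  fix k assume k: "k < sum_list (r1 @ (l + m) # r2)"
  show "blk (l # m # r1 @ r2) (rot (sum_list r1) (l + m) k) =
    (if blk (r1 @ l # m # r2) k < length r1 then Suc (Suc (blk (r1 @ l # m # r2) k))
     else if blk (r1 @ l # m # r2) k = length r1 then 0
      else if blk (r1 @ l # m # r2) k = Suc (length r1) then 1 else blk (r1 @ l # m # r2) k)"
    using k blk_props(1)[of k r1] by (auto simp: rot_def blk_append blk_Cons ac_simps)
qed (use len in \<open>auto simp: inj_on_def nth_append nth_Cons' split: if_splits\<close>)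

lemma Pinv_rotate:
  assumes x: "x \<in> Pinv B act (r1 @ c # r2)"
  shows "lact B act (sum_list (r1 @ c # r2)) (rot (sum_list r1) c) x \<in> Pinv B act (c # r1 @ r2)"
proof -
  let ?n = "sum_list (r1 @ c # r2)"
  define g where "g j = (if j < length r1 then Suc j else if j = length r1 then 0 else j)" for j
  have S: "rot (sum_list r1) c \<in> Sym ?n" by (rule rot_Sym) simp
  have bl: "blk (c # r1 @ r2) (rot (sum_list r1) c k) = g (blk (r1 @ c # r2) k)" if "k < ?n" for k
    using that blk_props(1)[of k r1] by (auto simp: g_def rot_def blk_append blk_Cons add.commute)
  have "SF ?n (\<lambda>k. g (blk (r1 @ c # r2) k)) = SF ?n (blk (r1 @ c # r2))"
    by (rule SF_inj[where S = UNIV]) (auto simp: inj_on_def g_def split: if_splits)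
  then have "conj_by (rot (sum_list r1) c) (Symc (r1 @ c # r2)) = Symc (c # r1 @ r2)"
    using SF_conj[OF S, of "blk (c # r1 @ r2)" "\<lambda>k. g (blk (r1 @ c # r2) k)"] bl
    by (simp add: Symc_eq algebra_simps)
  then show ?thesis using Pfix_conj[OF S Symc_subgrp] x by (simp add: Pinv_eq_Pfix algebra_simps)
qed

text \<open>Rotate the sum to the front, apply \<beta>5, and rotate each term back.\<close>

lemma beta_add_at:
  assumes b: "beta_obj B act sc beta" and x: "x \<in> Pinv B act (r1 @ c # r2)"
    and len: "length as1 = length r1" "length as2 = length r2"
  shows "beta x (r1 @ c # r2) (as1 @ (a0 + a1) # as2)
    = (\<Sum>l\<le>c. beta x (r1 @ l # (c - l) # r2) (as1 @ a0 # a1 # as2))"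
proof -
  let ?y = "lact B act (sum_list (r1 @ c # r2)) (rot (sum_list r1) c) x"
  have "beta x (r1 @ c # r2) (as1 @ (a0 + a1) # as2) = beta ?y (c # r1 @ r2) ((a0 + a1) # as1 @ as2)"
    by (rule beta_rotate[OF b x len])
  also have "\<dots> = (\<Sum>l\<le>c. beta ?y (l # (c - l) # r1 @ r2) (a0 # a1 # as1 @ as2))"
    using beta_objD(5)[OF b Pinv_rotate[OF x], of a1 "as1 @ as2" a0] len by simp
  also have "\<dots> = (\<Sum>l\<le>c. beta x (r1 @ l # (c - l) # r2) (as1 @ a0 # a1 # as2))"
  proof (rule sum.cong[OF refl])
    fix l assume "l \<in> {..c}"
    then have "x \<in> Pinv B act (r1 @ l # (c - l) # r2)" using Pinv_split[of B act r1 l "c - l" r2] x by auto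
    from beta_rotate2[OF b this len, of a0 a1] \<open>l \<in> {..c}\<close>
    show "beta ?y (l # (c - l) # r1 @ r2) (a0 # a1 # as1 @ as2) = beta x (r1 @ l # (c - l) # r2) (as1 @ a0 # a1 # as2)"
      by simp
  qed
  finally show ?thesis .
qed

lemma beta_scale_at:
  assumes b: "beta_obj B act sc beta" and x: "x \<in> Pinv B act (r1 @ c # r2)"
    and len: "length as1 = length r1" "length as2 = length r2"
  shows "beta x (r1 @ c # r2) (as1 @ sc e a # as2) = sc (e ^ c) (beta x (r1 @ c # r2) (as1 @ a # as2))"
  using beta_rotate[OF b x len] beta_objD(3)[OF b Pinv_rotate[OF x], of a "as1 @ as2" e] len by simp

lemma beta_drop_zero:
  assumes b: "beta_obj B act sc beta" and x: "x \<in> Pinv B act (r1 @ r2)"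
    and len: "length as1 = length r1" "length as2 = length r2"
  shows "beta x (r1 @ 0 # r2) (as1 @ a # as2) = beta x (r1 @ r2) (as1 @ as2)"
proof -
  have "beta x (r1 @ r2) (as1 @ as2) = beta (lact B act (sum_list (r1 @ r2)) id x) (r1 @ 0 # r2) (as1 @ a # as2)"
  proof (rule beta_relabel_inj[OF b x, where g = "\<lambda>j. if j < length r1 then j else Suc j"])
    fix k assume k: "k < sum_list (r1 @ r2)"
    show "blk (r1 @ 0 # r2) (id k) = (if blk (r1 @ r2) k < length r1 then blk (r1 @ r2) k else Suc (blk (r1 @ r2) k))"
      using k blk_props(1)[of k r1] by (auto simp: blk_append blk_Cons)
  qed (use len in \<open>auto simp: Sym_id inj_on_def nth_append nth_Cons' split: if_splits\<close>)
  then show ?thesis using x by (simp add: Pinv_def lact_id)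
qed

end

section \<open>The wreath product\<close>

text \<open>The sizes of the consecutive blocks of the composite, one for each input of the outer
  operation. The operad axioms speak of such a list, while the wreath product and the partition are
  given through \<open>base\<close>.\<close>

definition mlist :: "nat list \<Rightarrow> nat list list \<Rightarrow> nat list" where
  "mlist r qs = map (\<lambda>k. msz qs (blk r k)) [0..<sum_list r]"

lemma length_mlist [simp]: "length (mlist r qs) = sum_list r" by (simp add: mlist_def)

lemma nth_mlist: "k < sum_list r \<Longrightarrow> mlist r qs ! k = msz qs (blk r k)" by (simp add: mlist_def)

lemma sum_msz_blk:
  "i < length r \<Longrightarrow> t \<le> r ! i \<Longrightarrow> (\<Sum>k<off r i + t. msz qs (blk r k)) = base r qs i + t * msz qs i"
proof (induction i arbitrary: t)
  case 0
  then show ?case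
  proof (induction t)
    case (Suc t)
    then show ?case using blk_off[of 0 r t] by (simp add: base_def)
  qed (simp add: base_def)
next
  case (Suc i)
  from Suc.prems(2) show ?case
  proof (induction t)
    case 0
    have "off r (Suc i) = off r i + r ! i" using Suc.prems by (simp add: off_Suc)
    then show ?case using Suc.IH[of "r ! i"] Suc.prems by (simp add: base_def)
  next
    case (Suc t)
    then show ?case using blk_off[of "Suc i" r t] \<open>Suc i < length r\<close> by simp
  qed
qed

text \<open>The dictionary between the two descriptions of block starts: number the blocks
  consecutively, or by segment \<open>i\<close> and copy \<open>t\<close>.\<close>

lemma off_mlist:
  assumes "i < length r" "t \<le> r ! i"
  shows "off (mlist r qs) (off r i + t) = base r qs i + t * msz qs i"
proof -
  have le: "off r i + t \<le> sum_list r"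
    using off_mono[of "Suc i" "length r" r] assms by (simp add: off_Suc)
  have "off (mlist r qs) (off r i + t) = (\<Sum>k<off r i + t. mlist r qs ! k)"
    using le by (simp add: off_eq_sum)
  also have "\<dots> = (\<Sum>k<off r i + t. msz qs (blk r k))"
    using le by (intro sum.cong) (auto simp: nth_mlist)
  finally show ?thesis using sum_msz_blk[OF assms] by simp
qed

lemma sum_mlist: "sum_list (mlist r qs) = Mtot r qs"
proof (cases "length r")
  case 0
  then show ?thesis by (simp add: mlist_def Mtot_def base_def)
next
  case (Suc i)
  have "sum_list (mlist r qs) = off (mlist r qs) (off r i + r ! i)"
    using Suc off_Suc[of i r] off_length[of "mlist r qs"] off_length[of r] by simp
  also have "\<dots> = base r qs i + r ! i * msz qs i" using Suc by (intro off_mlist) auto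
  also have "\<dots> = Mtot r qs" using Suc by (simp add: Mtot_def base_def)
  finally show ?thesis .
qed

text \<open>The label is the place of the pair (segment, part inside the block) in the flattened
  list of parts; the copy of the block within its segment is forgotten.\<close>

definition dlab :: "nat list \<Rightarrow> nat list list \<Rightarrow> nat \<Rightarrow> nat" where
  "dlab r qs k = (let j = blk (mlist r qs) k; i = blk r j in
     off (map length qs) i + blk (qs ! i) (k - off (mlist r qs) j))"

lemma dlab_off:
  assumes "k < sum_list r" "t < mlist r qs ! k"
  shows "dlab r qs (off (mlist r qs) k + t) = off (map length qs) (blk r k) + blk (qs ! blk r k) t"
  using assms blk_off[of k "mlist r qs" t] by (simp add: dlab_def Let_def)

lemma mpos_cases:
  assumes "k < Mtot r qs"
  obtains j t where "j < sum_list r" "t < mlist r qs ! j" "k = off (mlist r qs) j + t" "t < sum_list (qs ! blk r j)"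
proof -
  from assms have "k < sum_list (mlist r qs)" by (simp add: sum_mlist)
  then obtain j t where "j < length (mlist r qs)" "t < mlist r qs ! j" "k = off (mlist r qs) j + t"
    by (rule pos_cases)
  with that show ?thesis by (simp add: nth_mlist msz_def)
qed

lemma off_pair_eq:
  assumes "i < length L" "j < L ! i" "i' < length L" "j' < L ! i'"
  shows "off L i + j = off L i' + j' \<longleftrightarrow> i = i' \<and> j = j'"
  using blk_off[OF assms(1,2)] blk_off[OF assms(3,4)] by auto

lemma dlab_less:
  assumes "length qs = length r" "k < Mtot r qs"
  shows "dlab r qs k < sum_list (map length qs)"
  using assms(2)
proof (rule mpos_cases)
  fix j t assume a: "j < sum_list r" "t < mlist r qs ! j" "k = off (mlist r qs) j + t" "t < sum_list (qs ! blk r j)"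
  show ?thesis unfolding a(3) dlab_off[OF a(1,2)]
    using blk_props(1)[OF a(1)] blk_props(1)[OF a(4)] assms(1) by (intro off_less) simp_all
qed

text \<open>A position of the composite is uniquely a segment \<open>i\<close>, a copy
  \<open>t\<close> and a place in the block, and a label is uniquely a segment and a part. Comparing
  these coordinates identifies the fibres of \<open>dlab\<close>.\<close>

lemma diamond_eq:
  assumes q: "length qs = length r"
  shows "diamond r qs = lparts (Mtot r qs) (sum_list (map length qs)) (dlab r qs)"
proof -
  define D where "D i = map (\<lambda>j. \<Union>t<r ! i. (\<lambda>k. base r qs i + t * msz qs i + k) ` ivl (qs ! i) j) [0..<length (qs ! i)]" for i
  define xss where "xss = map D [0..<length r]"
  define L where "L = map length qs"
  have L: "map length xss = L" using q by (intro nth_equalityI) (simp_all add: xss_def L_def D_def)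
  have "concat xss = lparts (Mtot r qs) (sum_list L) (dlab r qs)"
  proof (rule nth_equalityI)
    show "length (concat xss) = length (lparts (Mtot r qs) (sum_list L) (dlab r qs))"
      by (simp add: length_concat L lparts_def)
    fix c assume "c < length (concat xss)"
    then have c: "c < sum_list L" by (simp add: length_concat L)
    then obtain i j where ij: "i < length L" "j < L ! i" "c = off L i + j" by (rule pos_cases)
    then have i: "i < length r" "j < length (qs ! i)" using q by (simp_all add: L_def)
    have "concat xss ! c = xss ! i ! j"
      using nth_concat_off[of i xss j] i ij(3) L by (simp add: xss_def D_def)
    also have "\<dots> = (\<Union>t<r ! i. (\<lambda>k. base r qs i + t * msz qs i + k) ` ivl (qs ! i) j)"
      using i by (simp add: xss_def D_def)
    also have "\<dots> = {k. k < Mtot r qs \<and> dlab r qs k = c}"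
    proof (intro equalityI subsetI)
      fix k assume "k \<in> (\<Union>t<r ! i. (\<lambda>k. base r qs i + t * msz qs i + k) ` ivl (qs ! i) j)"
      then obtain t s where ts: "t < r ! i" "s \<in> ivl (qs ! i) j" "k = base r qs i + t * msz qs i + s" by auto
      have s: "s < sum_list (qs ! i)" "blk (qs ! i) s = j" using ts(2) i by (simp_all add: ivl_iff_blk)
      have n: "off r i + t < sum_list r" "blk r (off r i + t) = i"
        using off_less[OF i(1) ts(1)] blk_off[OF i(1) ts(1)] by simp_all
      have m: "s < mlist r qs ! (off r i + t)" using n s by (simp add: nth_mlist msz_def)
      have k: "k = off (mlist r qs) (off r i + t) + s" using off_mlist[of i r t qs] i ts by simp
      have "k < Mtot r qs" unfolding k using off_less[of "off r i + t" "mlist r qs" s] n m by (simp add: sum_mlist)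
      moreover have "dlab r qs k = c" unfolding k dlab_off[OF n(1) m] using n s ij by (simp add: L_def)
      ultimately show "k \<in> {k. k < Mtot r qs \<and> dlab r qs k = c}" by simp
    next
      fix k assume "k \<in> {k. k < Mtot r qs \<and> dlab r qs k = c}"
      then have k: "k < Mtot r qs" "dlab r qs k = c" by simp_all
      from k(1) obtain j' t where a: "j' < sum_list r" "t < mlist r qs ! j'" "k = off (mlist r qs) j' + t"
          "t < sum_list (qs ! blk r j')" by (rule mpos_cases)
      from a(1) obtain i' s where b: "i' < length r" "s < r ! i'" "j' = off r i' + s" "blk r j' = i'" by (rule pos_cases)
      have "off L i' + blk (qs ! i') t = off L i + j"
        using k(2) dlab_off[OF a(1,2)] a(3) b(4) ij(3) by (simp add: L_def)
      then have eq: "i' = i" "blk (qs ! i') t = j"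
        using off_pair_eq[of i' L "blk (qs ! i') t" i j] ij b blk_props(1)[OF a(4)] q by (simp_all add: L_def)
      have "k = base r qs i + s * msz qs i + t" using a(3) b eq off_mlist[of i r s qs] by simp
      moreover have "t \<in> ivl (qs ! i) j" using a(4) b eq i by (simp add: ivl_iff_blk)
      ultimately show "k \<in> (\<Union>t<r ! i. (\<lambda>k. base r qs i + t * msz qs i + k) ` ivl (qs ! i) j)"
        using b eq by auto
    qed
    also have "\<dots> = lparts (Mtot r qs) (sum_list L) (dlab r qs) ! c" using c by (simp add: lparts_def)
    finally show "concat xss ! c = lparts (Mtot r qs) (sum_list L) (dlab r qs) ! c" .
  qed
  then show ?thesis by (simp add: diamond_def xss_def D_def[abs_def] L_def)
qed

lemma SymR_diamond: "length qs = length r \<Longrightarrow> SymR (Mtot r qs) (diamond r qs) = SF (Mtot r qs) (dlab r qs)"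
  by (simp add: diamond_eq SymR_lparts dlab_less)

lemma dsum_off: "i < length ms \<Longrightarrow> t < ms ! i \<Longrightarrow> dsum ms \<tau>s (off ms i + t) = off ms i + (\<tau>s ! i) t"
  by (simp add: dsum_def off_less blk_off)

lemma dsum_Sym:
  assumes "length \<tau>s = length ms" "\<And>i. i < length ms \<Longrightarrow> \<tau>s ! i \<in> Sym (ms ! i)"
  shows "dsum ms \<tau>s \<in> Sym (sum_list ms)"
proof (rule SymI)
  show "\<not> k < sum_list ms \<Longrightarrow> dsum ms \<tau>s k = k" for k by (simp add: dsum_def)
  fix k assume "k < sum_list ms"
  then obtain i t where it: "i < length ms" "t < ms ! i" "k = off ms i + t" by (rule pos_cases)
  have "(\<tau>s ! i) t < ms ! i" using assms(2)[OF it(1)] it by (simp add: Sym_less)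
  then show "dsum ms \<tau>s k < sum_list ms" using it by (simp add: dsum_off off_less)
next
  show "inj_on (dsum ms \<tau>s) {..<sum_list ms}"
  proof (rule inj_onI)
    fix k l assume kl: "k \<in> {..<sum_list ms}" "l \<in> {..<sum_list ms}" "dsum ms \<tau>s k = dsum ms \<tau>s l"
    from kl(1) obtain i t where k: "i < length ms" "t < ms ! i" "k = off ms i + t" by (auto elim: pos_cases)
    from kl(2) obtain j s where l: "j < length ms" "s < ms ! j" "l = off ms j + s" by (auto elim: pos_cases)
    have lt: "(\<tau>s ! i) t < ms ! i" "(\<tau>s ! j) s < ms ! j"
      using assms(2)[OF k(1)] assms(2)[OF l(1)] k l by (simp_all add: Sym_less)
    have "off ms i + (\<tau>s ! i) t = off ms j + (\<tau>s ! j) s" using kl(3) k l by (simp add: dsum_off)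
    then have "i = j \<and> (\<tau>s ! i) t = (\<tau>s ! j) s"
      using off_pair_eq[OF k(1) lt(1) l(1) lt(2)] by blast
    then have "i = j" "(\<tau>s ! i) t = (\<tau>s ! i) s" by metis+
    then have "t = s" using assms(2)[OF k(1)] by (metis Sym_inv_apply(1))
    then show "k = l" using \<open>i = j\<close> k l by simp
  qed
qed

text \<open>The element of the wreath product that permutes the blocks by \<open>\<pi>\<close> and then acts by \<open>\<theta> k\<close>
  in block \<open>k\<close>; so \<open>\<theta>\<close> is indexed by the target block, unlike in the definition of the group.\<close>

definition wr :: "nat list \<Rightarrow> (nat \<Rightarrow> nat) \<Rightarrow> (nat \<Rightarrow> nat \<Rightarrow> nat) \<Rightarrow> nat \<Rightarrow> nat" where
  "wr ms \<pi> \<theta> = dsum ms (map \<theta> [0..<length ms]) \<circ> block_perm ms \<pi>"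

lemma wr_restrict: "wr ms \<pi> (restrict \<theta> {..<length ms}) = wr ms \<pi> \<theta>"
proof -
  have "map (restrict \<theta> {..<length ms}) [0..<length ms] = map \<theta> [0..<length ms]" by simp
  then show ?thesis unfolding wr_def by (simp only:)
qed

text \<open>The extensional function space fixes \<theta> outside the existing blocks; without that
  the parametrisation could not be injective.\<close>

definition wparams :: "nat list \<Rightarrow> nat list list \<Rightarrow> ((nat \<Rightarrow> nat) \<times> (nat \<Rightarrow> nat \<Rightarrow> nat)) set" where
  "wparams r qs = Symc r \<times> (\<Pi>\<^sub>E k\<in>{..<sum_list r}. Symc (qs ! blk r k))"

lemma Symc_blk: "\<pi> \<in> Symc r \<Longrightarrow> k < sum_list r \<Longrightarrow> blk r (\<pi> k) = blk r k"
  by (simp add: Symc_eq SF_def)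

lemma Symc_Sym: "\<pi> \<in> Symc r \<Longrightarrow> \<pi> \<in> Sym (sum_list r)"
  by (simp add: Symc_eq SF_def)

lemma Symc_inv: "\<pi> \<in> Symc r \<Longrightarrow> inv \<pi> \<in> Symc r"
  using subgrpD(4)[OF Symc_subgrp] .

lemma mlist_perm: "\<pi> \<in> Symc r \<Longrightarrow> k < sum_list r \<Longrightarrow> mlist r qs ! \<pi> k = mlist r qs ! k"
  using Symc_blk[of \<pi> r k] Sym_less[OF Symc_Sym, of \<pi> r k] by (simp add: nth_mlist)

text \<open>Blocks are only permuted within a segment, where all have the same length, so their
  starting points stay the same.\<close>

lemma plist_mlist:
  assumes "\<pi> \<in> Symc r"
  shows "plist \<pi> (mlist r qs) = mlist r qs"
proof (rule nth_equalityI)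
  fix i assume i: "i < length (plist \<pi> (mlist r qs))"
  then show "plist \<pi> (mlist r qs) ! i = mlist r qs ! i"
    using mlist_perm[OF Symc_inv[OF assms], of i qs] by (simp add: nth_plist)
qed simp

lemma wr_off:
  assumes p: "\<pi> \<in> Symc r" and k: "k < sum_list r" "t < mlist r qs ! k"
  shows "wr (mlist r qs) \<pi> \<theta> (off (mlist r qs) k + t) = off (mlist r qs) (\<pi> k) + \<theta> (\<pi> k) t"
proof -
  have S: "\<pi> \<in> Sym (length (mlist r qs))" using Symc_Sym[OF p] by simp
  have pk: "\<pi> k < sum_list r" using k Sym_less[OF S] by simp
  have t: "t < mlist r qs ! \<pi> k" using mlist_perm[OF p k(1)] k(2) by simp
  show ?thesis using block_perm_off[OF S, of k t] k pk t dsum_off[of "\<pi> k" "mlist r qs" t]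
    by (simp add: wr_def plist_mlist[OF p])
qed

text \<open>The condition in \<open>wparams\<close> without extensionality, so that products and
  inverses of \<theta> need not be restricted again.\<close>

definition blockwise :: "nat list \<Rightarrow> nat list list \<Rightarrow> (nat \<Rightarrow> nat \<Rightarrow> nat) \<Rightarrow> bool" where
  "blockwise r qs \<theta> \<longleftrightarrow> (\<forall>k<sum_list r. \<theta> k \<in> Symc (qs ! blk r k))"

lemma blockwiseI: "(\<And>k. k < sum_list r \<Longrightarrow> \<theta> k \<in> Symc (qs ! blk r k)) \<Longrightarrow> blockwise r qs \<theta>"
  by (simp add: blockwise_def)

lemma blockwiseD: "blockwise r qs \<theta> \<Longrightarrow> k < sum_list r \<Longrightarrow> \<theta> k \<in> Symc (qs ! blk r k)"
  by (simp add: blockwise_def)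

lemma wparamsD:
  assumes "blockwise r qs \<theta>" "k < sum_list r"
  shows "\<theta> k \<in> Sym (mlist r qs ! k)"
  using Symc_Sym[OF blockwiseD[OF assms]] assms(2) by (simp add: nth_mlist msz_def)

lemma wr_Sym:
  assumes p: "\<pi> \<in> Symc r" and t: "blockwise r qs \<theta>"
  shows "wr (mlist r qs) \<pi> \<theta> \<in> Sym (Mtot r qs)"
  unfolding wr_def sum_mlist[symmetric]
proof (rule Sym_comp)
  show "dsum (mlist r qs) (map \<theta> [0..<length (mlist r qs)]) \<in> Sym (sum_list (mlist r qs))"
    using wparamsD[OF t] by (intro dsum_Sym) auto
  show "block_perm (mlist r qs) \<pi> \<in> Sym (sum_list (mlist r qs))"
    using Symc_Sym[OF p] by (intro block_perm_Sym) simp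
qed

lemma Sym_Mtot_eqI:
  assumes "\<sigma> \<in> Sym (Mtot r qs)" "\<tau> \<in> Sym (Mtot r qs)"
    "\<And>k t. k < sum_list r \<Longrightarrow> t < mlist r qs ! k \<Longrightarrow> \<sigma> (off (mlist r qs) k + t) = \<tau> (off (mlist r qs) k + t)"
  shows "\<sigma> = \<tau>"
proof (rule Sym_eqI[OF assms(1,2)])
  fix k assume "k < Mtot r qs"
  then show "\<sigma> k = \<tau> k" by (rule mpos_cases) (simp add: assms(3))
qed

lemma wreath_memI:
  assumes p: "\<pi> \<in> Symc r" and t: "blockwise r qs \<theta>"
  shows "wr (mlist r qs) \<pi> \<theta> \<in> wreath r qs"
proof -
  \<comment> \<open>The restriction of \<pi> to segment \<open>i\<close>, shifted to start at
    0.\<close>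
  define P where "P i t = (if t < r ! i then \<pi> (off r i + t) - off r i else t)" for i t
  have P: "\<pi> (off r i + t) = off r i + P i t \<and> P i t < r ! i" if "i < length r" "t < r ! i" for i t
  proof -
    have "\<pi> (off r i + t) < sum_list r" "blk r (\<pi> (off r i + t)) = i"
      using off_less[OF that] Symc_blk[OF p off_less[OF that]] blk_off[OF that] Sym_less[OF Symc_Sym[OF p]] by simp_all
    then have "off r i \<le> \<pi> (off r i + t)" "\<pi> (off r i + t) < off r i + r ! i"
      using blk_props(2,3)[of "\<pi> (off r i + t)" r] that by (simp_all add: off_Suc)
    then show ?thesis using that by (simp add: P_def)
  qed
  have PS: "P i \<in> Sym (r ! i)" if i: "i < length r" for i
  proof (rule SymI)
    show "inj_on (P i) {..<r ! i}"
    proof (rule inj_onI)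
      fix s t assume st: "s \<in> {..<r ! i}" "t \<in> {..<r ! i}" "P i s = P i t"
      then have "\<pi> (off r i + s) = \<pi> (off r i + t)" using P[OF i] by simp
      then have "off r i + s = off r i + t" by (metis Sym_inv_apply(1)[OF Symc_Sym[OF p]])
      then show "s = t" by simp
    qed
  qed (use P[OF i] in \<open>auto simp: P_def\<close>)
  have eq: "wr (mlist r qs) \<pi> \<theta> (base r qs i + t * msz qs i + k)
      = base r qs i + P i t * msz qs i + \<theta> (\<pi> (off r i + t)) k"
    if a: "i < length r" "t < r ! i" "k < msz qs i" for i t k
  proof -
    have n: "off r i + t < sum_list r" "blk r (off r i + t) = i" using off_less[OF a(1,2)] blk_off[OF a(1,2)] by simp_all
    have "wr (mlist r qs) \<pi> \<theta> (off (mlist r qs) (off r i + t) + k)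
        = off (mlist r qs) (\<pi> (off r i + t)) + \<theta> (\<pi> (off r i + t)) k"
      using a n by (intro wr_off[OF p]) (simp_all add: nth_mlist)
    then show ?thesis using off_mlist[of i r t qs] off_mlist[of i r "P i t" qs] a P[OF a(1,2)] by simp
  qed
  have th: "\<theta> (\<pi> (off r i + t)) \<in> Symc (qs ! i)" if "i < length r" "t < r ! i" for i t
    using blockwiseD[OF t, of "\<pi> (off r i + t)"] off_less[OF that] Symc_blk[OF p off_less[OF that]] blk_off[OF that]
      Sym_less[OF Symc_Sym[OF p]] by simp
  show ?thesis
    \<comment> \<open>The definition of the group indexes \<theta> by the source block (i, t), hence
      the reindexing along \<pi> in the witness.\<close>
    unfolding wreath_def using wr_Sym[OF p t]
    by (auto intro!: exI[of _ P] exI[of _ "\<lambda>i t. \<theta> (\<pi> (off r i + t))"] simp: PS th eq)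
qed

lemma wreath_cases:
  assumes "w \<in> wreath r qs"
  obtains \<pi> \<theta> where "\<pi> \<in> Symc r" "blockwise r qs \<theta>" "w = wr (mlist r qs) \<pi> \<theta>"
proof -
  from assms obtain P T where w: "w \<in> Sym (Mtot r qs)"
    and PT: "\<And>i. i < length r \<Longrightarrow> P i \<in> Sym (r ! i)" "\<And>i t. i < length r \<Longrightarrow> t < r ! i \<Longrightarrow> T i t \<in> Symc (qs ! i)"
    and eq: "\<And>i t k. i < length r \<Longrightarrow> t < r ! i \<Longrightarrow> k < msz qs i \<Longrightarrow>
        w (base r qs i + t * msz qs i + k) = base r qs i + P i t * msz qs i + T i t k"
    unfolding wreath_def by blast
  \<comment> \<open>The permutations of the separate segments are glued to one permutation of all
    inputs of the outer operation.\<close>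
  define \<pi> where "\<pi> = dsum r (map P [0..<length r])"
  have pS: "\<pi> \<in> Sym (sum_list r)" unfolding \<pi>_def using PT by (intro dsum_Sym) auto
  have po: "\<pi> (off r i + t) = off r i + P i t" if "i < length r" "t < r ! i" for i t
    using that by (simp add: \<pi>_def dsum_off)
  have Pl: "P i t < r ! i" if "i < length r" "t < r ! i" for i t using PT(1)[OF that(1)] that by (simp add: Sym_less)
  have p: "\<pi> \<in> Symc r"
  proof -
    have "blk r (\<pi> k) = blk r k" if "k < sum_list r" for k
      using that by (rule pos_cases) (simp add: po Pl blk_off)
    then show ?thesis using pS by (simp add: Symc_eq SF_def)
  qed
  \<comment> \<open>Block \<open>k\<close> is now the target, so its source is found through the
    inverse of \<pi>.\<close>
  define \<theta> where "\<theta> k = T (blk r k) (inv \<pi> k - off r (blk r k))" for k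
  have th: "\<theta> (\<pi> (off r i + t)) = T i t" if "i < length r" "t < r ! i" for i t
    using that Symc_blk[OF p off_less[OF that]] pS by (simp add: \<theta>_def blk_off)
  have t: "blockwise r qs \<theta>"
  proof (rule blockwiseI)
    fix k assume k: "k < sum_list r"
    have "inv \<pi> k < sum_list r" "blk r (inv \<pi> k) = blk r k"
      using k Symc_blk[OF Symc_inv[OF p] k] Sym_less[OF Sym_inv[OF pS]] by simp_all
    then have "blk r k < length r" "inv \<pi> k - off r (blk r k) < r ! blk r k"
      using blk_props[of "inv \<pi> k" r] by (simp_all add: off_Suc)
    then show "\<theta> k \<in> Symc (qs ! blk r k)" unfolding \<theta>_def by (rule PT(2))
  qed
  have "w = wr (mlist r qs) \<pi> \<theta>"
  proof (rule Sym_Mtot_eqI[OF w wr_Sym[OF p t]])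
    fix k s assume k: "k < sum_list r" "s < mlist r qs ! k"
    from k(1) obtain i t where it: "i < length r" "t < r ! i" "k = off r i + t" "blk r k = i" by (rule pos_cases)
    have s: "s < msz qs i" using k it by (simp add: nth_mlist)
    show "w (off (mlist r qs) k + s) = wr (mlist r qs) \<pi> \<theta> (off (mlist r qs) k + s)"
      unfolding wr_off[OF p k]
      using eq[OF it(1,2) s] off_mlist[of i r t qs] off_mlist[of i r "P i t" qs] it Pl[OF it(1,2)] th[OF it(1,2)] po[OF it(1,2)] by simp
  qed
  from that[OF p t this] show ?thesis .
qed

lemma wreath_eq_image: "wreath r qs = (\<lambda>(\<pi>, \<theta>). wr (mlist r qs) \<pi> \<theta>) ` wparams r qs"
proof (intro equalityI subsetI)
  fix w assume "w \<in> wreath r qs"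
  then obtain \<pi> \<theta> where a: "\<pi> \<in> Symc r" "blockwise r qs \<theta>" "w = wr (mlist r qs) \<pi> \<theta>"
    by (rule wreath_cases) blast
  have "w = wr (mlist r qs) \<pi> (restrict \<theta> {..<sum_list r})" using wr_restrict[of "mlist r qs" \<pi> \<theta>] a(3) by simp
  moreover have "(\<pi>, restrict \<theta> {..<sum_list r}) \<in> wparams r qs" using a by (auto simp: wparams_def blockwise_def)
  ultimately show "w \<in> (\<lambda>(\<pi>, \<theta>). wr (mlist r qs) \<pi> \<theta>) ` wparams r qs" by force
next
  fix w assume "w \<in> (\<lambda>(\<pi>, \<theta>). wr (mlist r qs) \<pi> \<theta>) ` wparams r qs"
  then obtain \<pi> \<theta> where "\<pi> \<in> Symc r" "blockwise r qs \<theta>" "w = wr (mlist r qs) \<pi> \<theta>"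
    by (auto simp: wparams_def blockwise_def)
  then show "w \<in> wreath r qs" using wreath_memI by blast
qed

text \<open>A nonempty block has a position whose image shows where the block goes, and then how it
  is permuted inside. The order of empty blocks would leave no trace, hence the positivity.\<close>

lemma wr_inj:
  assumes pos: "\<And>k. k < sum_list r \<Longrightarrow> 0 < mlist r qs ! k"
  shows "inj_on (\<lambda>(\<pi>, \<theta>). wr (mlist r qs) \<pi> \<theta>) (wparams r qs)"
proof (rule inj_onI, clarify)
  fix \<pi> \<theta> \<pi>' \<theta>'
  assume a: "(\<pi>, \<theta>) \<in> wparams r qs" "(\<pi>', \<theta>') \<in> wparams r qs" "wr (mlist r qs) \<pi> \<theta> = wr (mlist r qs) \<pi>' \<theta>'"
  have p: "\<pi> \<in> Symc r" "\<pi>' \<in> Symc r" and t: "blockwise r qs \<theta>"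
    "blockwise r qs \<theta>'" using a by (auto simp: wparams_def blockwise_def)
  note th = wparamsD[OF t(1)] wparamsD[OF t(2)]
  have key: "\<pi> k = \<pi>' k \<and> \<theta> (\<pi> k) s = \<theta>' (\<pi>' k) s" if k: "k < sum_list r" "s < mlist r qs ! k" for k s
  proof -
    have pk: "\<pi> k < sum_list r" "\<pi>' k < sum_list r" using k p Symc_Sym Sym_less by metis+
    have "off (mlist r qs) (\<pi> k) + \<theta> (\<pi> k) s = off (mlist r qs) (\<pi>' k) + \<theta>' (\<pi>' k) s"
      using arg_cong[OF a(3), of "\<lambda>f. f (off (mlist r qs) k + s)"] wr_off[OF p(1) k] wr_off[OF p(2) k] by simp
    moreover have "\<theta> (\<pi> k) s < mlist r qs ! \<pi> k" "\<theta>' (\<pi>' k) s < mlist r qs ! \<pi>' k"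
      using Sym_less[OF th(1)[OF pk(1)], of s] Sym_less[OF th(2)[OF pk(2)], of s]
        mlist_perm[OF p(1) k(1)] mlist_perm[OF p(2) k(1)] k(2) by simp_all
    ultimately show ?thesis
      using off_pair_eq[of "\<pi> k" "mlist r qs" "\<theta> (\<pi> k) s" "\<pi>' k" "\<theta>' (\<pi>' k) s"] pk
      unfolding length_mlist by blast
  qed
  have pp: "\<pi> = \<pi>'" using key pos by (intro Sym_eqI[OF Symc_Sym[OF p(1)] Symc_Sym[OF p(2)]]) blast
  moreover have "\<theta> = \<theta>'"
  proof
    fix k
    show "\<theta> k = \<theta>' k"
    proof (cases "k < sum_list r")
      case True
      have i: "inv \<pi> k < sum_list r" "\<pi> (inv \<pi> k) = k"
        using True Sym_less[OF Sym_inv[OF Symc_Sym[OF p(1)]]] Symc_Sym[OF p(1)] by simp_all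
      show ?thesis
      proof (rule Sym_eqI[OF th(1)[OF True] th(2)[OF True]])
        fix s assume "s < mlist r qs ! k"
        then have "s < mlist r qs ! inv \<pi> k" using mlist_perm[OF p(1) i(1)] i(2) by simp
        then show "\<theta> k s = \<theta>' k s" using key[OF i(1)] i(2) pp by simp
      qed
    next
      case False
      then show ?thesis using a(1,2) by (auto simp: wparams_def PiE_def extensional_def)
    qed
  qed
  ultimately show "\<pi> = \<pi>' \<and> \<theta> = \<theta>'" by simp
qed

lemma wreath_subset: "length qs = length r \<Longrightarrow> wreath r qs \<subseteq> SF (Mtot r qs) (dlab r qs)"
proof
  fix w assume q: "length qs = length r" and "w \<in> wreath r qs"
  then obtain \<pi> \<theta> where a: "\<pi> \<in> Symc r" "blockwise r qs \<theta>" "w = wr (mlist r qs) \<pi> \<theta>"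
    by (elim wreath_cases) blast
  have "dlab r qs (w k) = dlab r qs k" if "k < Mtot r qs" for k
    using that
  proof (rule mpos_cases)
    fix j t assume b: "j < sum_list r" "t < mlist r qs ! j" "k = off (mlist r qs) j + t" "t < sum_list (qs ! blk r j)"
    have pj: "\<pi> j < sum_list r" using b Sym_less[OF Symc_Sym[OF a(1)]] by simp
    have bj: "blk r (\<pi> j) = blk r j" by (rule Symc_blk[OF a(1) b(1)])
    have ts: "\<theta> (\<pi> j) \<in> Symc (qs ! blk r j)" using blockwiseD[OF a(2) pj] bj by simp
    have t: "\<theta> (\<pi> j) t < mlist r qs ! \<pi> j"
      using Sym_less[OF wparamsD[OF a(2) pj], of t] mlist_perm[OF a(1) b(1)] b(2) by simp
    show "dlab r qs (w k) = dlab r qs k"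
      unfolding b(3) a(3) wr_off[OF a(1) b(1,2)] dlab_off[OF pj t] dlab_off[OF b(1,2)]
      using bj Symc_blk[OF ts b(4)] by simp
  qed
  then show "w \<in> SF (Mtot r qs) (dlab r qs)" using wr_Sym[OF a(1,2)] a(3) by (simp add: SF_def)
qed

text \<open>The multiplication of a semidirect product. Since \<theta> is indexed by target blocks,
  the factor from the right element is looked up at the block that \<pi> sends to
  \<open>k\<close>.\<close>

lemma wr_comp:
  assumes p: "\<pi> \<in> Symc r" "\<pi>' \<in> Symc r" and t: "blockwise r qs \<theta>"
    "blockwise r qs \<theta>'"
  shows "wr (mlist r qs) \<pi> \<theta> \<circ> wr (mlist r qs) \<pi>' \<theta>' = wr (mlist r qs) (\<pi> \<circ> \<pi>') (\<lambda>k. \<theta> k \<circ> \<theta>' (inv \<pi> k))"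
    "blockwise r qs (\<lambda>k. \<theta> k \<circ> \<theta>' (inv \<pi> k))"
proof -
  have pp: "\<pi> \<circ> \<pi>' \<in> Symc r" using subgrpD(3)[OF Symc_subgrp] p by blast
  show tt: "blockwise r qs (\<lambda>k. \<theta> k \<circ> \<theta>' (inv \<pi> k))"
  proof (rule blockwiseI)
    fix k assume k: "k < sum_list r"
    have "inv \<pi> k < sum_list r" "blk r (inv \<pi> k) = blk r k"
      using k Symc_blk[OF Symc_inv[OF p(1)] k] Sym_less[OF Sym_inv[OF Symc_Sym[OF p(1)]]] by simp_all
    then show "\<theta> k \<circ> \<theta>' (inv \<pi> k) \<in> Symc (qs ! blk r k)"
      using blockwiseD[OF t(1) k] blockwiseD[OF t(2), of "inv \<pi> k"] subgrpD(3)[OF Symc_subgrp] by simp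
  qed
  show "wr (mlist r qs) \<pi> \<theta> \<circ> wr (mlist r qs) \<pi>' \<theta>' = wr (mlist r qs) (\<pi> \<circ> \<pi>') (\<lambda>k. \<theta> k \<circ> \<theta>' (inv \<pi> k))"
  proof (rule Sym_Mtot_eqI[OF Sym_comp[OF wr_Sym[OF p(1) t(1)] wr_Sym[OF p(2) t(2)]] wr_Sym[OF pp tt]])
    fix k s assume k: "k < sum_list r" "s < mlist r qs ! k"
    have pk: "\<pi>' k < sum_list r" using k Sym_less[OF Symc_Sym[OF p(2)]] by simp
    have "\<theta>' (\<pi>' k) s < mlist r qs ! \<pi>' k"
      using Sym_less[OF wparamsD[OF t(2) pk], of s] mlist_perm[OF p(2) k(1)] k(2) by simp
    then show "(wr (mlist r qs) \<pi> \<theta> \<circ> wr (mlist r qs) \<pi>' \<theta>') (off (mlist r qs) k + s)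
        = wr (mlist r qs) (\<pi> \<circ> \<pi>') (\<lambda>k. \<theta> k \<circ> \<theta>' (inv \<pi> k)) (off (mlist r qs) k + s)"
      using wr_off[OF p(1) pk] wr_off[OF p(2) k] wr_off[OF pp k] Symc_Sym[OF p(1)] by simp
  qed
qed

lemma wr_id: "wr (mlist r qs) id (\<lambda>k. id) = id"
proof (rule Sym_Mtot_eqI[OF wr_Sym Sym_id])
  show i: "id \<in> Symc r" by (rule subgrpD(2)[OF Symc_subgrp])
  show "blockwise r qs (\<lambda>k. id)" by (simp add: blockwise_def subgrpD(2)[OF Symc_subgrp])
  fix k t assume "k < sum_list r" "t < mlist r qs ! k"
  then show "wr (mlist r qs) id (\<lambda>k. id) (off (mlist r qs) k + t) = id (off (mlist r qs) k + t)"
    using wr_off[OF i] by simp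
qed

lemma wr_inv:
  assumes p: "\<pi> \<in> Symc r" and t: "blockwise r qs \<theta>"
  shows "inv (wr (mlist r qs) \<pi> \<theta>) = wr (mlist r qs) (inv \<pi>) (\<lambda>k. inv (\<theta> (\<pi> k)))"
    "blockwise r qs (\<lambda>k. inv (\<theta> (\<pi> k)))"
proof -
  let ?m = "mlist r qs"
  show ti: "blockwise r qs (\<lambda>k. inv (\<theta> (\<pi> k)))"
    using blockwiseD[OF t, of "\<pi> k" for k] Symc_blk[OF p] Sym_less[OF Symc_Sym[OF p]] Symc_inv
    by (simp add: blockwise_def)
  note pi = Symc_inv[OF p]
  note S = wr_Sym[OF p t] and Si = wr_Sym[OF pi ti]
  have "wr ?m (inv \<pi>) (\<lambda>k. inv (\<theta> (\<pi> k))) \<circ> wr ?m \<pi> \<theta> = id"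
  proof (rule Sym_Mtot_eqI[OF Sym_comp[OF Si S] Sym_id])
    fix k s assume k: "k < sum_list r" "s < mlist r qs ! k"
    have pk: "\<pi> k < sum_list r" using k Sym_less[OF Symc_Sym[OF p]] by simp
    have T: "\<theta> (\<pi> k) \<in> Sym (?m ! \<pi> k)" by (rule wparamsD[OF t pk])
    have "\<theta> (\<pi> k) s < mlist r qs ! \<pi> k" using Sym_less[OF T, of s] mlist_perm[OF p k(1)] k(2) by simp
    then show "(wr ?m (inv \<pi>) (\<lambda>k. inv (\<theta> (\<pi> k))) \<circ> wr ?m \<pi> \<theta>) (off ?m k + s) = id (off ?m k + s)"
      using wr_off[OF pi pk] wr_off[OF p k] Symc_Sym[OF p] T by simp
  qed
  then have "wr ?m (inv \<pi>) (\<lambda>k. inv (\<theta> (\<pi> k))) \<circ> wr ?m \<pi> \<theta> \<circ> inv (wr ?m \<pi> \<theta>) = inv (wr ?m \<pi> \<theta>)" by simp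
  then show "inv (wr ?m \<pi> \<theta>) = wr ?m (inv \<pi>) (\<lambda>k. inv (\<theta> (\<pi> k)))" by (simp only: Sym_cancel[OF S])
qed

lemma wreath_subgrp: "subgrp (Mtot r qs) (wreath r qs)"
  unfolding subgrp_def
proof (intro conjI ballI)
  show "wreath r qs \<subseteq> Sym (Mtot r qs)" by (auto simp: wreath_def)
  show "id \<in> wreath r qs"
    using wreath_memI[of id r qs "\<lambda>k. id"] subgrpD(2)[OF Symc_subgrp] by (simp add: wr_id blockwise_def)
next
  fix v w assume "v \<in> wreath r qs" "w \<in> wreath r qs"
  from this(1) obtain \<pi> \<theta> where a: "\<pi> \<in> Symc r" "blockwise r qs \<theta>" "v = wr (mlist r qs) \<pi> \<theta>"
    by (elim wreath_cases) blast
  from \<open>w \<in> wreath r qs\<close> obtain \<pi>' \<theta>' where b: "\<pi>' \<in> Symc r" "blockwise r qs \<theta>'" "w = wr (mlist r qs) \<pi>' \<theta>'"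
    by (elim wreath_cases) blast
  have "\<pi> \<circ> \<pi>' \<in> Symc r" using subgrpD(3)[OF Symc_subgrp] a b by blast
  then show "v \<circ> w \<in> wreath r qs"
    unfolding a(3) b(3) wr_comp(1)[OF a(1) b(1) a(2) b(2)]
    by (rule wreath_memI[OF _ wr_comp(2)[OF a(1) b(1) a(2) b(2)]])
next
  fix w assume "w \<in> wreath r qs"
  then obtain \<pi> \<theta> where a: "\<pi> \<in> Symc r" "blockwise r qs \<theta>" "w = wr (mlist r qs) \<pi> \<theta>"
    by (elim wreath_cases) blast
  show "inv w \<in> wreath r qs"
    unfolding a(3) wr_inv(1)[OF a(1,2)] by (rule wreath_memI[OF Symc_inv[OF a(1)] wr_inv(2)[OF a(1,2)]])
qed

section \<open>Composition in the linear operad\<close>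

definition LS :: "nat \<Rightarrow> (nat \<Rightarrow> 'o set) \<Rightarrow> 'o list set" where
  "LS n A = {cs. length cs = n \<and> (\<forall>k<n. cs ! k \<in> A k)}"

lemma listset_iff: "cs \<in> listset As \<longleftrightarrow> length cs = length As \<and> (\<forall>i<length As. cs ! i \<in> As ! i)"
proof (induction As arbitrary: cs)
  case (Cons A As)
  show ?case
  proof (cases cs)
    case (Cons c cs')
    then show ?thesis using Cons.IH[of cs'] by (auto simp: set_Cons_def nth_Cons less_Suc_eq_0_disj split: nat.splits)
  qed (auto simp: set_Cons_def)
qed auto

lemma finite_listset: "(\<And>A. A \<in> set As \<Longrightarrow> finite A) \<Longrightarrow> finite (listset As)"
proof (induction As)
  case (Cons A As)
  have "listset (A # As) = (\<lambda>(a, as). a # as) ` (A \<times> listset As)" by (auto simp: set_Cons_def)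
  then show ?case using Cons by simp
qed simp

lemma LS_eq: "LS n A = listset (map A [0..<n])"
  by (auto simp: LS_def listset_iff)

lemma finite_LS: "(\<And>k. k < n \<Longrightarrow> finite (A k)) \<Longrightarrow> finite (LS n A)"
  unfolding LS_eq by (rule finite_listset) auto

abbreviation supp :: "('o \<Rightarrow> 'k::zero) \<Rightarrow> 'o set" where
  "supp x \<equiv> {z. x z \<noteq> 0}"

text \<open>Supports change under sums and scalars. Summing over a fixed larger index set makes two
  compositions comparable term by term.\<close>

lemma lcomp_superset:
  fixes x :: "'o \<Rightarrow> 'k::field"
  assumes X: "finite X" "supp x \<subseteq> X"
    and A: "\<And>k. k < n \<Longrightarrow> finite (A k)" "\<And>k. k < n \<Longrightarrow> supp (y k) \<subseteq> A k"
  shows "lcomp cmp x (map y [0..<n]) z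
    = (\<Sum>(b, cs)\<in>X \<times> LS n A. if cmp b cs = z then x b * (\<Prod>k<n. y k (cs ! k)) else 0)"
proof -
  have LSe: "listset (map (\<lambda>y. supp y) (map y [0..<n])) = LS n (\<lambda>k. supp (y k))"
    by (simp add: LS_eq comp_def)
  have "lcomp cmp x (map y [0..<n]) z
    = (\<Sum>b\<in>supp x. \<Sum>cs\<in>LS n (\<lambda>k. supp (y k)). if cmp b cs = z then x b * (\<Prod>k<n. y k (cs ! k)) else 0)"
    unfolding lcomp_def LSe by (intro sum.cong refl if_cong arg_cong2[where f = "(*)"]) (auto intro!: prod.cong)
  also have "\<dots> = (\<Sum>(b, cs)\<in>supp x \<times> LS n (\<lambda>k. supp (y k)). if cmp b cs = z then x b * (\<Prod>k<n. y k (cs ! k)) else 0)"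
    by (rule sum.cartesian_product)
  also have "\<dots> = (\<Sum>(b, cs)\<in>X \<times> LS n A. if cmp b cs = z then x b * (\<Prod>k<n. y k (cs ! k)) else 0)"
  proof (rule sum.mono_neutral_left)
    show "finite (X \<times> LS n A)" by (rule finite_cartesian_product[OF X(1) finite_LS]) (rule A(1))
    show "supp x \<times> LS n (\<lambda>k. supp (y k)) \<subseteq> X \<times> LS n A" using X(2) A(2) unfolding LS_def by blast
    show "\<forall>i\<in>X \<times> LS n A - supp x \<times> LS n (\<lambda>k. supp (y k)).
      (case i of (b, cs) \<Rightarrow> if cmp b cs = z then x b * (\<Prod>k<n. y k (cs ! k)) else 0) = 0"
    proof (rule ballI)
      fix i assume i: "i \<in> X \<times> LS n A - supp x \<times> LS n (\<lambda>k. supp (y k))"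
      obtain b cs where bc: "i = (b, cs)" by (cases i)
      have "x b = 0 \<or> (\<exists>k<n. y k (cs ! k) = 0)" using i unfolding bc LS_def by blast
      then have "x b * (\<Prod>k<n. y k (cs ! k)) = 0" by auto
      then show "(case i of (b, cs) \<Rightarrow> if cmp b cs = z then x b * (\<Prod>k<n. y k (cs ! k)) else 0) = 0"
        unfolding bc prod.case by (simp only: if_cancel)
    qed
  qed
  finally show ?thesis .
qed

lemma lcomp_add_left:
  fixes x x' :: "'o \<Rightarrow> 'k::field"
  assumes "finite (supp x)" "finite (supp x')" "\<And>k. k < n \<Longrightarrow> finite (supp (y k))"
  shows "lcomp cmp (\<lambda>z. x z + x' z) (map y [0..<n])
    = (\<lambda>z. lcomp cmp x (map y [0..<n]) z + lcomp cmp x' (map y [0..<n]) z)"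
proof
  fix z
  let ?X = "supp x \<union> supp x'" and ?A = "\<lambda>k. supp (y k)"
  have eq: "lcomp cmp w (map y [0..<n]) z
     = (\<Sum>(b, cs)\<in>?X \<times> LS n ?A. if cmp b cs = z then w b * (\<Prod>k<n. y k (cs ! k)) else 0)"
    if "supp w \<subseteq> ?X" for w using assms that by (intro lcomp_superset) auto
  have sub: "supp (\<lambda>z. x z + x' z) \<subseteq> ?X" "supp x \<subseteq> ?X" "supp x' \<subseteq> ?X" by auto
  show "lcomp cmp (\<lambda>z. x z + x' z) (map y [0..<n]) z
    = lcomp cmp x (map y [0..<n]) z + lcomp cmp x' (map y [0..<n]) z"
    unfolding eq[OF sub(1)] eq[OF sub(2)] eq[OF sub(3)] sum.distrib[symmetric]
    by (rule sum.cong) (auto simp: distrib_right)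
qed

lemma lcomp_scale:
  fixes x :: "'o \<Rightarrow> 'k::field"
  assumes "finite (supp x)" "\<And>k. k < n \<Longrightarrow> finite (supp (y k))"
  shows "lcomp cmp (\<lambda>z. c * x z) (map (\<lambda>k z. d k * y k z) [0..<n])
    = (\<lambda>z. c * (\<Prod>k<n. d k) * lcomp cmp x (map y [0..<n]) z)"
proof
  fix z
  let ?A = "\<lambda>k. supp (y k)"
  have e1: "lcomp cmp (\<lambda>z. c * x z) (map (\<lambda>k z. d k * y k z) [0..<n]) z
     = (\<Sum>(b, cs)\<in>supp x \<times> LS n ?A. if cmp b cs = z then c * x b * (\<Prod>k<n. d k * y k (cs ! k)) else 0)"
    using assms by (intro lcomp_superset) auto
  have e2: "lcomp cmp x (map y [0..<n]) z
     = (\<Sum>(b, cs)\<in>supp x \<times> LS n ?A. if cmp b cs = z then x b * (\<Prod>k<n. y k (cs ! k)) else 0)"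
    using assms by (intro lcomp_superset) auto
  show "lcomp cmp (\<lambda>z. c * x z) (map (\<lambda>k z. d k * y k z) [0..<n]) z
    = c * (\<Prod>k<n. d k) * lcomp cmp x (map y [0..<n]) z"
    unfolding e1 e2 sum_distrib_left by (rule sum.cong) (auto simp: prod.distrib)
qed

lemma lcomp_slot_add:
  fixes x :: "'o \<Rightarrow> 'k::field"
  assumes fin: "finite (supp x)" "\<And>k. k < n \<Longrightarrow> finite (supp (y k))" "finite (supp v)" "finite (supp v')" and j: "j < n"
  shows "lcomp cmp x (map (y(j := (\<lambda>z. v z + v' z))) [0..<n])
    = (\<lambda>z. lcomp cmp x (map (y(j := v)) [0..<n]) z + lcomp cmp x (map (y(j := v')) [0..<n]) z)"
proof
  fix z
  let ?A = "\<lambda>k. if k = j then supp v \<union> supp v' else supp (y k)"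
  have eq: "lcomp cmp x (map (y(j := w)) [0..<n]) z
     = (\<Sum>(b, cs)\<in>supp x \<times> LS n ?A. if cmp b cs = z then x b * (\<Prod>k<n. (y(j := w)) k (cs ! k)) else 0)"
    if "supp w \<subseteq> supp v \<union> supp v'" for w
    using assms that by (intro lcomp_superset) auto
  have sub: "supp (\<lambda>z. v z + v' z) \<subseteq> supp v \<union> supp v'" "supp v \<subseteq> supp v \<union> supp v'" "supp v' \<subseteq> supp v \<union> supp v'" by auto
  have pr: "(\<Prod>k<n. (y(j := w)) k (cs ! k)) = w (cs ! j) * (\<Prod>k\<in>{..<n} - {j}. y k (cs ! k))" for w cs
  proof -
    have "(\<Prod>k<n. (y(j := w)) k (cs ! k)) = (y(j := w)) j (cs ! j) * (\<Prod>k\<in>{..<n} - {j}. (y(j := w)) k (cs ! k))"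
      using j by (intro prod.remove) auto
    also have "(\<Prod>k\<in>{..<n} - {j}. (y(j := w)) k (cs ! k)) = (\<Prod>k\<in>{..<n} - {j}. y k (cs ! k))"
      by (rule prod.cong) auto
    finally show ?thesis by simp
  qed
  show "lcomp cmp x (map (y(j := (\<lambda>z. v z + v' z))) [0..<n]) z
    = lcomp cmp x (map (y(j := v)) [0..<n]) z + lcomp cmp x (map (y(j := v')) [0..<n]) z"
    unfolding eq[OF sub(1)] eq[OF sub(2)] eq[OF sub(3)] sum.distrib[symmetric] pr
    by (rule sum.cong) (auto simp: algebra_simps)
qed

text \<open>Multilinear expansion: \<open>S\<close> is the set of inputs in \<open>I\<close> that
  receive \<open>v\<close>, the others in \<open>I\<close> receive \<open>v'\<close>. It will be
  compared with the coset sums that come from splitting a slot.\<close>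

lemma lcomp_expand:
  fixes x :: "'o \<Rightarrow> 'k::field"
  assumes fin: "finite (supp x)" "finite (supp v)" "finite (supp v')" and I: "finite I" "I \<subseteq> {..<n}"
    and y: "\<And>k. k < n \<Longrightarrow> finite (supp (y k))"
  shows "lcomp cmp x (map (\<lambda>k. if k \<in> I then (\<lambda>z. v z + v' z) else y k) [0..<n])
    = (\<lambda>z. \<Sum>S\<in>Pow I. lcomp cmp x (map (\<lambda>k. if k \<in> I then (if k \<in> S then v else v') else y k) [0..<n]) z)"
  using I y
proof (induction I arbitrary: y rule: finite_induct)
  case empty
  then show ?case by simp
next
  case (insert j I)
  let ?vv = "\<lambda>z. v z + v' z"
  have fvv: "finite (supp ?vv)" by (rule finite_subset[of _ "supp v \<union> supp v'"]) (use fin in auto)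
  let ?y0 = "\<lambda>k. if k \<in> I then ?vv else y k"
  have fy0: "finite (supp (?y0 k))" if "k < n" for k using insert.prems(2)[OF that] fvv by (cases "k \<in> I") simp_all
  have j: "j < n" "I \<subseteq> {..<n}" using insert.prems by auto
  have "lcomp cmp x (map (\<lambda>k. if k \<in> insert j I then ?vv else y k) [0..<n])
      = lcomp cmp x (map (?y0(j := ?vv)) [0..<n])"
    by (rule arg_cong[where f = "lcomp cmp x"]) (auto intro!: map_cong)
  also have "\<dots> = (\<lambda>z. lcomp cmp x (map (?y0(j := v)) [0..<n]) z + lcomp cmp x (map (?y0(j := v')) [0..<n]) z)"
    by (rule lcomp_slot_add[OF fin(1) fy0 fin(2,3) j(1)])
  also have "\<dots> = (\<lambda>z. (\<Sum>S\<in>Pow I. lcomp cmp x (map (\<lambda>k. if k \<in> insert j I then (if k \<in> insert j S then v else v') else y k) [0..<n]) z)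
      + (\<Sum>S\<in>Pow I. lcomp cmp x (map (\<lambda>k. if k \<in> insert j I then (if k \<in> S then v else v') else y k) [0..<n]) z))"
  proof -
    have step: "lcomp cmp x (map (?y0(j := w)) [0..<n])
      = (\<lambda>z. \<Sum>S\<in>Pow I. lcomp cmp x (map (\<lambda>k. if k \<in> I then (if k \<in> S then v else v') else (y(j := w)) k) [0..<n]) z)"
      if w: "finite (supp w)" for w
    proof -
      have "lcomp cmp x (map (?y0(j := w)) [0..<n]) = lcomp cmp x (map (\<lambda>k. if k \<in> I then ?vv else (y(j := w)) k) [0..<n])"
        using insert.hyps(2) by (intro arg_cong[where f = "lcomp cmp x"]) (auto intro!: map_cong)
      also have "\<dots> = (\<lambda>z. \<Sum>S\<in>Pow I. lcomp cmp x (map (\<lambda>k. if k \<in> I then (if k \<in> S then v else v') else (y(j := w)) k) [0..<n]) z)"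
        using insert.prems(2) w by (intro insert.IH[OF j(2)]) simp
      finally show ?thesis .
    qed
    have e1: "(\<lambda>k. if k \<in> I then (if k \<in> S then v else v') else (y(j := v)) k)
        = (\<lambda>k. if k \<in> insert j I then (if k \<in> insert j S then v else v') else y k)" for S
      using insert.hyps(2) by (intro ext) auto
    have e2: "(\<lambda>k. if k \<in> I then (if k \<in> S then v else v') else (y(j := v')) k)
        = (\<lambda>k. if k \<in> insert j I then (if k \<in> S then v else v') else y k)" if "S \<in> Pow I" for S
      using insert.hyps(2) that by (intro ext) auto
    have s1: "(\<Sum>S\<in>Pow I. lcomp cmp x (map (\<lambda>k. if k \<in> I then (if k \<in> S then v else v') else (y(j := v)) k) [0..<n]) z)
      = (\<Sum>S\<in>Pow I. lcomp cmp x (map (\<lambda>k. if k \<in> insert j I then (if k \<in> insert j S then v else v') else y k) [0..<n]) z)" for z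
      by (rule sum.cong[OF refl]) (simp only: e1)
    have s2: "(\<Sum>S\<in>Pow I. lcomp cmp x (map (\<lambda>k. if k \<in> I then (if k \<in> S then v else v') else (y(j := v')) k) [0..<n]) z)
      = (\<Sum>S\<in>Pow I. lcomp cmp x (map (\<lambda>k. if k \<in> insert j I then (if k \<in> S then v else v') else y k) [0..<n]) z)" for z
      by (rule sum.cong[OF refl]) (simp only: e2)
    show ?thesis unfolding step[OF fin(2)] step[OF fin(3)] s1 s2 by (rule refl)
  qed
  also have "\<dots> = (\<lambda>z. \<Sum>S\<in>Pow (insert j I). lcomp cmp x (map (\<lambda>k. if k \<in> insert j I then (if k \<in> S then v else v') else y k) [0..<n]) z)"
  proof
    fix z
    let ?F = "\<lambda>S. lcomp cmp x (map (\<lambda>k. if k \<in> insert j I then (if k \<in> S then v else v') else y k) [0..<n]) z"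
    have "sum ?F (Pow (insert j I)) = sum ?F (Pow I) + sum ?F (insert j ` Pow I)"
      unfolding Pow_insert using insert.hyps by (intro sum.union_disjoint) auto
    also have "sum ?F (insert j ` Pow I) = sum (\<lambda>S. ?F (insert j S)) (Pow I)"
      using insert.hyps by (subst sum.reindex) (auto simp: inj_on_def o_def)
    finally show "(\<Sum>S\<in>Pow I. ?F (insert j S)) + (\<Sum>S\<in>Pow I. ?F S) = sum ?F (Pow (insert j I))" by (simp add: add.commute)
  qed
  finally show ?case .
qed

lemma Pn_finite: "x \<in> Pn B n \<Longrightarrow> finite (supp x)" by (simp add: Pn_def)

lemma Pinv_Pn: "x \<in> Pinv B act r \<Longrightarrow> x \<in> Pn B (sum_list r)" by (simp add: Pinv_def)

text \<open>Block \<open>i\<close> contains \<open>r ! i\<close> inputs. This is the origin of the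
  exponents in \<gamma>6b and in the homogeneity of composition.\<close>

lemma prod_blk:
  fixes s :: "nat \<Rightarrow> 'm::comm_monoid_mult"
  shows "(\<Prod>k<sum_list r. s (blk r k)) = (\<Prod>i<length r. s i ^ (r ! i))"
proof -
  have "(\<Prod>k<sum_list r. s (blk r k)) = (\<Prod>i<length r. \<Prod>k\<in>{k \<in> {..<sum_list r}. blk r k = i}. s (blk r k))"
    by (rule prod.group[symmetric]) (auto simp: blk_props)
  also have "\<dots> = (\<Prod>i<length r. s i ^ (r ! i))"
  proof (rule prod.cong[OF refl])
    fix i assume "i \<in> {..<length r}"
    then have i: "i < length r" by simp
    have "{k \<in> {..<sum_list r}. blk r k = i} = ivl r i" using i by (auto simp: ivl_iff_blk)
    moreover have "card (ivl r i) = r ! i" using i by (simp add: ivl_def off_Suc)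
    moreover have "(\<Prod>k\<in>{k \<in> {..<sum_list r}. blk r k = i}. s (blk r k)) = (\<Prod>k\<in>{k \<in> {..<sum_list r}. blk r k = i}. s i)"
      by (rule prod.cong) auto
    ultimately show "(\<Prod>k\<in>{k \<in> {..<sum_list r}. blk r k = i}. s (blk r k)) = s i ^ (r ! i)" by simp
  qed
  finally show ?thesis .
qed

context set_op
begin

lemma lcomp_Pn:
  fixes x :: "'o \<Rightarrow> 'k::field"
  assumes x: "x \<in> Pn B n" and y: "\<And>k. k < n \<Longrightarrow> y k \<in> Pn B (ms ! k)" and ms: "length ms = n"
  shows "lcomp cmp x (map y [0..<n]) \<in> Pn B (sum_list ms)"
proof -
  let ?S = "supp x \<times> LS n (\<lambda>k. supp (y k))"
  have fin: "finite ?S" by (rule finite_cartesian_product[OF Pn_finite[OF x] finite_LS]) (rule Pn_finite[OF y])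
  have eq: "lcomp cmp x (map y [0..<n]) z
     = (\<Sum>(b, cs)\<in>?S. if cmp b cs = z then x b * (\<Prod>k<n. y k (cs ! k)) else 0)" for z
    by (intro lcomp_superset Pn_finite[OF x] order_refl) (rule Pn_finite[OF y])
  have ne: "\<exists>(b, cs)\<in>?S. cmp b cs = z" if "lcomp cmp x (map y [0..<n]) z \<noteq> 0" for z
  proof (rule ccontr)
    assume "\<not> ?thesis"
    then have "lcomp cmp x (map y [0..<n]) z = 0" unfolding eq by (intro sum.neutral) auto
    with that show False by simp
  qed
  have "supp (lcomp cmp x (map y [0..<n])) \<subseteq> (\<lambda>(b, cs). cmp b cs) ` ?S" using ne by force
  then have "finite (supp (lcomp cmp x (map y [0..<n])))" using fin finite_surj by blast
  moreover have "z \<in> B (sum_list ms)" if z: "lcomp cmp x (map y [0..<n]) z \<noteq> 0" for z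
  proof -
    from ne[OF z] obtain b cs where bc: "x b \<noteq> 0" "cs \<in> LS n (\<lambda>k. supp (y k))" "cmp b cs = z" by auto
    have "b \<in> B n" using bc x by (auto simp: Pn_def)
    moreover have "length cs = n" "\<And>k. k < n \<Longrightarrow> cs ! k \<in> B (ms ! k)"
      using bc y by (auto simp: LS_def Pn_def)
    ultimately show ?thesis using cmp_in[of b n cs ms] ms bc(3) by blast
  qed
  ultimately show ?thesis by (simp add: Pn_def)
qed

text \<open>The two equivariance axioms of the operad combined: the outer one contributes the block
  permutation, the inner one the permutations inside the blocks.\<close>

lemma act_wr:
  assumes p: "\<pi> \<in> Symc r" and t: "blockwise r qs \<theta>"
    and b: "b \<in> B (sum_list r)" and cs: "length cs = sum_list r" "\<And>k. k < sum_list r \<Longrightarrow> cs ! k \<in> B (mlist r qs ! k)"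
  shows "act (wr (mlist r qs) \<pi> \<theta>) (cmp b cs) = cmp (act \<pi> b) (map (\<lambda>k. act (\<theta> k) (cs ! inv \<pi> k)) [0..<sum_list r])"
proof -
  let ?n = "sum_list r" and ?m = "mlist r qs"
  \<comment> \<open>Permuted in advance, so that the outer axiom returns exactly \<open>cs\<close>
    on its right-hand side.\<close>
  define ys where "ys = map (\<lambda>k. cs ! inv \<pi> k) [0..<?n]"
  note pS = Symc_Sym[OF p] and pi = Symc_inv[OF p]
  have ys: "length ys = ?n" "\<And>k. k < ?n \<Longrightarrow> ys ! k \<in> B (?m ! k)"
  proof -
    fix k assume k: "k < ?n"
    have "inv \<pi> k < ?n" using k Sym_less[OF Sym_inv[OF pS]] by simp
    then show "ys ! k \<in> B (?m ! k)" using cs(2)[of "inv \<pi> k"] mlist_perm[OF pi k] k by (simp add: ys_def)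
  qed (simp add: ys_def)
  have e1: "map (\<lambda>i. ?m ! \<pi> i) [0..<?n] = ?m"
    using mlist_perm[OF p] by (intro nth_equalityI) simp_all
  have e2: "map (\<lambda>i. ys ! \<pi> i) [0..<?n] = cs"
    using Sym_less[OF pS] pS cs(1) by (intro nth_equalityI) (simp_all add: ys_def)
  have c: "cmp (act \<pi> b) ys = act (block_perm ?m \<pi>) (cmp b cs)"
    using cmp_act_left[OF b ys(1) _ ys(2) pS] e1 e2 by simp
  have bm: "block_perm ?m \<pi> \<in> Sym (sum_list ?m)" by (rule block_perm_Sym) (use pS in simp)
  have dm: "dsum ?m (map \<theta> [0..<?n]) \<in> Sym (sum_list ?m)"
    using wparamsD[OF t] by (intro dsum_Sym) simp_all
  have X: "cmp b cs \<in> B (sum_list ?m)" by (rule cmp_in[OF b cs(1) _ cs(2)]) simp_all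
  have "map (\<lambda>k. act (\<theta> k) (cs ! inv \<pi> k)) [0..<?n] = map (\<lambda>i. act (map \<theta> [0..<?n] ! i) (ys ! i)) [0..<?n]"
    by (rule map_cong) (simp_all add: ys_def)
  then have "cmp (act \<pi> b) (map (\<lambda>k. act (\<theta> k) (cs ! inv \<pi> k)) [0..<?n])
      = cmp (act \<pi> b) (map (\<lambda>i. act (map \<theta> [0..<?n] ! i) (ys ! i)) [0..<?n])" by (rule arg_cong)
  also have "\<dots> = act (dsum ?m (map \<theta> [0..<?n])) (cmp (act \<pi> b) ys)"
    by (rule cmp_act_right[OF act_in[OF pS b] ys(1) length_mlist ys(2)]) (simp_all add: wparamsD[OF t])
  also have "\<dots> = act (dsum ?m (map \<theta> [0..<?n]) \<circ> block_perm ?m \<pi>) (cmp b cs)"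
    unfolding c by (rule act_comp[OF dm bm X, symmetric])
  finally show ?thesis by (simp add: wr_def)
qed

lemma Pinv_act: "x \<in> Pinv B act r \<Longrightarrow> g \<in> Symc r \<Longrightarrow> y \<in> B (sum_list r) \<Longrightarrow> x (act g y) = x y"
  unfolding Pinv_eq_Pfix by (rule Pfix_const[OF Symc_subgrp]) (auto simp: orbR_def)

text \<open>A wreath product element only permutes the inner operations: \<theta> is absorbed
  because they are invariant, and the effect of \<pi> on the outer operation because that is
  invariant.\<close>

lemma lact_lcomp:
  fixes x :: "'o \<Rightarrow> 'k::field"
  assumes p: "\<pi> \<in> Symc r" and t: "blockwise r qs \<theta>" and x: "x \<in> Pinv B act r"
    and y: "\<And>k. k < sum_list r \<Longrightarrow> y k \<in> Pinv B act (qs ! blk r k)"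
  shows "lact B act (Mtot r qs) (wr (mlist r qs) \<pi> \<theta>) (lcomp cmp x (map y [0..<sum_list r]))
    = lcomp cmp x (map (\<lambda>k. y (inv \<pi> k)) [0..<sum_list r])"
proof
  fix z
  let ?n = "sum_list r" and ?m = "mlist r qs" and ?M = "Mtot r qs"
  let ?w = "wr ?m \<pi> \<theta>"
  note pS = Symc_Sym[OF p] and pi = Symc_inv[OF p] and wS = wr_Sym[OF p t]
  have yP: "y k \<in> Pn B (?m ! k)" if "k < ?n" for k
    using Pinv_Pn[OF y[OF that]] that by (simp add: nth_mlist msz_def)
  have il: "inv \<pi> k < ?n" "\<pi> k < ?n" if "k < ?n" for k
    using that Sym_less[OF Sym_inv[OF pS]] Sym_less[OF pS] by simp_all
  have y': "y (inv \<pi> k) \<in> Pinv B act (qs ! blk r k)" if "k < ?n" for k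
    using y[OF il(1)[OF that]] Symc_blk[OF pi that] by simp
  have yP': "y (inv \<pi> k) \<in> Pn B (?m ! k)" if "k < ?n" for k
    using Pinv_Pn[OF y'[OF that]] that by (simp add: nth_mlist msz_def)
  note xP = Pinv_Pn[OF x]
  let ?S = "supp x \<times> LS ?n (\<lambda>k. supp (y k))" and ?T = "supp x \<times> LS ?n (\<lambda>k. supp (y (inv \<pi> k)))"
  have eS: "lcomp cmp x (map y [0..<?n]) v
     = (\<Sum>(b, cs)\<in>?S. if cmp b cs = v then x b * (\<Prod>k<?n. y k (cs ! k)) else 0)" for v
    by (intro lcomp_superset Pn_finite[OF xP] order_refl) (rule Pn_finite[OF yP])
  have eT: "lcomp cmp x (map (\<lambda>k. y (inv \<pi> k)) [0..<?n]) v
     = (\<Sum>(b, cs)\<in>?T. if cmp b cs = v then x b * (\<Prod>k<?n. y (inv \<pi> k) (cs ! k)) else 0)" for v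
    by (intro lcomp_superset Pn_finite[OF xP] order_refl) (rule Pn_finite[OF yP'])
  show "lact B act ?M ?w (lcomp cmp x (map y [0..<?n])) z = lcomp cmp x (map (\<lambda>k. y (inv \<pi> k)) [0..<?n]) z"
  proof (cases "z \<in> B ?M")
    case False
    have "lcomp cmp x (map (\<lambda>k. y (inv \<pi> k)) [0..<?n]) \<in> Pn B (sum_list ?m)"
      by (rule lcomp_Pn[OF xP yP']) simp_all
    then show ?thesis using False by (simp add: lact_def Pn_outside sum_mlist)
  next
    case z: True
    \<comment> \<open>\<open>?J\<close> and \<open>?I\<close> are mutually inverse on the pairs with
      nonzero coefficients. They match the composites equal to the translate of \<open>z\<close>
      with the composites equal to \<open>z\<close>.\<close>
    let ?J = "\<lambda>(b, cs). (act \<pi> b, map (\<lambda>k. act (\<theta> k) (cs ! inv \<pi> k)) [0..<?n])"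
    let ?I = "\<lambda>(b, cs). (act (inv \<pi>) b, map (\<lambda>k. act (inv (\<theta> (\<pi> k))) (cs ! \<pi> k)) [0..<?n])"
    have inB: "b \<in> B ?n" if "x b \<noteq> 0" for b using that xP by (auto simp: Pn_def)
    have tS: "\<theta> k \<in> Sym (?m ! k)" if "k < ?n" for k by (rule wparamsD[OF t that])
    have th: "y (inv \<pi> k) (act (\<theta> k) c) = y (inv \<pi> k) c" if "k < ?n" "c \<in> B (?m ! k)" for k c
      using Pinv_act[OF y'[OF that(1)] blockwiseD[OF t that(1)], of c] that by (simp add: nth_mlist msz_def)
    have thi: "y k (act (inv (\<theta> (\<pi> k))) c) = y k c" if k: "k < ?n" and c: "c \<in> B (?m ! k)" for k c
    proof -
      have "inv (\<theta> (\<pi> k)) \<in> Symc (qs ! blk r k)"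
        using blockwiseD[OF wr_inv(2)[OF p t] k] .
      then show ?thesis using Pinv_act[OF y[OF k], of "inv (\<theta> (\<pi> k))" c] c k by (simp add: nth_mlist msz_def)
    qed
    have Sin: "cs ! k \<in> B (?m ! k)" "length cs = ?n" if "(b, cs) \<in> ?S" "k < ?n" for b cs k
      using that yP[OF that(2)] by (auto simp: LS_def Pn_def)
    have Tin: "cs ! k \<in> B (?m ! k)" "length cs = ?n" if "(b, cs) \<in> ?T" "k < ?n" for b cs k
      using that yP'[OF that(2)] by (auto simp: LS_def Pn_def)
    have Sin2: "cs ! inv \<pi> k \<in> B (?m ! k)" if "(b, cs) \<in> ?S" "k < ?n" for b cs k
      using Sin(1)[OF that(1) il(1)[OF that(2)]] mlist_perm[OF pi that(2)] by simp
    have Tin2: "cs ! \<pi> k \<in> B (?m ! k)" if "(b, cs) \<in> ?T" "k < ?n" for b cs k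
      using Tin(1)[OF that(1) il(2)[OF that(2)]] mlist_perm[OF p that(2)] by simp
    have SJ: "?I (?J (b, cs)) = (b, cs) \<and> ?J (b, cs) \<in> ?T \<and>
        (case ?J (b, cs) of (b, cs) \<Rightarrow> if cmp b cs = z then x b * (\<Prod>k<?n. y (inv \<pi> k) (cs ! k)) else 0)
         = (if cmp b cs = act (inv ?w) z then x b * (\<Prod>k<?n. y k (cs ! k)) else 0)"
      if a: "b \<in> supp x" "cs \<in> LS ?n (\<lambda>k. supp (y k))" for b cs
    proof -
      from a have S: "(b, cs) \<in> ?S" and bB: "b \<in> B ?n" and lcs: "length cs = ?n"
        using inB by (auto simp: LS_def)
      have r1: "?I (?J (b, cs)) = (b, cs)"
      proof -
        have "map (\<lambda>k. act (inv (\<theta> (\<pi> k))) (map (\<lambda>k. act (\<theta> k) (cs ! inv \<pi> k)) [0..<?n] ! \<pi> k)) [0..<?n] = cs"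
        proof (rule nth_equalityI)
          fix k assume "k < length (map (\<lambda>k. act (inv (\<theta> (\<pi> k))) (map (\<lambda>k. act (\<theta> k) (cs ! inv \<pi> k)) [0..<?n] ! \<pi> k)) [0..<?n])"
          then have k: "k < ?n" by simp
          have "cs ! k \<in> B (?m ! \<pi> k)" using Sin(1)[OF S k] mlist_perm[OF p k] by simp
          then show "map (\<lambda>k. act (inv (\<theta> (\<pi> k))) (map (\<lambda>k. act (\<theta> k) (cs ! inv \<pi> k)) [0..<?n] ! \<pi> k)) [0..<?n] ! k = cs ! k"
            using k il(2)[OF k] pS act_inv(1)[OF tS[OF il(2)[OF k]]] by simp
        qed (use lcs in simp)
        then show ?thesis using act_inv(1)[OF pS bB] by simp
      qed
      have "x (act \<pi> b) = x b" by (rule Pinv_act[OF x p bB])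
      moreover have "y (inv \<pi> k) (act (\<theta> k) (cs ! inv \<pi> k)) = y (inv \<pi> k) (cs ! inv \<pi> k)" if "k < ?n" for k
        by (rule th[OF that Sin2[OF S that]])
      moreover have "y (inv \<pi> k) (cs ! inv \<pi> k) \<noteq> 0" if "k < ?n" for k using a il(1)[OF that] by (auto simp: LS_def)
      ultimately have r2: "?J (b, cs) \<in> ?T" using a by (auto simp: LS_def)
      have pr: "(\<Prod>k<?n. y (inv \<pi> k) (map (\<lambda>k. act (\<theta> k) (cs ! inv \<pi> k)) [0..<?n] ! k)) = (\<Prod>k<?n. y k (cs ! k))"
      proof -
        have "(\<Prod>k<?n. y (inv \<pi> k) (map (\<lambda>k. act (\<theta> k) (cs ! inv \<pi> k)) [0..<?n] ! k)) = (\<Prod>k<?n. y (inv \<pi> k) (cs ! inv \<pi> k))"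
          using th[OF _ Sin2[OF S]] by (intro prod.cong) auto
        also have "\<dots> = (\<Prod>k<?n. y k (cs ! k))" using Sym_prod[OF Sym_inv[OF pS], of "\<lambda>k. y k (cs ! k)"] .
        finally show ?thesis .
      qed
      have aw: "act ?w (cmp b cs) = cmp (act \<pi> b) (map (\<lambda>k. act (\<theta> k) (cs ! inv \<pi> k)) [0..<?n])"
        by (rule act_wr[OF p t bB lcs]) (rule Sin(1)[OF S])
      have cB: "cmp b cs \<in> B ?M" using cmp_in[OF bB lcs, of ?m] Sin(1)[OF S] by (simp add: sum_mlist)
      have "cmp b cs = act (inv ?w) z \<longleftrightarrow> cmp (act \<pi> b) (map (\<lambda>k. act (\<theta> k) (cs ! inv \<pi> k)) [0..<?n]) = z"
        using act_eq_iff[OF wS cB z] aw by auto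
      then have r3: "(case ?J (b, cs) of (b, cs) \<Rightarrow> if cmp b cs = z then x b * (\<Prod>k<?n. y (inv \<pi> k) (cs ! k)) else 0)
         = (if cmp b cs = act (inv ?w) z then x b * (\<Prod>k<?n. y k (cs ! k)) else 0)"
        unfolding prod.case pr Pinv_act[OF x p bB] by (simp only:)
      from r1 r2 r3 show ?thesis by blast
    qed
    have TI: "?J (?I (b, cs)) = (b, cs) \<and> ?I (b, cs) \<in> ?S"
      if a: "b \<in> supp x" "cs \<in> LS ?n (\<lambda>k. supp (y (inv \<pi> k)))" for b cs
    proof -
      from a have T: "(b, cs) \<in> ?T" and bB: "b \<in> B ?n" and lcs: "length cs = ?n"
        using inB by (auto simp: LS_def)
      have r1: "?J (?I (b, cs)) = (b, cs)"
      proof -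
        have "map (\<lambda>k. act (\<theta> k) (map (\<lambda>k. act (inv (\<theta> (\<pi> k))) (cs ! \<pi> k)) [0..<?n] ! inv \<pi> k)) [0..<?n] = cs"
        proof (rule nth_equalityI)
          fix k assume "k < length (map (\<lambda>k. act (\<theta> k) (map (\<lambda>k. act (inv (\<theta> (\<pi> k))) (cs ! \<pi> k)) [0..<?n] ! inv \<pi> k)) [0..<?n])"
          then have k: "k < ?n" by simp
          show "map (\<lambda>k. act (\<theta> k) (map (\<lambda>k. act (inv (\<theta> (\<pi> k))) (cs ! \<pi> k)) [0..<?n] ! inv \<pi> k)) [0..<?n] ! k = cs ! k"
            using k il(1)[OF k] pS act_inv(2)[OF tS[OF k] Tin(1)[OF T k]] by simp
        qed (use lcs in simp)
        then show ?thesis using act_inv(2)[OF pS bB] by simp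
      qed
      have "x (act (inv \<pi>) b) = x b" by (rule Pinv_act[OF x pi bB])
      moreover have "y k (act (inv (\<theta> (\<pi> k))) (cs ! \<pi> k)) = y k (cs ! \<pi> k)" if "k < ?n" for k
        by (rule thi[OF that Tin2[OF T that]])
      moreover have "y k (cs ! \<pi> k) \<noteq> 0" if "k < ?n" for k
      proof -
        have "y (inv \<pi> (\<pi> k)) (cs ! \<pi> k) \<noteq> 0" using a il(2)[OF that] unfolding LS_def by blast
        then show ?thesis using pS by simp
      qed
      ultimately have r2: "?I (b, cs) \<in> ?S" using a by (auto simp: LS_def)
      from r1 r2 show ?thesis by blast
    qed
    have "lact B act ?M ?w (lcomp cmp x (map y [0..<?n])) z
      = (\<Sum>(b, cs)\<in>?S. if cmp b cs = act (inv ?w) z then x b * (\<Prod>k<?n. y k (cs ! k)) else 0)"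
      using z by (simp add: lact_def eS)
    also have "\<dots> = (\<Sum>(b, cs)\<in>?T. if cmp b cs = z then x b * (\<Prod>k<?n. y (inv \<pi> k) (cs ! k)) else 0)"
    proof (rule sum.reindex_bij_witness[where i = ?I and j = ?J])
      fix p assume "p \<in> ?S"
      then obtain b cs where p: "p = (b, cs)" and a: "b \<in> supp x" "cs \<in> LS ?n (\<lambda>k. supp (y k))" by blast
      show "?I (?J p) = p" unfolding p by (rule conjunct1[OF SJ[OF a]])
      show "?J p \<in> ?T" unfolding p by (rule conjunct1[OF conjunct2[OF SJ[OF a]]])
      show "(case ?J p of (b, cs) \<Rightarrow> if cmp b cs = z then x b * (\<Prod>k<?n. y (inv \<pi> k) (cs ! k)) else 0)
         = (case p of (b, cs) \<Rightarrow> if cmp b cs = act (inv ?w) z then x b * (\<Prod>k<?n. y k (cs ! k)) else 0)"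
        using conjunct2[OF conjunct2[OF SJ[OF a]]] unfolding p prod.case .
    next
      fix p assume "p \<in> ?T"
      then obtain b cs where p: "p = (b, cs)" and a: "b \<in> supp x" "cs \<in> LS ?n (\<lambda>k. supp (y (inv \<pi> k)))" by blast
      show "?J (?I p) = p" unfolding p by (rule conjunct1[OF TI[OF a]])
      show "?I p \<in> ?S" unfolding p by (rule conjunct2[OF TI[OF a]])
    qed
    also have "\<dots> = lcomp cmp x (map (\<lambda>k. y (inv \<pi> k)) [0..<?n]) z" by (rule eT[symmetric])
    finally show ?thesis .
  qed
qed

text \<open>All inputs in one block of \<open>r\<close> carry the same inner operation, so permuting
  them by \<pi> changes nothing.\<close>

lemma lcomp_Pfix_wreath:
  fixes x :: "'o \<Rightarrow> 'k::field"
  assumes x: "x \<in> Pinv B act r" and xs: "\<And>i. i < length r \<Longrightarrow> xs ! i \<in> Pinv B act (qs ! i)"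
  shows "lcomp cmp x (map (\<lambda>k. xs ! blk r k) [0..<sum_list r]) \<in> Pfix B act (Mtot r qs) (wreath r qs)"
proof -
  let ?z = "lcomp cmp x (map (\<lambda>k. xs ! blk r k) [0..<sum_list r])"
  have y: "xs ! blk r k \<in> Pinv B act (qs ! blk r k)" if "k < sum_list r" for k
    using xs blk_props(1)[OF that] by blast
  have "?z \<in> Pn B (sum_list (mlist r qs))"
    using Pinv_Pn[OF y] by (intro lcomp_Pn[OF Pinv_Pn[OF x]]) (simp_all add: nth_mlist msz_def)
  moreover have "lact B act (Mtot r qs) w ?z = ?z" if w: "w \<in> wreath r qs" for w
  proof -
    obtain \<pi> \<theta> where a: "\<pi> \<in> Symc r" "blockwise r qs \<theta>" "w = wr (mlist r qs) \<pi> \<theta>"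
      using w by (rule wreath_cases)
    have "lact B act (Mtot r qs) w ?z = lcomp cmp x (map (\<lambda>k. xs ! blk r (inv \<pi> k)) [0..<sum_list r])"
      unfolding a(3) by (rule lact_lcomp[OF a(1,2) x, where y = "\<lambda>k. xs ! blk r k"]) (rule y)
    also have "\<dots> = ?z" using Symc_blk[OF Symc_inv[OF a(1)]]
      by (intro arg_cong[where f = "lcomp cmp x"] map_cong) auto
    finally show ?thesis .
  qed
  ultimately show ?thesis by (simp add: Pfix_def sum_mlist)
qed

text \<open>The coefficient of \<open>z\<close> in the composite of orbit sums is the number
  \<open>L z\<close> of pairs (b, cs) that compose to \<open>z\<close>. Each pair comes from
  \<open>s\<close> parameters of the wreath product, \<open>s\<close> being the product of
  stabiliser orders, so \<open>s * L z\<close> counts the group elements sending \<open>X\<close> to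
  \<open>z\<close> and \<open>csum_count\<close> applies.\<close>

lemma csum_lcomp_ind:
  assumes q: "length qs = length r" and x: "x \<in> B (sum_list r)"
    and xs: "\<And>i. i < length r \<Longrightarrow> xs ! i \<in> B (sum_list (qs ! i))"
  defines "X \<equiv> cmp x (map (\<lambda>k. xs ! blk r k) [0..<sum_list r])"
  shows "X \<in> B (Mtot r qs)"
    and "csum (SF (Mtot r qs) (dlab r qs)) (wreath r qs) (\<lambda>\<tau>. lact B act (Mtot r qs) \<tau>
         (lcomp cmp (ind (orbR act (Symc r) x)) (map (\<lambda>k. ind (orbR act (Symc (qs ! blk r k)) (xs ! blk r k))) [0..<sum_list r])))
     = (\<lambda>z. of_nat (card (stab act (SF (Mtot r qs) (dlab r qs)) X) div
          (card (stab act (Symc r) x) * (\<Prod>i<length r. card (stab act (Symc (qs ! i)) (xs ! i)) ^ (r ! i))))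
        * (ind (orbR act (SF (Mtot r qs) (dlab r qs)) X) z :: 'k::field))"
proof -
  let ?n = "sum_list r" and ?m = "mlist r qs" and ?M = "Mtot r qs"
  let ?W = "wreath r qs" and ?G = "SF (Mtot r qs) (dlab r qs)"
  define xk where "xk = (\<lambda>k. xs ! blk r k)"
  define H where "H k = Symc (qs ! blk r k)" for k
  define O1 where "O1 = orbR act (Symc r) x"
  define O2 where "O2 k = orbR act (H k) (xk k)" for k
  have xkB: "xk k \<in> B (sum_list (qs ! blk r k))" "xk k \<in> B (?m ! k)" if "k < ?n" for k
    using xs[OF blk_props(1)[OF that]] that by (simp_all add: xk_def nth_mlist msz_def)
  have X: "X = cmp x (map xk [0..<?n])" by (simp add: X_def xk_def)
  have "X \<in> B (sum_list ?m)" unfolding X by (rule cmp_in[OF x]) (use xkB in simp_all)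
  then show XB: "X \<in> B ?M" by (simp add: sum_mlist)
  have Hs: "subgrp (sum_list (qs ! blk r k)) (H k)" for k by (simp add: H_def Symc_subgrp)
  define s where "s = card (stab act (Symc r) x) * (\<Prod>k<?n. card (stab act (H k) (xk k)))"
  have seq: "s = card (stab act (Symc r) x) * (\<Prod>i<length r. card (stab act (Symc (qs ! i)) (xs ! i)) ^ (r ! i))"
    using prod_blk[of "\<lambda>i. card (stab act (Symc (qs ! i)) (xs ! i))" r] by (simp add: s_def H_def xk_def)
  have spos: "s > 0" using stab_card_pos[OF Symc_subgrp x] stab_card_pos[OF Hs xkB(1)] by (simp add: s_def)
  define S where "S = O1 \<times> LS ?n O2"
  define L where "L z = card {p \<in> S. (\<lambda>(b, cs). cmp b cs) p = z}" for z
  have fO: "finite O1" "finite (O2 k)" for k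
    using subgrp_finite[OF Symc_subgrp] subgrp_finite[OF Hs] by (simp_all add: O1_def O2_def orbR_def)
  have fS: "finite S" unfolding S_def using fO by (auto intro!: finite_LS)
  have lc: "lcomp cmp (ind O1) (map (\<lambda>k. ind (O2 k)) [0..<?n]) z = (of_nat (L z) :: 'k)" for z
  proof -
    have "lcomp cmp (ind O1) (map (\<lambda>k. ind (O2 k)) [0..<?n]) z
      = (\<Sum>(b, cs)\<in>O1 \<times> LS ?n O2. if cmp b cs = z then ind O1 b * (\<Prod>k<?n. ind (O2 k) (cs ! k)) else (0::'k))"
      using fO by (intro lcomp_superset) (auto simp: ind_def split: if_splits)
    also have "\<dots> = (\<Sum>p\<in>S. if (\<lambda>(b, cs). cmp b cs) p = z then 1 else 0)"
      unfolding S_def by (rule sum.cong) (auto simp: ind_def LS_def)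
    also have "\<dots> = of_nat (L z)" using fS by (simp add: L_def sum.If_cases Int_def)
    finally show ?thesis .
  qed
  let ?P = "wparams r qs"
  let ?Phi = "\<lambda>(\<pi>, \<theta>). (act \<pi> x, map (\<lambda>k. act (\<theta> k) (xk k)) [0..<?n])"
  have fP: "finite ?P" unfolding wparams_def
    by (intro finite_cartesian_product finite_PiE) (auto simp: subgrp_finite[OF Symc_subgrp])
  have PhiS: "?Phi ` ?P \<subseteq> S"
    by (auto simp: wparams_def S_def O1_def O2_def LS_def orbR_def H_def PiE_def Pi_def)
  \<comment> \<open>The conditions on \<pi> and on the single values of \<theta> are independent, so
    the fibre is a product of cosets of stabilisers.\<close>
  have fibre: "card {p \<in> ?P. ?Phi p = (b, cs)} = s" if bc: "(b, cs) \<in> S" for b cs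
  proof -
    have lc: "length cs = ?n" and b: "b \<in> O1" and c: "\<And>k. k < ?n \<Longrightarrow> cs ! k \<in> O2 k" using bc by (auto simp: S_def LS_def)
    have "{p \<in> ?P. ?Phi p = (b, cs)} = {\<pi> \<in> Symc r. act \<pi> x = b} \<times> (\<Pi>\<^sub>E k\<in>{..<?n}. {\<sigma> \<in> H k. act \<sigma> (xk k) = cs ! k})"
    proof -
      have "map (\<lambda>k. act (\<theta> k) (xk k)) [0..<?n] = cs \<longleftrightarrow> (\<forall>k<?n. act (\<theta> k) (xk k) = cs ! k)" for \<theta>
        using lc by (auto simp: list_eq_iff_nth_eq)
      then show ?thesis by (auto simp: wparams_def H_def PiE_def Pi_def)
    qed
    then have "card {p \<in> ?P. ?Phi p = (b, cs)} = card {\<pi> \<in> Symc r. act \<pi> x = b} * (\<Prod>k<?n. card {\<sigma> \<in> H k. act \<sigma> (xk k) = cs ! k})"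
      by (simp add: card_cartesian_product card_PiE)
    also have "card {\<pi> \<in> Symc r. act \<pi> x = b} = card (stab act (Symc r) x)"
      by (rule card_orbit_fibre[OF Symc_subgrp x]) (use b O1_def in simp)
    also have "(\<Prod>k<?n. card {\<sigma> \<in> H k. act \<sigma> (xk k) = cs ! k}) = (\<Prod>k<?n. card (stab act (H k) (xk k)))"
    proof (rule prod.cong[OF refl])
      fix k assume "k \<in> {..<?n}"
      then have k: "k < ?n" by simp
      show "card {\<sigma> \<in> H k. act \<sigma> (xk k) = cs ! k} = card (stab act (H k) (xk k))"
        by (rule card_orbit_fibre[OF Hs xkB(1)[OF k]]) (use c[OF k] O2_def in simp)
    qed
    finally show ?thesis by (simp add: s_def)
  qed
  have aw: "act (wr ?m \<pi> \<theta>) X = (\<lambda>(b, cs). cmp b cs) (?Phi (\<pi>, \<theta>))" if "(\<pi>, \<theta>) \<in> ?P" for \<pi> \<theta>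
  proof -
    have p: "\<pi> \<in> Symc r" and t: "blockwise r qs \<theta>" using that by (auto simp: wparams_def blockwise_def)
    have "act (wr ?m \<pi> \<theta>) X = cmp (act \<pi> x) (map (\<lambda>k. act (\<theta> k) (map xk [0..<?n] ! inv \<pi> k)) [0..<?n])"
      unfolding X by (rule act_wr[OF p t x]) (use xkB in simp_all)
    \<comment> \<open>The operations \<open>xk\<close> depend only on the block of \<open>r\<close>,
      which \<pi> preserves; the permutation of the list is invisible.\<close>
    also have "map (\<lambda>k. act (\<theta> k) (map xk [0..<?n] ! inv \<pi> k)) [0..<?n] = map (\<lambda>k. act (\<theta> k) (xk k)) [0..<?n]"
      using Sym_less[OF Sym_inv[OF Symc_Sym[OF p]]] Symc_blk[OF Symc_inv[OF p]] by (intro map_cong) (auto simp: xk_def)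
    finally show ?thesis by simp
  qed
  \<comment> \<open>Blocks are nonempty because there are no operations of arity 0. This makes
    parameters and group elements correspond bijectively.\<close>
  have pos: "0 < ?m ! k" if "k < ?n" for k using xkB(2)[OF that] B0 by (metis empty_iff neq0_conv)
  have "s * L z = card {w \<in> ?W. act w X = z}" for z
  proof -
    let ?C = "\<lambda>(b, cs). cmp b cs"
    have "card {w \<in> ?W. act w X = z} = card {p \<in> ?P. ?C (?Phi p) = z}"
    proof -
      have "{w \<in> ?W. act w X = z} = (\<lambda>(\<pi>, \<theta>). wr ?m \<pi> \<theta>) ` {p \<in> ?P. ?C (?Phi p) = z}"
      proof (intro equalityI subsetI)
        fix w assume "w \<in> {w \<in> ?W. act w X = z}"
        then obtain \<pi> \<theta> where w: "(\<pi>, \<theta>) \<in> ?P" "w = wr ?m \<pi> \<theta>" "act w X = z"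
          unfolding wreath_eq_image by auto
        then have "(\<pi>, \<theta>) \<in> {p \<in> ?P. ?C (?Phi p) = z}" using aw[OF w(1)] by simp
        then show "w \<in> (\<lambda>(\<pi>, \<theta>). wr ?m \<pi> \<theta>) ` {p \<in> ?P. ?C (?Phi p) = z}"
          by (rule rev_image_eqI) (simp add: w(2))
      next
        fix w assume "w \<in> (\<lambda>(\<pi>, \<theta>). wr ?m \<pi> \<theta>) ` {p \<in> ?P. ?C (?Phi p) = z}"
        then obtain \<pi> \<theta> where w: "(\<pi>, \<theta>) \<in> ?P" "w = wr ?m \<pi> \<theta>" "?C (?Phi (\<pi>, \<theta>)) = z" by auto
        have "w \<in> ?W" unfolding wreath_eq_image by (rule rev_image_eqI[OF w(1)]) (simp add: w(2))
        then show "w \<in> {w \<in> ?W. act w X = z}" using aw[OF w(1)] w(2,3) by simp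
      qed
      moreover have "inj_on (\<lambda>(\<pi>, \<theta>). wr ?m \<pi> \<theta>) {p \<in> ?P. ?C (?Phi p) = z}"
        using wr_inj[of r qs, OF pos] by (rule inj_on_subset) auto
      ultimately show ?thesis by (simp add: card_image)
    qed
    also have "\<dots> = (\<Sum>p\<in>{p \<in> ?P. ?C (?Phi p) = z}. 1)" by simp
    \<comment> \<open>Regrouping by the pair: there are \<open>L z\<close> pairs, with
      \<open>s\<close> parameters over each.\<close>
    also have "\<dots> = (\<Sum>y\<in>{y \<in> S. ?C y = z}. \<Sum>p\<in>{p \<in> {p \<in> ?P. ?C (?Phi p) = z}. ?Phi p = y}. 1)"
      by (rule sum.group[symmetric]) (use fP fS PhiS in auto)
    also have "\<dots> = (\<Sum>y\<in>{y \<in> S. ?C y = z}. s)"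
    proof (rule sum.cong[OF refl])
      fix y assume "y \<in> {y \<in> S. ?C y = z}"
      then obtain b cs where y: "y = (b, cs)" "(b, cs) \<in> S" "cmp b cs = z" by (cases y) auto
      have "{p \<in> {p \<in> ?P. ?C (?Phi p) = z}. ?Phi p = y} = {p \<in> ?P. ?Phi p = (b, cs)}" using y by auto
      then show "(\<Sum>p\<in>{p \<in> {p \<in> ?P. ?C (?Phi p) = z}. ?Phi p = y}. 1) = s" using fibre[OF y(2)] by simp
    qed
    also have "\<dots> = s * L z" by (simp add: L_def)
    finally show ?thesis by simp
  qed
  then have "csum ?G ?W (\<lambda>\<tau>. lact B act ?M \<tau> (\<lambda>z. of_nat (L z) :: 'k))
    = (\<lambda>z. of_nat (card (stab act ?G X) div s) * ind (orbR act ?G X) z)"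
    by (intro csum_count[OF SF_subgrp wreath_subgrp wreath_subset[OF q] XB spos])
  moreover have "lcomp cmp (ind (orbR act (Symc r) x)) (map (\<lambda>k. ind (orbR act (Symc (qs ! blk r k)) (xs ! blk r k))) [0..<?n])
    = (\<lambda>z. of_nat (L z) :: 'k)"
    using lc by (auto simp: O1_def O2_def H_def xk_def)
  ultimately show "csum ?G ?W (\<lambda>\<tau>. lact B act ?M \<tau>
         (lcomp cmp (ind (orbR act (Symc r) x)) (map (\<lambda>k. ind (orbR act (Symc (qs ! blk r k)) (xs ! blk r k))) [0..<?n])))
     = (\<lambda>z. of_nat (card (stab act ?G X) div
          (card (stab act (Symc r) x) * (\<Prod>i<length r. card (stab act (Symc (qs ! i)) (xs ! i)) ^ (r ! i))))
        * (ind (orbR act ?G X) z :: 'k))"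
    by (simp add: seq)
qed

end

section \<open>Reducing the composition axiom to orbit sums\<close>

lemma lparts_cong: "(\<And>k. k < n \<Longrightarrow> f k = f' k) \<Longrightarrow> lparts n p f = lparts n p f'"
  by (auto simp: lparts_def)

lemma SF_cong:
  assumes "\<And>k. k < n \<Longrightarrow> f k = f' k"
  shows "SF n f = SF n f'"
  unfolding SF_def using assms Sym_less by (metis (lifting))

definition relabels :: "(nat \<Rightarrow> nat) \<Rightarrow> nat list \<Rightarrow> nat list \<Rightarrow> nat list list \<Rightarrow> nat list list \<Rightarrow> bool" where
  "relabels h r' r qs' qs \<longleftrightarrow> sum_list r' = sum_list r \<and> (\<forall>k<sum_list r. blk r k = h (blk r' k)) \<and>
     length qs' = length r' \<and> length qs = length r \<and> (\<forall>j<length r'. h j < length r \<and> qs' ! j = qs ! h j)"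

lemma relabels_mlist:
  assumes "relabels h r' r qs' qs"
  shows "mlist r' qs' = mlist r qs" "Mtot r' qs' = Mtot r qs"
    "\<And>k. k < sum_list r \<Longrightarrow> qs' ! blk r' k = qs ! blk r k"
proof -
  have s: "sum_list r' = sum_list r" using assms by (simp add: relabels_def)
  show q: "qs' ! blk r' k = qs ! blk r k" if "k < sum_list r" for k
    using assms that blk_props(1)[of k r'] s unfolding relabels_def by metis
  show "mlist r' qs' = mlist r qs"
    using q s by (intro nth_equalityI) (simp_all add: nth_mlist msz_def)
  then show "Mtot r' qs' = Mtot r qs" using sum_mlist by metis
qed

text \<open>The map induced by \<open>h\<close> on flattened labels: the slot changes according to
  \<open>h\<close>, the part inside the slot stays.\<close>

definition lab_map :: "(nat \<Rightarrow> nat) \<Rightarrow> nat list list \<Rightarrow> nat list list \<Rightarrow> nat \<Rightarrow> nat" where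
  "lab_map h qs' qs c = off (map length qs) (h (blk (map length qs') c)) + (c - off (map length qs') (blk (map length qs') c))"

lemma relabels_dlab:
  fixes h qs' qs
  assumes R: "relabels h r' r qs' qs"
  defines "g \<equiv> lab_map h qs' qs"
  shows "\<And>k. k < Mtot r qs \<Longrightarrow> dlab r qs k = g (dlab r' qs' k)"
    "\<And>j t. j < length r' \<Longrightarrow> t < length (qs' ! j) \<Longrightarrow> g (off (map length qs') j + t) = off (map length qs) (h j) + t"
    "\<And>c. c < sum_list (map length qs') \<Longrightarrow> g c < sum_list (map length qs)"
    "inj_on h {..<length r'} \<Longrightarrow> inj_on g {..<sum_list (map length qs')}"
proof -
  have l: "length qs' = length r'" "length qs = length r" "sum_list r' = sum_list r"
    and h: "\<And>j. j < length r' \<Longrightarrow> h j < length r \<and> qs' ! j = qs ! h j"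
    and b: "\<And>k. k < sum_list r \<Longrightarrow> blk r k = h (blk r' k)"
    using R by (simp_all add: relabels_def)
  show go: "g (off (map length qs') j + t) = off (map length qs) (h j) + t"
    if "j < length r'" "t < length (qs' ! j)" for j t
    using that l blk_off[of j "map length qs'" t] by (simp add: g_def lab_map_def)
  show "dlab r qs k = g (dlab r' qs' k)" if "k < Mtot r qs" for k
    using that
  proof (rule mpos_cases)
    fix j t assume a: "j < sum_list r" "t < mlist r qs ! j" "k = off (mlist r qs) j + t" "t < sum_list (qs ! blk r j)"
    have j': "j < sum_list r'" using a(1) l by simp
    have t': "t < mlist r' qs' ! j" using a(2) relabels_mlist(1)[OF R] by simp
    have q: "qs' ! blk r' j = qs ! blk r j" by (rule relabels_mlist(3)[OF R a(1)])
    have k': "k = off (mlist r' qs') j + t" using a(3) relabels_mlist(1)[OF R] by simp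
    have "dlab r' qs' k = off (map length qs') (blk r' j) + blk (qs' ! blk r' j) t"
      unfolding k' by (rule dlab_off[OF j' t'])
    moreover have "blk (qs' ! blk r' j) t < length (qs' ! blk r' j)" using blk_props(1)[of t "qs ! blk r j"] a(4) q by simp
    ultimately have "g (dlab r' qs' k) = off (map length qs) (h (blk r' j)) + blk (qs' ! blk r' j) t"
      using go[OF blk_props(1)[OF j']] by simp
    then show ?thesis unfolding a(3) dlab_off[OF a(1,2)] using q b[OF a(1)] by simp
  qed
  show "g c < sum_list (map length qs)" if "c < sum_list (map length qs')" for c
    using that
  proof (rule pos_cases)
    fix i t assume a: "i < length (map length qs')" "t < map length qs' ! i" "c = off (map length qs') i + t"
    show ?thesis unfolding a(3) using go[of i t] a h[of i] l by (simp add: off_less)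
  qed
  show "inj_on g {..<sum_list (map length qs')}" if inj: "inj_on h {..<length r'}"
  proof (rule inj_onI)
    fix c d assume cd: "c \<in> {..<sum_list (map length qs')}" "d \<in> {..<sum_list (map length qs')}" "g c = g d"
    from cd(1) obtain i t where a: "i < length (map length qs')" "t < map length qs' ! i" "c = off (map length qs') i + t"
      by (auto elim: pos_cases)
    from cd(2) obtain j s where e: "j < length (map length qs')" "s < map length qs' ! j" "d = off (map length qs') j + s"
      by (auto elim: pos_cases)
    have ij: "i < length r'" "j < length r'" using a e l by simp_all
    have "off (map length qs) (h i) + t = off (map length qs) (h j) + s"
      using cd(3) go[of i t] go[of j s] a e ij by simp
    moreover have "h i < length (map length qs)" "h j < length (map length qs)"
      "t < map length qs ! h i" "s < map length qs ! h j" using a e ij h[of i] h[of j] l by simp_all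
    ultimately have "h i = h j \<and> t = s" using off_pair_eq by blast
    then have "i = j" "t = s" using inj ij by (auto dest: inj_onD)
    then show "c = d" using a e by simp
  qed
qed

lemma relabels_wreath_subset:
  assumes R: "relabels h r' r qs' qs"
  shows "wreath r' qs' \<subseteq> wreath r qs"
proof
  have s: "sum_list r' = sum_list r" using R by (simp add: relabels_def)
  have sub: "Symc r' \<subseteq> Symc r"
    unfolding Symc_eq s by (rule SF_mono[where h = h]) (use R in \<open>simp add: relabels_def\<close>)
  fix w assume "w \<in> wreath r' qs'"
  then obtain \<pi> \<theta> where a: "\<pi> \<in> Symc r'" "blockwise r' qs' \<theta>" "w = wr (mlist r' qs') \<pi> \<theta>" by (rule wreath_cases)
  have "blockwise r qs \<theta>" using a(2) relabels_mlist(3)[OF R] s by (simp add: blockwise_def)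
  moreover have "\<pi> \<in> Symc r" using a(1) sub by auto
  ultimately show "w \<in> wreath r qs" unfolding a(3) relabels_mlist(1)[OF R] by (intro wreath_memI)
qed

text \<open>An injective \<open>h\<close> separates the same inputs on both sides, so the outer
  permutations are the same, and so are the inner groups, input by input.\<close>

lemma relabels_wreath_eq:
  assumes R: "relabels h r' r qs' qs" and inj: "inj_on h {..<length r'}"
  shows "wreath r' qs' = wreath r qs"
proof -
  have s: "sum_list r' = sum_list r" using R by (simp add: relabels_def)
  have "SF (sum_list r) (blk r) = SF (sum_list r) (\<lambda>k. h (blk r' k))"
    by (rule SF_cong) (use R in \<open>simp add: relabels_def\<close>)
  also have "\<dots> = SF (sum_list r) (blk r')"
    by (rule SF_inj[where S = "{..<length r'}"]) (use inj s in \<open>auto simp: blk_props\<close>)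
  finally have "Symc r' = Symc r" by (simp add: Symc_eq s)
  moreover have "(\<Pi>\<^sub>E k\<in>{..<sum_list r}. Symc (qs' ! blk r' k)) = (\<Pi>\<^sub>E k\<in>{..<sum_list r}. Symc (qs ! blk r k))"
    by (rule PiE_cong) (simp add: relabels_mlist(3)[OF R])
  ultimately show ?thesis unfolding wreath_eq_image wparams_def relabels_mlist(1)[OF R] s by simp
qed

lemma nth_skip: "length as = n \<Longrightarrow> (as @ a # as') ! (if j < n then j else Suc j) = (as @ as') ! j"
  by (auto simp: nth_append)

lemma map3_zip:
  assumes "length xs = n" "length ys = n" "length zs = n"
  shows "map (\<lambda>i. F (xs ! i) (ys ! i) (zs ! i)) [0..<n] = map (\<lambda>(x, y, z). F x y z) (zip xs (zip ys zs))"
  using assms by (intro nth_equalityI) auto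

text \<open>Splitting a block amounts to marking its first \<open>l\<close> places, so the smaller
  group is the set stabiliser of \<open>I\<close> in the larger one.\<close>

lemma Symc_split_iff:
  fixes r1 r2 :: "nat list"
  assumes l: "l \<le> c"
  defines "I \<equiv> {sum_list r1..<sum_list r1 + l}"
  shows "\<sigma> \<in> Symc (r1 @ l # (c - l) # r2) \<longleftrightarrow> \<sigma> \<in> Symc (r1 @ c # r2) \<and> \<sigma> ` I = I"
proof -
  let ?r = "r1 @ c # r2" and ?r' = "r1 @ l # (c - l) # r2" and ?i = "length r1"
  have c: "l + (c - l) = c" using l by simp
  have n: "sum_list ?r' = sum_list ?r" using l by simp
  have b: "blk ?r k = (if blk ?r' k \<le> ?i then blk ?r' k else blk ?r' k - 1)" if "k < sum_list ?r" for k
    using blk_split[of k r1 l "c - l" r2] that unfolding c by simp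
  have bI: "blk ?r' k = ?i \<longleftrightarrow> k \<in> I" if "k < sum_list ?r" for k
    using that l blk_props(1)[of k r1] by (auto simp: blk_append blk_Cons I_def split: if_splits)
  have b': "blk ?r' k = (if blk ?r k < ?i then blk ?r k else if blk ?r k = ?i then (if k \<in> I then ?i else Suc ?i) else Suc (blk ?r k))"
    if "k < sum_list ?r" for k
    using b[OF that] bI[OF that] by (auto split: if_splits)
  have In: "k < sum_list ?r" if "k \<in> I" for k using that l by (auto simp: I_def)
  show ?thesis
  proof
    assume s: "\<sigma> \<in> Symc ?r'"
    have S: "\<sigma> \<in> Sym (sum_list ?r)" using Symc_Sym[OF s] n by simp
    have p: "blk ?r' (\<sigma> k) = blk ?r' k" if "k < sum_list ?r" for k using Symc_blk[OF s] that n by simp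
    have "\<sigma> \<in> Symc ?r" using S b p Sym_less[OF S] by (simp add: Symc_eq SF_def del: sum_list_append)
    moreover have "\<sigma> ` I \<subseteq> I"
      using p bI In Sym_less[OF S] by (metis image_subsetI)
    then have "\<sigma> ` I = I"
      using Sym_bij[OF S] by (intro endo_inj_surj) (auto simp: I_def bij_def intro: inj_on_subset)
    ultimately show "\<sigma> \<in> Symc ?r \<and> \<sigma> ` I = I" by blast
  next
    assume s: "\<sigma> \<in> Symc ?r \<and> \<sigma> ` I = I"
    have S: "\<sigma> \<in> Sym (sum_list ?r)" using s Symc_Sym by blast
    have "\<sigma> k \<in> I \<longleftrightarrow> k \<in> I" for k
      using s Sym_bij[OF S] by (metis bij_is_inj inj_image_mem_iff)
    moreover have "blk ?r (\<sigma> k) = blk ?r k" if "k < sum_list ?r" for k using s Symc_blk that by blast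
    ultimately have "blk ?r' (\<sigma> k) = blk ?r' k" if "k < sum_list ?r" for k
      unfolding b'[OF that] b'[OF Sym_less[OF S, THEN iffD2, OF that]] using that by simp
    then show "\<sigma> \<in> Symc ?r'" using S unfolding Symc_eq SF_def n by simp
  qed
qed

text \<open>Transitivity on subsets of size \<open>l\<close> of a block. The labelling that marks
  the subset and records the block elsewhere has fibre sizes that depend only on \<open>l\<close>,
  so \<open>label_perm_exists\<close> applies.\<close>

lemma Symc_move:
  assumes l: "l \<le> c" and S: "S \<subseteq> {sum_list r1..<sum_list r1 + c}" "card S = l"
  shows "\<exists>\<pi>\<in>Symc (r1 @ c # r2). \<pi> ` {sum_list r1..<sum_list r1 + l} = S"
proof -
  let ?r = "r1 @ c # r2" and ?i = "length r1" and ?n = "sum_list (r1 @ c # r2)"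
  define J where "J = {sum_list r1..<sum_list r1 + c}"
  \<comment> \<open>Label 0 is reserved for the marked set; hence the shift of the block
    indices.\<close>
  define f where "f A k = (if k \<in> A then 0 else Suc (blk ?r k))" for A k
  define I where "I = {sum_list r1..<sum_list r1 + l}"
  have IJ: "I \<subseteq> J" using l by (auto simp: I_def J_def)
  have SJ: "S \<subseteq> J" using S by (simp add: J_def)
  have Jb: "blk ?r k = ?i \<longleftrightarrow> k \<in> J" if "k < ?n" for k
    using that blk_props(1)[of k r1] by (auto simp: J_def blk_append blk_Cons split: if_splits)
  have Jn: "k < ?n" if "k \<in> J" for k using that by (auto simp: J_def)
  have cnt: "card {k. k < ?n \<and> f A k = j}
      = (if j = 0 then l else if j = Suc ?i then c - l else card {k. k < ?n \<and> blk ?r k = j - 1})"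
    if A: "A \<subseteq> J" "card A = l" for A j
  proof -
    consider "j = 0" | "j = Suc ?i" | "j \<noteq> 0" "j \<noteq> Suc ?i" by blast
    then show ?thesis
    proof cases
      case 1
      have "{k. k < ?n \<and> f A k = 0} = A" using A Jn by (auto simp: f_def)
      then show ?thesis using A 1 by simp
    next
      case 2
      have "{k. k < ?n \<and> f A k = Suc ?i} = J - A" using Jb Jn by (auto simp: f_def)
      moreover have "card (J - A) = c - l" using A by (subst card_Diff_subset) (auto simp: J_def intro: finite_subset)
      ultimately show ?thesis using 2 by simp
    next
      case 3
      have "f A k = j \<longleftrightarrow> blk ?r k = j - 1" if "k < ?n" for k
        using Jb[OF that] A(1) 3 by (cases "k \<in> A") (auto simp: f_def)
      then have "{k. k < ?n \<and> f A k = j} = {k. k < ?n \<and> blk ?r k = j - 1}" by blast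
      then show ?thesis using 3 by simp
    qed
  qed
  have cI: "card I = l" by (simp add: I_def)
  have "\<exists>\<pi>\<in>Sym ?n. \<forall>k<?n. f S (\<pi> k) = f I k"
  proof (rule label_perm_exists[where p = "Suc (length ?r)"])
    show "f I k < Suc (length ?r)" if "k < ?n" for k using blk_props(1)[OF that] by (simp add: f_def)
    show "card {k. k < ?n \<and> f I k = j} = card {k. k < ?n \<and> f S k = j}" for j
      unfolding cnt[OF IJ cI] cnt[OF SJ S(2)] by (rule refl)
  qed
  then obtain \<pi> where p: "\<pi> \<in> Sym ?n" "\<And>k. k < ?n \<Longrightarrow> f S (\<pi> k) = f I k" by blast
  have mem: "\<pi> k \<in> S \<longleftrightarrow> k \<in> I" if "k < ?n" for k using p(2)[OF that] by (auto simp: f_def split: if_splits)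
  have "blk ?r (\<pi> k) = blk ?r k" if k: "k < ?n" for k
  proof (cases "k \<in> I")
    case True
    then have "\<pi> k \<in> S" using mem k by simp
    then have "blk ?r (\<pi> k) = ?i" "blk ?r k = ?i" using True SJ IJ Jb Jn by blast+
    then show ?thesis by simp
  next
    case False
    then show ?thesis using p(2)[OF k] mem[OF k] by (simp add: f_def)
  qed
  then have "\<pi> \<in> Symc ?r" using p(1) by (simp add: Symc_eq SF_def)
  moreover have "\<pi> ` I = S"
  proof (intro equalityI subsetI)
    fix k assume "k \<in> S"
    then have "k < ?n" using SJ Jn by blast
    then have "inv \<pi> k < ?n" "\<pi> (inv \<pi> k) = k" using p(1) Sym_less[OF Sym_inv[OF p(1)]] by simp_all
    then show "k \<in> \<pi> ` I" using mem[of "inv \<pi> k"] \<open>k \<in> S\<close> by (metis image_eqI)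
  qed (use mem IJ Jn in blast)
  ultimately show ?thesis unfolding I_def by blast
qed

text \<open>The composition axioms are not assumed here, so that the locale also serves the family
  built from \<gamma>, for which they remain to be proved.\<close>

locale beta_law = set_op B act u cmp + vector_space sc
  for B :: "nat \<Rightarrow> 'o set" and act u cmp and sc :: "'k::field \<Rightarrow> 'a::ab_group_add \<Rightarrow> 'a" +
  fixes beta :: "('o \<Rightarrow> 'k) \<Rightarrow> nat list \<Rightarrow> 'a list \<Rightarrow> 'a"
  assumes b: "beta_obj B act sc beta"
begin

lemma beta_zero: "length as = length r \<Longrightarrow> beta (\<lambda>z. 0) r as = 0"
  using beta_objD(7)[OF b, of "\<lambda>z. 0" r as 0] by (simp add: Pinv_eq_Pfix Pfix_zero)

lemma beta_sum:
  assumes "finite I" "\<And>i. i \<in> I \<Longrightarrow> x i \<in> Pinv B act r" "length as = length r"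
  shows "beta (\<lambda>z. \<Sum>i\<in>I. x i z) r as = (\<Sum>i\<in>I. beta (x i) r as)"
  using assms
proof (induction I rule: finite_induct)
  case empty
  then show ?case by (simp add: beta_zero)
next
  case (insert i I)
  have "(\<lambda>z. \<Sum>i\<in>I. x i z) \<in> Pinv B act r" unfolding Pinv_eq_Pfix
    by (rule Pfix_sum) (use insert.prems in \<open>simp add: Pinv_eq_Pfix\<close>)
  then show ?case using insert beta_objD(6)[OF b] by simp
qed

lemma betaR_dom:
  assumes f: "\<And>k. k < n \<Longrightarrow> f k < p" and x: "x \<in> Pfix B act n (SF n f)"
  shows "lact B act n (straighten n (lparts n p f)) x \<in> Pinv B act (cnt n p f)"
    "sum_list (cnt n p f) = n"
proof -
  have s: "straightens n p f (straighten n (lparts n p f))" by (rule straightens_straighten[OF f])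
  then have S: "straighten n (lparts n p f) \<in> Sym n" by (simp add: straightens_def)
  show n: "sum_list (cnt n p f) = n" by (rule sum_cnt[OF f])
  have "conj_by (straighten n (lparts n p f)) (SF n f) = Symc (cnt n p f)"
    using SF_conj[OF S, of "blk (cnt n p f)" f] s n by (simp add: straightens_def Symc_eq)
  then show "lact B act n (straighten n (lparts n p f)) x \<in> Pinv B act (cnt n p f)"
    using Pfix_conj[OF S SF_subgrp x] n by (simp add: Pinv_eq_Pfix)
qed

lemma betaR_zero: "length as = p \<Longrightarrow> betaR n beta B act (\<lambda>z. 0) (lparts n p f) as = 0"
  by (simp add: betaR_def lact_zero beta_zero lparts_def)

lemma betaR_scale:
  assumes f: "\<And>k. k < n \<Longrightarrow> f k < p" and x: "x \<in> Pfix B act n (SF n f)" and l: "length as = p"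
  shows "betaR n beta B act (\<lambda>z. c * x z) (lparts n p f) as = sc c (betaR n beta B act x (lparts n p f) as)"
  using beta_objD(7)[OF b betaR_dom(1)[OF f x], of as c] l by (simp add: betaR_def lact_scale cnt_def[symmetric])

lemma betaR_add:
  assumes f: "\<And>k. k < n \<Longrightarrow> f k < p" and x: "x \<in> Pfix B act n (SF n f)" "y \<in> Pfix B act n (SF n f)" and l: "length as = p"
  shows "betaR n beta B act (\<lambda>z. x z + y z) (lparts n p f) as
    = betaR n beta B act x (lparts n p f) as + betaR n beta B act y (lparts n p f) as"
  using beta_objD(6)[OF b betaR_dom(1)[OF f x(1)] betaR_dom(1)[OF f x(2)], of as] l
  by (simp add: betaR_def lact_add cnt_def[symmetric])

lemma betaR_sum:
  assumes f: "\<And>k. k < n \<Longrightarrow> f k < p" and x: "\<And>i. i \<in> I \<Longrightarrow> x i \<in> Pfix B act n (SF n f)" and l: "length as = p" and I: "finite I"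
  shows "betaR n beta B act (\<lambda>z. \<Sum>i\<in>I. x i z) (lparts n p f) as = (\<Sum>i\<in>I. betaR n beta B act (x i) (lparts n p f) as)"
  using beta_sum[OF I, of "\<lambda>i. lact B act n (straighten n (lparts n p f)) (x i)" "cnt n p f" as] betaR_dom(1)[OF f x] l
  by (simp add: betaR_def lact_sum cnt_def[symmetric])

definition comp_data :: "('o \<Rightarrow> 'k) \<Rightarrow> nat list \<Rightarrow> ('o \<Rightarrow> 'k) list \<Rightarrow> nat list list \<Rightarrow> 'a list list \<Rightarrow> bool" where
  "comp_data x r xs qs bs \<longleftrightarrow> x \<in> Pinv B act r \<and> length xs = length r \<and> length qs = length r \<and> length bs = length r \<and>
     (\<forall>i<length r. xs ! i \<in> Pinv B act (qs ! i) \<and> length (bs ! i) = length (qs ! i))"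

definition comp_lhs :: "('o \<Rightarrow> 'k) \<Rightarrow> nat list \<Rightarrow> ('o \<Rightarrow> 'k) list \<Rightarrow> nat list list \<Rightarrow> 'a list list \<Rightarrow> 'a" where
  "comp_lhs x r xs qs bs = beta x r (map (\<lambda>i. beta (xs ! i) (qs ! i) (bs ! i)) [0..<length r])"

definition comp_elt :: "('o \<Rightarrow> 'k) \<Rightarrow> nat list \<Rightarrow> ('o \<Rightarrow> 'k) list \<Rightarrow> 'o \<Rightarrow> 'k" where
  "comp_elt x r xs = lcomp cmp x (map (\<lambda>k. xs ! blk r k) [0..<sum_list r])"

text \<open>The right-hand side of \<beta>7b with the partition written as a labelling;
  \<open>beta'_obj_iff\<close> translates back.\<close>

definition comp_rhs :: "('o \<Rightarrow> 'k) \<Rightarrow> nat list \<Rightarrow> ('o \<Rightarrow> 'k) list \<Rightarrow> nat list list \<Rightarrow> 'a list list \<Rightarrow> 'a" where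
  "comp_rhs x r xs qs bs = betaR (Mtot r qs) beta B act
     (csum (SF (Mtot r qs) (dlab r qs)) (wreath r qs) (\<lambda>\<tau>. lact B act (Mtot r qs) \<tau> (comp_elt x r xs)))
     (lparts (Mtot r qs) (sum_list (map length qs)) (dlab r qs)) (concat bs)"

lemma comp_dataD:
  assumes "comp_data x r xs qs bs"
  shows "x \<in> Pinv B act r" "length xs = length r" "length qs = length r" "length bs = length r"
    "\<And>i. i < length r \<Longrightarrow> xs ! i \<in> Pinv B act (qs ! i)" "\<And>i. i < length r \<Longrightarrow> length (bs ! i) = length (qs ! i)"
    "map length bs = map length qs" "length (concat bs) = sum_list (map length qs)"
proof -
  show 1: "x \<in> Pinv B act r" "length xs = length r" "length qs = length r" "length bs = length r"
    "\<And>i. i < length r \<Longrightarrow> xs ! i \<in> Pinv B act (qs ! i)" "\<And>i. i < length r \<Longrightarrow> length (bs ! i) = length (qs ! i)"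
    using assms by (simp_all add: comp_data_def)
  show "map length bs = map length qs" using 1 by (intro nth_equalityI) simp_all
  then show "length (concat bs) = sum_list (map length qs)" by (simp add: length_concat)
qed

lemma comp_elt_Pfix: "comp_data x r xs qs bs \<Longrightarrow> comp_elt x r xs \<in> Pfix B act (Mtot r qs) (wreath r qs)"
  unfolding comp_elt_def by (rule lcomp_Pfix_wreath[OF comp_dataD(1,5)])

text \<open>Merging repeated arguments brings a coset sum over the group of the coarser partition,
  and \<open>csum_trans\<close> fuses it with the one already present. Only the smaller wreath
  product remembers the refinement.\<close>

lemma comp_rhs_relabel:
  assumes D': "comp_data x' r' xs' qs' bs'" and D: "comp_data x r xs qs bs" and R: "relabels h r' r qs' qs"
    and bs: "\<And>j. j < length r' \<Longrightarrow> bs' ! j = bs ! h j"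
  shows "comp_rhs x' r' xs' qs' bs' = betaR (Mtot r qs) beta B act
     (csum (SF (Mtot r qs) (dlab r qs)) (wreath r' qs') (\<lambda>\<tau>. lact B act (Mtot r qs) \<tau> (comp_elt x' r' xs')))
     (lparts (Mtot r qs) (sum_list (map length qs)) (dlab r qs)) (concat bs)"
proof -
  let ?M = "Mtot r qs" and ?z = "comp_elt x' r' xs'" and ?L = "map length qs" and ?L' = "map length qs'"
  define g where "g = lab_map h qs' qs"
  note g = relabels_dlab[OF R, folded g_def]
  have M: "Mtot r' qs' = ?M" by (rule relabels_mlist(2)[OF R])
  have q': "length qs' = length r'" by (rule comp_dataD(3)[OF D'])
  have h: "h j < length r" if "j < length r'" for j using R that by (simp add: relabels_def)
  define Y where "Y = csum (SF ?M (dlab r' qs')) (wreath r' qs') (\<lambda>\<tau>. lact B act ?M \<tau> ?z)"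
  have W: "subgrp ?M (wreath r' qs')" "wreath r' qs' \<subseteq> SF ?M (dlab r' qs')"
    using wreath_subgrp[of r' qs'] wreath_subset[OF q'] M by simp_all
  have z: "?z \<in> Pfix B act ?M (wreath r' qs')" using comp_elt_Pfix[OF D'] M by simp
  have Y: "Y \<in> Pfix B act ?M (SF ?M (dlab r' qs'))" unfolding Y_def by (rule csum_Pfix[OF SF_subgrp W z])
  have dl: "dlab r' qs' k < sum_list ?L'" if "k < ?M" for k using dlab_less[OF q'] that M by simp
  have sf: "SF ?M (\<lambda>k. g (dlab r' qs' k)) = SF ?M (dlab r qs)" by (rule SF_cong) (simp add: g(1))
  have lp: "lparts ?M (sum_list ?L) (\<lambda>k. g (dlab r' qs' k)) = lparts ?M (sum_list ?L) (dlab r qs)"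
    by (rule lparts_cong) (simp add: g(1))
  have c': "concat bs' = map (\<lambda>c. concat bs ! g c) [0..<sum_list ?L']"
  proof (rule nth_equalityI)
    fix c assume "c < length (concat bs')"
    then have c: "c < sum_list ?L'" using comp_dataD(8)[OF D'] by simp
    then obtain i t where a: "i < length ?L'" "t < ?L' ! i" "c = off ?L' i + t" by (rule pos_cases)
    have i: "i < length r'" using a q' by simp
    have t: "t < length (bs' ! i)" "t < length (qs' ! i)" using a i comp_dataD(6)[OF D' i] q' by simp_all
    have "concat bs' ! c = bs' ! i ! t"
      using nth_concat_off[of i bs' t] a(3) comp_dataD(4,7)[OF D'] i t by simp
    moreover have "concat bs ! g c = bs ! h i ! t"
      using nth_concat_off[of "h i" bs t] g(2)[OF i t(2)] a(3) comp_dataD(4,7)[OF D] h[OF i] t bs[OF i] by simp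
    ultimately show "concat bs' ! c = map (\<lambda>c. concat bs ! g c) [0..<sum_list ?L'] ! c" using c bs[OF i] by simp
  qed (use comp_dataD(8)[OF D'] in simp)
  have c: "concat bs = map ((!) (concat bs)) [0..<sum_list ?L]"
    using comp_dataD(8)[OF D] by (metis map_nth)
  have "comp_rhs x' r' xs' qs' bs' = betaR ?M beta B act Y (lparts ?M (sum_list ?L') (dlab r' qs')) (concat bs')"
    by (simp add: comp_rhs_def M Y_def)
  also have "\<dots> = betaR ?M beta B act (csum (SF ?M (\<lambda>k. g (dlab r' qs' k))) (SF ?M (dlab r' qs')) (\<lambda>\<sigma>. lact B act ?M \<sigma> Y))
        (lparts ?M (sum_list ?L) (\<lambda>k. g (dlab r' qs' k))) (map ((!) (concat bs)) [0..<sum_list ?L])"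
    unfolding c' by (rule betaR_relabel[OF b dl g(3) Y])
  also have "csum (SF ?M (\<lambda>k. g (dlab r' qs' k))) (SF ?M (dlab r' qs')) (\<lambda>\<sigma>. lact B act ?M \<sigma> Y)
     = csum (SF ?M (dlab r qs)) (wreath r' qs') (\<lambda>\<tau>. lact B act ?M \<tau> ?z)"
    unfolding sf Y_def by (rule csum_trans[OF SF_subgrp SF_subgrp _ W z]) (rule SF_mono[where h = g], rule g(1))
  finally show ?thesis unfolding lp c[symmetric] .
qed

lemma comp_lhs_split:
  assumes "length xs1 = length r1" "length qs1 = length r1" "length bs1 = length r1"
    "length xs2 = length r2" "length qs2 = length r2" "length bs2 = length r2"
  shows "comp_lhs x (r1 @ c # r2) (xs1 @ v # xs2) (qs1 @ q # qs2) (bs1 @ d # bs2)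
      = beta x (r1 @ c # r2) (map (\<lambda>(x, y, z). beta x y z) (zip xs1 (zip qs1 bs1)) @ beta v q d # map (\<lambda>(x, y, z). beta x y z) (zip xs2 (zip qs2 bs2)))"
    "comp_lhs x (r1 @ r2) (xs1 @ xs2) (qs1 @ qs2) (bs1 @ bs2)
      = beta x (r1 @ r2) (map (\<lambda>(x, y, z). beta x y z) (zip xs1 (zip qs1 bs1)) @ map (\<lambda>(x, y, z). beta x y z) (zip xs2 (zip qs2 bs2)))"
proof -
  show "comp_lhs x (r1 @ c # r2) (xs1 @ v # xs2) (qs1 @ q # qs2) (bs1 @ d # bs2)
      = beta x (r1 @ c # r2) (map (\<lambda>(x, y, z). beta x y z) (zip xs1 (zip qs1 bs1)) @ beta v q d # map (\<lambda>(x, y, z). beta x y z) (zip xs2 (zip qs2 bs2)))"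
    unfolding comp_lhs_def by (subst map3_zip[where F = beta]) (use assms in simp_all)
  show "comp_lhs x (r1 @ r2) (xs1 @ xs2) (qs1 @ qs2) (bs1 @ bs2)
      = beta x (r1 @ r2) (map (\<lambda>(x, y, z). beta x y z) (zip xs1 (zip qs1 bs1)) @ map (\<lambda>(x, y, z). beta x y z) (zip xs2 (zip qs2 bs2)))"
    unfolding comp_lhs_def by (subst map3_zip[where F = beta]) (use assms in simp_all)
qed

text \<open>A slot of multiplicity 0 supplies no input to the outer operation: the composite element
  is the same, and the wreath product too, because the relabelling is injective.\<close>

lemma comp_drop:
  assumes D: "comp_data x (r1 @ 0 # r2) (xs1 @ v # xs2) (qs1 @ q # qs2) (bs1 @ d # bs2)"
    and l: "length xs1 = length r1" "length qs1 = length r1" "length bs1 = length r1"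
  shows "comp_data x (r1 @ r2) (xs1 @ xs2) (qs1 @ qs2) (bs1 @ bs2)"
    "comp_lhs x (r1 @ 0 # r2) (xs1 @ v # xs2) (qs1 @ q # qs2) (bs1 @ d # bs2)
     = comp_lhs x (r1 @ r2) (xs1 @ xs2) (qs1 @ qs2) (bs1 @ bs2)"
    "comp_rhs x (r1 @ 0 # r2) (xs1 @ v # xs2) (qs1 @ q # qs2) (bs1 @ d # bs2)
     = comp_rhs x (r1 @ r2) (xs1 @ xs2) (qs1 @ qs2) (bs1 @ bs2)"
proof -
  let ?r = "r1 @ 0 # r2" and ?r' = "r1 @ r2" and ?qs = "qs1 @ q # qs2" and ?qs' = "qs1 @ qs2"
  let ?h = "\<lambda>j. if j < length r1 then j else Suc j"
  have l2: "length xs2 = length r2" "length qs2 = length r2" "length bs2 = length r2"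
    using comp_dataD(2-4)[OF D] l by simp_all
  have bl: "blk ?r k = ?h (blk ?r' k)" if "k < sum_list ?r'" for k
    using that blk_props(1)[of k r1] by (auto simp: blk_append blk_Cons)
  have R: "relabels ?h ?r' ?r ?qs' ?qs"
    unfolding relabels_def using bl l l2 by (simp add: nth_append)
  have inj: "inj_on ?h {..<length ?r'}" by (auto simp: inj_on_def split: if_splits)
  have "SF (sum_list ?r') (blk ?r) = SF (sum_list ?r') (blk ?r')"
    using SF_cong[of "sum_list ?r'" "blk ?r" "\<lambda>k. ?h (blk ?r' k)"] SF_inj[of "sum_list ?r'" "blk ?r'" "{..<length ?r'}" ?h] bl inj
      blk_props(1)[of _ ?r'] by simp
  then have P: "Pinv B act ?r = (Pinv B act ?r' :: ('o \<Rightarrow> 'k) set)" by (simp add: Pinv_eq_Pfix Symc_eq)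
  have "(xs1 @ xs2) ! j \<in> Pinv B act ((qs1 @ qs2) ! j) \<and> length ((bs1 @ bs2) ! j) = length ((qs1 @ qs2) ! j)"
    if "j < length ?r'" for j
  proof -
    have "?h j < length ?r" using that by simp
    from comp_dataD(5,6)[OF D this] show ?thesis unfolding nth_skip[OF l(1)] nth_skip[OF l(2)] nth_skip[OF l(3)] by simp
  qed
  then show D': "comp_data x (r1 @ r2) (xs1 @ xs2) (qs1 @ qs2) (bs1 @ bs2)"
    using comp_dataD(1)[OF D] P l l2 by (simp add: comp_data_def)
  show "comp_lhs x ?r (xs1 @ v # xs2) ?qs (bs1 @ d # bs2) = comp_lhs x ?r' (xs1 @ xs2) ?qs' (bs1 @ bs2)"
    unfolding comp_lhs_split[OF l l2] using comp_dataD(1)[OF D'] l l2 by (intro beta_drop_zero[OF b]) simp_all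
  have z: "comp_elt x ?r (xs1 @ v # xs2) = comp_elt x ?r' (xs1 @ xs2)"
  proof -
    have "map (\<lambda>k. (xs1 @ v # xs2) ! blk ?r k) [0..<sum_list ?r] = map (\<lambda>k. (xs1 @ xs2) ! blk ?r' k) [0..<sum_list ?r']"
    proof (rule map_cong)
      fix k assume "k \<in> set [0..<sum_list ?r']"
      then have k: "k < sum_list ?r'" by simp
      show "(xs1 @ v # xs2) ! blk ?r k = (xs1 @ xs2) ! blk ?r' k" unfolding bl[OF k] by (rule nth_skip[OF l(1)])
    qed simp
    then show ?thesis unfolding comp_elt_def by (simp only:)
  qed
  show "comp_rhs x ?r (xs1 @ v # xs2) ?qs (bs1 @ d # bs2) = comp_rhs x ?r' (xs1 @ xs2) ?qs' (bs1 @ bs2)"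
    unfolding comp_rhs_relabel[OF D' D R nth_skip[OF l(3), symmetric]] relabels_wreath_eq[OF R inj] z[symmetric]
    by (simp only: comp_rhs_def)
qed

text \<open>On the left \<beta>3 with scalar 0 gives the factor 0 to the power \<open>c\<close>; on
  the right some input of the outer operation is 0. Both need \<open>c > 0\<close>.\<close>

lemma comp_zero_slot:
  assumes D: "comp_data x (r1 @ c # r2) (xs1 @ (\<lambda>z. 0) # xs2) (qs1 @ q # qs2) (bs1 @ d # bs2)"
    and l: "length xs1 = length r1" "length qs1 = length r1" "length bs1 = length r1" and c: "c > 0"
  shows "comp_lhs x (r1 @ c # r2) (xs1 @ (\<lambda>z. 0) # xs2) (qs1 @ q # qs2) (bs1 @ d # bs2) = 0"
    "comp_rhs x (r1 @ c # r2) (xs1 @ (\<lambda>z. 0) # xs2) (qs1 @ q # qs2) (bs1 @ d # bs2) = 0"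
proof -
  let ?r = "r1 @ c # r2" and ?xs = "xs1 @ (\<lambda>z. 0) # xs2" and ?qs = "qs1 @ q # qs2"
  have l2: "length xs2 = length r2" "length qs2 = length r2" "length bs2 = length r2"
    using comp_dataD(2-4)[OF D] l by simp_all
  have "length d = length q" using comp_dataD(6)[OF D, of "length r1"] l by (simp add: nth_append)
  then have b0: "beta (\<lambda>z. 0) q d = 0" by (simp add: beta_zero)
  have "beta x ?r (as1 @ 0 # as2) = 0" if "length as1 = length r1" "length as2 = length r2" for as1 as2
    using beta_scale_at[OF b comp_dataD(1)[OF D] that, of 0 0] c by (simp add: zero_power)
  then show "comp_lhs x ?r ?xs ?qs (bs1 @ d # bs2) = 0"
    unfolding comp_lhs_split[OF l l2] b0 using l l2 by simp
  have bl: "blk ?r (sum_list r1) = length r1" using c by (simp add: blk_append blk_Cons)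
  let ?n = "sum_list ?r"
  define y where "y k = ?xs ! blk ?r k" for k
  have yf: "finite (supp (y k))" if "k < ?n" for k
    using Pn_finite[OF Pinv_Pn[OF comp_dataD(5)[OF D blk_props(1)[OF that]]]] by (simp add: y_def)
  \<comment> \<open>Only the first input of the slot, at index \<open>sum_list r1\<close>, is given
    the scalar 0; this already annihilates the product of scalars.\<close>
  have "comp_elt x ?r ?xs = lcomp cmp (\<lambda>z. 1 * x z) (map (\<lambda>k z. (if k = sum_list r1 then 0 else 1) * y k z) [0..<?n])"
  proof -
    have "?xs ! blk ?r k = (\<lambda>z. (if k = sum_list r1 then 0 else 1) * y k z)" for k
      using bl l by (cases "k = sum_list r1") (auto simp: y_def nth_append)
    then show ?thesis unfolding comp_elt_def by simp
  qed
  also have "\<dots> = (\<lambda>z. 1 * (\<Prod>k<?n. if k = sum_list r1 then 0 else 1) * lcomp cmp x (map y [0..<?n]) z)"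
    by (rule lcomp_scale[OF Pn_finite[OF Pinv_Pn[OF comp_dataD(1)[OF D]]] yf])
  also have "(\<Prod>k<?n. if k = sum_list r1 then 0 else 1) = (0 :: 'k)" using c by simp
  finally have z: "comp_elt x ?r ?xs = (\<lambda>z. 0)" by simp
  have "csum (SF (Mtot ?r ?qs) (dlab ?r ?qs)) (wreath ?r ?qs) (\<lambda>\<tau>. lact B act (Mtot ?r ?qs) \<tau> (comp_elt x ?r ?xs)) = (\<lambda>z. 0 * (0::'k))"
    unfolding z by (simp add: csum_def lact_zero)
  then show "comp_rhs x ?r ?xs ?qs (bs1 @ d # bs2) = 0"
    unfolding comp_rhs_def using betaR_zero[OF comp_dataD(8)[OF D]] by simp
qed

lemma comp_add_left:
  assumes D: "comp_data x r xs qs bs" "comp_data x' r xs qs bs"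
  shows "comp_lhs (\<lambda>z. x z + x' z) r xs qs bs = comp_lhs x r xs qs bs + comp_lhs x' r xs qs bs"
    "comp_rhs (\<lambda>z. x z + x' z) r xs qs bs = comp_rhs x r xs qs bs + comp_rhs x' r xs qs bs"
proof -
  show "comp_lhs (\<lambda>z. x z + x' z) r xs qs bs = comp_lhs x r xs qs bs + comp_lhs x' r xs qs bs"
    unfolding comp_lhs_def by (rule beta_objD(6)[OF b comp_dataD(1)[OF D(1)] comp_dataD(1)[OF D(2)]]) simp
  have yf: "finite (supp (xs ! blk r k))" if "k < sum_list r" for k
    using Pn_finite[OF Pinv_Pn[OF comp_dataD(5)[OF D(1) blk_props(1)[OF that]]]] .
  have xf: "finite (supp x)" "finite (supp x')" using D comp_dataD(1) Pn_finite Pinv_Pn by blast+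
  have e: "comp_elt (\<lambda>z. x z + x' z) r xs = (\<lambda>z. comp_elt x r xs z + comp_elt x' r xs z)"
    unfolding comp_elt_def by (rule lcomp_add_left[OF xf yf])
  note P = csum_Pfix[OF SF_subgrp wreath_subgrp wreath_subset[OF comp_dataD(3)[OF D(1)]] comp_elt_Pfix[OF D(1)]]
    csum_Pfix[OF SF_subgrp wreath_subgrp wreath_subset[OF comp_dataD(3)[OF D(1)]] comp_elt_Pfix[OF D(2)]]
  show "comp_rhs (\<lambda>z. x z + x' z) r xs qs bs = comp_rhs x r xs qs bs + comp_rhs x' r xs qs bs"
    unfolding comp_rhs_def e lact_add csum_add
    by (rule betaR_add[OF dlab_less[OF comp_dataD(3)[OF D(1)]] P comp_dataD(8)[OF D(1)]])
qed

lemma beta_scale_all: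
  assumes x: "x \<in> Pinv B act r"
  shows "beta x r (map (\<lambda>i. sc (c i) (a i)) [0..<length r]) = sc (\<Prod>i<length r. c i ^ (r ! i)) (beta x r (map a [0..<length r]))"
proof -
  \<comment> \<open>The first \<open>m\<close> arguments are scaled; \<open>m\<close> grows one by
    one.\<close>
  have "beta x r (map (\<lambda>i. if i < m then sc (c i) (a i) else a i) [0..<length r])
      = sc (\<Prod>i<m. c i ^ (r ! i)) (beta x r (map a [0..<length r]))" if "m \<le> length r" for m
    using that
  proof (induction m)
    case (Suc m)
    then have m: "m < length r" by simp
    have r: "r = take m r @ r ! m # drop (Suc m) r" using m by (rule id_take_nth_drop)
    have sp: "map F [0..<length r] = map F [0..<m] @ F m # map F [Suc m..<length r]" for F :: "nat \<Rightarrow> 'a"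
      using m upt_add_eq_append[of 0 m "length r - m"] by (simp add: upt_conv_Cons)
    have e1: "map (\<lambda>i. if i < Suc m then sc (c i) (a i) else a i) [0..<m] = map (\<lambda>i. if i < m then sc (c i) (a i) else a i) [0..<m]"
      "map (\<lambda>i. if i < Suc m then sc (c i) (a i) else a i) [Suc m..<length r] = map (\<lambda>i. if i < m then sc (c i) (a i) else a i) [Suc m..<length r]"
      by (rule map_cong; simp)+
    have "beta x r (map (\<lambda>i. if i < Suc m then sc (c i) (a i) else a i) [0..<length r])
      = sc (c m ^ (r ! m)) (beta x r (map (\<lambda>i. if i < m then sc (c i) (a i) else a i) [0..<length r]))"
      unfolding sp e1
      using beta_scale_at[OF b, of x "take m r" "r ! m" "drop (Suc m) r" "map (\<lambda>i. if i < m then sc (c i) (a i) else a i) [0..<m]"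
          "map (\<lambda>i. if i < m then sc (c i) (a i) else a i) [Suc m..<length r]" "c m" "a m"] x m
      unfolding r[symmetric] by simp
    also have "\<dots> = sc (\<Prod>i<Suc m. c i ^ (r ! i)) (beta x r (map a [0..<length r]))"
      using Suc by (simp add: mult.commute)
    finally show ?case .
  qed simp
  note m = this[OF order_refl]
  have "map (\<lambda>i. if i < length r then sc (c i) (a i) else a i) [0..<length r] = map (\<lambda>i. sc (c i) (a i)) [0..<length r]"
    by (rule map_cong) simp_all
  with m show ?thesis by (simp only:)
qed

text \<open>Both sides are homogeneous of degree \<open>r ! i\<close> in the inner operation
  \<open>i\<close>: on the left by \<beta>3, on the right because that operation occurs at
  \<open>r ! i\<close> inputs.\<close>

lemma comp_scale:
  assumes D: "comp_data x r xs qs bs" and l: "length cs = length r"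
  defines "ys \<equiv> map (\<lambda>i z. cs ! i * (xs ! i) z) [0..<length r]"
  shows "comp_data (\<lambda>z. e * x z) r ys qs bs"
    "comp_lhs (\<lambda>z. e * x z) r ys qs bs = sc (e * (\<Prod>i<length r. (cs ! i) ^ (r ! i))) (comp_lhs x r xs qs bs)"
    "comp_rhs (\<lambda>z. e * x z) r ys qs bs = sc (e * (\<Prod>i<length r. (cs ! i) ^ (r ! i))) (comp_rhs x r xs qs bs)"
proof -
  note DD = comp_dataD[OF D]
  show D': "comp_data (\<lambda>z. e * x z) r ys qs bs"
    using DD by (simp add: comp_data_def ys_def Pinv_eq_Pfix Pfix_scale)
  have mm: "map (\<lambda>i. beta (ys ! i) (qs ! i) (bs ! i)) [0..<length r] = map (\<lambda>i. sc (cs ! i) (beta (xs ! i) (qs ! i) (bs ! i))) [0..<length r]"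
    using beta_objD(7)[OF b DD(5)] DD(6) by (intro map_cong) (simp_all add: ys_def)
  have "comp_lhs (\<lambda>z. e * x z) r ys qs bs = sc e (beta x r (map (\<lambda>i. beta (ys ! i) (qs ! i) (bs ! i)) [0..<length r]))"
    unfolding comp_lhs_def by (rule beta_objD(7)[OF b DD(1)]) simp
  then show "comp_lhs (\<lambda>z. e * x z) r ys qs bs = sc (e * (\<Prod>i<length r. (cs ! i) ^ (r ! i))) (comp_lhs x r xs qs bs)"
    unfolding mm beta_scale_all[OF DD(1)] comp_lhs_def by simp
  have yf: "finite (supp (xs ! blk r k))" if "k < sum_list r" for k
    using Pn_finite[OF Pinv_Pn[OF DD(5)[OF blk_props(1)[OF that]]]] .
  have "map (\<lambda>k. ys ! blk r k) [0..<sum_list r] = map (\<lambda>k z. cs ! blk r k * (xs ! blk r k) z) [0..<sum_list r]"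
    by (rule map_cong) (simp_all add: ys_def blk_props)
  then have "comp_elt (\<lambda>z. e * x z) r ys = (\<lambda>z. e * (\<Prod>k<sum_list r. cs ! blk r k) * comp_elt x r xs z)"
    unfolding comp_elt_def using lcomp_scale[where cmp = cmp and n = "sum_list r" and c = e and d = "\<lambda>k. cs ! blk r k"
        and y = "\<lambda>k. xs ! blk r k", OF Pn_finite[OF Pinv_Pn[OF DD(1)]] yf]
    by (simp only:)
  then have el: "comp_elt (\<lambda>z. e * x z) r ys = (\<lambda>z. e * (\<Prod>i<length r. (cs ! i) ^ (r ! i)) * comp_elt x r xs z)"
    by (simp add: prod_blk)
  note P = csum_Pfix[OF SF_subgrp wreath_subgrp wreath_subset[OF DD(3)] comp_elt_Pfix[OF D]]
  show "comp_rhs (\<lambda>z. e * x z) r ys qs bs = sc (e * (\<Prod>i<length r. (cs ! i) ^ (r ! i))) (comp_rhs x r xs qs bs)"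
    unfolding comp_rhs_def el lact_scale csum_scale by (rule betaR_scale[OF dlab_less[OF DD(3)] P DD(8)])
qed

text \<open>Left cosets of the split wreath product correspond to the subsets of size
  \<open>l\<close> of the slot: an element is sent to the set of blocks to which it moves the first
  \<open>l\<close> ones. \<open>Symc_split_iff\<close> says that this separates cosets,
  \<open>Symc_move\<close> that every subset occurs.\<close>

lemma csum_wreath_split:
  fixes r1 r2 :: "nat list"
  assumes R: "relabels h (r1 @ l # (c - l) # r2) (r1 @ c # r2) qs' qs"
    and l: "l \<le> c" and x: "x \<in> Pinv B act (r1 @ c # r2)"
    and v: "v \<in> Pinv B act (qs ! length r1)" "v' \<in> Pinv B act (qs ! length r1)" and m: "0 < sum_list (qs ! length r1)"
    and xs: "\<And>i. i < length (r1 @ c # r2) \<Longrightarrow> i \<noteq> length r1 \<Longrightarrow> y i \<in> Pinv B act (qs ! i)"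
  defines "J \<equiv> {sum_list r1..<sum_list r1 + c}" and "I \<equiv> {sum_list r1..<sum_list r1 + l}"
    and "n \<equiv> sum_list (r1 @ c # r2)"
  defines "Z \<equiv> \<lambda>S. lcomp cmp x (map (\<lambda>k. if k \<in> J then (if k \<in> S then v else v') else y (blk (r1 @ c # r2) k)) [0..<n])"
  shows "csum (wreath (r1 @ c # r2) qs) (wreath (r1 @ l # (c - l) # r2) qs') (\<lambda>\<tau>. lact B act (Mtot (r1 @ c # r2) qs) \<tau> (Z I))
    = (\<lambda>z. \<Sum>S\<in>{S. S \<subseteq> J \<and> card S = l}. Z S z)"
proof -
  let ?r = "r1 @ c # r2" and ?r' = "r1 @ l # (c - l) # r2" and ?i = "length r1"
  let ?m = "mlist ?r qs" and ?W = "wreath ?r qs" and ?W' = "wreath ?r' qs'"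
  have M: "mlist ?r' qs' = ?m" "Mtot ?r' qs' = Mtot ?r qs" using relabels_mlist[OF R] by simp_all
  have n': "sum_list ?r' = n" using l by (simp add: n_def)
  have Jb: "blk ?r k = ?i \<longleftrightarrow> k \<in> J" if "k < n" for k
    using that blk_props(1)[of k r1] by (auto simp: J_def n_def blk_append blk_Cons split: if_splits)
  have Jn: "k < n" if "k \<in> J" for k using that by (auto simp: J_def n_def)
  have IJ: "I \<subseteq> J" using l by (auto simp: I_def J_def)
  have mpos: "0 < ?m ! k" if "k \<in> J" for k
  proof -
    have "blk ?r k = ?i" using Jb[OF Jn[OF that]] that by simp
    then show ?thesis using Jn[OF that] m by (simp add: nth_mlist msz_def n_def)
  qed
  have yk: "(if k \<in> J then (if k \<in> S then v else v') else y (blk ?r k)) \<in> Pinv B act (qs ! blk ?r k)" if k: "k < n" for k S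
    using v xs[of "blk ?r k"] Jb[OF k] blk_props(1)[of k ?r] k by (auto simp: n_def)
  \<comment> \<open>Reads the block permutation off a group element through the images of block
    starts; the blocks in \<open>J\<close> are nonempty, so each start really lies in its
    block.\<close>
  define e where "e w = (\<lambda>k. blk ?m (w (off ?m k))) ` I" for w
  have read: "blk ?m (wr ?m \<pi> \<theta> (off ?m k)) = \<pi> k" if p: "\<pi> \<in> Symc ?r" and t: "blockwise ?r qs \<theta>" and k: "k \<in> J" for \<pi> \<theta> k
  proof -
    have kn: "k < sum_list ?r" using Jn[OF k] by (simp add: n_def)
    have pk: "\<pi> k < sum_list ?r" using kn Sym_less[OF Symc_Sym[OF p]] by simp
    have "wr ?m \<pi> \<theta> (off ?m k + 0) = off ?m (\<pi> k) + \<theta> (\<pi> k) 0" by (rule wr_off[OF p kn mpos[OF k]])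
    moreover have "\<theta> (\<pi> k) 0 < ?m ! \<pi> k"
      using Sym_less[OF wparamsD[OF t pk], of 0] mlist_perm[OF p kn] mpos[OF k] by simp
    ultimately show ?thesis using blk_off[of "\<pi> k" ?m "\<theta> (\<pi> k) 0"] pk by simp
  qed
  have ew: "e (wr ?m \<pi> \<theta>) = \<pi> ` I" if "\<pi> \<in> Symc ?r" "blockwise ?r qs \<theta>" for \<pi> \<theta>
    unfolding e_def by (rule image_cong) (use read[OF that] IJ in auto)
  \<comment> \<open>Both sides say that the quotient of the two block permutations maps
    \<open>I\<close> onto itself. The parts inside the blocks impose nothing further, since the
    inner groups agree input by input.\<close>
  have key: "inv w \<circ> w' \<in> ?W' \<longleftrightarrow> e w = e w'" if w: "w \<in> ?W" "w' \<in> ?W" for w w'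
  proof -
    obtain \<pi> \<theta> where a: "\<pi> \<in> Symc ?r" "blockwise ?r qs \<theta>" "w = wr ?m \<pi> \<theta>" using w(1) by (rule wreath_cases)
    obtain \<pi>' \<theta>' where a': "\<pi>' \<in> Symc ?r" "blockwise ?r qs \<theta>'" "w' = wr ?m \<pi>' \<theta>'" using w(2) by (rule wreath_cases)
    note ai = Symc_inv[OF a(1)] and ti = wr_inv(2)[OF a(1,2)]
    define \<theta>'' where "\<theta>'' k = inv (\<theta> (\<pi> k)) \<circ> \<theta>' (inv (inv \<pi>) k)" for k
    have pp: "inv \<pi> \<circ> \<pi>' \<in> Symc ?r" using subgrpD(3)[OF Symc_subgrp ai a'(1)] .
    have ww: "inv w \<circ> w' = wr ?m (inv \<pi> \<circ> \<pi>') \<theta>''" "blockwise ?r qs \<theta>''"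
      unfolding a(3) a'(3) wr_inv(1)[OF a(1,2)] \<theta>''_def
      using wr_comp[OF ai a'(1) ti a'(2)] by simp_all
    have inj: "inj \<pi>" using Sym_bij[OF Symc_Sym[OF a(1)]] by (simp add: bij_is_inj)
    have "e w = e w' \<longleftrightarrow> \<pi> ` I = \<pi>' ` I" using ew a a' by simp
    also have "\<dots> \<longleftrightarrow> (inv \<pi> \<circ> \<pi>') ` I = I"
    proof -
      have "\<pi>' ` I = \<pi> ` ((inv \<pi> \<circ> \<pi>') ` I)" using Symc_Sym[OF a(1)] by (simp add: image_image)
      then show ?thesis using inj_image_eq_iff[OF inj] by metis
    qed
    also have "\<dots> \<longleftrightarrow> inv \<pi> \<circ> \<pi>' \<in> Symc ?r'"
      using Symc_split_iff[OF l, of "inv \<pi> \<circ> \<pi>'" r1 r2] pp by (simp add: I_def)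
    also have "\<dots> \<longleftrightarrow> inv w \<circ> w' \<in> ?W'"
    proof
      assume "inv \<pi> \<circ> \<pi>' \<in> Symc ?r'"
      moreover have "blockwise ?r' qs' \<theta>''"
        using ww(2) relabels_mlist(3)[OF R] n' unfolding blockwise_def n_def by simp
      ultimately show "inv w \<circ> w' \<in> ?W'" unfolding ww(1) M(1)[symmetric] by (rule wreath_memI)
    next
      assume "inv w \<circ> w' \<in> ?W'"
      then obtain \<rho> \<eta> where q: "\<rho> \<in> Symc ?r'" "blockwise ?r' qs' \<eta>" "inv w \<circ> w' = wr ?m \<rho> \<eta>"
        using M(1) by (metis wreath_cases)
      have q2: "\<rho> \<in> Symc ?r" "\<rho> ` I = I" using Symc_split_iff[OF l, of \<rho> r1 r2] q(1) by (simp_all add: I_def)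
      have "blockwise ?r qs \<eta>" using q(2) relabels_mlist(3)[OF R] n' unfolding blockwise_def n_def by simp
      then have "(inv \<pi> \<circ> \<pi>') ` I = \<rho> ` I" using ew[OF pp ww(2)] ew[OF q2(1)] q(3) ww(1) by simp
      then show "inv \<pi> \<circ> \<pi>' \<in> Symc ?r'" using Symc_split_iff[OF l, of "inv \<pi> \<circ> \<pi>'" r1 r2] pp q2 by (simp add: I_def)
    qed
    finally show ?thesis by blast
  qed
  \<comment> \<open>The inner operations are moved along \<pi>. Slots are preserved, so only the set
    of inputs receiving \<open>v\<close> changes, from \<open>I\<close> to its image.\<close>
  have phi: "lact B act (Mtot ?r qs) w (Z I) = Z (e w)" if w: "w \<in> ?W" for w
  proof -
    obtain \<pi> \<theta> where a: "\<pi> \<in> Symc ?r" "blockwise ?r qs \<theta>" "w = wr ?m \<pi> \<theta>" using w by (rule wreath_cases)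
    let ?y = "\<lambda>S k. if k \<in> J then (if k \<in> S then v else v') else y (blk ?r k)"
    have "lact B act (Mtot ?r qs) w (lcomp cmp x (map (?y I) [0..<sum_list ?r]))
        = lcomp cmp x (map (\<lambda>k. ?y I (inv \<pi> k)) [0..<sum_list ?r])"
      unfolding a(3) by (rule lact_lcomp[OF a(1,2) x]) (rule yk, simp add: n_def)
    also have "map (\<lambda>k. ?y I (inv \<pi> k)) [0..<sum_list ?r] = map (?y (\<pi> ` I)) [0..<sum_list ?r]"
    proof (rule map_cong[OF refl])
      fix k assume "k \<in> set [0..<sum_list ?r]"
      then have k: "k < n" by (simp add: n_def)
      have pS: "\<pi> \<in> Sym n" using Symc_Sym[OF a(1)] by (simp add: n_def)
      have ik: "inv \<pi> k < n" using k Sym_less[OF Sym_inv[OF pS]] by simp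
      have bk: "blk ?r (inv \<pi> k) = blk ?r k" using Symc_blk[OF Symc_inv[OF a(1)]] k by (simp add: n_def)
      have "inv \<pi> k \<in> J \<longleftrightarrow> k \<in> J" using Jb[OF k] Jb[OF ik] bk by simp
      moreover have "inv \<pi> k \<in> I \<longleftrightarrow> k \<in> \<pi> ` I"
      proof
        assume "inv \<pi> k \<in> I"
        then have "\<pi> (inv \<pi> k) \<in> \<pi> ` I" by blast
        then show "k \<in> \<pi> ` I" using pS by simp
      next
        assume "k \<in> \<pi> ` I"
        then obtain j where "j \<in> I" "k = \<pi> j" by blast
        then show "inv \<pi> k \<in> I" using pS by simp
      qed
      ultimately show "?y I (inv \<pi> k) = ?y (\<pi> ` I) k" using bk by simp
    qed
    finally show ?thesis unfolding Z_def ew[OF a(1,2), folded a(3)] n_def .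
  qed
  have img: "e ` ?W = {S. S \<subseteq> J \<and> card S = l}"
  proof (intro equalityI subsetI)
    fix S assume "S \<in> e ` ?W"
    then obtain w where w: "w \<in> ?W" "S = e w" by blast
    obtain \<pi> \<theta> where a: "\<pi> \<in> Symc ?r" "blockwise ?r qs \<theta>" "w = wr ?m \<pi> \<theta>" using w(1) by (rule wreath_cases)
    have S: "S = \<pi> ` I" using w(2) ew[OF a(1,2)] a(3) by simp
    have pS: "\<pi> \<in> Sym n" using Symc_Sym[OF a(1)] by (simp add: n_def)
    have "\<pi> k \<in> J" if "k \<in> I" for k
    proof -
      have k: "k \<in> J" "k < n" using that IJ Jn by auto
      have "blk ?r (\<pi> k) = blk ?r k" using Symc_blk[OF a(1)] k(2) by (simp add: n_def)
      then show ?thesis using Jb[OF k(2)] Jb[of "\<pi> k"] k Sym_less[OF pS] by simp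
    qed
    moreover have "card (\<pi> ` I) = l"
      using Sym_bij[OF pS] by (subst card_image) (auto simp: I_def bij_def intro: inj_on_subset)
    ultimately show "S \<in> {S. S \<subseteq> J \<and> card S = l}" using S by auto
  next
    fix S assume "S \<in> {S. S \<subseteq> J \<and> card S = l}"
    then obtain \<pi> where p: "\<pi> \<in> Symc ?r" "\<pi> ` I = S"
      using Symc_move[OF l, of S r1 r2] by (auto simp: J_def I_def)
    have t: "blockwise ?r qs (\<lambda>k. id)" by (simp add: blockwise_def subgrpD(2)[OF Symc_subgrp])
    have "e (wr ?m \<pi> (\<lambda>k. id)) = S" using ew[OF p(1) t] p(2) by simp
    then show "S \<in> e ` ?W" using wreath_memI[OF p(1) t] by blast
  qed
  have W': "subgrp (Mtot ?r qs) ?W'" using wreath_subgrp[of ?r' qs'] M by simp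
  show ?thesis
    using csum_reindex[OF wreath_subgrp W' relabels_wreath_subset[OF R], where e = e and F = Z
        and \<phi> = "\<lambda>\<tau>. lact B act (Mtot ?r qs) \<tau> (Z I)"] key phi img by simp
qed

text \<open>On the left, additivity splits the multiplicity \<open>c\<close> in all ways. On the
  right, multilinearity gives a sum over subsets of the slot. Grouped by size, these sums are the
  coset sums by which the split wreath products sit in the given one, so the terms match one by
  one.\<close>

lemma comp_split:
  fixes r1 r2 :: "nat list"
  assumes D: "comp_data x (r1 @ c # r2) (xs1 @ (\<lambda>z. v z + v' z) # xs2) (qs1 @ q # qs2) (bs1 @ d # bs2)"
    and l: "length xs1 = length r1" "length qs1 = length r1" "length bs1 = length r1"
    and v: "v \<in> Pinv B act q" "v' \<in> Pinv B act q" and q: "0 < sum_list q"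
    and IH: "\<And>l. l \<le> c \<Longrightarrow> comp_data x (r1 @ l # (c - l) # r2) (xs1 @ v # v' # xs2) (qs1 @ q # q # qs2) (bs1 @ d # d # bs2) \<Longrightarrow>
        comp_lhs x (r1 @ l # (c - l) # r2) (xs1 @ v # v' # xs2) (qs1 @ q # q # qs2) (bs1 @ d # d # bs2)
        = comp_rhs x (r1 @ l # (c - l) # r2) (xs1 @ v # v' # xs2) (qs1 @ q # q # qs2) (bs1 @ d # d # bs2)"
  shows "comp_lhs x (r1 @ c # r2) (xs1 @ (\<lambda>z. v z + v' z) # xs2) (qs1 @ q # qs2) (bs1 @ d # bs2)
    = comp_rhs x (r1 @ c # r2) (xs1 @ (\<lambda>z. v z + v' z) # xs2) (qs1 @ q # qs2) (bs1 @ d # bs2)"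
proof -
  let ?i = "length r1"
  define r xs qs bs where "r = r1 @ c # r2" and "xs = xs1 @ (\<lambda>z. v z + v' z) # xs2" and "qs = qs1 @ q # qs2" and "bs = bs1 @ d # bs2"
  define xs' qs' bs' where "xs' = xs1 @ v # v' # xs2" and "qs' = qs1 @ q # q # qs2" and "bs' = bs1 @ d # d # bs2"
  define r' where "r' l = r1 @ l # (c - l) # r2" for l
  define n where "n = sum_list r"
  note D' = D[folded r_def xs_def qs_def bs_def]
  note DD = comp_dataD[OF D']
  let ?h = "\<lambda>j. if j \<le> ?i then j else j - 1"
  have l2: "length xs2 = length r2" "length qs2 = length r2" "length bs2 = length r2"
    using DD(2-4) l by (simp_all add: r_def xs_def qs_def bs_def)
  have dq: "length d = length q" using DD(6)[of ?i] l by (simp add: r_def qs_def bs_def nth_append)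
  have nl: "sum_list (r' k) = n" if "k \<le> c" for k using that by (simp add: r'_def r_def n_def)
  have R: "relabels ?h (r' k) r qs' qs" if k: "k \<le> c" for k
  proof -
    have "blk r j = ?h (blk (r' k) j)" if "j < n" for j
      using blk_split[of j r1 k "c - k" r2] that k by (simp add: r_def r'_def n_def)
    moreover have "qs' ! j = qs ! ?h j \<and> ?h j < length r" if "j < length (r' k)" for j
      using that l l2 by (auto simp: qs'_def qs_def r_def r'_def nth_append nth_Cons')
    ultimately show ?thesis using nl[OF k] l l2 by (simp add: relabels_def n_def) (simp add: r_def r'_def qs_def qs'_def)
  qed
  have bs'h: "bs' ! j = bs ! ?h j" if "j < length (r' k)" for j k
    using that l l2 by (auto simp: bs'_def bs_def r'_def nth_append nth_Cons')
  have Dl: "comp_data x (r' k) xs' qs' bs'" if k: "k \<le> c" for k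
  proof -
    have "x \<in> Pinv B act (r' k)" using DD(1) Pinv_split[of B act r1 k "c - k" r2] k by (auto simp: r_def r'_def)
    moreover have "xs' ! j \<in> Pinv B act (qs' ! j) \<and> length (bs' ! j) = length (qs' ! j)" if j: "j < length (r' k)" for j
    proof (cases "j = ?i \<or> j = Suc ?i")
      case True
      then show ?thesis using v dq l by (auto simp: xs'_def qs'_def bs'_def nth_append)
    next
      case False
      have h: "?h j < length r" using R[OF k] j unfolding relabels_def by blast
      have "xs' ! j = xs ! ?h j" using False j l l2 by (auto simp: xs'_def xs_def r'_def nth_append nth_Cons')
      moreover have "qs' ! j = qs ! ?h j" using R[OF k] j unfolding relabels_def by blast
      ultimately show ?thesis using DD(5,6)[OF h] bs'h[OF j] by simp
    qed
    ultimately show ?thesis using l l2 by (simp add: comp_data_def) (simp add: r'_def xs'_def qs'_def bs'_def)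
  qed
  let ?M = "Mtot r qs" and ?D = "dlab r qs" and ?P = "sum_list (map length qs)"
  let ?G = "SF ?M ?D" and ?W = "wreath r qs"
  define J where "J = {sum_list r1..<sum_list r1 + c}"
  \<comment> \<open>The composite in which exactly the inputs in \<open>S\<close> receive
    \<open>v\<close> and the rest of the slot receives \<open>v'\<close>; \<open>A k\<close>
    collects the sets of size \<open>k\<close>.\<close>
  define Z where "Z S = lcomp cmp x (map (\<lambda>k. if k \<in> J then (if k \<in> S then v else v') else xs ! blk r k) [0..<n])" for S
  define A where "A k = (\<lambda>z. \<Sum>S\<in>{S. S \<subseteq> J \<and> card S = k}. Z S z)" for k
  have xf: "finite (supp x)" using Pn_finite[OF Pinv_Pn[OF DD(1)]] .
  have vf: "finite (supp v)" "finite (supp v')" using v Pn_finite Pinv_Pn by blast+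
  have xsf: "finite (supp (xs ! blk r k))" if "k < n" for k
    using Pn_finite[OF Pinv_Pn[OF DD(5)[OF blk_props(1)]]] that by (simp add: n_def)
  have Jb: "blk r k = ?i \<longleftrightarrow> k \<in> J" if "k < n" for k
    using that blk_props(1)[of k r1] by (auto simp: J_def n_def r_def blk_append blk_Cons split: if_splits)
  \<comment> \<open>After splitting the slot, \<open>v\<close> sits on its first \<open>k\<close>
    inputs: one representative of all subsets of that size.\<close>
  have zl: "comp_elt x (r' k) xs' = Z {sum_list r1..<sum_list r1 + k}" if k: "k \<le> c" for k
  proof -
    have "xs' ! blk (r' k) j = (if j \<in> J then (if j \<in> {sum_list r1..<sum_list r1 + k} then v else v') else xs ! blk r j)"
      if "j < n" for j
      using that k l blk_props(1)[of j r1]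
      by (auto simp: J_def n_def r_def r'_def xs_def xs'_def blk_append blk_Cons nth_append)
    then show ?thesis unfolding comp_elt_def Z_def nl[OF k]
      by (intro arg_cong[where f = "lcomp cmp x"] map_cong) simp_all
  qed
  have zfull: "comp_elt x r xs = (\<lambda>z. \<Sum>k\<le>c. A k z)"
  proof -
    have "xs ! blk r k = (if k \<in> J then (\<lambda>z. v z + v' z) else xs ! blk r k)" if "k < n" for k
    proof (cases "k \<in> J")
      case True
      then have "blk r k = ?i" using Jb[OF that] by simp
      then show ?thesis using True l by (simp add: xs_def nth_append)
    qed simp
    then have "comp_elt x r xs = lcomp cmp x (map (\<lambda>k. if k \<in> J then (\<lambda>z. v z + v' z) else xs ! blk r k) [0..<n])"
      unfolding comp_elt_def n_def[symmetric]
      by (intro arg_cong[where f = "lcomp cmp x"] map_cong refl) simp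
    also have "\<dots> = (\<lambda>z. \<Sum>S\<in>Pow J. Z S z)"
      unfolding Z_def by (rule lcomp_expand[OF xf vf _ _ xsf]) (auto simp: J_def n_def r_def)
    also have "\<dots> = (\<lambda>z. \<Sum>k\<le>c. A k z)"
    proof
      fix z
      have "(\<Sum>S\<in>Pow J. Z S z) = (\<Sum>k\<le>c. \<Sum>S\<in>{S \<in> Pow J. card S = k}. Z S z)"
      proof (rule sum.group[symmetric])
        show "card ` Pow J \<subseteq> {..c}" using card_mono[of J] by (auto simp: J_def)
      qed (auto simp: J_def)
      then show "(\<Sum>S\<in>Pow J. Z S z) = (\<Sum>k\<le>c. A k z)" by (simp add: A_def Pow_def)
    qed
    finally show ?thesis .
  qed
  define Y where "Y k = csum ?G ?W (\<lambda>\<tau>. lact B act ?M \<tau> (A k))" for k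
  have AW: "A k = csum ?W (wreath (r' k) qs') (\<lambda>\<tau>. lact B act ?M \<tau> (comp_elt x (r' k) xs'))" if k: "k \<le> c" for k
  proof -
    have 1: "0 < sum_list (qs ! ?i)" "v \<in> Pinv B act (qs ! ?i)" "v' \<in> Pinv B act (qs ! ?i)"
      using q v l by (simp_all add: qs_def nth_append)
    show ?thesis unfolding zl[OF k] unfolding A_def Z_def r'_def J_def n_def r_def
      by (rule csum_wreath_split[symmetric, OF R[OF k, unfolded r_def r'_def] k DD(1)[unfolded r_def] 1(2,3,1)])
        (use DD(5) in \<open>simp add: r_def\<close>)
  qed
  have el: "comp_elt x (r' k) xs' \<in> Pfix B act ?M (wreath (r' k) qs')" if "k \<le> c" for k
    using comp_elt_Pfix[OF Dl[OF that]] relabels_mlist(2)[OF R[OF that]] by simp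
  have Wk: "subgrp ?M (wreath (r' k) qs')" "wreath (r' k) qs' \<subseteq> ?W" if "k \<le> c" for k
    using wreath_subgrp[of "r' k" qs'] relabels_mlist(2)[OF R[OF that]] relabels_wreath_subset[OF R[OF that]] by simp_all
  have AP: "A k \<in> Pfix B act ?M ?W" if "k \<le> c" for k
    unfolding AW[OF that] by (rule csum_Pfix[OF wreath_subgrp Wk[OF that] el[OF that]])
  have YP: "Y k \<in> Pfix B act ?M ?G" if "k \<in> {..c}" for k
    unfolding Y_def using that by (intro csum_Pfix[OF SF_subgrp wreath_subgrp wreath_subset[OF DD(3)] AP]) simp
  \<comment> \<open>In the split data the arguments \<open>d\<close> occur twice; merging them leads
    to the partition of the given data.\<close>
  have rk: "comp_rhs x (r' k) xs' qs' bs' = betaR ?M beta B act (Y k) (lparts ?M ?P ?D) (concat bs)" if k: "k \<le> c" for k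
  proof -
    have "Y k = csum ?G (wreath (r' k) qs') (\<lambda>\<tau>. lact B act ?M \<tau> (comp_elt x (r' k) xs'))"
      unfolding Y_def AW[OF k] by (rule csum_trans[OF SF_subgrp wreath_subgrp wreath_subset[OF DD(3)] Wk[OF k] el[OF k]])
    then show ?thesis using comp_rhs_relabel[OF Dl[OF k] D' R[OF k] bs'h] by simp
  qed
  let ?p1 = "map (\<lambda>(x, y, z). beta x y z) (zip xs1 (zip qs1 bs1))" and ?p2 = "map (\<lambda>(x, y, z). beta x y z) (zip xs2 (zip qs2 bs2))"
  have "comp_lhs x r xs qs bs = beta x (r1 @ c # r2) (?p1 @ (beta v q d + beta v' q d) # ?p2)"
    unfolding r_def xs_def qs_def bs_def comp_lhs_split[OF l l2] beta_objD(6)[OF b v dq] by (rule refl)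
  also have "\<dots> = (\<Sum>k\<le>c. beta x (r1 @ k # (c - k) # r2) (?p1 @ beta v q d # beta v' q d # ?p2))"
    using l l2 by (intro beta_add_at[OF b DD(1)[unfolded r_def]]) simp_all
  also have "\<dots> = (\<Sum>k\<le>c. comp_lhs x (r' k) xs' qs' bs')"
  proof (rule sum.cong[OF refl])
    fix k
    have "comp_lhs x (r1 @ k # ((c - k) # r2)) (xs1 @ v # (v' # xs2)) (qs1 @ q # (q # qs2)) (bs1 @ d # (d # bs2))
      = beta x (r1 @ k # (c - k) # r2) (?p1 @ beta v q d # map (\<lambda>(x, y, z). beta x y z) (zip (v' # xs2) (zip (q # qs2) (d # bs2))))"
      by (rule comp_lhs_split(1)) (use l l2 in simp_all)
    then show "beta x (r1 @ k # (c - k) # r2) (?p1 @ beta v q d # beta v' q d # ?p2) = comp_lhs x (r' k) xs' qs' bs'"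
      by (simp add: r'_def xs'_def qs'_def bs'_def)
  qed
  also have "\<dots> = (\<Sum>k\<le>c. betaR ?M beta B act (Y k) (lparts ?M ?P ?D) (concat bs))"
  proof (rule sum.cong[OF refl])
    fix k assume "k \<in> {..c}"
    then have k: "k \<le> c" by simp
    have "comp_lhs x (r' k) xs' qs' bs' = comp_rhs x (r' k) xs' qs' bs'"
      using IH[OF k] Dl[OF k] unfolding r'_def xs'_def qs'_def bs'_def by blast
    then show "comp_lhs x (r' k) xs' qs' bs' = betaR ?M beta B act (Y k) (lparts ?M ?P ?D) (concat bs)" using rk[OF k] by simp
  qed
  also have "\<dots> = betaR ?M beta B act (\<lambda>z. \<Sum>k\<le>c. Y k z) (lparts ?M ?P ?D) (concat bs)"
    by (rule betaR_sum[symmetric, OF dlab_less[OF DD(3)] YP DD(8)]) simp_all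
  also have "(\<lambda>z. \<Sum>k\<le>c. Y k z) = csum ?G ?W (\<lambda>\<tau>. lact B act ?M \<tau> (comp_elt x r xs))"
    unfolding zfull Y_def lact_sum csum_sum by (rule refl)
  finally show ?thesis unfolding comp_rhs_def r_def xs_def qs_def bs_def .
qed

text \<open>\<beta>7b restricted to orbit sums; by \<open>basis_law_iff\<close> it is \<gamma>6b for
  the associated family.\<close>

definition basis_law :: bool where
  "basis_law \<longleftrightarrow> (\<forall>x r xs qs bs. x \<in> B (sum_list r) \<and> length xs = length r \<and> length qs = length r \<and> length bs = length r \<and>
     (\<forall>i<length r. xs ! i \<in> B (sum_list (qs ! i)) \<and> length (bs ! i) = length (qs ! i)) \<longrightarrow>
     comp_lhs (ind (orbR act (Symc r) x)) r (map (\<lambda>i. ind (orbR act (Symc (qs ! i)) (xs ! i))) [0..<length r]) qs bs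
     = comp_rhs (ind (orbR act (Symc r) x)) r (map (\<lambda>i. ind (orbR act (Symc (qs ! i)) (xs ! i))) [0..<length r]) qs bs)"

text \<open>Both sides are linear in the outer operation once the inner ones are fixed.\<close>

lemma comp_law_left:
  assumes law: basis_law and D: "comp_data x r es qs bs"
    and es: "length ys = length r" "\<And>i. i < length r \<Longrightarrow> ys ! i \<in> B (sum_list (qs ! i))"
      "es = map (\<lambda>i. ind (orbR act (Symc (qs ! i)) (ys ! i))) [0..<length r]"
  shows "comp_lhs x r es qs bs = comp_rhs x r es qs bs"
proof -
  note DD = comp_dataD[OF D]
  \<comment> \<open>\<open>comp_scale\<close> rescales all operations at once; scalars 1 on the
    inner ones leave a statement on the outer one alone.\<close>
  have one: "map (\<lambda>i z. replicate (length r) (1::'k) ! i * (es ! i) z) [0..<length r] = es"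
    using DD(2) by (intro nth_equalityI) simp_all
  have Dx: "comp_data y r es qs bs" if "y \<in> Pinv B act r" for y using D that by (simp add: comp_data_def)
  have sl: "comp_lhs (\<lambda>z. e * y z) r es qs bs = sc e (comp_lhs y r es qs bs)"
    "comp_rhs (\<lambda>z. e * y z) r es qs bs = sc e (comp_rhs y r es qs bs)" if "y \<in> Pinv B act r" for e y
    using comp_scale(2,3)[OF Dx[OF that], of "replicate (length r) 1" e] unfolding one by simp_all
  have "x \<in> Pfix B act (sum_list r) (Symc r)" using DD(1) by (simp add: Pinv_eq_Pfix)
  then show ?thesis
  proof (rule Pfix_induct[OF Symc_subgrp, where P = "\<lambda>x. comp_lhs x r es qs bs = comp_rhs x r es qs bs"])
    show "comp_lhs (\<lambda>z. 0) r es qs bs = comp_rhs (\<lambda>z. 0) r es qs bs" using sl[OF DD(1), of 0] by simp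
    fix y w and c :: 'k assume y: "y \<in> B (sum_list r)" and w: "w \<in> Pfix B act (sum_list r) (Symc r)"
      and P: "comp_lhs w r es qs bs = comp_rhs w r es qs bs"
    have i: "(ind (orbR act (Symc r) y) :: 'o \<Rightarrow> 'k) \<in> Pinv B act r" unfolding Pinv_eq_Pfix by (rule ind_Pfix[OF Symc_subgrp y])
    have ci: "(\<lambda>z. c * ind (orbR act (Symc r) y) z) \<in> Pinv B act r" using i by (simp add: Pinv_eq_Pfix Pfix_scale)
    have w': "w \<in> Pinv B act r" using w by (simp add: Pinv_eq_Pfix)
    have "comp_lhs (ind (orbR act (Symc r) y)) r es qs bs = comp_rhs (ind (orbR act (Symc r) y)) r es qs bs"
      unfolding es(3) using law y es(1,2) DD(3,4,6) unfolding basis_law_def by blast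
    then show "comp_lhs (\<lambda>z. c * ind (orbR act (Symc r) y) z + w z) r es qs bs
        = comp_rhs (\<lambda>z. c * ind (orbR act (Symc r) y) z + w z) r es qs bs"
      using comp_add_left[OF Dx[OF ci] Dx[OF w']] sl[OF i] P by simp
  qed
qed

text \<open>Induction on the number of slots plus the squared support sizes. A split lowers the
  squares by twice the product of two positive sizes, hence by at least 2, and adds one slot;
  removing an empty slot lowers the length.\<close>

lemma comp_law:
  assumes law: basis_law
  shows "comp_data x r xs qs bs \<Longrightarrow> comp_lhs x r xs qs bs = comp_rhs x r xs qs bs"
proof (induction "length r + (\<Sum>v\<leftarrow>xs. (card (supp v))\<^sup>2)" arbitrary: r xs qs bs rule: less_induct)
  case less
  note DD = comp_dataD[OF less.prems]
  have dec: "\<exists>r1 c r2 xs1 v xs2 qs1 q qs2 bs1 d bs2. r = r1 @ c # r2 \<and> xs = xs1 @ v # xs2 \<and> qs = qs1 @ q # qs2 \<and> bs = bs1 @ d # bs2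
      \<and> length xs1 = length r1 \<and> length qs1 = length r1 \<and> length bs1 = length r1 \<and> c = r ! i \<and> v = xs ! i \<and> q = qs ! i"
    if i: "i < length r" for i
    by (rule exI[of _ "take i r"], rule exI[of _ "r ! i"], rule exI[of _ "drop (Suc i) r"],
        rule exI[of _ "take i xs"], rule exI[of _ "xs ! i"], rule exI[of _ "drop (Suc i) xs"],
        rule exI[of _ "take i qs"], rule exI[of _ "qs ! i"], rule exI[of _ "drop (Suc i) qs"],
        rule exI[of _ "take i bs"], rule exI[of _ "bs ! i"], rule exI[of _ "drop (Suc i) bs"])
      (use i DD(2-4) in \<open>simp add: id_take_nth_drop[symmetric]\<close>)
  show ?case
  \<comment> \<open>Empty slots go first: afterwards every multiplicity is positive, as
    \<open>comp_zero_slot\<close> requires.\<close>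
  proof (cases "\<exists>i<length r. r ! i = 0")
    case True
    then obtain i where i: "i < length r" "r ! i = 0" by blast
    obtain r1 r2 xs1 v xs2 qs1 q qs2 bs1 d bs2 where s: "r = r1 @ 0 # r2" "xs = xs1 @ v # xs2" "qs = qs1 @ q # qs2" "bs = bs1 @ d # bs2"
      "length xs1 = length r1" "length qs1 = length r1" "length bs1 = length r1" using dec[OF i(1)] i(2) by metis
    note dr = comp_drop[OF less.prems[unfolded s] s(5-7)]
    have "comp_lhs x (r1 @ r2) (xs1 @ xs2) (qs1 @ qs2) (bs1 @ bs2) = comp_rhs x (r1 @ r2) (xs1 @ xs2) (qs1 @ qs2) (bs1 @ bs2)"
      by (rule less.hyps[OF _ dr(1)]) (simp add: s)
    then show ?thesis unfolding s dr(2,3) .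
  next
    case rpos: False
    show ?thesis
    proof (cases "\<exists>i<length r. xs ! i = (\<lambda>z. 0)")
      case True
      then obtain i where i: "i < length r" "xs ! i = (\<lambda>z. 0)" by blast
      obtain r1 c r2 xs1 xs2 qs1 q qs2 bs1 d bs2 where s: "r = r1 @ c # r2" "xs = xs1 @ (\<lambda>z. 0) # xs2" "qs = qs1 @ q # qs2" "bs = bs1 @ d # bs2"
        "length xs1 = length r1" "length qs1 = length r1" "length bs1 = length r1" "c = r ! i" using dec[OF i(1)] i(2) by metis
      have "c > 0" using s(8) rpos i by auto
      then show ?thesis using comp_zero_slot[OF less.prems[unfolded s(1-4)] s(5-7)] unfolding s(1-4) by simp
    next
      case xpos: False
      \<comment> \<open>When every inner operation is a multiple of one orbit sum, homogeneity
        removes the scalars and \<open>comp_law_left\<close> finishes.\<close>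
      let ?single = "\<lambda>i. \<exists>y\<in>B (sum_list (qs ! i)). \<exists>c. xs ! i = (\<lambda>z. c * ind (orbR act (Symc (qs ! i)) y) z)"
      show ?thesis
      proof (cases "\<exists>i<length r. \<not> ?single i")
        case True
        then obtain i where i: "i < length r" "\<not> ?single i" by blast
        obtain y where y: "(xs ! i) y \<noteq> 0" using xpos i(1) by fastforce
        have xi: "xs ! i \<in> Pfix B act (sum_list (qs ! i)) (Symc (qs ! i))" using DD(5)[OF i(1)] by (simp add: Pinv_eq_Pfix)
        note sp = Pfix_split[OF Symc_subgrp xi y]
        define O1 where "O1 = orbR act (Symc (qs ! i)) y"
        define v where "v = (\<lambda>z. (xs ! i) y * (ind O1 z :: 'k))"
        define v' where "v' = (\<lambda>z. if z \<in> O1 then 0 else (xs ! i) z)"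
        have eq: "xs ! i = (\<lambda>z. v z + v' z)" using sp(3) unfolding v_def v'_def O1_def .
        have vP: "v \<in> Pinv B act (qs ! i)" "v' \<in> Pinv B act (qs ! i)"
          unfolding Pinv_eq_Pfix v_def v'_def O1_def using sp(2) Pfix_scale[OF ind_Pfix[OF Symc_subgrp sp(1)]] by blast+
        have q: "0 < sum_list (qs ! i)" using sp(1) B0 by (metis empty_iff neq0_conv)
        have sv: "supp v = O1" using y by (auto simp: v_def ind_def)
        have sv': "supp v' = supp (xs ! i) - O1" unfolding v'_def by auto
        have fx: "finite (supp (xs ! i))" using Pn_finite[OF Pinv_Pn[OF DD(5)[OF i(1)]]] .
        have O1: "O1 \<subseteq> supp (xs ! i)" "y \<in> O1" using sp(5) orbR_self[OF Symc_subgrp sp(1)] by (simp_all add: O1_def)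
        \<comment> \<open>Otherwise the operation would be a multiple of one orbit sum after all.
          Nonempty supports on both sides make the measure drop.\<close>
        have "supp v' \<noteq> {}"
        proof
          assume "supp v' = {}"
          then have "xs ! i = v" unfolding eq by auto
          then show False using i(2) sp(1) unfolding v_def O1_def by blast
        qed
        moreover have "finite O1" by (rule finite_subset[OF O1(1) fx])
        ultimately have pos: "0 < card (supp v)" "0 < card (supp v')"
          using O1(2) fx sv' unfolding sv by (auto simp: card_gt_0_iff)
        have card: "card (supp (xs ! i)) = card (supp v) + card (supp v')"
          unfolding sv sv' using O1 fx finite_subset[OF O1(1) fx] by (simp add: card_Diff_subset card_mono)
        obtain r1 c r2 xs1 xs2 qs1 qs2 bs1 d bs2 where s: "r = r1 @ c # r2" "xs = xs1 @ xs ! i # xs2" "qs = qs1 @ qs ! i # qs2" "bs = bs1 @ d # bs2"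
          "length xs1 = length r1" "length qs1 = length r1" "length bs1 = length r1" using dec[OF i(1)] by metis
        define q' where "q' = qs ! i"
        have sx: "xs = xs1 @ (\<lambda>z. v z + v' z) # xs2" "qs = qs1 @ q' # qs2" using s(2,3) eq q'_def by simp_all
        have "comp_lhs x (r1 @ c # r2) (xs1 @ (\<lambda>z. v z + v' z) # xs2) (qs1 @ q' # qs2) (bs1 @ d # bs2)
          = comp_rhs x (r1 @ c # r2) (xs1 @ (\<lambda>z. v z + v' z) # xs2) (qs1 @ q' # qs2) (bs1 @ d # bs2)"
        proof (rule comp_split)
          show "comp_data x (r1 @ c # r2) (xs1 @ (\<lambda>z. v z + v' z) # xs2) (qs1 @ q' # qs2) (bs1 @ d # bs2)"
            using less.prems s(1,4) sx by simp
          fix l assume "l \<le> c"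
            and Dl: "comp_data x (r1 @ l # (c - l) # r2) (xs1 @ v # v' # xs2) (qs1 @ q' # q' # qs2) (bs1 @ d # d # bs2)"
          show "comp_lhs x (r1 @ l # (c - l) # r2) (xs1 @ v # v' # xs2) (qs1 @ q' # q' # qs2) (bs1 @ d # d # bs2)
            = comp_rhs x (r1 @ l # (c - l) # r2) (xs1 @ v # v' # xs2) (qs1 @ q' # q' # qs2) (bs1 @ d # d # bs2)"
          proof (rule less.hyps[OF _ Dl])
            have "(card (supp (xs ! i)))\<^sup>2 = (card (supp v))\<^sup>2 + (card (supp v'))\<^sup>2 + 2 * (card (supp v) * card (supp v'))"
              unfolding card by (simp add: power2_eq_square algebra_simps)
            moreover have "0 < card (supp v) * card (supp v')" using pos by (rule mult_pos_pos)
            then have "Suc 0 < 2 * (card (supp v) * card (supp v'))" by linarith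
            moreover have "(\<Sum>v\<leftarrow>xs. (card (supp v))\<^sup>2) = (\<Sum>v\<leftarrow>xs1. (card (supp v))\<^sup>2) + ((card (supp (xs ! i)))\<^sup>2 + (\<Sum>v\<leftarrow>xs2. (card (supp v))\<^sup>2))"
              by (subst s(2)) simp
            ultimately show "length (r1 @ l # (c - l) # r2) + (\<Sum>v\<leftarrow>xs1 @ v # v' # xs2. (card (supp v))\<^sup>2)
                < length r + (\<Sum>v\<leftarrow>xs. (card (supp v))\<^sup>2)"
              using s(1) by simp
          qed
        qed (use s vP q q'_def in simp_all)
        then show ?thesis using s(1,4) sx by simp
      next
        case False
        then have "\<forall>i. \<exists>y. \<exists>c. i < length r \<longrightarrow> y \<in> B (sum_list (qs ! i)) \<and> xs ! i = (\<lambda>z. c * ind (orbR act (Symc (qs ! i)) y) z)"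
          by blast
        then obtain Yf C where YC: "\<And>i. i < length r \<Longrightarrow> Yf i \<in> B (sum_list (qs ! i))"
          "\<And>i. i < length r \<Longrightarrow> xs ! i = (\<lambda>z. C i * ind (orbR act (Symc (qs ! i)) (Yf i)) z)" by metis
        define ys where "ys = map Yf [0..<length r]"
        define es where "es = map (\<lambda>i. ind (orbR act (Symc (qs ! i)) (ys ! i)) :: 'o \<Rightarrow> 'k) [0..<length r]"
        define cs where "cs = map C [0..<length r]"
        have D1: "comp_data x r es qs bs"
          using DD(1-4,6) YC(1) by (auto simp: comp_data_def es_def ys_def Pinv_eq_Pfix intro!: ind_Pfix[OF Symc_subgrp])
        have "comp_lhs x r es qs bs = comp_rhs x r es qs bs"
          by (rule comp_law_left[OF law D1, of ys]) (use YC(1) in \<open>simp_all add: ys_def es_def\<close>)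
        moreover have "map (\<lambda>i z. cs ! i * (es ! i) z) [0..<length r] = xs"
          using YC(2) DD(2) by (intro nth_equalityI) (simp_all add: cs_def es_def ys_def)
        ultimately show ?thesis using comp_scale(2,3)[OF D1, of cs 1] by (simp add: cs_def)
      qed
    qed
  qed
qed

text \<open>The count of \<open>csum_lcomp_ind\<close> gives a multiple of one orbit sum;
  straightening carries that orbit to the orbit of the straightened element under the group of the
  composition, as \<gamma>6b has it.\<close>

lemma comp_rhs_ind:
  assumes x: "x \<in> B (sum_list r)" and l: "length xs = length r" "length qs = length r" "length bs = length r"
    and xs: "\<And>i. i < length r \<Longrightarrow> xs ! i \<in> B (sum_list (qs ! i))" "\<And>i. i < length r \<Longrightarrow> length (bs ! i) = length (qs ! i)"
  defines "X \<equiv> cmp x (concat (map (\<lambda>i. replicate (r ! i) (xs ! i)) [0..<length r]))"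
  defines "R \<equiv> diamond r qs"
  shows "comp_rhs (ind (orbR act (Symc r) x)) r (map (\<lambda>i. ind (orbR act (Symc (qs ! i)) (xs ! i))) [0..<length r]) qs bs
    = sc (of_nat (card (stab act (SymR (Mtot r qs) R) X) div
         (card (stab act (Symc r) x) * (\<Prod>i<length r. card (stab act (Symc (qs ! i)) (xs ! i)) ^ (r ! i)))))
       (beta (ind (orbR act (Symc (map card R)) (act (straighten (Mtot r qs) R) X))) (map card R) (concat bs))"
    "act (straighten (Mtot r qs) R) X \<in> B (sum_list (map card R))" "length (concat bs) = length (map card R)"
proof -
  let ?M = "Mtot r qs" and ?D = "dlab r qs" and ?P = "sum_list (map length qs)"
  let ?G = "SF ?M ?D" and ?es = "map (\<lambda>i. ind (orbR act (Symc (qs ! i)) (xs ! i)) :: 'o \<Rightarrow> 'k) [0..<length r]"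
  let ?k = "card (stab act ?G X) div
         (card (stab act (Symc r) x) * (\<Prod>i<length r. card (stab act (Symc (qs ! i)) (xs ! i)) ^ (r ! i)))"
  have R: "R = lparts ?M ?P ?D" unfolding R_def by (rule diamond_eq[OF l(2)])
  have cR: "map card R = cnt ?M ?P ?D" by (simp add: R cnt_def)
  have X: "X = cmp x (map (\<lambda>k. xs ! blk r k) [0..<sum_list r])"
    unfolding X_def using concat_replicate_nth[of r "(!) xs"] by simp
  have cX: "X \<in> B ?M" unfolding X by (rule csum_lcomp_ind(1)[OF l(2) x xs(1)])
  define \<tau> where "\<tau> = straighten ?M R"
  have st: "straightens ?M ?P ?D \<tau>" unfolding \<tau>_def R by (rule straightens_straighten) (rule dlab_less[OF l(2)])
  then have S: "\<tau> \<in> Sym ?M" by (simp add: straightens_def)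
  have n: "sum_list (map card R) = ?M" unfolding cR by (rule sum_cnt) (rule dlab_less[OF l(2)])
  have cj: "conj_by \<tau> ?G = Symc (map card R)"
    using SF_conj[OF S, of "blk (map card R)" ?D] st n by (simp add: straightens_def Symc_eq cR)
  show XB: "act (straighten (Mtot r qs) R) X \<in> B (sum_list (map card R))"
    using act_in[OF S cX] n by (simp add: \<tau>_def)
  have lb: "map length bs = map length qs" using l xs(2) by (intro nth_equalityI) simp_all
  show len: "length (concat bs) = length (map card R)" by (simp add: length_concat lb R lparts_def)
  have e: "comp_elt (ind (orbR act (Symc r) x)) r ?es
      = lcomp cmp (ind (orbR act (Symc r) x)) (map (\<lambda>k. ind (orbR act (Symc (qs ! blk r k)) (xs ! blk r k))) [0..<sum_list r])"
    unfolding comp_elt_def by (intro arg_cong[where f = "lcomp cmp _"] map_cong) (simp_all add: blk_props)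
  have cs: "csum ?G (wreath r qs) (\<lambda>\<tau>. lact B act ?M \<tau> (comp_elt (ind (orbR act (Symc r) x)) r ?es))
      = (\<lambda>z. of_nat ?k * ind (orbR act ?G X) z)"
    unfolding e X by (rule csum_lcomp_ind(2)[OF l(2) x xs(1)])
  have o: "lact B act ?M \<tau> (ind (orbR act ?G X)) = (ind (orbR act (Symc (map card R)) (act \<tau> X)) :: 'o \<Rightarrow> 'k)"
    by (simp only: lact_ind[OF S orbR_subset[OF SF_subgrp cX]] act_orbR_conj[OF S SF_subgrp cX] cj)
  have iP: "ind (orbR act (Symc (map card R)) (act \<tau> X)) \<in> Pinv B act (map card R)"
    unfolding Pinv_eq_Pfix by (rule ind_Pfix[OF Symc_subgrp]) (use XB \<tau>_def in simp)
  have "comp_rhs (ind (orbR act (Symc r) x)) r ?es qs bs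
     = beta (lact B act ?M \<tau> (\<lambda>z. of_nat ?k * ind (orbR act ?G X) z)) (map card R) (concat bs)"
    unfolding comp_rhs_def cs betaR_def R[symmetric] \<tau>_def[symmetric] by (rule refl)
  also have "\<dots> = sc (of_nat ?k) (beta (ind (orbR act (Symc (map card R)) (act \<tau> X))) (map card R) (concat bs))"
    unfolding lact_scale o by (rule beta_objD(7)[OF b iP len])
  finally show "comp_rhs (ind (orbR act (Symc r) x)) r ?es qs bs
    = sc (of_nat (card (stab act (SymR ?M R) X) div
         (card (stab act (Symc r) x) * (\<Prod>i<length r. card (stab act (Symc (qs ! i)) (xs ! i)) ^ (r ! i)))))
       (beta (ind (orbR act (Symc (map card R)) (act (straighten ?M R) X))) (map card R) (concat bs))"
    unfolding \<tau>_def R_def SymR_diamond[OF l(2)] .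
qed

lemma beta'_obj_iff:
  "beta'_obj B act u cmp sc beta \<longleftrightarrow> (\<forall>a. beta (delta u) [1] [a] = a) \<and>
    (\<forall>x r xs qs bs. comp_data x r xs qs bs \<longrightarrow> comp_lhs x r xs qs bs = comp_rhs x r xs qs bs)"
proof -
  have e: "concat (map (\<lambda>i. replicate (r ! i) (xs ! i)) [0..<length r]) = map (\<lambda>k. xs ! blk r k) [0..<sum_list r]" for r and xs :: "('o \<Rightarrow> 'k) list"
    using concat_replicate_nth[of r "(!) xs"] .
  have "comp_rhs x r xs qs bs = betaR (Mtot r qs) beta B act
          (csum (SymR (Mtot r qs) (diamond r qs)) (wreath r qs)
             (\<lambda>\<tau>. lact B act (Mtot r qs) \<tau>
                 (lcomp cmp x (concat (map (\<lambda>i. replicate (r ! i) (xs ! i)) [0..<length r])))))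
          (diamond r qs) (concat bs)" if "comp_data x r xs qs bs" for x r xs qs bs
    unfolding comp_rhs_def comp_elt_def e SymR_diamond[OF comp_dataD(3)[OF that]] unfolding diamond_eq[OF comp_dataD(3)[OF that]] by (rule refl)
  then have "(\<forall>x r xs qs bs. comp_data x r xs qs bs \<longrightarrow> comp_lhs x r xs qs bs = comp_rhs x r xs qs bs) \<longleftrightarrow>
     (\<forall>x r xs qs bs. comp_data x r xs qs bs \<longrightarrow> comp_lhs x r xs qs bs = betaR (Mtot r qs) beta B act
          (csum (SymR (Mtot r qs) (diamond r qs)) (wreath r qs)
             (\<lambda>\<tau>. lact B act (Mtot r qs) \<tau>
                 (lcomp cmp x (concat (map (\<lambda>i. replicate (r ! i) (xs ! i)) [0..<length r])))))
          (diamond r qs) (concat bs))" by simp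
  then show ?thesis unfolding beta'_obj_def using b by (simp only: comp_data_def comp_lhs_def simp_thms)
qed

end

section \<open>The two kinds of objects\<close>

text \<open>Linearity is only available on invariants: an operation of \<beta> is set to 0 elsewhere
  and is not linear in the whole function space.\<close>

definition lin_on :: "('k::field \<Rightarrow> 'a::ab_group_add \<Rightarrow> 'a) \<Rightarrow> ('o \<Rightarrow> 'k) set \<Rightarrow> (('o \<Rightarrow> 'k) \<Rightarrow> 'a) \<Rightarrow> bool" where
  "lin_on sc S F \<longleftrightarrow> (\<forall>x\<in>S. \<forall>y\<in>S. F (\<lambda>z. x z + y z) = F x + F y) \<and> (\<forall>c. \<forall>x\<in>S. F (\<lambda>z. c * x z) = sc c (F x))"

lemma lin_on_add: "lin_on sc S F \<Longrightarrow> x \<in> S \<Longrightarrow> y \<in> S \<Longrightarrow> F (\<lambda>z. x z + y z) = F x + F y"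
  unfolding lin_on_def by blast

lemma lin_on_scale: "lin_on sc S F \<Longrightarrow> x \<in> S \<Longrightarrow> F (\<lambda>z. c * x z) = sc c (F x)"
  unfolding lin_on_def by blast

lemma lin_onI:
  assumes "\<And>x y. x \<in> S \<Longrightarrow> y \<in> S \<Longrightarrow> F (\<lambda>z. x z + y z) = F x + F y"
    "\<And>c x. x \<in> S \<Longrightarrow> F (\<lambda>z. c * x z) = sc c (F x)"
  shows "lin_on sc S F"
  unfolding lin_on_def using assms by blast

lemma (in vector_space) lin_on_zero:
  assumes "lin_on scale S F" "(\<lambda>z. 0) \<in> S"
  shows "F (\<lambda>z. 0) = 0"
  using lin_on_scale[OF assms, of 0] by simp

lemma lin_on_compose:
  assumes "lin_on sc S' F" "\<And>x. x \<in> S \<Longrightarrow> T x \<in> S'"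
    "\<And>x y. T (\<lambda>z. x z + y z) = (\<lambda>z. T x z + T y z)" "\<And>c x. T (\<lambda>z. c * x z) = (\<lambda>z. c * T x z)"
  shows "lin_on sc S (\<lambda>x. F (T x))"
  by (rule lin_onI) (simp_all only: assms(3,4) lin_on_add[OF assms(1) assms(2) assms(2)] lin_on_scale[OF assms(1) assms(2)])

lemma lin_on_subset: "lin_on sc S' F \<Longrightarrow> S \<subseteq> S' \<Longrightarrow> lin_on sc S F"
  unfolding lin_on_def by blast

lemma Symc_Cons_0: "Symc (0 # r) = Symc r"
proof -
  have "SF (sum_list r) (blk (0 # r)) = SF (sum_list r) (\<lambda>k. Suc (blk r k))"
    by (rule SF_cong) (simp add: blk_Cons)
  also have "\<dots> = SF (sum_list r) (blk r)" by (rule SF_inj[where S = UNIV]) simp_all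
  finally show ?thesis by (simp add: Symc_eq)
qed

lemma Pinv_Cons_0: "Pinv B act (0 # r) = Pinv B act r"
  by (simp add: Pinv_eq_Pfix Symc_Cons_0)

lemma Symc_tri: "sum_list q = length r \<Longrightarrow> Symc r \<subseteq> Symc (tri q r)"
  unfolding Symc_eq sum_tri by (rule SF_mono[where h = "blk q"]) (rule blk_tri)

lemma Symc_tri_subgrp: "sum_list q = length r \<Longrightarrow> subgrp (sum_list r) (Symc (tri q r))"
  using Symc_subgrp[of "tri q r"] by (simp add: sum_tri)

lemma conj_block_perm:
  assumes "\<rho> \<in> Sym (length r)"
  shows "conj_by (block_perm r \<rho>) (Symc r) = Symc (plist \<rho> r)"
proof -
  have "SF (sum_list r) (\<lambda>k. \<rho> (blk r k)) = SF (sum_list r) (blk r)"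
    using bij_is_inj[OF Sym_bij[OF assms]] by (intro SF_inj[where S = UNIV]) auto
  then show ?thesis
    using SF_conj[OF block_perm_Sym[OF assms], of "blk (plist \<rho> r)" "\<lambda>k. \<rho> (blk r k)"] blk_block_perm(1)[OF assms]
    by (simp add: Symc_eq sum_plist[OF assms])
qed

lemma length_concat_replicate:
  "length as = length q \<Longrightarrow> length (concat (map (\<lambda>j. replicate (q ! j) (as ! j)) [0..<length q])) = sum_list q"
  by (simp add: concat_replicate_nth)

section \<open>Extending identities from orbit sums to all invariants\<close>

context set_op
begin

text \<open>By \<open>Pfix_induct\<close>, two maps that are linear on the invariants and agree on
  orbit sums are equal there. The axioms \<beta>1 to \<beta>5 and the comparison of morphisms are
  reduced in this way.\<close>

lemma linear_ext:
  fixes F G :: "('o \<Rightarrow> 'k::field) \<Rightarrow> 'a::ab_group_add"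
  assumes vs: "vector_space sc" and F: "lin_on sc (Pinv B act r) F" and G: "lin_on sc (Pinv B act r) G"
    and eq: "\<And>y. y \<in> B (sum_list r) \<Longrightarrow> F (ind (orbc act r y)) = G (ind (orbc act r y))" and x: "x \<in> Pinv B act r"
  shows "F x = G x"
proof -
  interpret vector_space sc by (rule vs)
  have "x \<in> Pfix B act (sum_list r) (Symc r)" using x by (simp add: Pinv_eq_Pfix)
  then show ?thesis
  proof (rule Pfix_induct[OF Symc_subgrp, where P = "\<lambda>x. F x = G x"])
    have z: "(\<lambda>z. 0) \<in> Pinv B act r" by (simp add: Pinv_eq_Pfix Pfix_zero)
    show "F (\<lambda>z. 0) = G (\<lambda>z. 0)" by (simp only: lin_on_zero[OF F z] lin_on_zero[OF G z])
    fix y w and c :: 'k assume y: "y \<in> B (sum_list r)" and w: "w \<in> Pfix B act (sum_list r) (Symc r)" and P: "F w = G w"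
    have i: "(ind (orbR act (Symc r) y) :: 'o \<Rightarrow> 'k) \<in> Pinv B act r" unfolding Pinv_eq_Pfix by (rule ind_Pfix[OF Symc_subgrp y])
    have ci: "(\<lambda>z. c * ind (orbR act (Symc r) y) z) \<in> Pinv B act r" using i by (simp add: Pinv_eq_Pfix Pfix_scale)
    have w': "w \<in> Pinv B act r" using w by (simp add: Pinv_eq_Pfix)
    have "F (\<lambda>z. c * ind (orbR act (Symc r) y) z + w z) = sc c (F (ind (orbR act (Symc r) y))) + F w"
      by (simp only: lin_on_add[OF F ci w'] lin_on_scale[OF F i])
    moreover have "G (\<lambda>z. c * ind (orbR act (Symc r) y) z + w z) = sc c (G (ind (orbR act (Symc r) y))) + G w"
      by (simp only: lin_on_add[OF G ci w'] lin_on_scale[OF G i])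
    ultimately show "F (\<lambda>z. c * ind (orbR act (Symc r) y) z + w z) = G (\<lambda>z. c * ind (orbR act (Symc r) y) z + w z)"
      using eq[OF y] P by (simp add: orbc_eq_orbR)
  qed
qed

lemma ind_Pinv: "y \<in> B (sum_list r) \<Longrightarrow> ind (orbc act r y) \<in> Pinv B act r"
  unfolding Pinv_eq_Pfix orbc_eq_orbR by (rule ind_Pfix[OF Symc_subgrp])

lemma lact_block_perm_ind:
  assumes "\<rho> \<in> Sym (length r)" "x \<in> B (sum_list r)"
  shows "lact B act (sum_list r) (block_perm r \<rho>) (ind (orbc act r x)) = ind (orbc act (plist \<rho> r) (act (block_perm r \<rho>) x))"
  unfolding orbc_eq_orbR lact_ind[OF block_perm_Sym[OF assms(1)] orbR_subset[OF Symc_subgrp assms(2)]]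
    act_orbR_conj[OF block_perm_Sym[OF assms(1)] Symc_subgrp assms(2)] conj_block_perm[OF assms(1)] by (rule refl)

lemma Pinv_block_perm:
  "\<rho> \<in> Sym (length r) \<Longrightarrow> x \<in> Pinv B act r \<Longrightarrow> lact B act (sum_list r) (block_perm r \<rho>) x \<in> Pinv B act (plist \<rho> r)"
  using Pfix_conj[OF block_perm_Sym Symc_subgrp] by (simp add: Pinv_eq_Pfix conj_block_perm sum_plist)

lemma csum_tri_ind:
  assumes "sum_list q = length r" "x \<in> B (sum_list r)"
  shows "csum (Symc (tri q r)) (Symc r) (\<lambda>\<sigma>. lact B act (sum_list r) \<sigma> (ind (orbc act r x)))
    = (\<lambda>z. of_nat (card (stab act (Symc (tri q r)) x) div card (stab act (Symc r) x)) * (ind (orbc act (tri q r) x) z :: 'k::field))"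
  unfolding orbc_eq_orbR by (rule csum_ind[OF Symc_tri_subgrp[OF assms(1)] Symc_subgrp Symc_tri[OF assms(1)] assms(2)])

lemma csum_tri_Pinv:
  assumes "sum_list q = length r" "x \<in> Pinv B act r"
  shows "csum (Symc (tri q r)) (Symc r) (\<lambda>\<sigma>. lact B act (sum_list r) \<sigma> x) \<in> Pinv B act (tri q r)"
  using csum_Pfix[OF Symc_tri_subgrp[OF assms(1)] Symc_subgrp Symc_tri[OF assms(1)]] assms
  by (simp add: Pinv_eq_Pfix sum_tri)

text \<open>An orbit is the disjoint union of the orbits of a subgroup that it contains. This is the
  inner sum in \<gamma>5.\<close>

lemma ind_refine:
  assumes s: "sum_list r' = sum_list r" "Symc r' \<subseteq> Symc r" and x: "x \<in> B (sum_list r)"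
  shows "ind (orbc act r x) = (\<lambda>z. \<Sum>Q\<in>orbc act r' ` orbc act r x. (ind Q z :: 'k::field))"
proof
  fix z
  let ?S = "orbc act r' ` orbc act r x"
  note g = Symc_subgrp[of r] and g' = Symc_subgrp[of r', unfolded s(1)]
  have fin: "finite ?S" using subgrp_finite[OF g] by (simp add: orbc_def)
  have sub: "orbc act r x \<subseteq> B (sum_list r)" unfolding orbc_eq_orbR by (rule orbR_subset[OF g x])
  \<comment> \<open>A point of the large orbit lies in exactly one of the small ones, its own; hence
    one nonzero summand.\<close>
  have iff: "z \<in> Q \<longleftrightarrow> z \<in> orbc act r x \<and> Q = orbc act r' z" if Q: "Q \<in> ?S" for Q
  proof -
    obtain y where y: "y \<in> orbc act r x" "Q = orbc act r' y" using Q by blast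
    have yB: "y \<in> B (sum_list r)" using y sub by blast
    show ?thesis
    proof
      assume z: "z \<in> Q"
      have "orbc act r y = orbc act r x" using orbR_eq[OF g x] y(1) by (simp add: orbc_eq_orbR)
      moreover have "z \<in> orbc act r y" using z s(2) unfolding y(2) orbc_def by blast
      ultimately show "z \<in> orbc act r x \<and> Q = orbc act r' z"
        using orbR_eq[OF g' yB] z y(2) by (simp add: orbc_eq_orbR)
    next
      assume z: "z \<in> orbc act r x \<and> Q = orbc act r' z"
      then show "z \<in> Q" using orbR_self[OF g'] sub by (auto simp: orbc_eq_orbR)
    qed
  qed
  have "(\<Sum>Q\<in>?S. (ind Q z :: 'k)) = (\<Sum>Q\<in>?S. if Q = orbc act r' z then (if z \<in> orbc act r x then 1 else 0) else 0)"
    using iff by (intro sum.cong) (auto simp: ind_def)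
  also have "\<dots> = ind (orbc act r x) z" using fin by (auto simp: sum.delta ind_def)
  finally show "ind (orbc act r x) z = (\<Sum>Q\<in>?S. (ind Q z :: 'k))" by simp
qed

text \<open>The symmetric group on one letter is trivial, so the orbit sum of the unit is
  \<open>delta u\<close> and the two unit axioms coincide.\<close>

lemma orbc_unit: "orbc act [1] u = {u}"
proof -
  have "Sym 1 = {id}" unfolding Sym_def by (auto simp: permutes_sing lessThan_Suc)
  then have "Symc [1] = {id}"
    using subgrpD(2)[OF Symc_subgrp[of "[1]"]] Symc_Sym[of _ "[1]"] by auto
  then show ?thesis using act_id[OF unit_in] by (simp add: orbc_def)
qed

lemma split_hd:
  assumes "r \<noteq> []" "l \<le> hd r"
  shows "sum_list (l # (hd r - l) # tl r) = sum_list r" "Symc (l # (hd r - l) # tl r) \<subseteq> Symc r"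
    "Pinv B act r \<subseteq> Pinv B act (l # (hd r - l) # tl r)"
proof -
  obtain c r2 where r: "r = c # r2" using assms(1) by (cases r) auto
  show s: "sum_list (l # (hd r - l) # tl r) = sum_list r" using r assms(2) by simp
  show sub: "Symc (l # (hd r - l) # tl r) \<subseteq> Symc r"
    unfolding Symc_eq s
  proof (rule SF_mono[where h = "\<lambda>j. if j \<le> 0 then j else j - 1"])
    fix k assume "k < sum_list r"
    then show "blk r k = (if blk (l # (hd r - l) # tl r) k \<le> 0 then blk (l # (hd r - l) # tl r) k else blk (l # (hd r - l) # tl r) k - 1)"
      using blk_split[of k "[]" l "c - l" r2] r assms(2) by simp
  qed
  show "Pinv B act r \<subseteq> Pinv B act (l # (hd r - l) # tl r)"
    unfolding Pinv_eq_Pfix s by (rule Pfix_mono[OF sub])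
qed

end

section \<open>From \<beta> to \<gamma>\<close>

context beta_law
begin

lemma lin_on_beta: "length as = length r \<Longrightarrow> lin_on sc (Pinv B act r) (\<lambda>x. beta x r as)"
  by (rule lin_onI) (simp_all add: beta_objD(6)[OF b] beta_objD(7)[OF b])

abbreviation gam :: "'o set \<Rightarrow> nat list \<Rightarrow> 'a list \<Rightarrow> 'a" where "gam \<equiv> Pfun B act beta"

lemma gam_ind:
  assumes "x \<in> B (sum_list r)" "length as = length r"
  shows "gam (orbc act r x) r as = beta (ind (orbc act r x)) r as"
  using assms by (auto simp: Pfun_def gamma_dom_def ind_def)

text \<open>Each axiom is the corresponding one for \<beta> on an orbit sum. The coefficient in
  \<gamma>4 comes from the coset sum of an orbit sum, the inner sum in \<gamma>5 from decomposing an
  orbit.\<close>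

lemma gamma_obj_Pfun: "gamma_obj B act sc gam"
  unfolding gamma_obj_def
proof (intro conjI allI impI; (elim conjE)?)
  show "\<not> gamma_dom B act Q r as \<Longrightarrow> gam Q r as = 0" for Q r as by (simp add: Pfun_def)
next
  fix x r \<rho> and as :: "'a list" assume a: "x \<in> B (sum_list r)" "length as = length r" "\<rho> \<in> Sym (length r)"
  have xB: "act (block_perm r \<rho>) x \<in> B (sum_list (plist \<rho> r))"
    using act_in[OF block_perm_Sym[OF a(3)] a(1)] by (simp add: sum_plist[OF a(3)])
  have l: "length (plist \<rho> as) = length (plist \<rho> r)" using a(2) by simp
  have "gam (orbc act r x) r as = beta (ind (orbc act r x)) r as" by (rule gam_ind[OF a(1,2)])
  also have "\<dots> = beta (lact B act (sum_list r) (block_perm r \<rho>) (ind (orbc act r x))) (plist \<rho> r) (plist \<rho> as)"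
    by (rule beta_objD(2)[OF b ind_Pinv[OF a(1)] a(2,3)])
  also have "\<dots> = beta (ind (orbc act (plist \<rho> r) (act (block_perm r \<rho>) x))) (plist \<rho> r) (plist \<rho> as)"
    by (simp only: lact_block_perm_ind[OF a(3,1)])
  also have "\<dots> = gam (orbc act (plist \<rho> r) (act (block_perm r \<rho>) x)) (plist \<rho> r) (plist \<rho> as)"
    by (rule gam_ind[OF xB l, symmetric])
  finally have e: "gam (orbc act r x) r as = gam (orbc act (plist \<rho> r) (act (block_perm r \<rho>) x)) (plist \<rho> r) (plist \<rho> as)" .
  show "gam (orbc act r x) r as = gam (orbc act (plist \<rho> r) (act (block_perm r \<rho>) x)) (plist \<rho> r) (plist \<rho> as)"
    by (rule e)
next
  fix x r and a0 :: 'a and as :: "'a list" assume a: "x \<in> B (sum_list r)" "length as = length r"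
  then have x0: "x \<in> B (sum_list (0 # r))" and l0: "length (a0 # as) = length (0 # r)" by simp_all
  have o: "orbc act (0 # r) x = orbc act r x" by (simp add: orbc_eq_orbR Symc_Cons_0)
  show "gam (orbc act (0 # r) x) (0 # r) (a0 # as) = gam (orbc act r x) r as"
    unfolding gam_ind[OF x0 l0] gam_ind[OF a]
    using beta_objD(8)[OF b ind_Pinv[OF x0] a(2), of a0] unfolding o .
next
  fix x r c and a :: 'a and as :: "'a list" assume a: "x \<in> B (sum_list r)" "length (a # as) = length r"
  then have l: "length (sc c a # as) = length r" by simp
  show "gam (orbc act r x) r (sc c a # as) = sc (c ^ hd r) (gam (orbc act r x) r (a # as))"
    unfolding gam_ind[OF a(1) l] gam_ind[OF a] by (rule beta_objD(3)[OF b ind_Pinv[OF a(1)] a(2)])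
next
  fix x r q and as :: "'a list" assume a: "x \<in> B (sum_list r)" "sum_list q = length r" "length as = length q"
  let ?as = "concat (map (\<lambda>j. replicate (q ! j) (as ! j)) [0..<length q])"
  have xt: "x \<in> B (sum_list (tri q r))" "length as = length (tri q r)" using a by (simp_all add: sum_tri)
  have "gam (orbc act r x) r ?as = beta (ind (orbc act r x)) r ?as"
    using length_concat_replicate[OF a(3)] a(2) by (intro gam_ind[OF a(1)]) simp
  also have "\<dots> = sc (of_nat (card (stab act (Symc (tri q r)) x) div card (stab act (Symc r) x))) (beta (ind (orbc act (tri q r) x)) (tri q r) as)"
    unfolding beta_objD(4)[OF b ind_Pinv[OF a(1)] a(2,3)] csum_tri_ind[OF a(2,1)]
    by (rule beta_objD(7)[OF b ind_Pinv[OF xt(1)] xt(2)])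
  finally show "gam (orbc act r x) r ?as =
        sc (of_nat (card (stab act (Symc (tri q r)) x) div card (stab act (Symc r) x))) (gam (orbc act (tri q r) x) (tri q r) as)"
    using gam_ind[OF xt] by simp
next
  fix x r and a0 a1 :: 'a and as :: "'a list" assume a: "x \<in> B (sum_list r)" "length (a1 # as) = length r"
  then have ne: "r \<noteq> []" and la: "length ((a0 + a1) # as) = length r" by auto
  have "gam (orbc act r x) r ((a0 + a1) # as) = (\<Sum>l\<le>hd r. beta (ind (orbc act r x)) (l # (hd r - l) # tl r) (a0 # a1 # as))"
    using gam_ind[OF a(1) la] beta_objD(5)[OF b ind_Pinv[OF a(1)] a(2)] by simp
  also have "\<dots> = (\<Sum>l\<le>hd r. \<Sum>Q\<in>orbc act (l # (hd r - l) # tl r) ` orbc act r x. gam Q (l # (hd r - l) # tl r) (a0 # a1 # as))"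
  proof (rule sum.cong[OF refl])
    fix l assume "l \<in> {..hd r}"
    then have l: "l \<le> hd r" by simp
    let ?r = "l # (hd r - l) # tl r"
    note sp = split_hd[OF ne l]
    have len: "length (a0 # a1 # as) = length ?r" using a(2) by simp
    have yB: "y \<in> B (sum_list ?r)" if "y \<in> orbc act r x" for y
      using that orbR_subset[OF Symc_subgrp a(1)] sp(1) by (auto simp: orbc_eq_orbR)
    have "beta (ind (orbc act r x)) ?r (a0 # a1 # as) = (\<Sum>Q\<in>orbc act ?r ` orbc act r x. beta (ind Q) ?r (a0 # a1 # as))"
      unfolding ind_refine[OF sp(1,2) a(1)]
    proof (rule beta_sum[OF _ _ len])
      show "finite (orbc act ?r ` orbc act r x)" using subgrp_finite[OF Symc_subgrp] by (simp add: orbc_def)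
      show "ind Q \<in> Pinv B act ?r" if "Q \<in> orbc act ?r ` orbc act r x" for Q using that yB ind_Pinv by blast
    qed
    also have "\<dots> = (\<Sum>Q\<in>orbc act ?r ` orbc act r x. gam Q ?r (a0 # a1 # as))"
      using gam_ind[OF yB len] by (intro sum.cong) auto
    finally show "beta (ind (orbc act r x)) ?r (a0 # a1 # as) = (\<Sum>Q\<in>orbc act ?r ` orbc act r x. gam Q ?r (a0 # a1 # as))" .
  qed
  finally show "gam (orbc act r x) r ((a0 + a1) # as)
    = (\<Sum>l\<le>hd r. \<Sum>Q\<in>orbc act (l # (hd r - l) # tl r) ` orbc act r x. gam Q (l # (hd r - l) # tl r) (a0 # a1 # as))" .
qed

lemma gam_unit: "gam (orbc act [1] u) [1] [a] = beta (delta u) [1] [a]"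
  using gam_ind[of u "[1]" "[a]"] unit_in unfolding orbc_unit by (simp add: ind_def delta_def)

text \<open>On orbit sums \<open>beta\<close> and \<open>gam\<close> agree by definition, and
  \<open>comp_rhs_ind\<close> has put the right-hand side into the shape of \<gamma>6b.\<close>

lemma basis_law_iff:
  "basis_law \<longleftrightarrow> (\<forall>x r xs qs as. x \<in> B (sum_list r) \<and> length xs = length r \<and> length qs = length r \<and> length as = length r \<and>
     (\<forall>i<length r. xs ! i \<in> B (sum_list (qs ! i)) \<and> length (as ! i) = length (qs ! i)) \<longrightarrow>
     gam (orbc act r x) r (map (\<lambda>i. gam (orbc act (qs ! i) (xs ! i)) (qs ! i) (as ! i)) [0..<length r]) =
     (let X = cmp x (concat (map (\<lambda>i. replicate (r ! i) (xs ! i)) [0..<length r])) in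
         sc (of_nat (card (stab act (SymR (Mtot r qs) (diamond r qs)) X) div
                     (card (stab act (Symc r) x) * (\<Prod>i<length r. card (stab act (Symc (qs ! i)) (xs ! i)) ^ (r ! i)))))
            (gammaR (Mtot r qs) gam act X (diamond r qs) (concat as))))"
proof -
  have L: "comp_lhs (ind (orbR act (Symc r) x)) r (map (\<lambda>i. ind (orbR act (Symc (qs ! i)) (xs ! i))) [0..<length r]) qs as
      = gam (orbc act r x) r (map (\<lambda>i. gam (orbc act (qs ! i) (xs ! i)) (qs ! i) (as ! i)) [0..<length r])"
    and R: "comp_rhs (ind (orbR act (Symc r) x)) r (map (\<lambda>i. ind (orbR act (Symc (qs ! i)) (xs ! i))) [0..<length r]) qs as
      = (let X = cmp x (concat (map (\<lambda>i. replicate (r ! i) (xs ! i)) [0..<length r])) in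
         sc (of_nat (card (stab act (SymR (Mtot r qs) (diamond r qs)) X) div
                     (card (stab act (Symc r) x) * (\<Prod>i<length r. card (stab act (Symc (qs ! i)) (xs ! i)) ^ (r ! i)))))
            (gammaR (Mtot r qs) gam act X (diamond r qs) (concat as)))"
    if x: "x \<in> B (sum_list r)" and l: "length xs = length r" "length qs = length r" "length as = length r"
      and xs: "\<And>i. i < length r \<Longrightarrow> xs ! i \<in> B (sum_list (qs ! i))" "\<And>i. i < length r \<Longrightarrow> length (as ! i) = length (qs ! i)"
    for x r xs qs as
  proof -
    have mm: "map (\<lambda>i. beta (map (\<lambda>i. ind (orbR act (Symc (qs ! i)) (xs ! i))) [0..<length r] ! i) (qs ! i) (as ! i)) [0..<length r]
       = map (\<lambda>i. gam (orbc act (qs ! i) (xs ! i)) (qs ! i) (as ! i)) [0..<length r]"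
      using gam_ind[OF xs(1) xs(2)] by (intro map_cong) (simp_all add: orbc_eq_orbR)
    show "comp_lhs (ind (orbR act (Symc r) x)) r (map (\<lambda>i. ind (orbR act (Symc (qs ! i)) (xs ! i))) [0..<length r]) qs as
      = gam (orbc act r x) r (map (\<lambda>i. gam (orbc act (qs ! i) (xs ! i)) (qs ! i) (as ! i)) [0..<length r])"
      unfolding comp_lhs_def mm by (subst gam_ind[OF x]) (simp_all add: orbc_eq_orbR)
    show "comp_rhs (ind (orbR act (Symc r) x)) r (map (\<lambda>i. ind (orbR act (Symc (qs ! i)) (xs ! i))) [0..<length r]) qs as
      = (let X = cmp x (concat (map (\<lambda>i. replicate (r ! i) (xs ! i)) [0..<length r])) in
         sc (of_nat (card (stab act (SymR (Mtot r qs) (diamond r qs)) X) div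
                     (card (stab act (Symc r) x) * (\<Prod>i<length r. card (stab act (Symc (qs ! i)) (xs ! i)) ^ (r ! i)))))
            (gammaR (Mtot r qs) gam act X (diamond r qs) (concat as)))"
    proof -
      let ?X = "cmp x (concat (map (\<lambda>i. replicate (r ! i) (xs ! i)) [0..<length r]))" and ?R = "diamond r qs"
      have "act (straighten (Mtot r qs) ?R) ?X \<in> B (sum_list (map card ?R))" by (rule comp_rhs_ind(2)[OF x l xs])
      moreover have "length (concat as) = length (map card ?R)" by (rule comp_rhs_ind(3)[OF x l xs])
      ultimately have gi: "gam (orbc act (map card ?R) (act (straighten (Mtot r qs) ?R) ?X)) (map card ?R) (concat as)
          = beta (ind (orbc act (map card ?R) (act (straighten (Mtot r qs) ?R) ?X))) (map card ?R) (concat as)"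
        by (rule gam_ind)
      show ?thesis unfolding Let_def gammaR_def gi unfolding orbc_eq_orbR by (rule comp_rhs_ind(1)[OF x l xs])
    qed
  qed
  show ?thesis unfolding basis_law_def by (intro iff_allI imp_cong refl) (simp add: L R)
qed

lemma gamma'_obj_Pfun:
  assumes "beta'_obj B act u cmp sc beta"
  shows "gamma'_obj B act u cmp sc gam"
proof -
  have law: "comp_lhs x r xs qs bs = comp_rhs x r xs qs bs" if "comp_data x r xs qs bs" for x r xs qs bs
    using assms that unfolding beta'_obj_iff by blast
  have basis_law
    unfolding basis_law_def
  proof (intro allI impI, elim conjE, rule law)
    fix x r xs qs and bs :: "'a list list"
    assume "x \<in> B (sum_list r)" "length xs = length r" "length qs = length r" "length bs = length r"
      "\<forall>i<length r. xs ! i \<in> B (sum_list (qs ! i)) \<and> length (bs ! i) = length (qs ! i)"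
    then show "comp_data (ind (orbR act (Symc r) x)) r (map (\<lambda>i. ind (orbR act (Symc (qs ! i)) (xs ! i))) [0..<length r]) qs bs"
      using ind_Pinv unfolding orbc_eq_orbR by (auto simp: comp_data_def)
  qed
  moreover have "gam (orbc act [1] u) [1] [a] = a" for a using assms unfolding gam_unit beta'_obj_iff by blast
  ultimately show ?thesis unfolding gamma'_obj_def basis_law_iff[symmetric] using gamma_obj_Pfun by blast
qed

text \<open>The direction that needs the polynomial reduction: \<gamma>6b only gives \<beta>7b on
  orbit sums, and \<open>comp_law\<close> extends it to all invariants.\<close>

lemma beta'_obj_from_Pfun:
  assumes "gamma'_obj B act u cmp sc gam"
  shows "beta'_obj B act u cmp sc beta"
proof -
  have basis_law using assms unfolding gamma'_obj_def basis_law_iff[symmetric] by blast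
  moreover have "beta (delta u) [1] [a] = a" for a
    using assms unfolding gamma'_obj_def gam_unit[symmetric] by blast
  ultimately show ?thesis unfolding beta'_obj_iff using comp_law by blast
qed

end

lemma gamma_objD:
  assumes "gamma_obj B act sc gamma"
  shows "\<And>Q r as. \<not> gamma_dom B act Q r as \<Longrightarrow> gamma Q r as = 0"
    and "\<And>x r as \<rho>. x \<in> B (sum_list r) \<Longrightarrow> length as = length r \<Longrightarrow> \<rho> \<in> Sym (length r) \<Longrightarrow>
        gamma (orbc act r x) r as =
        gamma (orbc act (plist \<rho> r) (act (block_perm r \<rho>) x)) (plist \<rho> r) (plist \<rho> as)"
    and "\<And>x r a0 as. x \<in> B (sum_list r) \<Longrightarrow> length as = length r \<Longrightarrow>
        gamma (orbc act (0 # r) x) (0 # r) (a0 # as) = gamma (orbc act r x) r as"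
    and "\<And>x r a as c. x \<in> B (sum_list r) \<Longrightarrow> length (a # as) = length r \<Longrightarrow>
        gamma (orbc act r x) r (sc c a # as) = sc (c ^ hd r) (gamma (orbc act r x) r (a # as))"
    and "\<And>x r q as. x \<in> B (sum_list r) \<Longrightarrow> sum_list q = length r \<Longrightarrow> length as = length q \<Longrightarrow>
        gamma (orbc act r x) r (concat (map (\<lambda>j. replicate (q ! j) (as ! j)) [0..<length q])) =
        sc (of_nat (card (stab act (Symc (tri q r)) x) div card (stab act (Symc r) x)))
           (gamma (orbc act (tri q r) x) (tri q r) as)"
    and "\<And>x r a0 a1 as. x \<in> B (sum_list r) \<Longrightarrow> length (a1 # as) = length r \<Longrightarrow>
        gamma (orbc act r x) r ((a0 + a1) # as) =
        (\<Sum>l\<le>hd r. \<Sum>Q\<in>orbc act (l # (hd r - l) # tl r) ` orbc act r x.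
            gamma Q (l # (hd r - l) # tl r) (a0 # a1 # as))"
proof (goal_cases)
  case 1 then show ?case using assms[unfolded gamma_obj_def, THEN conjunct1] by blast
next
  case 2 then show ?case using assms[unfolded gamma_obj_def, THEN conjunct2, THEN conjunct1] by blast
next
  case 3 then show ?case using assms[unfolded gamma_obj_def, THEN conjunct2, THEN conjunct2, THEN conjunct1] by blast
next
  case 4 then show ?case using assms[unfolded gamma_obj_def, THEN conjunct2, THEN conjunct2, THEN conjunct2, THEN conjunct1] by blast
next
  case 5 then show ?case using assms[unfolded gamma_obj_def, THEN conjunct2, THEN conjunct2, THEN conjunct2, THEN conjunct2, THEN conjunct1] by blast
next
  case 6 then show ?case using assms[unfolded gamma_obj_def, THEN conjunct2, THEN conjunct2, THEN conjunct2, THEN conjunct2, THEN conjunct2] by blast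
qed

section \<open>From \<gamma> to \<beta>\<close>

locale gamma_law = set_op B act u cmp + vector_space sc
  for B :: "nat \<Rightarrow> 'o set" and act u cmp and sc :: "'k::field \<Rightarrow> 'a::ab_group_add \<Rightarrow> 'a" +
  fixes gamma :: "'o set \<Rightarrow> nat list \<Rightarrow> 'a list \<Rightarrow> 'a"
  assumes g: "gamma_obj B act sc gamma"
begin

text \<open>The linear extension of \<gamma> from orbit sums. The coefficient of an orbit is read at
  an arbitrary point of it, which is harmless because \<open>x\<close> is constant on
  orbits.\<close>

definition bet :: "('o \<Rightarrow> 'k) \<Rightarrow> nat list \<Rightarrow> 'a list \<Rightarrow> 'a" where
  "bet x r as = (if beta_dom B act x r as
     then \<Sum>Q\<in>orbc act r ` supp x. sc (x (SOME y. y \<in> Q)) (gamma Q r as) else 0)"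

lemma orbc_some:
  assumes "x \<in> Pinv B act r" "y \<in> B (sum_list r)"
  shows "x (SOME z. z \<in> orbc act r y) = x y"
proof -
  have "y \<in> orbc act r y" unfolding orbc_eq_orbR by (rule orbR_self[OF Symc_subgrp assms(2)])
  then have "(SOME z. z \<in> orbc act r y) \<in> orbc act r y" by (rule someI[of "\<lambda>z. z \<in> orbc act r y"])
  then show ?thesis using Pfix_const[OF Symc_subgrp _ assms(2)] assms(1) by (simp add: Pinv_eq_Pfix orbc_eq_orbR)
qed

text \<open>For additivity, two operations with different supports must be summed over the same
  orbits; extra orbits carry coefficient 0.\<close>

lemma bet_superset:
  assumes x: "x \<in> Pinv B act r" and l: "length as = length r" and Y: "finite Y" "supp x \<subseteq> Y" "Y \<subseteq> B (sum_list r)"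
  shows "bet x r as = (\<Sum>Q\<in>orbc act r ` Y. sc (x (SOME y. y \<in> Q)) (gamma Q r as))"
proof -
  have "bet x r as = (\<Sum>Q\<in>orbc act r ` supp x. sc (x (SOME y. y \<in> Q)) (gamma Q r as))"
    using x l by (simp add: bet_def beta_dom_def)
  also have "\<dots> = (\<Sum>Q\<in>orbc act r ` Y. sc (x (SOME y. y \<in> Q)) (gamma Q r as))"
  proof (rule sum.mono_neutral_left)
    show "\<forall>Q\<in>orbc act r ` Y - orbc act r ` supp x. sc (x (SOME y. y \<in> Q)) (gamma Q r as) = 0"
    proof
      fix Q assume Q: "Q \<in> orbc act r ` Y - orbc act r ` supp x"
      then obtain y where y: "y \<in> Y" "Q = orbc act r y" by blast
      then have "x y = 0" using Q by blast
      then have "x (SOME z. z \<in> Q) = 0" using orbc_some[OF x, of y] y Y(3) by auto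
      then show "sc (x (SOME y. y \<in> Q)) (gamma Q r as) = 0" by simp
    qed
  qed (use Y in auto)
  finally show ?thesis .
qed

lemma supp_Pinv: "x \<in> Pinv B act r \<Longrightarrow> finite (supp x) \<and> supp x \<subseteq> B (sum_list r)"
  by (auto simp: Pinv_def Pn_def)

lemma lin_on_bet:
  assumes l: "length as = length r"
  shows "lin_on sc (Pinv B act r) (\<lambda>x. bet x r as)"
proof (rule lin_onI)
  fix x y :: "'o \<Rightarrow> 'k" assume x: "x \<in> Pinv B act r" and y: "y \<in> Pinv B act r"
  have xy: "(\<lambda>z. x z + y z) \<in> Pinv B act r" using x y by (simp add: Pinv_eq_Pfix Pfix_add)
  let ?Y = "supp x \<union> supp y"
  have Y: "finite ?Y" "?Y \<subseteq> B (sum_list r)" using supp_Pinv[OF x] supp_Pinv[OF y] by auto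
  have "bet w r as = (\<Sum>Q\<in>orbc act r ` ?Y. sc (w (SOME y. y \<in> Q)) (gamma Q r as))"
    if "w \<in> Pinv B act r" "supp w \<subseteq> ?Y" for w by (rule bet_superset[OF that(1) l Y(1) that(2) Y(2)])
  note e = this
  have "bet (\<lambda>z. x z + y z) r as = (\<Sum>Q\<in>orbc act r ` ?Y. sc (x (SOME y. y \<in> Q) + y (SOME y. y \<in> Q)) (gamma Q r as))"
    by (rule e[OF xy]) auto
  also have "\<dots> = bet x r as + bet y r as"
    unfolding e[OF x Un_upper1] e[OF y Un_upper2] by (simp add: scale_left_distrib sum.distrib)
  finally show "bet (\<lambda>z. x z + y z) r as = bet x r as + bet y r as" .
next
  fix c and x :: "'o \<Rightarrow> 'k" assume x: "x \<in> Pinv B act r"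
  have cx: "(\<lambda>z. c * x z) \<in> Pinv B act r" using x by (simp add: Pinv_eq_Pfix Pfix_scale)
  have "bet (\<lambda>z. c * x z) r as = (\<Sum>Q\<in>orbc act r ` supp x. sc (c * x (SOME y. y \<in> Q)) (gamma Q r as))"
    using supp_Pinv[OF x] by (intro bet_superset[OF cx l]) auto
  also have "\<dots> = sc c (bet x r as)"
    using x l by (simp add: bet_def beta_dom_def scale_sum_right)
  finally show "bet (\<lambda>z. c * x z) r as = sc c (bet x r as)" .
qed

lemma bet_ind:
  assumes y: "y \<in> B (sum_list r)" and l: "length as = length r"
  shows "bet (ind (orbc act r y)) r as = gamma (orbc act r y) r as"
proof -
  let ?Q = "orbc act r y"
  have sub: "?Q \<subseteq> B (sum_list r)" unfolding orbc_eq_orbR by (rule orbR_subset[OF Symc_subgrp y])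
  have self: "y \<in> ?Q" unfolding orbc_eq_orbR by (rule orbR_self[OF Symc_subgrp y])
  have fin: "finite ?Q" using subgrp_finite[OF Symc_subgrp, of r] by (simp add: orbc_def)
  have sp: "supp (ind ?Q :: 'o \<Rightarrow> 'k) \<subseteq> ?Q" by (auto simp: ind_def split: if_splits)
  have "orbc act r w = ?Q" if "w \<in> ?Q" for w
    using orbR_eq[OF Symc_subgrp y] that by (simp add: orbc_eq_orbR)
  then have img: "orbc act r ` ?Q = {?Q}" using self by blast
  have "(ind ?Q (SOME z. z \<in> ?Q) :: 'k) = ind ?Q y" by (rule orbc_some[OF ind_Pinv[OF y] y])
  then have "(ind ?Q (SOME z. z \<in> ?Q) :: 'k) = 1" using self by (simp add: ind_def)
  then show ?thesis using bet_superset[OF ind_Pinv[OF y] l fin sp sub] unfolding img by simp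
qed

text \<open>In \<beta>1 to \<beta>5 both sides are linear in the operation, so
  \<open>linear_ext\<close> leaves orbit sums, where each axiom is the one for \<gamma>. The two
  parts of \<beta>6 hold by construction.\<close>

lemma beta_obj_bet: "beta_obj B act sc bet"
  unfolding beta_obj_def
proof (intro conjI allI impI; (elim conjE)?)
  show "\<not> beta_dom B act x r as \<Longrightarrow> bet x r as = 0" for x r as by (simp add: bet_def)
next
  fix r and x :: "'o \<Rightarrow> 'k" and \<rho> and as :: "'a list" assume a: "beta_dom B act x r as" "\<rho> \<in> Sym (length r)"
  then have l: "length as = length r" and x: "x \<in> Pinv B act r" by (simp_all add: beta_dom_def)
  show "bet x r as = bet (lact B act (sum_list r) (block_perm r \<rho>) x) (plist \<rho> r) (plist \<rho> as)"
  proof (rule linear_ext[OF vector_space_axioms lin_on_bet[OF l] _ _ x])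
    show "lin_on sc (Pinv B act r) (\<lambda>x. bet (lact B act (sum_list r) (block_perm r \<rho>) x) (plist \<rho> r) (plist \<rho> as))"
      by (rule lin_on_compose[OF lin_on_bet Pinv_block_perm[OF a(2)] lact_add lact_scale]) (simp add: l)
    fix y assume y: "y \<in> B (sum_list r)"
    have yB: "act (block_perm r \<rho>) y \<in> B (sum_list (plist \<rho> r))"
      using act_in[OF block_perm_Sym[OF a(2)] y] by (simp add: sum_plist[OF a(2)])
    have l': "length (plist \<rho> as) = length (plist \<rho> r)" using l by simp
    show "bet (ind (orbc act r y)) r as = bet (lact B act (sum_list r) (block_perm r \<rho>) (ind (orbc act r y))) (plist \<rho> r) (plist \<rho> as)"
      unfolding lact_block_perm_ind[OF a(2) y] bet_ind[OF y l] bet_ind[OF yB l'] by (rule gamma_objD(2)[OF g y l a(2)])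
  qed
next
  fix r and x :: "'o \<Rightarrow> 'k" and a0 :: 'a and as :: "'a list" assume a: "beta_dom B act x (0 # r) (a0 # as)"
  then have l: "length (a0 # as) = length (0 # r)" "length as = length r" and x: "x \<in> Pinv B act (0 # r)" by (simp_all add: beta_dom_def)
  show "bet x (0 # r) (a0 # as) = bet x r as"
  proof (rule linear_ext[OF vector_space_axioms lin_on_bet[OF l(1)] _ _ x])
    show "lin_on sc (Pinv B act (0 # r)) (\<lambda>x. bet x r as)" unfolding Pinv_Cons_0 by (rule lin_on_bet[OF l(2)])
    fix y assume y: "y \<in> B (sum_list (0 # r))"
    then have y': "y \<in> B (sum_list r)" by simp
    have o: "orbc act (0 # r) y = orbc act r y" by (simp add: orbc_eq_orbR Symc_Cons_0)
    show "bet (ind (orbc act (0 # r) y)) (0 # r) (a0 # as) = bet (ind (orbc act (0 # r) y)) r as"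
      using bet_ind[OF y l(1)] bet_ind[OF y' l(2)] gamma_objD(3)[OF g y' l(2)] unfolding o by simp
  qed
next
  fix r and x :: "'o \<Rightarrow> 'k" and c and a :: 'a and as :: "'a list" assume a: "beta_dom B act x r (a # as)"
  then have l: "length (a # as) = length r" "length (sc c a # as) = length r" and x: "x \<in> Pinv B act r" by (simp_all add: beta_dom_def)
  show "bet x r (sc c a # as) = sc (c ^ hd r) (bet x r (a # as))"
  proof (rule linear_ext[OF vector_space_axioms lin_on_bet[OF l(2)] _ _ x])
    show "lin_on sc (Pinv B act r) (\<lambda>x. sc (c ^ hd r) (bet x r (a # as)))"
      by (rule lin_onI) (simp_all add: lin_on_add[OF lin_on_bet[OF l(1)]] lin_on_scale[OF lin_on_bet[OF l(1)]] scale_right_distrib mult.commute)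
    fix y assume y: "y \<in> B (sum_list r)"
    show "bet (ind (orbc act r y)) r (sc c a # as) = sc (c ^ hd r) (bet (ind (orbc act r y)) r (a # as))"
      unfolding bet_ind[OF y l(1)] bet_ind[OF y l(2)] by (rule gamma_objD(4)[OF g y l(1)])
  qed
next
  fix r and x :: "'o \<Rightarrow> 'k" and q and as :: "'a list" assume x: "x \<in> Pinv B act r" and q: "sum_list q = length r" and as: "length as = length q"
  let ?as = "concat (map (\<lambda>j. replicate (q ! j) (as ! j)) [0..<length q])"
  have l: "length ?as = length r" using length_concat_replicate[OF as] q by simp
  have lt: "length as = length (tri q r)" using as by simp
  let ?T = "\<lambda>x. csum (Symc (tri q r)) (Symc r) (\<lambda>\<sigma>. lact B act (sum_list r) \<sigma> x)"
  show "bet x r ?as = bet (?T x) (tri q r) as"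
  proof (rule linear_ext[OF vector_space_axioms lin_on_bet[OF l] _ _ x])
    show "lin_on sc (Pinv B act r) (\<lambda>x. bet (?T x) (tri q r) as)"
      by (rule lin_on_compose[OF lin_on_bet[OF lt] csum_tri_Pinv[OF q]]) (simp_all add: lact_add lact_scale csum_add csum_scale)
    fix y assume y: "y \<in> B (sum_list r)"
    have yt: "y \<in> B (sum_list (tri q r))" using y q by (simp add: sum_tri)
    have sl: "bet (\<lambda>z. e * ind (orbc act (tri q r) y) z) (tri q r) as = sc e (bet (ind (orbc act (tri q r) y)) (tri q r) as)" for e
      by (rule lin_on_scale[OF lin_on_bet[OF lt] ind_Pinv[OF yt]])
    show "bet (ind (orbc act r y)) r ?as = bet (?T (ind (orbc act r y))) (tri q r) as"
      unfolding csum_tri_ind[OF q y] sl bet_ind[OF y l] bet_ind[OF yt lt] by (rule gamma_objD(5)[OF g y q as])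
  qed
next
  fix r and x :: "'o \<Rightarrow> 'k" and a0 a1 :: 'a and as :: "'a list" assume a: "beta_dom B act x r (a1 # as)"
  then have l: "length (a1 # as) = length r" "length ((a0 + a1) # as) = length r" and x: "x \<in> Pinv B act r" by (simp_all add: beta_dom_def)
  then have ne: "r \<noteq> []" by auto
  let ?r = "\<lambda>l. l # (hd r - l) # tl r"
  have len: "length (a0 # a1 # as) = length (?r l)" for l using l by simp
  have linl: "lin_on sc (Pinv B act r) (\<lambda>x. bet x (?r l) (a0 # a1 # as))" if "l \<le> hd r" for l
    by (rule lin_on_subset[OF lin_on_bet[OF len] split_hd(3)[OF ne that]])
  show "bet x r ((a0 + a1) # as) = (\<Sum>l\<le>hd r. bet x (?r l) (a0 # a1 # as))"
  proof (rule linear_ext[OF vector_space_axioms lin_on_bet[OF l(2)] _ _ x])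
    show "lin_on sc (Pinv B act r) (\<lambda>x. \<Sum>l\<le>hd r. bet x (?r l) (a0 # a1 # as))"
      by (rule lin_onI) (simp_all add: lin_on_add[OF linl] lin_on_scale[OF linl] sum.distrib scale_sum_right)
    fix y assume y: "y \<in> B (sum_list r)"
    have "bet (ind (orbc act r y)) (?r l) (a0 # a1 # as) = (\<Sum>Q\<in>orbc act (?r l) ` orbc act r y. gamma Q (?r l) (a0 # a1 # as))"
      if lr: "l \<le> hd r" for l
    proof -
      note sp = split_hd[OF ne lr]
      have yB: "w \<in> B (sum_list (?r l))" if "w \<in> orbc act r y" for w
        using that orbR_subset[OF Symc_subgrp y] sp(1) by (auto simp: orbc_eq_orbR)
      let ?Qs = "orbc act (?r l) ` orbc act r y"
      have fin: "finite ?Qs" using subgrp_finite[OF Symc_subgrp] by (simp add: orbc_def)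
      have QP: "(ind Q :: 'o \<Rightarrow> 'k) \<in> Pinv B act (?r l)" if "Q \<in> ?Qs" for Q using that yB ind_Pinv by blast
      have lin: "bet (\<lambda>z. \<Sum>Q\<in>S. ind Q z) (?r l) (a0 # a1 # as) = (\<Sum>Q\<in>S. bet (ind Q) (?r l) (a0 # a1 # as))"
        if "finite S" "S \<subseteq> ?Qs" for S
        using that
      proof (induction S rule: finite_induct)
        case empty
        have "bet (\<lambda>z. 0) (?r l) (a0 # a1 # as) = 0"
          by (rule lin_on_zero[OF lin_on_bet[OF len]]) (simp add: Pinv_eq_Pfix Pfix_zero)
        then show ?case by simp
      next
        case (insert Q S)
        have "(\<lambda>z. \<Sum>Q\<in>S. (ind Q z :: 'k)) \<in> Pinv B act (?r l)"
          unfolding Pinv_eq_Pfix by (rule Pfix_sum) (use QP insert.prems in \<open>auto simp: Pinv_eq_Pfix\<close>)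
        then show ?case using insert lin_on_add[OF lin_on_bet[OF len, of l] QP[of Q]] by simp
      qed
      have "bet (ind (orbc act r y)) (?r l) (a0 # a1 # as) = (\<Sum>Q\<in>?Qs. bet (ind Q) (?r l) (a0 # a1 # as))"
        unfolding ind_refine[OF sp(1,2) y] by (rule lin[OF fin order_refl])
      also have "\<dots> = (\<Sum>Q\<in>?Qs. gamma Q (?r l) (a0 # a1 # as))"
        using bet_ind[OF yB len] by (intro sum.cong) auto
      finally show ?thesis .
    qed
    then show "bet (ind (orbc act r y)) r ((a0 + a1) # as) = (\<Sum>l\<le>hd r. bet (ind (orbc act r y)) (?r l) (a0 # a1 # as))"
      unfolding bet_ind[OF y l(2)] gamma_objD(6)[OF g y l(1)] by simp
  qed
next
  fix r and x y :: "'o \<Rightarrow> 'k" and as :: "'a list" assume "x \<in> Pinv B act r" "y \<in> Pinv B act r" "length as = length r"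
  then show "bet (\<lambda>z. x z + y z) r as = bet x r as + bet y r as" by (intro lin_on_add[OF lin_on_bet])
next
  fix c r and x :: "'o \<Rightarrow> 'k" and as :: "'a list" assume "x \<in> Pinv B act r" "length as = length r"
  then show "bet (\<lambda>z. c * x z) r as = sc c (bet x r as)" by (intro lin_on_scale[OF lin_on_bet])
qed

lemma Pfun_bet: "Pfun B act bet = gamma"
proof (intro ext)
  fix Q r as
  show "Pfun B act bet Q r as = gamma Q r as"
  proof (cases "gamma_dom B act Q r as")
    case True
    then obtain y where y: "y \<in> B (sum_list r)" "Q = orbc act r y" "length as = length r" by (auto simp: gamma_dom_def)
    then show ?thesis using bet_ind[OF y(1,3)] True by (simp add: Pfun_def ind_def)
  next
    case False
    then show ?thesis using gamma_objD(1)[OF g] by (simp add: Pfun_def)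
  qed
qed

end

section \<open>Injectivity on objects, and morphisms\<close>

lemma (in set_op) Pfun_inj:
  assumes vs: "vector_space sc" and b: "beta_obj B act sc beta" "beta_obj B act sc beta'" and eq: "Pfun B act beta = Pfun B act beta'"
  shows "beta = beta'"
proof (intro ext)
  interpret L: beta_law B act u cmp sc beta by (intro beta_law.intro beta_law_axioms.intro set_op_axioms vs b(1))
  interpret L': beta_law B act u cmp sc beta' by (intro beta_law.intro beta_law_axioms.intro set_op_axioms vs b(2))
  fix x r as
  show "beta x r as = beta' x r as"
  proof (cases "beta_dom B act x r as")
    case True
    then have l: "length as = length r" and x: "x \<in> Pinv B act r" by (simp_all add: beta_dom_def)
    show ?thesis
      by (rule linear_ext[OF vs L.lin_on_beta[OF l] L'.lin_on_beta[OF l] _ x])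
        (use L.gam_ind[OF _ l] L'.gam_ind[OF _ l] eq in simp)
  qed (simp add: beta_objD(1)[OF b(1)] beta_objD(1)[OF b(2)])
qed

text \<open>Commuting with \<gamma> is commuting with \<beta> on orbit sums; since \<open>f\<close>
  is linear, both sides of the condition are linear in the operation and the rest follows by
  extension.\<close>

lemma (in set_op) hom_iff:
  fixes sA :: "'k::field \<Rightarrow> 'a::ab_group_add \<Rightarrow> 'a" and sB :: "'k \<Rightarrow> 'b::ab_group_add \<Rightarrow> 'b"
  assumes vs: "vector_space sA" "vector_space sB" and b: "beta_obj B act sA betaA" "beta_obj B act sB betaB"
  shows "beta_hom B act sA sB betaA betaB f \<longleftrightarrow> gamma_hom B act sA sB (Pfun B act betaA) (Pfun B act betaB) f"
proof -
  interpret A: beta_law B act u cmp sA betaA by (intro beta_law.intro beta_law_axioms.intro set_op_axioms vs(1) b(1))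
  interpret Bl: beta_law B act u cmp sB betaB by (intro beta_law.intro beta_law_axioms.intro set_op_axioms vs(2) b(2))
  show ?thesis
  proof
    assume h: "beta_hom B act sA sB betaA betaB f"
    show "gamma_hom B act sA sB (Pfun B act betaA) (Pfun B act betaB) f"
      unfolding gamma_hom_def
    proof (intro conjI allI impI)
      show "Vector_Spaces.linear sA sB f" using h by (simp add: beta_hom_def)
      fix Q r and as :: "'a list" assume "gamma_dom B act Q r as"
      then obtain y where y: "y \<in> B (sum_list r)" "Q = orbc act r y" "length as = length r" by (auto simp: gamma_dom_def)
      have "beta_dom B act (ind Q :: 'o \<Rightarrow> 'k) r as" using ind_Pinv[OF y(1)] y by (simp add: beta_dom_def)
      then have "f (betaA (ind Q) r as) = betaB (ind Q) r (map f as)" using h by (simp add: beta_hom_def)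
      then show "f (Pfun B act betaA Q r as) = Pfun B act betaB Q r (map f as)"
        using A.gam_ind[OF y(1,3)] Bl.gam_ind[OF y(1), of "map f as"] y by simp
    qed
  next
    assume h: "gamma_hom B act sA sB (Pfun B act betaA) (Pfun B act betaB) f"
    show "beta_hom B act sA sB betaA betaB f"
      unfolding beta_hom_def
    proof (intro conjI allI impI)
      show lin: "Vector_Spaces.linear sA sB f" using h by (simp add: gamma_hom_def)
      interpret lf: Vector_Spaces.linear sA sB f by (rule lin)
      fix r and x :: "'o \<Rightarrow> 'k" and as :: "'a list" assume "beta_dom B act x r as"
      then have l: "length as = length r" "length (map f as) = length r" and x: "x \<in> Pinv B act r" by (simp_all add: beta_dom_def)
      have lf: "lin_on sB (Pinv B act r) (\<lambda>x. f (betaA x r as))"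
        by (rule lin_onI) (simp_all add: lin_on_add[OF A.lin_on_beta[OF l(1)]] lin_on_scale[OF A.lin_on_beta[OF l(1)]] lf.add lf.scale)
      show "f (betaA x r as) = betaB x r (map f as)"
      proof (rule linear_ext[OF vs(2) lf Bl.lin_on_beta[OF l(2)] _ x])
        fix y assume y: "y \<in> B (sum_list r)"
        then have "gamma_dom B act (orbc act r y) r as" using l by (auto simp: gamma_dom_def)
        then have "f (Pfun B act betaA (orbc act r y) r as) = Pfun B act betaB (orbc act r y) r (map f as)"
          using h unfolding gamma_hom_def by blast
        then show "f (betaA (ind (orbc act r y)) r as) = betaB (ind (orbc act r y)) r (map f as)"
          unfolding A.gam_ind[OF y l(1)] Bl.gam_ind[OF y l(2)] .
      qed
    qed
  qed
qed

text \<open>The functor keeps the underlying space and the underlying map. So an isomorphism of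
  categories means: it is well defined on objects, bijective on the structures on each vector space,
  and a linear map is a morphism on one side exactly if it is one on the other.\<close>

theorem theorem4p9:
  fixes B :: "nat \<Rightarrow> 'o set" and act :: "(nat \<Rightarrow> nat) \<Rightarrow> 'o \<Rightarrow> 'o" and u :: 'o
    and cmp :: "'o \<Rightarrow> 'o list \<Rightarrow> 'o"
    and sA :: "'k::field \<Rightarrow> 'a::ab_group_add \<Rightarrow> 'a" and sB :: "'k \<Rightarrow> 'b::ab_group_add \<Rightarrow> 'b"
  assumes "set_operad B act u cmp"
    and "B 0 = {}"
    and "Vector_Spaces.vector_space sA"
    and "Vector_Spaces.vector_space sB"
  shows "(\<forall>beta. beta'_obj B act u cmp sA beta \<longrightarrow> gamma'_obj B act u cmp sA (Pfun B act beta))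
    \<and> (\<forall>gamma. gamma'_obj B act u cmp sA gamma \<longrightarrow>
          (\<exists>!beta. beta'_obj B act u cmp sA beta \<and> Pfun B act beta = gamma))
    \<and> (\<forall>betaA betaB f. beta'_obj B act u cmp sA betaA \<and> beta'_obj B act u cmp sB betaB \<longrightarrow>
          (beta_hom B act sA sB betaA betaB f \<longleftrightarrow>
           gamma_hom B act sA sB (Pfun B act betaA) (Pfun B act betaB) f))"
proof -
  interpret set_op B act u cmp by (rule set_op.intro[OF assms(1,2)])
  have obj: "beta_obj B act sc beta" if "beta'_obj B act u cmp sc beta" for sc beta
    using that by (simp add: beta'_obj_def)
  have law: "beta_law B act u cmp sc beta" if "vector_space sc" "beta_obj B act sc beta" for sc beta
    using that by (intro beta_law.intro beta_law_axioms.intro set_op_axioms)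
  show ?thesis
  proof (intro conjI allI impI)
    fix beta assume b: "beta'_obj B act u cmp sA beta"
    show "gamma'_obj B act u cmp sA (Pfun B act beta)"
      by (rule beta_law.gamma'_obj_Pfun[OF law[OF assms(3) obj[OF b]] b])
  next
    fix gamma assume c: "gamma'_obj B act u cmp sA gamma"
    interpret C: gamma_law B act u cmp sA gamma
      using c by (intro gamma_law.intro gamma_law_axioms.intro set_op_axioms assms(3)) (simp add: gamma'_obj_def)
    have "beta'_obj B act u cmp sA C.bet"
      by (rule beta_law.beta'_obj_from_Pfun[OF law[OF assms(3) C.beta_obj_bet]]) (simp add: C.Pfun_bet c)
    then show "\<exists>!beta. beta'_obj B act u cmp sA beta \<and> Pfun B act beta = gamma"
      using C.Pfun_bet Pfun_inj[OF assms(3) obj obj] by blast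
  next
    fix betaA betaB f assume "beta'_obj B act u cmp sA betaA \<and> beta'_obj B act u cmp sB betaB"
    then show "beta_hom B act sA sB betaA betaB f \<longleftrightarrow> gamma_hom B act sA sB (Pfun B act betaA) (Pfun B act betaB) f"
      using hom_iff[OF assms(3,4)] by (simp add: beta'_obj_def)
  qed
qed

end
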